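(* Let $d,\sigma,q\ge 1$ be integers, $V\ge0$, $\nu,\mu\in\mathbb{R}$, let $Q=(Q_1,\dots,Q_q):\mathbb{T}^d\to\mathbb{R}^q$ be smooth, let $s\ge s_d$ be an integer and $r=s+2$. Assume that the subspace $H=\operatorname{span}\{Q_j\mid j=1,\dots,q\}$ of $C^r(\mathbb{T}^d;\mathbb{R})$ is saturating, that $\mathbf{1}\in\operatorname{span}\{Q_j\mid j=1,\dots,q\}$, and that $r_1=1$, $r_2=-\nu$. Then for any $\varepsilon>0$, $\mathcal{T}>0$, $\psi_0\in H^s$ and $\theta\in C^r(\mathbb{T}^d;\mathbb{R})$, there are $T\in(0,\mathcal{T})$ and $u\in\Theta(\psi_0,T)\cap C^\infty([0,T];\mathbb{R}^q)$ such that $$\left\|\mathcal{R}_T(\psi_0,(u,1,-\nu))-e^{(1-i\nu)\theta}\psi_0\right\|_s<\varepsilon.$$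
   Context: $\mathbb{T}^d=\mathbb{R}^d/2\pi\mathbb{Z}^d$; $\langle\cdot,\cdot\rangle$ is the Euclidean scalar product; $\mathbf{1}$ is the function identically equal to $1$; $s_d$ is the smallest integer strictly greater than $d/2$. $H^s=H^s(\mathbb{T}^d;\mathbb{C})$ with norm $\|f\|_s^2=\sum_{k\in\mathbb{Z}^d}(1+|k|^2)^s|\widehat f(k)|^2$, $\widehat f(k)=(2\pi)^{-d}\int_{[0,2\pi]^d}f(x)e^{-i\langle k,x\rangle}dx$. Equation: for $r_1,r_2\in\mathbb{R}$ and an $\mathbb{R}^q$-valued control $u$, consider on $\mathbb{T}^d$ $$\partial_t\psi=V\psi+(1+i\nu)\Delta\psi-(1+i\mu)|\psi|^{2\sigma}\psi+(r_1+ir_2)\langle u(t),Q(x)\rangle\psi,\qquad \psi(0)=\psi_0,$$ with solutions in the mild (Duhamel) sense. $\Theta(\psi_0,T)$ is the set of $u\in L^2([0,T];\mathbb{R}^q)$ for which this problem (here with $r_1=1$, $r_2=-\nu$) has a solution in $C([0,T];H^s)$ (such a solution is unique), and $\mathcal{R}_t(\psi_0,(u,r_1,r_2))$ denotes the value of that solution at time $t$. Saturation: for $\varphi\in C^1(\mathbb{T}^d;\mathbb{R})$ put $\mathbb{B}(\varphi)(x)=\sum_{j=1}^d(\partial_{x_j}\varphi(x))^2$. For a finite-dimensional subspace $H\subset C^r(\mathbb{T}^d;\mathbb{R})$, let $F(H)$ be the largest subspace of $C^r(\mathbb{T}^d;\mathbb{R})$ whose elements can be represented in the form $\theta_0+\sum_{j=1}^n\mathbb{B}(\theta_j)$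 for some integer $n\ge1$ and $\theta_0,\dots,\theta_n\in H$ ($F(H)$ is well defined and finite-dimensional). Set $H_0=H$, $H_j=F(H_{j-1})$ for $j\ge1$, and $H_\infty=\bigcup_{j\ge1}H_j$. $H$ is called saturating if $H_\infty$ is dense in $C^r(\mathbb{T}^d;\mathbb{R})$. *)

theory Defs
  imports "HOL-Analysis.Analysis" "HOL-Library.Function_Algebras"
begin

text \<open>
  Functions on the torus are \<open>2\<pi>\<close>-periodic functions on \<open>real ^ 'd\<close>. Elements of \<open>L\<^sup>2\<close> and \<open>H\<^sup>s\<close>
  are given by representatives: equality in these spaces is equality almost everywhere, and the
  notions below depend only on the equivalence class.
\<close>

definition torus_periodic :: "(real ^ 'd \<Rightarrow> 'a) \<Rightarrow> bool" where
  "torus_periodic f \<longleftrightarrow> (\<forall>x j. f (x + axis j (2 * pi)) = f x)"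

definition torus_cell :: "(real ^ 'd) set" where
  "torus_cell = cbox 0 (\<chi> i. 2 * pi)"

definition freq :: "int ^ 'd \<Rightarrow> real ^ 'd" where
  "freq k = (\<chi> i. real_of_int (k $ i))"

definition fourier_coeff :: "(real ^ 'd \<Rightarrow> complex) \<Rightarrow> int ^ 'd \<Rightarrow> complex" where
  "fourier_coeff f k =
     (LINT x:torus_cell|lebesgue. f x * exp (- (\<i> * complex_of_real (freq k \<bullet> x)))) / (2 * pi) ^ CARD('d)"

subsection \<open>Sobolev spaces\<close>

definition Hs :: "nat \<Rightarrow> (real ^ 'd \<Rightarrow> complex) set" where
  "Hs s = {f. torus_periodic f
            \<and> set_borel_measurable lebesgue torus_cell f
            \<and> set_integrable lebesgue torus_cell (\<lambda>x. (cmod (f x))\<^sup>2)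
            \<and> (\<lambda>k. (1 + (norm (freq k))\<^sup>2) ^ s * (cmod (fourier_coeff f k))\<^sup>2) summable_on UNIV}"

definition Hs_norm :: "nat \<Rightarrow> (real ^ 'd \<Rightarrow> complex) \<Rightarrow> real" where
  "Hs_norm s f = sqrt (\<Sum>\<^sub>\<infinity>k. (1 + (norm (freq k))\<^sup>2) ^ s * (cmod (fourier_coeff f k))\<^sup>2)"

definition Hs_continuous_on :: "nat \<Rightarrow> real set \<Rightarrow> (real \<Rightarrow> real ^ 'd \<Rightarrow> complex) \<Rightarrow> bool" where
  "Hs_continuous_on s I \<psi> \<longleftrightarrow>
     (\<forall>t\<in>I. \<psi> t \<in> Hs s \<and> ((\<lambda>\<tau>. Hs_norm s (\<lambda>x. \<psi> \<tau> x - \<psi> t x)) \<longlongrightarrow> 0) (at t within I))"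

definition sobolev_index :: "nat \<Rightarrow> nat" where
  "sobolev_index d = (LEAST n. real d / 2 < real n)"

subsection \<open>Differentiable functions on the torus\<close>

definition partial :: "'d \<Rightarrow> (real ^ 'd \<Rightarrow> 'b::real_normed_vector) \<Rightarrow> real ^ 'd \<Rightarrow> 'b" where
  "partial j f x = frechet_derivative f (at x) (axis j 1)"

text \<open>\<open>iter_partial js\<close> is a mixed partial derivative of order \<open>length js\<close>.\<close>

definition iter_partial :: "'d list \<Rightarrow> (real ^ 'd \<Rightarrow> 'b::real_normed_vector) \<Rightarrow> real ^ 'd \<Rightarrow> 'b" where
  "iter_partial js f = foldr partial js f"

definition Cr_torus :: "nat \<Rightarrow> (real ^ 'd \<Rightarrow> 'b::real_normed_vector) set" where
  "Cr_torus r = {f. torus_periodic f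
     \<and> (\<forall>js. length js < r \<longrightarrow> (\<forall>x. iter_partial js f differentiable (at x)))
     \<and> (\<forall>js. length js \<le> r \<longrightarrow> continuous_on UNIV (iter_partial js f))}"

definition smooth_torus :: "(real ^ 'd \<Rightarrow> 'b::real_normed_vector) set" where
  "smooth_torus = (\<Inter>r. Cr_torus r)"

definition Cr_norm :: "nat \<Rightarrow> (real ^ 'd \<Rightarrow> 'b::real_normed_vector) \<Rightarrow> real" where
  "Cr_norm r f = (SUP (js, x) \<in> {js. length js \<le> r} \<times> UNIV. norm (iter_partial js f x))"

subsection \<open>Saturation\<close>

interpretation real_fun: vector_space "\<lambda>(c::real) (f::real ^ 'd \<Rightarrow> real) x. c * f x"
  by unfold_locales (auto simp: fun_eq_iff algebra_simps)

definition grad_square :: "(real ^ 'd \<Rightarrow> real) \<Rightarrow> real ^ 'd \<Rightarrow> real" where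
  "grad_square \<phi> x = (\<Sum>j\<in>UNIV. (partial j \<phi> x)\<^sup>2)"

text \<open>
  The greatest element with respect to inclusion exists whenever \<open>H\<close> is a subspace: the
  representable functions are then closed under addition, so the sum of all admissible subspaces
  is admissible.
\<close>

definition sat_step ::
    "nat \<Rightarrow> (real ^ 'd \<Rightarrow> real) set \<Rightarrow> (real ^ 'd \<Rightarrow> real) set" where
  "sat_step r H = (GREATEST G. real_fun.subspace G \<and> G \<subseteq> Cr_torus r \<and>
     (\<forall>\<phi>\<in>G. \<exists>n\<ge>1. \<exists>\<theta>::nat \<Rightarrow> real ^ 'd \<Rightarrow> real. (\<forall>j\<le>n. \<theta> j \<in> H) \<and>
        \<phi> = (\<lambda>x. \<theta> 0 x + (\<Sum>j=1..n. grad_square (\<theta> j) x))))"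

definition sat_limit ::
    "nat \<Rightarrow> (real ^ 'd \<Rightarrow> real) set \<Rightarrow> (real ^ 'd \<Rightarrow> real) set" where
  "sat_limit r H = (\<Union>j\<in>{1..}. (sat_step r ^^ j) H)"

definition saturating :: "nat \<Rightarrow> (real ^ 'd \<Rightarrow> real) set \<Rightarrow> bool" where
  "saturating r H \<longleftrightarrow>
     (\<forall>f\<in>Cr_torus r. \<forall>\<epsilon>>0. \<exists>g\<in>sat_limit r H. Cr_norm r (\<lambda>x. f x - g x) < \<epsilon>)"

subsection \<open>The controlled complex Ginzburg--Landau equation\<close>

text \<open>The semigroup generated by \<open>(1 + i\<nu>)\<Delta>\<close>. For \<open>f \<in> H\<^sup>s\<close> with \<open>s > d/2\<close> the series converges
  absolutely for every \<open>t \<ge> 0\<close> and every \<open>x\<close>.\<close>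

definition heat_semigroup ::
    "real \<Rightarrow> real \<Rightarrow> (real ^ 'd \<Rightarrow> complex) \<Rightarrow> real ^ 'd \<Rightarrow> complex" where
  "heat_semigroup \<nu> t f x =
     (\<Sum>\<^sub>\<infinity>k. exp (- ((1 + \<i> * complex_of_real \<nu>) * complex_of_real (t * (norm (freq k))\<^sup>2)))
            * fourier_coeff f k * exp (\<i> * complex_of_real (freq k \<bullet> x)))"

definition cgl_source ::
    "real \<Rightarrow> real \<Rightarrow> nat \<Rightarrow> (real ^ 'd \<Rightarrow> real ^ 'q) \<Rightarrow> real ^ 'q \<Rightarrow> real \<Rightarrow> real
     \<Rightarrow> (real ^ 'd \<Rightarrow> complex) \<Rightarrow> real ^ 'd \<Rightarrow> complex" where
  "cgl_source V \<mu> \<sigma> Q w r1 r2 f x =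
     complex_of_real V * f x
     - (1 + \<i> * complex_of_real \<mu>) * complex_of_real (cmod (f x) ^ (2 * \<sigma>)) * f x
     + (complex_of_real r1 + \<i> * complex_of_real r2) * complex_of_real (w \<bullet> Q x) * f x"

text \<open>
  Solutions in \<open>C([0,T]; H\<^sup>s)\<close>, \<open>s > d/2\<close>, of Duhamel's formula. The \<open>H\<^sup>s\<close>-valued time integral is
  evaluated pointwise in \<open>x\<close>, point evaluation being continuous on \<open>H\<^sup>s\<close>.
\<close>

definition mild_solution ::
    "real \<Rightarrow> real \<Rightarrow> real \<Rightarrow> nat \<Rightarrow> (real ^ 'd \<Rightarrow> real ^ 'q) \<Rightarrow> nat \<Rightarrow> (real ^ 'd \<Rightarrow> complex)
     \<Rightarrow> (real \<Rightarrow> real ^ 'q) \<Rightarrow> real \<Rightarrow> real \<Rightarrow> real \<Rightarrow> (real \<Rightarrow> real ^ 'd \<Rightarrow> complex) \<Rightarrow> bool" where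
  "mild_solution V \<nu> \<mu> \<sigma> Q s \<psi>0 u r1 r2 T \<psi> \<longleftrightarrow>
     Hs_continuous_on s {0..T} \<psi> \<and>
     (\<forall>t\<in>{0..T}. AE x in lebesgue.
        set_integrable lebesgue {0..t}
          (\<lambda>\<tau>. heat_semigroup \<nu> (t - \<tau>) (cgl_source V \<mu> \<sigma> Q (u \<tau>) r1 r2 (\<psi> \<tau>)) x) \<and>
        \<psi> t x = heat_semigroup \<nu> t \<psi>0 x +
          (LINT \<tau>:{0..t}|lebesgue.
             heat_semigroup \<nu> (t - \<tau>) (cgl_source V \<mu> \<sigma> Q (u \<tau>) r1 r2 (\<psi> \<tau>)) x))"

definition L2_controls :: "real \<Rightarrow> (real \<Rightarrow> real ^ 'q) set" where
  "L2_controls T = {u. set_borel_measurable lebesgue {0..T} u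
                     \<and> set_integrable lebesgue {0..T} (\<lambda>t. (norm (u t))\<^sup>2)}"

text \<open>One-sided derivatives at the end points.\<close>

definition smooth_controls :: "real \<Rightarrow> (real \<Rightarrow> 'b::real_normed_vector) set" where
  "smooth_controls T = {u. \<exists>D. (\<forall>t\<in>{0..T}. D 0 t = u t) \<and>
     (\<forall>n::nat. \<forall>t\<in>{0..T}. (D n has_vector_derivative D (Suc n) t) (at t within {0..T}))}"

definition admissible_controls ::
    "real \<Rightarrow> real \<Rightarrow> real \<Rightarrow> nat \<Rightarrow> (real ^ 'd \<Rightarrow> real ^ 'q) \<Rightarrow> nat \<Rightarrow> (real ^ 'd \<Rightarrow> complex)
     \<Rightarrow> real \<Rightarrow> (real \<Rightarrow> real ^ 'q) set" where
  "admissible_controls V \<nu> \<mu> \<sigma> Q s \<psi>0 T =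
     {u \<in> L2_controls T. \<exists>\<psi>. mild_solution V \<nu> \<mu> \<sigma> Q s \<psi>0 u 1 (- \<nu>) T \<psi>}"

text \<open>
  The solution is unique only up to null sets in \<open>x\<close> at each time (and arbitrary outside \<open>[0,t]\<close>),
  so a representative is chosen.
\<close>

definition resolving_op ::
    "real \<Rightarrow> real \<Rightarrow> real \<Rightarrow> nat \<Rightarrow> (real ^ 'd \<Rightarrow> real ^ 'q) \<Rightarrow> nat \<Rightarrow> real
     \<Rightarrow> (real ^ 'd \<Rightarrow> complex) \<Rightarrow> (real \<Rightarrow> real ^ 'q) \<times> real \<times> real \<Rightarrow> real ^ 'd \<Rightarrow> complex" where
  "resolving_op V \<nu> \<mu> \<sigma> Q s t \<psi>0 = (\<lambda>(u, r1, r2).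
     (SOME \<psi>. mild_solution V \<nu> \<mu> \<sigma> Q s \<psi>0 u r1 r2 t \<psi>) t)"

end

theory Submission
  imports Defs
begin

text \<open>
  For \<open>s > d/2\<close> the space \<open>H\<^sup>s\<close> is a Banach algebra; it is represented by the square-summable families of
  weighted Fourier coefficients. Call \<open>q \<in> H\<^sup>s\<close> steerable if from every state \<open>x\<close> the controlled equation
  comes arbitrarily close to \<open>exp q \<cdot> x\<close> within arbitrarily short time. Strong short pulses make \<open>(1 - i\<nu>) \<phi>\<close>
  steerable for \<open>\<phi>\<close> in the span of the \<open>Q\<^sub>j\<close>, and sums and limits of steerable elements are steerable.
  For \<open>A = (1 - i\<nu>) \<theta> / sqrt (1 + \<nu>\<^sup>2)\<close> the conjugated flow \<open>exp (- \<lambda> A) S (1 / \<lambda>\<^sup>2) exp (\<lambda> A)\<close> tends, as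
  \<open>\<lambda> \<rightarrow> \<infinity>\<close>, to multiplication by the exponential of \<open>(1 + i\<nu>) \<Sum>\<^sub>j (\<partial>\<^sub>j A)\<^sup>2 = (1 - i\<nu>) B(\<theta>)\<close>. Hence
  \<open>(1 - i\<nu>) \<phi>\<close> is steerable for every \<open>\<phi>\<close> generated by the saturation process, and by density for
  every \<open>\<phi> \<in> C\<^sup>r\<close>.
\<close>

section \<open>Square-summable families\<close>

text \<open>The value \<open>r2 = - \<nu>\<close> is what lets the scheme close. Since
  \<open>(1 + i \<nu>) (1 - i \<nu>) = 1 + \<nu>^2\<close>, the square of
  \<open>(1 - i \<nu>) / sqrt (1 + \<nu>^2)\<close> times \<open>1 + i \<nu>\<close> is
  \<open>1 - i \<nu>\<close> again: squaring gradients returns to the complex direction of the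
  control, and the process can be iterated. The main obstacle is the nonlinearity. It is Lipschitz
  only on balls, so no evolution is taken for granted; existence always comes from shadowing, where
  an explicit curve that solves Duhamel's formula up to a small error forces a true solution near it
  on the whole interval. Moreover \<open>exp (\<lambda> A)\<close> may enlarge the state
  exponentially in \<open>\<lambda>\<close>, while the waiting time is only
  \<open>1 / \<lambda>^2\<close>. Here the function \<open>1\<close> in the span of the
  \<open>Q_j\<close> enters: it allows the state to be shrunk by a large scalar beforehand. A second
  obstacle is loss of derivatives. Each squaring costs one, and membership in \<open>C^r\<close>
  does not supply them through all iterations. Steerability is therefore carried along together with
  regularity of every order, inherited from the smooth \<open>Q\<close>.\<close>

typedef 'i l2 = "{a :: 'i \<Rightarrow> complex. (\<lambda>k. (cmod (a k))\<^sup>2) summable_on UNIV}"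
  morphisms l2_nth Abs_l2
  by (rule exI[of _ "\<lambda>_. 0"]) auto

setup_lifting type_definition_l2

lemma l2_summable: "(\<lambda>k. (cmod (l2_nth x k))\<^sup>2) summable_on A"
  using l2_nth[of x] by (auto intro: summable_on_subset_banach)

lemma l2_eqI: "(\<And>k. l2_nth x k = l2_nth y k) \<Longrightarrow> x = y"
  by (metis l2_nth_inverse ext)

lemma square_summable_add:
  assumes "(\<lambda>k. (cmod (a k))\<^sup>2) summable_on UNIV" "(\<lambda>k. (cmod (b k))\<^sup>2) summable_on UNIV"
  shows "(\<lambda>k. (cmod (a k + b k))\<^sup>2) summable_on UNIV"
proof (rule summable_on_comparison_test)
  show "(\<lambda>k. 2 * (cmod (a k))\<^sup>2 + 2 * (cmod (b k))\<^sup>2) summable_on UNIV"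
    using assms by (intro summable_on_add summable_on_cmult_right)
  fix k
  have "(cmod (a k + b k))\<^sup>2 \<le> (cmod (a k) + cmod (b k))\<^sup>2"
    by (intro power_mono norm_triangle_ineq) auto
  also have "\<dots> \<le> 2 * (cmod (a k))\<^sup>2 + 2 * (cmod (b k))\<^sup>2"
    using sum_squares_bound[of "cmod (a k)" "cmod (b k)"] by (simp add: power2_sum)
  finally show "(cmod (a k + b k))\<^sup>2 \<le> 2 * (cmod (a k))\<^sup>2 + 2 * (cmod (b k))\<^sup>2" .
qed auto

lemma square_summable_mult:
  assumes "(\<lambda>k. (cmod (a k))\<^sup>2) summable_on UNIV" "\<And>k. cmod (m k) \<le> C"
  shows "(\<lambda>k. (cmod (m k * a k))\<^sup>2) summable_on UNIV"
proof (rule summable_on_comparison_test)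
  show "(\<lambda>k. C\<^sup>2 * (cmod (a k))\<^sup>2) summable_on UNIV"
    using assms by (intro summable_on_cmult_right)
  show "(cmod (m k * a k))\<^sup>2 \<le> C\<^sup>2 * (cmod (a k))\<^sup>2" for k
    using assms(2)[of k] by (simp add: norm_mult power_mult_distrib mult_right_mono power_mono)
qed auto

lemma square_summable_prod:
  assumes "(\<lambda>k. (cmod (a k))\<^sup>2) summable_on UNIV" "(\<lambda>k. (cmod (b k))\<^sup>2) summable_on UNIV"
  shows "(\<lambda>k. Re (a k * cnj (b k))) summable_on UNIV"
proof -
  have "(\<lambda>k. norm (Re (a k * cnj (b k)))) summable_on UNIV"
  proof (rule summable_on_comparison_test)
    show "(\<lambda>k. (cmod (a k))\<^sup>2 + (cmod (b k))\<^sup>2) summable_on UNIV"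
      using assms by (intro summable_on_add)
    fix k
    have "norm (Re (a k * cnj (b k))) \<le> cmod (a k) * cmod (b k)"
      by (metis abs_Re_le_cmod complex_mod_cnj norm_mult real_norm_def)
    also have "\<dots> \<le> (cmod (a k))\<^sup>2 + (cmod (b k))\<^sup>2"
    proof -
      have "2 * (cmod (a k) * cmod (b k)) \<le> (cmod (a k))\<^sup>2 + (cmod (b k))\<^sup>2"
        using sum_squares_bound[of "cmod (a k)" "cmod (b k)"] by (simp add: mult.assoc)
      moreover have "0 \<le> cmod (a k) * cmod (b k)" by simp
      ultimately show ?thesis by linarith
    qed
    finally show "norm (Re (a k * cnj (b k))) \<le> (cmod (a k))\<^sup>2 + (cmod (b k))\<^sup>2" .
  qed auto
  then show ?thesis by (rule abs_summable_summable)
qed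

instantiation l2 :: (type) real_vector
begin
lift_definition zero_l2 :: "'a l2" is "\<lambda>_. 0" by simp
lift_definition plus_l2 :: "'a l2 \<Rightarrow> 'a l2 \<Rightarrow> 'a l2" is "\<lambda>a b k. a k + b k"
  by (rule square_summable_add)
lift_definition uminus_l2 :: "'a l2 \<Rightarrow> 'a l2" is "\<lambda>a k. - a k" by simp
lift_definition minus_l2 :: "'a l2 \<Rightarrow> 'a l2 \<Rightarrow> 'a l2" is "\<lambda>a b k. a k - b k"
  subgoal for a b using square_summable_add[of a "\<lambda>k. - b k"] by simp
  done
lift_definition scaleR_l2 :: "real \<Rightarrow> 'a l2 \<Rightarrow> 'a l2" is "\<lambda>r a k. complex_of_real r * a k"
  by (rule square_summable_mult) auto
instance
  by standard (transfer; simp add: fun_eq_iff algebra_simps)+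
end

lemmas l2_nth_simps [simp] =
  zero_l2.rep_eq plus_l2.rep_eq uminus_l2.rep_eq minus_l2.rep_eq scaleR_l2.rep_eq

lemma l2_nth_sum [simp]: "l2_nth (sum f A) k = (\<Sum>i\<in>A. l2_nth (f i) k)"
  by (induction A rule: infinite_finite_induct) auto

instantiation l2 :: (type) real_inner
begin
definition inner_l2 :: "'a l2 \<Rightarrow> 'a l2 \<Rightarrow> real" where
  "inner_l2 x y = (\<Sum>\<^sub>\<infinity>k. Re (l2_nth x k * cnj (l2_nth y k)))"
definition norm_l2 :: "'a l2 \<Rightarrow> real" where
  "norm_l2 x = sqrt (inner x x)"
definition sgn_l2 :: "'a l2 \<Rightarrow> 'a l2" where "sgn_l2 x = x /\<^sub>R norm x"
definition dist_l2 :: "'a l2 \<Rightarrow> 'a l2 \<Rightarrow> real" where "dist_l2 x y = norm (x - y)"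
definition uniformity_l2 :: "('a l2 \<times> 'a l2) filter" where
  "uniformity_l2 = (INF e\<in>{0 <..}. principal {(x, y). dist x y < e})"
definition open_l2 :: "'a l2 set \<Rightarrow> bool" where
  "open_l2 U = (\<forall>x\<in>U. eventually (\<lambda>(x', y). x' = x \<longrightarrow> y \<in> U) uniformity)"
instance
proof
  fix x y z :: "'a l2" and r :: real
  note sm = square_summable_prod[OF l2_summable l2_summable]
  show "inner x y = inner y x"
    unfolding inner_l2_def by (intro infsum_cong) (simp add: algebra_simps)
  show "inner (x + y) z = inner x z + inner y z"
    unfolding inner_l2_def by (subst infsum_add[symmetric]; (rule sm)?) (auto intro!: infsum_cong simp: algebra_simps)
  show "inner (r *\<^sub>R x) y = r * inner x y"
    unfolding inner_l2_def
    by (subst infsum_cmult_right[symmetric]; (rule sm)?) (auto intro!: infsum_cong simp: algebra_simps)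
  have *: "inner x x = (\<Sum>\<^sub>\<infinity>k. (cmod (l2_nth x k))\<^sup>2)" for x :: "'a l2"
    unfolding inner_l2_def by (intro infsum_cong) (simp add: complex_mult_cnj cmod_power2)
  show "0 \<le> inner x x"
    unfolding * by (rule infsum_nonneg) auto
  show "inner x x = 0 \<longleftrightarrow> x = 0"
  proof
    assume "inner x x = 0"
    then have "(cmod (l2_nth x k))\<^sup>2 = 0" for k
      unfolding * using nonneg_infsum_le_0D[of "\<lambda>k. (cmod (l2_nth x k))\<^sup>2" UNIV k] l2_summable by auto
    then show "x = 0" by (intro l2_eqI) auto
  qed (auto simp: *)
qed (auto simp: sgn_l2_def dist_l2_def uniformity_l2_def open_l2_def norm_l2_def)
end

lemma l2_norm_sq: "(norm x)\<^sup>2 = (\<Sum>\<^sub>\<infinity>k. (cmod (l2_nth x k))\<^sup>2)"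
proof -
  have "(norm x)\<^sup>2 = inner x x" by (simp add: power2_norm_eq_inner)
  also have "\<dots> = (\<Sum>\<^sub>\<infinity>k. (cmod (l2_nth x k))\<^sup>2)"
    unfolding inner_l2_def by (intro infsum_cong) (simp add: complex_mult_cnj cmod_power2)
  finally show ?thesis .
qed

lemma l2_sum_le: "finite F \<Longrightarrow> (\<Sum>k\<in>F. (cmod (l2_nth x k))\<^sup>2) \<le> (norm x)\<^sup>2"
  unfolding l2_norm_sq by (intro finite_sum_le_infsum l2_summable) auto

lemma norm_l2_nth_le: "cmod (l2_nth x k) \<le> norm x"
  using l2_sum_le[of "{k}" x] by (auto intro: power2_le_imp_le)

lemma l2_nth_blin: "bounded_linear (\<lambda>x. l2_nth x k)"
  by (rule bounded_linear_intro[where K = 1]) (auto simp: norm_l2_nth_le scaleR_conv_of_real)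

text \<open>Bounds on finite partial sums give summability and the norm bound at once. The operators
  on \<open>l2\<close> below are introduced through this test.\<close>

lemma Abs_l2I:
  assumes "\<And>F. finite F \<Longrightarrow> (\<Sum>k\<in>F. (cmod (a k))\<^sup>2) \<le> B\<^sup>2" "B \<ge> 0"
  shows "l2_nth (Abs_l2 a) = a" "norm (Abs_l2 a) \<le> B"
proof -
  have "bdd_above (sum (\<lambda>k. (cmod (a k))\<^sup>2) ` {F. F \<subseteq> UNIV \<and> finite F})"
    using assms by (intro bdd_aboveI[of _ "B\<^sup>2"]) auto
  then have s: "(\<lambda>k. (cmod (a k))\<^sup>2) summable_on UNIV"
    by (intro nonneg_bdd_above_summable_on) auto
  then show 1: "l2_nth (Abs_l2 a) = a" by (simp add: Abs_l2_inverse)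
  have "(norm (Abs_l2 a))\<^sup>2 \<le> B\<^sup>2"
    unfolding l2_norm_sq 1 using assms by (intro infsum_le_finite_sums s)
  then show "norm (Abs_l2 a) \<le> B" using assms(2) by (rule power2_le_imp_le)
qed

text \<open>The coordinates of a Cauchy sequence converge. The Cauchy estimate is passed to the
  limit on finite index sets, where coordinatewise convergence suffices, and only then taken over
  all of them.\<close>

instance l2 :: (type) banach
proof
  fix X :: "nat \<Rightarrow> 'a l2"
  assume C: "Cauchy X"
  have "Cauchy (\<lambda>n. l2_nth (X n) k)" for k
    by (rule bounded_linear.Cauchy[OF l2_nth_blin C])
  then have "\<exists>l. (\<lambda>n. l2_nth (X n) k) \<longlonglongrightarrow> l" for k
    by (simp add: Cauchy_convergent_iff convergent_def)
  then obtain a where a: "\<And>k. (\<lambda>n. l2_nth (X n) k) \<longlonglongrightarrow> a k" by metis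
  have key: "\<exists>M. \<forall>n\<ge>M. \<forall>F. finite F \<longrightarrow> (\<Sum>k\<in>F. (cmod (l2_nth (X n) k - a k))\<^sup>2) \<le> e\<^sup>2" if "e > 0" for e
  proof -
    from C that obtain M where M: "\<And>m n. m \<ge> M \<Longrightarrow> n \<ge> M \<Longrightarrow> norm (X m - X n) < e"
      by (meson CauchyD)
    have "(\<Sum>k\<in>F. (cmod (l2_nth (X n) k - a k))\<^sup>2) \<le> e\<^sup>2" if n: "n \<ge> M" and F: "finite F" for n F
    proof (rule tendsto_upperbound)
      show "(\<lambda>m. \<Sum>k\<in>F. (cmod (l2_nth (X n) k - l2_nth (X m) k))\<^sup>2)
              \<longlonglongrightarrow> (\<Sum>k\<in>F. (cmod (l2_nth (X n) k - a k))\<^sup>2)"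
        by (intro tendsto_intros a)
      have "(\<Sum>k\<in>F. (cmod (l2_nth (X n) k - l2_nth (X m) k))\<^sup>2) \<le> e\<^sup>2" if "m \<ge> M" for m
        using l2_sum_le[OF F, of "X n - X m"] M[OF n that] \<open>e > 0\<close>
        by simp (meson less_eq_real_def norm_ge_zero order_trans power_mono)
      then show "\<forall>\<^sub>F m in sequentially. (\<Sum>k\<in>F. (cmod (l2_nth (X n) k - l2_nth (X m) k))\<^sup>2) \<le> e\<^sup>2"
        by (auto simp: eventually_sequentially)
    qed auto
    then show ?thesis by blast
  qed
  from key[of 1] obtain M where M: "\<And>F. finite F \<Longrightarrow> (\<Sum>k\<in>F. (cmod (l2_nth (X M) k - a k))\<^sup>2) \<le> 1\<^sup>2"
    by auto
  note d = Abs_l2I(1)[of "\<lambda>k. l2_nth (X M) k - a k", OF M]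
  \<comment> \<open>The family \<open>a\<close> is not yet known to be square-summable; only its
    difference from \<open>X M\<close> is bounded, so the limit is assembled from that
    difference.\<close>
  define L where "L = X M - Abs_l2 (\<lambda>k. l2_nth (X M) k - a k)"
  have L: "l2_nth L = a" by (auto simp: L_def d fun_eq_iff)
  have "X \<longlonglongrightarrow> L"
  proof (rule LIMSEQ_I)
    fix r :: real assume r: "0 < r"
    then obtain N where N: "\<And>n F. n \<ge> N \<Longrightarrow> finite F \<Longrightarrow>
        (\<Sum>k\<in>F. (cmod (l2_nth (X n) k - a k))\<^sup>2) \<le> (r/2)\<^sup>2"
      using key[of "r/2"] by auto
    have "norm (X n - L) \<le> r/2" if "n \<ge> N" for n
    proof (rule power2_le_imp_le)
      show "(norm (X n - L))\<^sup>2 \<le> (r/2)\<^sup>2"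
        unfolding l2_norm_sq using N[OF that] L
        by (intro infsum_le_finite_sums l2_summable) auto
    qed (use r in auto)
    then show "\<exists>no. \<forall>n\<ge>no. norm (X n - L) < r"
      using r by (intro exI[of _ N]) (fastforce intro: le_less_trans)
  qed
  then show "convergent X" by (auto simp: convergent_def)
qed

text \<open>A Fourier multiplier; meaningful for bounded \<open>m\<close>, which keeps the product
  square-summable.\<close>

definition l2_mult :: "('i \<Rightarrow> complex) \<Rightarrow> 'i l2 \<Rightarrow> 'i l2" where
  "l2_mult m x = Abs_l2 (\<lambda>k. m k * l2_nth x k)"

lemma
  assumes "\<And>k. cmod (m k) \<le> C"
  shows l2_nth_mult: "l2_nth (l2_mult m x) k = m k * l2_nth x k"
    and norm_l2_mult_le: "norm (l2_mult m x) \<le> C * norm x"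
    and bounded_linear_l2_mult: "bounded_linear (l2_mult m)"
proof -
  have C: "C \<ge> 0" using assms[of undefined] norm_ge_zero[of "m undefined"] by linarith
  have *: "(\<Sum>k\<in>F. (cmod (m k * l2_nth x k))\<^sup>2) \<le> (C * norm x)\<^sup>2" if "finite F" for F x
  proof -
    have "(\<Sum>k\<in>F. (cmod (m k * l2_nth x k))\<^sup>2) \<le> (\<Sum>k\<in>F. C\<^sup>2 * (cmod (l2_nth x k))\<^sup>2)"
      using assms by (intro sum_mono) (simp add: norm_mult power_mult_distrib mult_right_mono power_mono)
    also have "\<dots> \<le> C\<^sup>2 * (norm x)\<^sup>2"
      unfolding sum_distrib_left[symmetric] using l2_sum_le[OF that] by (intro mult_left_mono) auto
    finally show ?thesis by (simp add: power_mult_distrib)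
  qed
  have 1: "l2_nth (l2_mult m x) k = m k * l2_nth x k" for x k
    unfolding l2_mult_def by (subst Abs_l2I(1)[OF *]) (use C in auto)
  then show "l2_nth (l2_mult m x) k = m k * l2_nth x k" .
  have 2: "norm (l2_mult m x) \<le> C * norm x" for x
    unfolding l2_mult_def by (rule Abs_l2I(2)[OF *]) (use C in auto)
  then show "norm (l2_mult m x) \<le> C * norm x" .
  show "bounded_linear (l2_mult m)"
    by (rule bounded_linear_intro[where K = C])
      (auto simp: 2 1 mult.commute[of _ C] algebra_simps intro!: l2_eqI)
qed

definition l2_delta :: "'i \<Rightarrow> complex \<Rightarrow> 'i l2" where
  "l2_delta i c = Abs_l2 (\<lambda>k. if k = i then c else 0)"

lemma l2_nth_delta: "l2_nth (l2_delta i c) k = (if k = i then c else 0)"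
  and norm_l2_delta_le: "norm (l2_delta i c) \<le> cmod c"
proof -
  have "(\<Sum>k\<in>F. (cmod (if k = i then c else 0))\<^sup>2) \<le> (cmod c)\<^sup>2" if "finite F" for F
  proof -
    have "(\<Sum>k\<in>F. (cmod (if k = i then c else 0))\<^sup>2) = (\<Sum>k\<in>F. if k = i then (cmod c)\<^sup>2 else 0)"
      by (rule sum.cong) auto
    also have "\<dots> \<le> (cmod c)\<^sup>2" using that by simp
    finally show ?thesis .
  qed
  note * = Abs_l2I[of "\<lambda>k. if k = i then c else 0", OF this]
  show "l2_nth (l2_delta i c) k = (if k = i then c else 0)"
    unfolding l2_delta_def by (subst *) auto
  show "norm (l2_delta i c) \<le> cmod c"
    unfolding l2_delta_def by (rule *) auto
qed

lemma bounded_linear_l2_delta: "bounded_linear (l2_delta i)"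
  by (rule bounded_linear_intro[where K = 1])
    (auto simp: norm_l2_delta_le l2_nth_delta scaleR_conv_of_real intro!: l2_eqI)

lemma l2_truncation:
  assumes "e > 0"
  shows "\<exists>F. finite F \<and> norm (x - (\<Sum>k\<in>F. l2_delta k (l2_nth x k))) < e"
proof -
  let ?f = "\<lambda>k. (cmod (l2_nth x k))\<^sup>2"
  from infsum_finite_approximation[OF l2_summable[of x UNIV], of "e\<^sup>2/2"] assms
  obtain F where F: "finite F" "dist (sum ?f F) (infsum ?f UNIV) \<le> e\<^sup>2/2" by auto
  let ?y = "x - (\<Sum>k\<in>F. l2_delta k (l2_nth x k))"
  have nth: "l2_nth ?y k = (if k \<in> F then 0 else l2_nth x k)" for k
    using F(1) by (auto simp: l2_nth_delta)
  have "(norm ?y)\<^sup>2 = infsum ?f (UNIV - F)"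
    unfolding l2_norm_sq nth by (intro infsum_cong_neutral) auto
  also have "\<dots> = infsum ?f UNIV - infsum ?f F"
    by (intro infsum_Diff l2_summable) auto
  also have "\<dots> \<le> e\<^sup>2/2" using F(2) infsum_finite[OF F(1), of ?f] unfolding dist_real_def by linarith
  also have "\<dots> < e\<^sup>2" using assms by auto
  finally have "norm ?y < e" using assms by (auto intro: power2_less_imp_less)
  with F(1) show ?thesis by blast
qed

text \<open>Finitely supported families are dense. This reduces product and Fourier identities to
  single modes, where they are computations with characters.\<close>

lemma bounded_linear_l2_eqI:
  fixes f g :: "'i l2 \<Rightarrow> 'b::real_normed_vector"
  assumes f: "bounded_linear f" and g: "bounded_linear g"
    and eq: "\<And>i c. f (l2_delta i c) = g (l2_delta i c)"
  shows "f x = g x"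
proof -
  interpret h: bounded_linear "\<lambda>x. f x - g x" using f g by (rule bounded_linear_sub)
  obtain K where K: "\<And>x. norm (f x - g x) \<le> norm x * K" "K > 0" using h.pos_bounded by blast
  have "norm (f x - g x) \<le> e" if "e > 0" for e
  proof -
    obtain F where F: "finite F" "norm (x - (\<Sum>k\<in>F. l2_delta k (l2_nth x k))) < e / K"
      using l2_truncation[of "e/K"] \<open>e > 0\<close> K(2) by auto
    let ?y = "\<Sum>k\<in>F. l2_delta k (l2_nth x k)"
    have "f x - g x = f (x - ?y) - g (x - ?y)"
      unfolding h.diff h.sum using eq by simp
    also have "norm \<dots> \<le> norm (x - ?y) * K" by (rule K)
    also have "\<dots> \<le> e" using F(2) K(2) by (simp add: field_simps)
    finally show ?thesis .
  qed
  then have "norm (f x - g x) \<le> 0" by (rule field_le_epsilon) simp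
  then show ?thesis by simp
qed

section \<open>The Sobolev algebra in weighted Fourier coefficients\<close>

text \<open>The square root of the Sobolev weight: Fourier coefficients multiplied by
  \<open>wt s\<close> have the \<open>H^s\<close> norm as their plain \<open>l2\<close>
  norm.\<close>

definition wt :: "nat \<Rightarrow> int ^ 'd \<Rightarrow> real" where
  "wt s k = sqrt ((1 + (norm (freq k))\<^sup>2) ^ s)"

definition chr :: "int ^ 'd \<Rightarrow> real ^ 'd \<Rightarrow> complex" where
  "chr k x = exp (\<i> * complex_of_real (freq k \<bullet> x))"

lemma wt_pos [simp]: "wt s k > 0" and wt_nz [simp]: "wt s k \<noteq> 0"
  and wt_sq: "(wt s k)\<^sup>2 = (1 + (norm (freq k))\<^sup>2) ^ s"
proof -
  have "1 + (norm (freq k))\<^sup>2 > 0" by (rule add_pos_nonneg) auto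
  then show "wt s k > 0" "(wt s k)\<^sup>2 = (1 + (norm (freq k))\<^sup>2) ^ s"
    unfolding wt_def by (auto intro: zero_le_power)
  then show "wt s k \<noteq> 0" by simp
qed

lemma wt_nonneg [simp]: "wt s k \<ge> 0"
  using wt_pos less_imp_le by blast

lemma freq_add: "freq (k + l) = freq k + freq l"
  and freq_minus: "freq (- k) = - freq k"
  and freq_diff: "freq (k - l) = freq k - freq l"
  and freq_0 [simp]: "freq 0 = 0"
  by (auto simp: freq_def vec_eq_iff)

lemma wt_0 [simp]: "wt s 0 = 1" and wt_minus [simp]: "wt s (- k) = wt s k"
  by (auto simp: wt_def freq_minus)

lemma chr_add: "chr (k + l) x = chr k x * chr l x"
  and chr_0 [simp]: "chr 0 x = 1"
  and cnj_chr: "cnj (chr k x) = chr (- k) x"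
  and norm_chr [simp]: "cmod (chr k x) = 1"
  by (auto simp: chr_def freq_add freq_minus inner_add_left algebra_simps exp_add[symmetric] exp_cnj)

text \<open>One of the frequencies \<open>l\<close> and \<open>k - l\<close> has at least half the
  length of \<open>k\<close>. Hence \<open>1 + |k|^2\<close> is at most four times the larger of the
  two bases, and the power of a maximum is at most the sum of the powers.\<close>

lemma wt_triangle: "(wt s k)\<^sup>2 \<le> 4 ^ s * ((wt s l)\<^sup>2 + (wt s (k - l))\<^sup>2)"
proof -
  let ?n = "\<lambda>k. 1 + (norm (freq k))\<^sup>2"
  let ?m = "max (?n l) (?n (k - l))"
  have "norm (freq k) \<le> norm (freq l) + norm (freq (k - l))"
    using norm_triangle_ineq[of "freq l" "freq (k - l)"] by (simp add: freq_diff)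
  then have "(norm (freq k))\<^sup>2 \<le> (norm (freq l) + norm (freq (k - l)))\<^sup>2"
    by (intro power_mono) auto
  also have "\<dots> \<le> 2 * (norm (freq l))\<^sup>2 + 2 * (norm (freq (k - l)))\<^sup>2"
    using sum_squares_bound[of "norm (freq l)" "norm (freq (k - l))"] by (simp add: power2_sum)
  finally have n: "?n k \<le> 2 * ?n l + 2 * ?n (k - l)" by simp
  have "?n k \<le> 4 * ?m"
    using n max.cobounded1[of "?n l" "?n (k - l)"] max.cobounded2[of "?n (k - l)" "?n l"]
    by argo
  then have "?n k ^ s \<le> (4 * ?m) ^ s" by (intro power_mono) auto
  also have "\<dots> = 4 ^ s * ?m ^ s" by (simp add: power_mult_distrib)
  also have "?m ^ s \<le> ?n l ^ s + ?n (k - l) ^ s"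
    by (auto simp: max_def)
  finally show ?thesis by (simp add: wt_sq)
qed

lemma summable_on_int_powr:
  assumes "p > 1/2"
  shows "(\<lambda>n::int. (1 + (real_of_int n)\<^sup>2) powr (- p)) summable_on UNIV"
proof -
  let ?f = "\<lambda>n::int. (1 + (real_of_int n)\<^sup>2) powr (- p)"
  have "summable (\<lambda>n. real n powr (- (2 * p)))"
    using assms by (subst summable_real_powr_iff) auto
  then have s1: "(\<lambda>n. real n powr (- (2 * p))) summable_on UNIV"
    by (intro summable_nonneg_imp_summable_on) auto
  have "(\<lambda>n. ?f (int n)) summable_on UNIV - {0}"
  proof (rule summable_on_comparison_test)
    show "(\<lambda>n. real n powr (- (2 * p))) summable_on UNIV - {0}"
      using s1 by (rule summable_on_subset_banach) auto
    fix n :: nat assume "n \<in> UNIV - {0}"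
    then have n: "real n > 0" by auto
    have "?f (int n) \<le> (real n ^ 2) powr (- p)"
      using assms n by (intro powr_mono2') auto
    also have "\<dots> = real n powr (- (2 * p))"
      using n by (simp add: powr_powr flip: powr_numeral)
    finally show "?f (int n) \<le> real n powr (- (2 * p))" .
  qed auto
  then have "(\<lambda>n. ?f (int n)) summable_on insert 0 (UNIV - {0})"
    by (subst summable_on_insert_iff) auto
  then have s2: "(\<lambda>n. ?f (int n)) summable_on UNIV" by (simp add: insert_UNIV)
  have "?f summable_on range int"
    using s2 by (subst summable_on_reindex) (auto simp: o_def)
  moreover have "?f summable_on range (\<lambda>n. - int n)"
    using s2 by (subst summable_on_reindex) (auto simp: o_def inj_on_def)
  moreover have "UNIV = range int \<union> range (\<lambda>n. - int n)"
    by (auto intro: int_cases2)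
  ultimately show ?thesis by (metis summable_on_union)
qed

text \<open>Splitting the exponent \<open>s\<close> evenly over the \<open>d\<close> coordinates
  gives \<open>p = s / d > 1/2\<close>. Each of the \<open>d\<close> equal factors is at most the
  one-dimensional term in \<open>k $ j\<close>, so the sum is dominated by the \<open>d\<close>-th
  power of a convergent one-dimensional sum.\<close>

lemma summable_on_inverse_wt:
  assumes "CARD('d) < 2 * s"
  shows "(\<lambda>k::int^'d. 1 / (wt s k)\<^sup>2) summable_on UNIV"
proof -
  define p where "p = real s / real CARD('d)"
  have "real CARD('d) < 2 * real s" using assms by linarith
  then have p: "p > 1/2" by (simp add: p_def field_simps)
  define f where "f = (\<lambda>n::int. (1 + (real_of_int n)\<^sup>2) powr (- p))"
  have f0: "f n \<ge> 0" for n by (auto simp: f_def)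
  have sf: "f summable_on UNIV" unfolding f_def using p by (rule summable_on_int_powr)
  have le: "1 / (wt s k)\<^sup>2 \<le> (\<Prod>j\<in>UNIV. f (k $ j))" for k :: "int^'d"
  proof -
    have n1: "1 + (norm (freq k))\<^sup>2 > 0" by (rule add_pos_nonneg) auto
    have "1 / (wt s k)\<^sup>2 = (1 + (norm (freq k))\<^sup>2) powr (- real s)"
      using n1 by (simp add: wt_sq powr_minus powr_realpow divide_inverse)
    also have "\<dots> = ((1 + (norm (freq k))\<^sup>2) powr (- p)) ^ CARD('d)"
      using n1 by (subst powr_power) (auto simp: p_def)
    also have "\<dots> = (\<Prod>j\<in>(UNIV::'d set). (1 + (norm (freq k))\<^sup>2) powr (- p))"
      by simp
    also have "\<dots> \<le> (\<Prod>j\<in>UNIV. f (k $ j))"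
    proof (intro prod_mono conjI)
      fix j
      have "\<bar>real_of_int (k $ j)\<bar> \<le> norm (freq k)"
        using component_le_norm_cart[of "freq k" j] by (simp add: freq_def)
      then have "(real_of_int (k $ j))\<^sup>2 \<le> (norm (freq k))\<^sup>2"
        by (simp add: abs_le_square_iff[symmetric])
      then show "(1 + (norm (freq k))\<^sup>2) powr (- p) \<le> f (k $ j)"
        unfolding f_def using p by (intro powr_mono2') (auto intro: add_pos_nonneg)
    qed auto
    finally show ?thesis .
  qed
  have "bdd_above (sum (\<lambda>k::int^'d. 1 / (wt s k)\<^sup>2) ` {F. F \<subseteq> UNIV \<and> finite F})"
  proof (rule bdd_aboveI)
    fix y assume "y \<in> sum (\<lambda>k::int^'d. 1 / (wt s k)\<^sup>2) ` {F. F \<subseteq> UNIV \<and> finite F}"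
    then obtain F where F: "finite F" "y = (\<Sum>k\<in>F. 1 / (wt s (k::int^'d))\<^sup>2)" by auto
    \<comment> \<open>A finite set of frequencies lies in the cube with sides \<open>I\<close>, over
      which the sum of products factorises.\<close>
    define I where "I = (\<Union>j. (\<lambda>k. k $ j) ` F)"
    have I: "finite I" using F by (auto simp: I_def)
    have FI: "F \<subseteq> vec_lambda ` (Pi\<^sub>E UNIV (\<lambda>_. I))"
    proof
      fix k assume "k \<in> F"
      then show "k \<in> vec_lambda ` (Pi\<^sub>E UNIV (\<lambda>_. I))"
        by (intro image_eqI[of _ _ "vec_nth k"]) (auto simp: I_def)
    qed
    have "y \<le> (\<Sum>k\<in>F. \<Prod>j\<in>UNIV. f (k $ j))" unfolding F using le by (intro sum_mono)
    also have "\<dots> \<le> (\<Sum>k::int^'d\<in>vec_lambda ` (Pi\<^sub>E UNIV (\<lambda>_. I)). \<Prod>j\<in>UNIV. f (k $ j))"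
      by (rule sum_mono2) (use FI I f0 in \<open>auto intro!: prod_nonneg finite_PiE\<close>)
    also have "\<dots> = (\<Sum>g\<in>Pi\<^sub>E (UNIV::'d set) (\<lambda>_. I). \<Prod>j\<in>UNIV. f (g j))"
      by (subst sum.reindex) (auto simp: inj_on_def vec_lambda_inject)
    also have "\<dots> = (\<Prod>j\<in>(UNIV::'d set). \<Sum>n\<in>I. f n)"
      using I by (intro prod_sum_PiE[symmetric]) auto
    also have "\<dots> \<le> (infsum f UNIV) ^ CARD('d)"
      using I f0 sf by (auto intro!: power_mono finite_sum_le_infsum sum_nonneg)
    finally show "y \<le> (infsum f UNIV) ^ CARD('d)" .
  qed
  then show ?thesis by (intro nonneg_bdd_above_summable_on) auto
qed

text \<open>The assumption is \<open>s > d/2\<close> without fractions; \<open>dim\<close> only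
  carries the type of coordinates.\<close>

locale sobolev_space =
  fixes s :: nat and dim :: "'d::finite itself"
  assumes s_gt: "CARD('d) < 2 * s"
begin

text \<open>The constant of the embedding of \<open>H^s\<close> into absolutely convergent Fourier
  series; the sum converges by \<open>s_gt\<close>.\<close>

definition Lam :: real where "Lam = sqrt (\<Sum>\<^sub>\<infinity>k::int^'d. 1 / (wt s k)\<^sup>2)"

text \<open>The true Fourier coefficient: elements of \<open>l2\<close> store it multiplied by the
  weight.\<close>

definition coef :: "(int^'d) l2 \<Rightarrow> int^'d \<Rightarrow> complex" where
  "coef x k = l2_nth x k / wt s k"

lemma Lam_nonneg: "Lam \<ge> 0"
  unfolding Lam_def by (intro real_sqrt_ge_zero infsum_nonneg) auto

lemma Lam_sum: "finite F \<Longrightarrow> (\<Sum>k\<in>F. 1 / (wt s (k::int^'d))\<^sup>2) \<le> Lam\<^sup>2"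
  unfolding Lam_def
  by (subst real_sqrt_pow2)
    (auto intro!: infsum_nonneg finite_sum_le_infsum summable_on_inverse_wt s_gt)

lemma coef_add: "coef (x + y) k = coef x k + coef y k"
  and coef_diff: "coef (x - y) k = coef x k - coef y k"
  and coef_scaleR: "coef (r *\<^sub>R x) k = complex_of_real r * coef x k"
  and coef_0 [simp]: "coef 0 k = 0"
  by (auto simp: coef_def add_divide_distrib diff_divide_distrib)

lemma coef_eqI: "(\<And>k. coef x k = coef y k) \<Longrightarrow> x = y"
  by (rule l2_eqI) (auto simp: coef_def)

text \<open>Sobolev embedding: Cauchy-Schwarz pairs the stored coefficients with the square-summable
  family \<open>1 / wt s\<close>. Point evaluation is a bounded functional for this reason.\<close>

lemma sum_coef_le: "finite F \<Longrightarrow> (\<Sum>k\<in>F. cmod (coef x k)) \<le> Lam * norm x"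
proof -
  assume F: "finite F"
  have "(\<Sum>k\<in>F. cmod (coef x k)) = (\<Sum>k\<in>F. \<bar>1 / wt s k\<bar> * \<bar>cmod (l2_nth x k)\<bar>)"
    by (auto simp: coef_def norm_divide)
  also have "\<dots> \<le> L2_set (\<lambda>k. 1 / wt s k) F * L2_set (\<lambda>k. cmod (l2_nth x k)) F"
    by (rule L2_set_mult_ineq)
  also have "\<dots> \<le> Lam * norm x"
    using Lam_sum[OF F] l2_sum_le[OF F, of x]
    by (intro mult_mono) (auto simp: L2_set_def power_divide Lam_nonneg intro!: real_le_lsqrt sum_nonneg)
  finally show ?thesis .
qed

lemma coef_abs_summable: "(\<lambda>k. norm (coef x k)) summable_on UNIV"
  using sum_coef_le
  by (intro nonneg_bdd_above_summable_on bdd_aboveI[of _ "Lam * norm x"]) auto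

definition ev :: "real^'d \<Rightarrow> (int^'d) l2 \<Rightarrow> complex" where
  "ev p x = (\<Sum>\<^sub>\<infinity>k. coef x k * chr k p)"

lemma ev_abs_summable: "(\<lambda>k. norm (coef x k * chr k p)) summable_on UNIV"
  using coef_abs_summable[of x] by (simp add: norm_mult)

lemmas ev_summable = abs_summable_summable[OF ev_abs_summable]

lemma ev_bound: "cmod (ev p x) \<le> Lam * norm x"
proof -
  have "cmod (ev p x) \<le> (\<Sum>\<^sub>\<infinity>k. norm (coef x k * chr k p))"
    unfolding ev_def by (rule norm_infsum_bound[OF ev_abs_summable])
  also have "\<dots> \<le> Lam * norm x"
    using sum_coef_le by (intro infsum_le_finite_sums ev_abs_summable) (auto simp: norm_mult)
  finally show ?thesis .
qed

lemma bounded_linear_ev: "bounded_linear (ev p)"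
proof (rule bounded_linear_intro[where K = Lam])
  show "ev p (x + y) = ev p x + ev p y" for x y
    unfolding ev_def by (subst infsum_add[symmetric]; (rule ev_summable)?) (simp add: coef_add algebra_simps)
  show "ev p (r *\<^sub>R x) = r *\<^sub>R ev p x" for r x
    unfolding ev_def scaleR_conv_of_real
    by (subst infsum_cmult_right[symmetric]; (rule ev_summable)?) (simp add: coef_scaleR algebra_simps)
  show "norm (ev p x) \<le> norm x * Lam" for x
    using ev_bound[of p x] by (simp add: mult.commute)
qed

definition conv :: "(int^'d) l2 \<Rightarrow> (int^'d) l2 \<Rightarrow> int^'d \<Rightarrow> complex" where
  "conv x y k = (\<Sum>\<^sub>\<infinity>l. coef x l * coef y (k - l))"

definition mul :: "(int^'d) l2 \<Rightarrow> (int^'d) l2 \<Rightarrow> (int^'d) l2" where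
  "mul x y = Abs_l2 (\<lambda>k. wt s k * conv x y k)"

definition Kmul :: real where "Kmul = sqrt (2 * 4 ^ s) * Lam"

lemma Kmul_nonneg: "Kmul \<ge> 0" unfolding Kmul_def using Lam_nonneg by auto

lemma conv_abs_summable: "(\<lambda>l. norm (coef x l * coef y (k - l))) summable_on UNIV"
proof (rule summable_on_comparison_test)
  show "(\<lambda>l. (Lam * norm y) * norm (coef x l)) summable_on UNIV"
    by (intro summable_on_cmult_right coef_abs_summable)
  show "norm (coef x l * coef y (k - l)) \<le> (Lam * norm y) * norm (coef x l)" for l
    using mult_right_mono[OF sum_coef_le[of "{k-l}" y] norm_ge_zero[of "coef x l"]]
    by (simp add: norm_mult mult.commute[of "cmod (coef x l)"])
qed auto

lemmas conv_summable = abs_summable_summable[OF conv_abs_summable]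

text \<open>The estimate that makes \<open>H^s\<close> an algebra. By \<open>wt_triangle\<close> the
  squared kernel is at most \<open>4 ^ s\<close> times a sum of two inverse squared weights, and
  each of these sums to at most \<open>Lam^2\<close>, uniformly in \<open>k\<close>.\<close>

lemma conv_kernel:
  fixes k :: "int^'d"
  assumes "finite L"
  shows "(\<Sum>l\<in>L. (wt s k / (wt s l * wt s (k - l)))\<^sup>2) \<le> Kmul\<^sup>2"
proof -
  have "(\<Sum>l\<in>L. (wt s k / (wt s l * wt s (k - l)))\<^sup>2)
      \<le> (\<Sum>l\<in>L. 4 ^ s * (1 / (wt s (k - l))\<^sup>2 + 1 / (wt s l)\<^sup>2))"
  proof (rule sum_mono)
    fix l
    have "(wt s k / (wt s l * wt s (k - l)))\<^sup>2 = (wt s k)\<^sup>2 / ((wt s l)\<^sup>2 * (wt s (k - l))\<^sup>2)"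
      by (simp add: power_divide power_mult_distrib)
    also have "\<dots> \<le> 4 ^ s * ((wt s l)\<^sup>2 + (wt s (k - l))\<^sup>2) / ((wt s l)\<^sup>2 * (wt s (k - l))\<^sup>2)"
      by (intro divide_right_mono wt_triangle) auto
    also have "\<dots> = 4 ^ s * (1 / (wt s (k - l))\<^sup>2 + 1 / (wt s l)\<^sup>2)"
      by (simp add: field_simps)
    finally show "(wt s k / (wt s l * wt s (k - l)))\<^sup>2 \<le> 4 ^ s * (1 / (wt s (k - l))\<^sup>2 + 1 / (wt s l)\<^sup>2)" .
  qed
  also have "\<dots> = 4 ^ s * ((\<Sum>l\<in>(\<lambda>l. k - l) ` L. 1 / (wt s l)\<^sup>2) + (\<Sum>l\<in>L. 1 / (wt s l)\<^sup>2))"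
    by (subst sum.reindex) (auto simp: inj_on_def sum.distrib sum_distrib_left distrib_left)
  also have "\<dots> \<le> 4 ^ s * (Lam\<^sup>2 + Lam\<^sup>2)"
    using assms by (intro mult_left_mono add_mono Lam_sum) auto
  also have "\<dots> = Kmul\<^sup>2" by (simp add: Kmul_def power_mult_distrib)
  finally show ?thesis .
qed

text \<open>With the inner convolution cut to a finite \<open>L\<close>, Cauchy-Schwarz splits off
  the kernel, bounded by \<open>Kmul^2\<close>; after exchanging the sums the rest factorises into
  the two norms. The bound does not depend on \<open>L\<close> and passes to the limit.\<close>

lemma conv_bound:
  assumes F: "finite F"
  shows "(\<Sum>k\<in>F. (cmod (wt s k * conv x y k))\<^sup>2) \<le> (Kmul * norm x * norm y)\<^sup>2"
proof (rule tendsto_upperbound)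
  show "((\<lambda>L. \<Sum>k\<in>F. (cmod (wt s k * (\<Sum>l\<in>L. coef x l * coef y (k - l))))\<^sup>2) \<longlongrightarrow>
      (\<Sum>k\<in>F. (cmod (wt s k * conv x y k))\<^sup>2)) (finite_subsets_at_top UNIV)"
    unfolding conv_def by (intro tendsto_intros infsum_tendsto conv_summable)
  have "(\<Sum>k\<in>F. (cmod (wt s k * (\<Sum>l\<in>L. coef x l * coef y (k - l))))\<^sup>2) \<le> (Kmul * norm x * norm y)\<^sup>2"
    if L: "finite L" for L
  proof -
    have "(\<Sum>k\<in>F. (cmod (wt s k * (\<Sum>l\<in>L. coef x l * coef y (k - l))))\<^sup>2)
        \<le> (\<Sum>k\<in>F. Kmul\<^sup>2 * (\<Sum>l\<in>L. (cmod (l2_nth x l) * cmod (l2_nth y (k - l)))\<^sup>2))"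
    proof (rule sum_mono)
      fix k :: "int^'d"
      let ?a = "\<lambda>l. wt s k / (wt s l * wt s (k - l))"
      let ?b = "\<lambda>l. cmod (l2_nth x l) * cmod (l2_nth y (k - l))"
      have "cmod (wt s k * (\<Sum>l\<in>L. coef x l * coef y (k - l))) = wt s k * cmod (\<Sum>l\<in>L. coef x l * coef y (k - l))"
        by (simp add: norm_mult)
      also have "\<dots> \<le> wt s k * (\<Sum>l\<in>L. cmod (coef x l * coef y (k - l)))"
        by (intro mult_left_mono norm_sum) auto
      also have "\<dots> = (\<Sum>l\<in>L. \<bar>?a l\<bar> * \<bar>?b l\<bar>)"
        by (auto simp: coef_def norm_mult norm_divide sum_distrib_left intro!: sum.cong)
      also have "\<dots> \<le> L2_set ?a L * L2_set ?b L"
        by (rule L2_set_mult_ineq)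
      finally have "(cmod (wt s k * (\<Sum>l\<in>L. coef x l * coef y (k - l))))\<^sup>2 \<le> (L2_set ?a L * L2_set ?b L)\<^sup>2"
        by (intro power_mono) auto
      also have "\<dots> = (\<Sum>l\<in>L. (?a l)\<^sup>2) * (\<Sum>l\<in>L. (?b l)\<^sup>2)"
        by (simp add: L2_set_def power_mult_distrib sum_nonneg)
      also have "\<dots> \<le> Kmul\<^sup>2 * (\<Sum>l\<in>L. (?b l)\<^sup>2)"
        using L by (intro mult_right_mono conv_kernel sum_nonneg) auto
      finally show "(cmod (wt s k * (\<Sum>l\<in>L. coef x l * coef y (k - l))))\<^sup>2 \<le> Kmul\<^sup>2 * (\<Sum>l\<in>L. (?b l)\<^sup>2)" .
    qed
    also have "\<dots> = Kmul\<^sup>2 * (\<Sum>l\<in>L. (cmod (l2_nth x l))\<^sup>2 * (\<Sum>k\<in>F. (cmod (l2_nth y (k - l)))\<^sup>2))"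
      by (subst sum_distrib_left[symmetric], subst sum.swap) (simp add: power_mult_distrib sum_distrib_left)
    also have "\<dots> \<le> Kmul\<^sup>2 * (\<Sum>l\<in>L. (cmod (l2_nth x l))\<^sup>2 * (norm y)\<^sup>2)"
    proof (intro mult_left_mono sum_mono)
      fix l
      have "(\<Sum>k\<in>F. (cmod (l2_nth y (k - l)))\<^sup>2) = (\<Sum>k\<in>(\<lambda>k. k - l) ` F. (cmod (l2_nth y k))\<^sup>2)"
        by (subst sum.reindex) (auto simp: inj_on_def)
      also have "\<dots> \<le> (norm y)\<^sup>2" using F by (intro l2_sum_le) auto
      finally show "(\<Sum>k\<in>F. (cmod (l2_nth y (k - l)))\<^sup>2) \<le> (norm y)\<^sup>2" .
    qed auto
    also have "\<dots> \<le> Kmul\<^sup>2 * ((norm x)\<^sup>2 * (norm y)\<^sup>2)"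
      unfolding sum_distrib_right[symmetric] by (intro mult_left_mono mult_right_mono l2_sum_le L) auto
    finally show ?thesis by (simp add: power_mult_distrib)
  qed
  then show "\<forall>\<^sub>F L in finite_subsets_at_top UNIV.
      (\<Sum>k\<in>F. (cmod (wt s k * (\<Sum>l\<in>L. coef x l * coef y (k - l))))\<^sup>2) \<le> (Kmul * norm x * norm y)\<^sup>2"
    by (intro eventually_finite_subsets_at_top_weakI) auto
qed auto

lemma coef_mul: "coef (mul x y) k = conv x y k"
  unfolding mul_def coef_def
  by (subst Abs_l2I(1)[OF conv_bound]) (auto simp: Kmul_nonneg)

lemma norm_mul_le: "norm (mul x y) \<le> Kmul * norm x * norm y"
  unfolding mul_def by (rule Abs_l2I(2)[OF conv_bound]) (auto simp: Kmul_nonneg)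

lemma bounded_bilinear_mul: "bounded_bilinear mul"
proof
  show "\<exists>K. \<forall>x y. norm (mul x y) \<le> norm x * norm y * K"
    using norm_mul_le by (intro exI[of _ Kmul]) (auto simp: algebra_simps)
next
  show "mul (x + y) z = mul x z + mul y z" for x y z
    by (rule coef_eqI, unfold coef_mul coef_add conv_def, subst infsum_add[symmetric]; (rule conv_summable)?)
      (simp add: coef_add ring_distribs)
  show "mul z (x + y) = mul z x + mul z y" for x y z
    by (rule coef_eqI, unfold coef_mul coef_add conv_def, subst infsum_add[symmetric]; (rule conv_summable)?)
      (simp add: coef_add ring_distribs)
  show "mul (r *\<^sub>R x) y = r *\<^sub>R mul x y" for r x y
    by (rule coef_eqI, unfold coef_mul coef_scaleR conv_def, subst infsum_cmult_right[symmetric]; (rule conv_summable)?)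
      (simp add: coef_scaleR ac_simps)
  show "mul x (r *\<^sub>R y) = r *\<^sub>R mul x y" for r x y
    by (rule coef_eqI, unfold coef_mul coef_scaleR conv_def, subst infsum_cmult_right[symmetric]; (rule conv_summable)?)
      (simp add: coef_scaleR ac_simps)
qed

definition mode :: "int^'d \<Rightarrow> complex \<Rightarrow> (int^'d) l2" where
  "mode k c = l2_delta k (complex_of_real (wt s k) * c)"

lemma coef_mode: "coef (mode k c) l = (if l = k then c else 0)"
  by (auto simp: coef_def mode_def l2_nth_delta)

lemma bounded_linear_mode: "bounded_linear (mode k)"
  unfolding mode_def by (rule bounded_linear_compose[OF bounded_linear_l2_delta bounded_linear_mult_right])

lemma ev_mode: "ev p (mode k c) = c * chr k p"
proof -
  have "ev p (mode k c) = (\<Sum>\<^sub>\<infinity>l\<in>{k}. c * chr l p)"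
    unfolding ev_def coef_mode by (rule infsum_cong_neutral) auto
  then show ?thesis by simp
qed

lemma l2_delta_mode: "l2_delta k c = mode k (c / wt s k)"
  by (simp add: mode_def)

lemma bounded_linear_eq_modeI:
  fixes f g :: "(int^'d) l2 \<Rightarrow> 'b::real_normed_vector"
  assumes "bounded_linear f" "bounded_linear g" "\<And>i c. f (mode i c) = g (mode i c)"
  shows "f x = g x"
  by (rule bounded_linear_l2_eqI[OF assms(1,2)]) (simp add: l2_delta_mode assms(3))

lemma mul_mode: "mul (mode k a) (mode l b) = mode (k + l) (a * b)"
proof (rule coef_eqI)
  fix m
  have "coef (mul (mode k a) (mode l b)) m = (\<Sum>\<^sub>\<infinity>i\<in>{k}. a * coef (mode l b) (m - i))"
    unfolding coef_mul conv_def coef_mode by (rule infsum_cong_neutral) auto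
  then show "coef (mul (mode k a) (mode l b)) m = coef (mode (k + l) (a * b)) m"
    by (auto simp: coef_mode)
qed

text \<open>Two density arguments, one for each factor, reduce this to
  \<open>chr (k + l) = chr k * chr l\<close>. Together with \<open>ev_eqI\<close> it allows
  algebraic identities in the algebra to be checked pointwise.\<close>

lemma ev_mul: "ev p (mul x y) = ev p x * ev p y"
proof -
  note l = bounded_bilinear.bounded_linear_left[OF bounded_bilinear_mul]
    and r = bounded_bilinear.bounded_linear_right[OF bounded_bilinear_mul]
  have 1: "ev p (mul (mode k a) y) = ev p (mode k a) * ev p y" for k a
    by (rule bounded_linear_eq_modeI[where f = "\<lambda>y. ev p (mul (mode k a) y)" and g = "\<lambda>y. ev p (mode k a) * ev p y",
          OF bounded_linear_compose[OF bounded_linear_ev r] bounded_linear_const_mult[OF bounded_linear_ev]])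
      (simp add: mul_mode ev_mode chr_add)
  show ?thesis
    by (rule bounded_linear_eq_modeI[where f = "\<lambda>x. ev p (mul x y)" and g = "\<lambda>x. ev p x * ev p y",
          OF bounded_linear_compose[OF bounded_linear_ev l] bounded_linear_mult_const[OF bounded_linear_ev]])
      (rule 1)
qed

end

section \<open>Fourier analysis on the torus\<close>

lemma torus_periodicD: "torus_periodic f \<Longrightarrow> f (x + axis j (2 * pi)) = f x"
  by (simp add: torus_periodic_def)

text \<open>The box enlarged by \<open>t\<close> in direction \<open>j\<close> is cut once at height
  \<open>2 * pi\<close> and once at height \<open>t\<close>. The two slabs that are cut off are
  translates by one period, so the remaining pieces have equal integrals.\<close>

lemma integral_torus_translate:
  fixes f :: "real ^ 'd \<Rightarrow> complex"
  assumes c: "continuous_on UNIV f" and p: "torus_periodic f" and t: "0 \<le> t" "t \<le> 2 * pi"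
  shows "integral torus_cell (\<lambda>x. f (x + axis j t)) = integral torus_cell f"
proof -
  define b :: "real^'d" where "b = (\<chi> i. 2 * pi)"
  define e :: "real^'d" where "e = axis j t"
  define C where "C = cbox 0 (b + e)"
  have ax: "x \<bullet> axis j 1 = x $ j" for x :: "real^'d" by (simp add: inner_axis)
  have int: "f integrable_on cbox u v" for u v
    by (rule integrable_continuous) (rule continuous_on_subset[OF c], simp)
  have pi: "pi > 0" by simp
  have k: "axis j (1::real) \<in> Basis" by simp
  have all_but: "((\<forall>i. P i) \<and> Q) = (\<forall>i. R i)"
    if "\<And>i. i \<noteq> j \<Longrightarrow> P i = R i" "(P j \<and> Q) = R j" for P R :: "'d \<Rightarrow> bool" and Q
    using that by metis
  have mem: "x \<in> C \<longleftrightarrow> (\<forall>i. 0 \<le> x $ i \<and> x $ i \<le> 2 * pi + (if i = j then t else 0))" for x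
    by (simp add: C_def mem_box_cart b_def e_def axis_def)
  have 1: "C \<inter> {x. x \<bullet> axis j 1 \<le> 2 * pi} = cbox 0 b"
    unfolding set_eq_iff Int_iff mem mem_Collect_eq ax mem_box_cart
    by (intro allI all_but) (use t in \<open>auto simp: b_def\<close>)
  have 2: "C \<inter> {x. x \<bullet> axis j 1 \<ge> 2 * pi} = cbox (axis j (2 * pi)) (b + e)"
    unfolding set_eq_iff Int_iff mem mem_Collect_eq ax mem_box_cart
    by (intro allI all_but) (use t pi in \<open>auto simp: b_def e_def axis_def\<close>)
  have 3: "C \<inter> {x. x \<bullet> axis j 1 \<le> t} = cbox 0 (b + e - axis j (2 * pi))"
    unfolding set_eq_iff Int_iff mem mem_Collect_eq ax mem_box_cart
    by (intro allI all_but) (use t pi in \<open>auto simp: b_def e_def axis_def\<close>)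
  have 4: "C \<inter> {x. x \<bullet> axis j 1 \<ge> t} = cbox e (b + e)"
    unfolding set_eq_iff Int_iff mem mem_Collect_eq ax mem_box_cart
    by (intro allI all_but) (use t pi in \<open>auto simp: b_def e_def axis_def\<close>)
  have 5: "integral (cbox (axis j (2 * pi)) (b + e)) f = integral (cbox 0 (b + e - axis j (2 * pi))) f"
  proof -
    have "integral (cbox (axis j (2 * pi) - axis j (2 * pi)) (b + e - axis j (2 * pi)))
        (\<lambda>x. f (x + axis j (2 * pi))) = integral (cbox (axis j (2 * pi)) (b + e)) f"
      by (rule integral_shift_cbox)
    then show ?thesis by (simp only: torus_periodicD[OF p] diff_self)
  qed
  have "integral (cbox (e - e) (b + e - e)) (\<lambda>x. f (x + e)) = integral (cbox e (b + e)) f"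
    by (rule integral_shift_cbox)
  then have "integral (cbox 0 b) (\<lambda>x. f (x + e)) = integral (cbox e (b + e)) f"
    by (simp only: diff_self add_diff_cancel)
  also have "\<dots> = integral C f - integral (cbox 0 (b + e - axis j (2 * pi))) f"
    using integral_split[OF int k, of 0 "b + e" t] 3 4 unfolding C_def by simp
  also have "\<dots> = integral (cbox 0 b) f"
    using integral_split[OF int k, of 0 "b + e" "2 * pi"] 1 2 5 unfolding C_def by simp
  finally show ?thesis by (simp add: torus_cell_def b_def e_def)
qed

lemma has_vector_derivative_axis:
  fixes f :: "real ^ 'd \<Rightarrow> 'b::real_normed_vector"
  assumes "f differentiable (at (x + axis j t))"
  shows "((\<lambda>t. f (x + axis j t)) has_vector_derivative partial j f (x + axis j t)) (at t)"
proof -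
  have ax: "axis j t = t *\<^sub>R axis j 1" for t :: real by (auto simp: axis_def vec_eq_iff)
  have "((\<lambda>t. x + t *\<^sub>R axis j 1) has_derivative (\<lambda>h. h *\<^sub>R axis j 1)) (at t)"
    by (auto intro!: derivative_eq_intros)
  moreover have "(\<lambda>t. x + axis j t) = (\<lambda>t. x + t *\<^sub>R axis j 1)" "axis j = (\<lambda>h. h *\<^sub>R axis j 1)"
    by (auto simp: axis_def vec_eq_iff fun_eq_iff)
  ultimately have 1: "((\<lambda>t. x + axis j t) has_derivative axis j) (at t)" by metis
  have 2: "(f has_derivative frechet_derivative f (at (x + axis j t))) (at (x + axis j t))"
    using assms by (simp add: frechet_derivative_works[symmetric])
  interpret bounded_linear "frechet_derivative f (at (x + axis j t))"
    using 2 by (rule has_derivative_bounded_linear)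
  have "(\<lambda>h. frechet_derivative f (at (x + axis j t)) (axis j h)) =
      (\<lambda>h. h *\<^sub>R frechet_derivative f (at (x + axis j t)) (axis j 1))"
    by (rule ext, subst ax, rule scaleR)
  then show ?thesis
    unfolding has_vector_derivative_def partial_def
    using has_derivative_compose[OF 1, OF 2] by simp
qed

lemma torus_periodic_partial:
  assumes "torus_periodic f"
  shows "torus_periodic (partial j f)"
  unfolding torus_periodic_def
proof (intro allI)
  fix x i
  have eq: "(\<lambda>x. f (x + axis i (2 * pi))) = f" using assms by (simp add: torus_periodic_def)
  \<comment> \<open>Equality for every candidate \<open>D\<close> makes the chosen
    \<open>frechet_derivative\<close> agree at both points even where \<open>f\<close> is not
    differentiable.\<close>
  have "(f has_derivative D) (at (x + axis i (2 * pi))) = (f has_derivative D) (at x)" for D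
  proof
    assume a: "(f has_derivative D) (at (x + axis i (2 * pi)))"
    have "((\<lambda>x. x + axis i (2 * pi)) has_derivative (\<lambda>h. h)) (at x)"
      by (auto intro!: derivative_eq_intros)
    from has_derivative_compose[OF this, where g = f, OF a] show "(f has_derivative D) (at x)"
      unfolding eq .
  next
    assume a: "(f has_derivative D) (at x)"
    have "((\<lambda>x. x - axis i (2 * pi)) has_derivative (\<lambda>h. h)) (at (x + axis i (2 * pi)))"
      by (auto intro!: derivative_eq_intros)
    from has_derivative_compose[OF this, where g = f and g' = D] a
    have "((\<lambda>x. f (x - axis i (2 * pi))) has_derivative D) (at (x + axis i (2 * pi)))"
      by (simp only: add_diff_cancel)
    moreover have "f (x - axis i (2 * pi)) = f x" for x
      using torus_periodicD[OF assms, of "x - axis i (2 * pi)" i] by (simp only: diff_add_cancel)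
    ultimately show "(f has_derivative D) (at (x + axis i (2 * pi)))" by (simp only:)
  qed
  then show "partial j f (x + axis i (2 * pi)) = partial j f x"
    unfolding partial_def frechet_derivative_def by simp
qed

text \<open>Along a full period in direction \<open>j\<close> the derivative integrates to zero.
  Averaging over translations by \<open>t\<close> and swapping the integrals turns this into
  \<open>2 * pi\<close> times the integral over the cell.\<close>

lemma integral_partial_torus:
  fixes f :: "real ^ 'd \<Rightarrow> complex"
  assumes p: "torus_periodic f" and d: "\<And>x. f differentiable (at x)"
    and c: "continuous_on UNIV (partial j f)"
  shows "integral torus_cell (partial j f) = 0"
proof -
  let ?g = "partial j f"
  have pi: "0 \<le> 2 * pi" by simp
  have ft: "integral {0..2*pi} (\<lambda>t. ?g (x + axis j t)) = 0" for x
  proof -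
    have "((\<lambda>t. ?g (x + axis j t)) has_integral (f (x + axis j (2 * pi)) - f (x + axis j 0))) {0..2*pi}"
      by (rule fundamental_theorem_of_calculus[where f = "\<lambda>t. f (x + axis j t)", OF pi])
        (rule has_vector_derivative_at_within[OF has_vector_derivative_axis[OF d]])
    moreover have "axis j (0::real) = 0" by (simp add: axis_def vec_eq_iff)
    ultimately show ?thesis using torus_periodicD[OF p, of x j] by (simp add: integral_unique)
  qed
  then have "0 = integral torus_cell (\<lambda>x. integral (cbox 0 (2*pi)) (\<lambda>t. ?g (x + axis j t)))"
    by (simp only: ft box_real integral_0)
  also have "\<dots> = integral (cbox 0 (2*pi)) (\<lambda>t. integral torus_cell (\<lambda>x. ?g (x + axis j t)))"
    unfolding torus_cell_def
  proof (rule integral_swap_continuous[where f = "\<lambda>x t. ?g (x + axis j t)"])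
    have ax: "axis j t = t *\<^sub>R axis j 1" for t :: real by (auto simp: axis_def vec_eq_iff)
    have "continuous_on A (\<lambda>z. ?g (fst z + snd z *\<^sub>R axis j 1))" for A
      by (rule continuous_on_compose2[OF c]) (auto intro!: continuous_intros)
    then show "continuous_on (cbox (0, 0) (\<chi> i. 2 * pi, 2 * pi)) (\<lambda>(x, t). ?g (x + axis j t))"
      by (simp add: case_prod_beta ax[of "snd _"])
  qed
  also have "\<dots> = integral (cbox 0 (2*pi)) (\<lambda>t. integral torus_cell ?g)"
    by (rule integral_cong) (simp add: integral_torus_translate[OF c torus_periodic_partial[OF p]])
  also have "\<dots> = (2*pi) *\<^sub>R integral torus_cell ?g"
    by simp
  finally show ?thesis by simp
qed

lemma partial_eqI:
  "(f has_derivative D) (at x) \<Longrightarrow> partial j f x = D (axis j 1)"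
  unfolding partial_def by (metis frechet_derivative_at)

lemma chr_has_derivative:
  "(chr k has_derivative (\<lambda>h. \<i> * complex_of_real (freq k \<bullet> h) * chr k x)) (at x)"
proof -
  have 1: "((\<lambda>x. \<i> * complex_of_real (freq k \<bullet> x)) has_derivative (\<lambda>h. \<i> * complex_of_real (freq k \<bullet> h))) (at x)"
    by (intro derivative_eq_intros) auto
  have 2: "(exp has_derivative (*) (exp (\<i> * complex_of_real (freq k \<bullet> x)))) (at (\<i> * complex_of_real (freq k \<bullet> x)))"
    using DERIV_exp has_field_derivative_def by blast
  from has_derivative_compose[OF 1, OF 2] show ?thesis
    unfolding chr_def by (simp add: mult.commute)
qed

lemma partial_chr: "partial j (chr k) x = \<i> * of_int (k $ j) * chr k x"
  by (subst partial_eqI[OF chr_has_derivative]) (simp add: freq_def inner_axis)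

lemma continuous_on_chr: "continuous_on A (chr k)"
  unfolding chr_def by (intro continuous_intros)

lemma torus_periodic_chr: "torus_periodic (chr k)"
  unfolding torus_periodic_def
proof (intro allI)
  fix x j
  have "chr k (axis j (2 * pi)) = exp ((2 * of_int (k $ j) * pi) * \<i>)"
    by (simp add: chr_def freq_def inner_axis algebra_simps)
  also have "\<dots> = 1" by (rule exp_integer_2pi) auto
  finally have "chr k (axis j (2 * pi)) = 1" .
  then show "chr k (x + axis j (2 * pi)) = chr k x"
    by (simp add: chr_def inner_add_right distrib_left exp_add)
qed

lemma content_torus_cell: "measure lborel (torus_cell :: (real^'d) set) = (2 * pi) ^ CARD('d)"
proof -
  have "(0::real^'d) \<in> torus_cell" by (simp add: torus_cell_def mem_box_cart)
  then show ?thesis unfolding torus_cell_def by (subst content_cbox_cart) auto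
qed

text \<open>If some \<open>k $ j\<close> is nonzero, then \<open>chr k\<close> is up to a nonzero
  factor its own derivative in direction \<open>j\<close>, and derivatives integrate to
  zero.\<close>

lemma integral_chr: "integral torus_cell (chr (k :: int^'d)) = (if k = 0 then (2 * pi) ^ CARD('d) else 0)"
proof (cases "k = 0")
  case True
  have "chr (0 :: int^'d) = (\<lambda>_. 1)" by (auto simp: fun_eq_iff)
  moreover note content_torus_cell[where 'd = 'd]
  ultimately show ?thesis using True by (simp add: torus_cell_def scaleR_conv_of_real)
next
  case False
  then obtain j where j: "k $ j \<noteq> 0" by (auto simp: vec_eq_iff)
  have "integral torus_cell (partial j (chr k)) = 0"
    by (rule integral_partial_torus)
      (auto simp: torus_periodic_chr partial_chr[abs_def] intro!: continuous_intros continuous_on_chr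
        differentiableI[OF chr_has_derivative])
  then show ?thesis using j False by (simp add: partial_chr[abs_def])
qed

lemma fourier_coeff_eq:
  "fourier_coeff f (k::int^'d) = (LINT x:torus_cell|lebesgue. f x * chr (- k) x) / (2 * pi) ^ CARD('d)"
  unfolding fourier_coeff_def chr_def by (simp add: freq_minus)

lemma set_integrable_torus:
  "continuous_on UNIV f \<Longrightarrow> set_integrable lebesgue torus_cell (f :: real^'d \<Rightarrow> complex)"
  unfolding torus_cell_def
  by (rule absolutely_integrable_continuous) (rule continuous_on_subset, auto)

lemma set_integral_torus:
  "continuous_on UNIV f \<Longrightarrow> (LINT x:torus_cell|lebesgue. f x) = integral torus_cell (f :: real^'d \<Rightarrow> complex)"
  by (rule set_lebesgue_integral_eq_integral(2)[OF set_integrable_torus])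

lemma fourier_coeff_cont:
  "continuous_on UNIV f \<Longrightarrow> fourier_coeff f (k::int^'d) = integral torus_cell (\<lambda>x. f x * chr (- k) x) / (2 * pi) ^ CARD('d)"
  unfolding fourier_coeff_eq by (subst set_integral_torus) (auto intro!: continuous_intros continuous_on_chr)

lemma fourier_coeff_chr: "fourier_coeff (chr l) k = (if k = l then 1 else 0)"
proof -
  have "(\<lambda>x. chr l x * chr (- k) x) = chr (l - k)"
    by (auto simp: fun_eq_iff simp flip: chr_add)
  then show ?thesis by (simp add: fourier_coeff_cont continuous_on_chr integral_chr)
qed

lemma integrable_torus:
  "continuous_on UNIV f \<Longrightarrow> (f :: real^'d \<Rightarrow> complex) integrable_on torus_cell"
  unfolding torus_cell_def by (intro integrable_continuous) (auto intro: continuous_on_subset)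

lemma fourier_coeff_partial:
  fixes f :: "real ^ 'd \<Rightarrow> complex"
  assumes p: "torus_periodic f" and d: "\<And>x. f differentiable (at x)"
    and c: "continuous_on UNIV (partial j f)"
  shows "fourier_coeff (partial j f) k = \<i> * of_int (k $ j) * fourier_coeff f k"
proof -
  have cf: "continuous_on UNIV f"
    using d by (simp add: continuous_on_eq_continuous_at differentiable_imp_continuous_within)
  let ?F = "\<lambda>x. f x * chr (- k) x"
  have der: "(?F has_derivative (\<lambda>h. f x * (\<i> * complex_of_real (freq (- k) \<bullet> h) * chr (- k) x) +
      frechet_derivative f (at x) h * chr (- k) x)) (at x)" for x
    by (intro has_derivative_mult chr_has_derivative frechet_derivative_works[THEN iffD1] d)
  have pF: "partial j ?F x = partial j f x * chr (- k) x - \<i> * of_int (k $ j) * (f x * chr (- k) x)" for x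
    by (subst partial_eqI[OF der]) (simp add: partial_def freq_def inner_axis algebra_simps)
  have "integral torus_cell (partial j ?F) = 0"
  proof (rule integral_partial_torus)
    show "torus_periodic ?F" using p torus_periodic_chr[of "- k"] by (simp add: torus_periodic_def)
    show "?F differentiable (at x)" for x using der by (rule differentiableI)
    show "continuous_on UNIV (partial j ?F)"
      unfolding pF[abs_def] by (intro continuous_intros c cf continuous_on_chr)
  qed
  moreover have "integral torus_cell (partial j ?F)
      = integral torus_cell (\<lambda>x. partial j f x * chr (- k) x) - \<i> * of_int (k $ j) * integral torus_cell ?F"
    unfolding pF[abs_def]
    by (subst integral_diff)
      (auto intro!: integrable_torus continuous_intros c cf continuous_on_chr)
  ultimately show ?thesis
    by (simp add: fourier_coeff_cont c cf)
qed

text \<open>Expanding \<open>|f - p|^2 >= 0\<close> for the partial Fourier sum \<open>p\<close>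
  over \<open>F\<close>. The \<open>L^2\<close> norm is then replaced by the supremum bound; the
  volume of the cell cancels against the normalisation of the coefficients.\<close>

lemma bessel_inequality:
  fixes f :: "real ^ 'd \<Rightarrow> complex"
  assumes c: "continuous_on UNIV f" and B: "\<And>x. cmod (f x) \<le> B" and F: "finite F"
  shows "(\<Sum>k\<in>F. (cmod (fourier_coeff f k))\<^sup>2) \<le> B\<^sup>2"
proof -
  define N where "N = complex_of_real ((2 * pi) ^ CARD('d))"
  define a where "a = fourier_coeff f"
  define p where "p = (\<lambda>x. \<Sum>k\<in>F. a k * chr k x)"
  define S where "S = (\<Sum>k\<in>F. (cmod (a k))\<^sup>2)"
  have N0: "N \<noteq> 0" by (simp add: N_def)
  have cp: "continuous_on UNIV p" unfolding p_def by (intro continuous_intros continuous_on_chr)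
  have fa: "integral torus_cell (\<lambda>x. f x * chr (- k) x) = N * a k" for k
    using N0 by (simp add: a_def fourier_coeff_cont[OF c] N_def)
  have 1: "integral torus_cell (\<lambda>x. f x * cnj (p x)) = N * S"
  proof -
    have "(\<lambda>x. f x * cnj (p x)) = (\<lambda>x. \<Sum>k\<in>F. cnj (a k) * (f x * chr (- k) x))"
      by (auto simp: p_def sum_distrib_left cnj_chr algebra_simps fun_eq_iff)
    then have "integral torus_cell (\<lambda>x. f x * cnj (p x)) = (\<Sum>k\<in>F. integral torus_cell (\<lambda>x. cnj (a k) * (f x * chr (- k) x)))"
      by (simp only:) (intro integral_sum F integrable_torus continuous_intros c continuous_on_chr)
    also have "\<dots> = (\<Sum>k\<in>F. N * (cmod (a k))\<^sup>2)"
      by (simp only: Henstock_Kurzweil_Integration.integral_mult_right fa) (simp add: complex_norm_square[symmetric] ac_simps)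
    finally show ?thesis by (simp add: S_def sum_distrib_left)
  qed
  have 2: "integral torus_cell (\<lambda>x. p x * cnj (p x)) = N * S"
  proof -
    have pc: "integral torus_cell (\<lambda>x. p x * chr (- k) x) = N * (if k \<in> F then a k else 0)" for k
    proof -
      have "(\<lambda>x. p x * chr (- k) x) = (\<lambda>x. \<Sum>l\<in>F. a l * chr (l - k) x)"
        by (auto simp: p_def sum_distrib_right fun_eq_iff mult.assoc simp flip: chr_add)
      then have "integral torus_cell (\<lambda>x. p x * chr (- k) x) = (\<Sum>l\<in>F. integral torus_cell (\<lambda>x. a l * chr (l - k) x))"
        by (simp only:) (intro integral_sum F integrable_torus continuous_intros c continuous_on_chr)
      also have "\<dots> = (\<Sum>l\<in>F. if l = k then a l * N else 0)"
        by (intro sum.cong refl) (simp add: integral_chr N_def)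
      finally show ?thesis using F by simp
    qed
    have "(\<lambda>x. p x * cnj (p x)) = (\<lambda>x. \<Sum>k\<in>F. cnj (a k) * (p x * chr (- k) x))"
      by (subst (2) p_def) (auto simp: sum_distrib_left cnj_chr algebra_simps fun_eq_iff)
    then have "integral torus_cell (\<lambda>x. p x * cnj (p x)) = (\<Sum>k\<in>F. integral torus_cell (\<lambda>x. cnj (a k) * (p x * chr (- k) x)))"
      by (simp only:) (intro integral_sum F integrable_torus continuous_intros cp continuous_on_chr)
    also have "\<dots> = (\<Sum>k\<in>F. N * (cmod (a k))\<^sup>2)"
      by (simp only: Henstock_Kurzweil_Integration.integral_mult_right pc) (simp add: complex_norm_square[symmetric] ac_simps)
    finally show ?thesis by (simp add: S_def sum_distrib_left)
  qed
  have 3: "integral torus_cell (\<lambda>x. p x * cnj (f x)) = N * S"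
  proof -
    have "(\<lambda>x. p x * cnj (f x)) = (\<lambda>x. cnj (f x * cnj (p x)))" by (simp add: mult.commute)
    moreover have "integral torus_cell (\<lambda>x. cnj (f x * cnj (p x))) = cnj (integral torus_cell (\<lambda>x. f x * cnj (p x)))"
      by (rule integral_linear[OF _ bounded_linear_cnj, unfolded o_def])
        (intro integrable_torus continuous_intros c cp)
    ultimately show ?thesis by (simp add: 1 N_def)
  qed
  have "integral torus_cell (\<lambda>x. (f x - p x) * cnj (f x - p x)) = integral torus_cell (\<lambda>x. f x * cnj (f x)) - N * S"
  proof -
    have "(\<lambda>x. (f x - p x) * cnj (f x - p x)) = (\<lambda>x. (f x * cnj (f x) - f x * cnj (p x)) - (p x * cnj (f x) - p x * cnj (p x)))"
      by (auto simp: algebra_simps fun_eq_iff)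
    then show ?thesis
      by (simp only:) (subst integral_diff, (intro integrable_torus continuous_intros c cp)+,
        subst integral_diff, (intro integrable_torus continuous_intros c cp)+,
        subst integral_diff, (intro integrable_torus continuous_intros c cp)+, simp add: 1 2 3)
  qed
  then have 4: "integral torus_cell (\<lambda>x. f x * cnj (f x)) = integral torus_cell (\<lambda>x. (f x - p x) * cnj (f x - p x)) + N * S"
    by simp
  have sq: "Re (integral torus_cell (\<lambda>x. g x * cnj (g x))) = integral torus_cell (\<lambda>x. (cmod (g x))\<^sup>2)"
    if "continuous_on UNIV g" for g :: "real^'d \<Rightarrow> complex"
  proof -
    have "integral torus_cell (\<lambda>x. Re (g x * cnj (g x))) = Re (integral torus_cell (\<lambda>x. g x * cnj (g x)))"
      by (rule integral_linear[OF _ bounded_linear_Re, unfolded o_def])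
        (intro integrable_torus continuous_intros that)
    then show ?thesis by (simp add: complex_mult_cnj cmod_power2)
  qed
  have "(2 * pi) ^ CARD('d) * S \<le> integral torus_cell (\<lambda>x. (cmod (f x))\<^sup>2)"
  proof -
    have "0 \<le> integral torus_cell (\<lambda>x. (cmod (f x - p x))\<^sup>2)"
      unfolding torus_cell_def
      by (intro integral_nonneg integrable_continuous continuous_intros)
        (auto intro: continuous_on_subset[OF c] continuous_on_subset[OF cp])
    with arg_cong[OF 4, of Re] show ?thesis
      using sq[OF c] sq[OF continuous_on_diff[OF c cp]] by (simp add: N_def)
  qed
  also have "\<dots> \<le> integral torus_cell (\<lambda>x::real^'d. B\<^sup>2)"
    unfolding torus_cell_def using B
    by (intro integral_le integrable_continuous continuous_intros)
      (auto intro: continuous_on_subset[OF c] power_mono)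
  also have "\<dots> = (2 * pi) ^ CARD('d) * B\<^sup>2"
    using content_torus_cell[where 'd = 'd] by (simp add: torus_cell_def)
  finally show ?thesis by (simp add: S_def a_def)
qed

section \<open>Fourier coefficients determine an integrable function almost everywhere\<close>

lemma torus_dominated:
  fixes H q :: "real^'d \<Rightarrow> complex"
  assumes H: "integrable lebesgue H" and H0: "\<And>x. x \<notin> torus_cell \<Longrightarrow> H x = 0"
    and q: "continuous_on UNIV q"
  shows "integrable lebesgue (\<lambda>x. H x * q x)"
proof -
  have "compact (q ` torus_cell)"
    by (rule compact_continuous_image[OF continuous_on_subset[OF q]]) (auto simp: torus_cell_def)
  then obtain B where B: "\<And>x. x \<in> torus_cell \<Longrightarrow> cmod (q x) \<le> B"
    by (meson bounded_iff compact_imp_bounded imageI)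
  have mq: "q \<in> borel_measurable lebesgue"
    using borel_measurable_continuous_onI[OF q] by (simp add: measurable_completion)
  show ?thesis
  proof (rule Bochner_Integration.integrable_bound)
    show "integrable lebesgue (\<lambda>x. complex_of_real B * H x)" using H by simp
    show "(\<lambda>x. H x * q x) \<in> borel_measurable lebesgue"
      using borel_measurable_integrable[OF H] mq by (rule borel_measurable_times)
    show "AE x in lebesgue. norm (H x * q x) \<le> norm (complex_of_real B * H x)"
    proof (rule AE_I2)
      fix x
      show "norm (H x * q x) \<le> norm (complex_of_real B * H x)"
      proof (cases "x \<in> torus_cell")
        case True
        then have "cmod (q x) \<le> \<bar>B\<bar>" using B by force
        then show ?thesis
          using mult_right_mono[of "cmod (q x)" "\<bar>B\<bar>" "cmod (H x)"] by (simp add: norm_mult mult.commute)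
      qed (simp add: H0)
    qed
  qed
qed

text \<open>The quotient map onto the torus inside complex space. Continuous functions are
  approximated on its compact image, where opposite faces of the cell are already glued
  together.\<close>

definition circ :: "real^'d \<Rightarrow> complex^'d" where "circ x = (\<chi> j. exp (\<i> * complex_of_real (x $ j)))"

lemma continuous_on_circ: "continuous_on A circ"
  unfolding circ_def by (intro continuous_intros)

lemma circ_inj:
  assumes "x \<in> box 0 (\<chi> i. 2 * pi)" "y \<in> box 0 (\<chi> i. 2 * pi)" "circ x = circ y"
  shows "x = y"
proof (subst vec_eq_iff, rule allI)
  fix j
  have "exp (\<i> * complex_of_real (x $ j)) = exp (\<i> * complex_of_real (y $ j))"
    using assms(3) by (simp add: circ_def vec_eq_iff)
  then obtain n :: int where n: "\<i> * complex_of_real (x $ j) = \<i> * complex_of_real (y $ j) + (of_int (2 * n) * pi) * \<i>"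
    unfolding exp_eq by auto
  then have "x $ j = y $ j + 2 * of_int n * pi"
    by (auto simp: complex_eq_iff)
  moreover have "0 < x $ j" "x $ j < 2 * pi" "0 < y $ j" "y $ j < 2 * pi"
    using assms by (auto simp: mem_box_cart)
  ultimately have "of_int n * pi < 1 * pi" "(-1) * pi < of_int n * pi"
    by linarith+
  then have "real_of_int n < 1" "-1 < real_of_int n"
    by (simp_all only: mult_less_cancel_right_pos[OF pi_gt_zero])
  then have "n = 0" by linarith
  then show "x $ j = y $ j" using \<open>x $ j = y $ j + 2 * of_int n * pi\<close> by simp
qed

text \<open>The function is taken to vanish outside the cell, so that integrals over the cell become
  integrals over the whole space.\<close>

locale zero_fourier =
  fixes H :: "real^'d \<Rightarrow> complex"
  assumes H: "integrable lebesgue H" and H0: "\<And>x. x \<notin> torus_cell \<Longrightarrow> H x = 0"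
    and zero: "\<And>k. (LINT x|lebesgue. H x * chr k x) = 0"
begin

lemma dominated: "continuous_on UNIV q \<Longrightarrow> integrable lebesgue (\<lambda>x. H x * q x)"
  by (rule torus_dominated[OF H]) (use H0 in auto)

text \<open>Orthogonality is demanded for \<open>q\<close> times every character, which makes the
  notion stable under multiplication by characters.\<close>

definition annih :: "(real^'d \<Rightarrow> complex) \<Rightarrow> bool" where
  "annih q \<longleftrightarrow> continuous_on UNIV q \<and> (\<forall>k. (LINT x|lebesgue. H x * (q x * chr k x)) = 0)"

text \<open>Multipliers of the annihilated functions form an algebra containing the characters.\<close>

definition multiplier :: "(real^'d \<Rightarrow> complex) \<Rightarrow> bool" where
  "multiplier p \<longleftrightarrow> continuous_on UNIV p \<and> (\<forall>q. annih q \<longrightarrow> annih (\<lambda>x. p x * q x))"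

lemma multiplier_mult: "multiplier p \<Longrightarrow> multiplier p' \<Longrightarrow> multiplier (\<lambda>x. p x * p' x)"
  unfolding multiplier_def by (auto intro!: continuous_intros simp: mult.assoc)

lemma multiplier_add: "multiplier p \<Longrightarrow> multiplier p' \<Longrightarrow> multiplier (\<lambda>x. p x + p' x)"
  unfolding multiplier_def
proof (intro conjI allI impI)
  fix q assume m: "continuous_on UNIV p \<and> (\<forall>q. annih q \<longrightarrow> annih (\<lambda>x. p x * q x))"
    "continuous_on UNIV p' \<and> (\<forall>q. annih q \<longrightarrow> annih (\<lambda>x. p' x * q x))" and q: "annih q"
  from m q have 1: "annih (\<lambda>x. p x * q x)" "annih (\<lambda>x. p' x * q x)" by auto
  show "annih (\<lambda>x. (p x + p' x) * q x)"
    unfolding annih_def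
  proof (intro conjI allI)
    fix k
    have i: "integrable lebesgue (\<lambda>x. H x * (p x * q x * chr k x))" "integrable lebesgue (\<lambda>x. H x * (p' x * q x * chr k x))"
      using dominated[OF continuous_on_mult[OF conjunct1[OF 1(1)[unfolded annih_def]] continuous_on_chr]]
        dominated[OF continuous_on_mult[OF conjunct1[OF 1(2)[unfolded annih_def]] continuous_on_chr]]
      by auto
    have "(LINT x|lebesgue. H x * ((p x + p' x) * q x * chr k x))
        = (LINT x|lebesgue. H x * (p x * q x * chr k x) + H x * (p' x * q x * chr k x))"
      by (simp only: distrib_right distrib_left)
    also have "\<dots> = 0" using i 1 by (simp add: annih_def)
    finally show "(LINT x|lebesgue. H x * ((p x + p' x) * q x * chr k x)) = 0" .
  qed (use 1 m q in \<open>auto simp: annih_def intro!: continuous_intros\<close>)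
qed (auto intro!: continuous_intros)

lemma multiplier_const: "multiplier (\<lambda>x. c)"
  unfolding multiplier_def annih_def
proof (intro conjI allI impI; (elim conjE)?)
  fix q k assume "\<forall>k. (LINT x|lebesgue. H x * (q x * chr k x)) = 0"
  then have "c * (LINT x|lebesgue. H x * (q x * chr k x)) = 0" by simp
  then have "(LINT x|lebesgue. c * (H x * (q x * chr k x))) = 0"
    by (simp only: integral_mult_right_zero)
  then show "(LINT x|lebesgue. H x * (c * q x * chr k x)) = 0" by (simp only: ac_simps)
qed (auto intro!: continuous_intros)

lemma multiplier_chr: "multiplier (chr l)"
  unfolding multiplier_def annih_def
proof (intro conjI allI impI; (elim conjE)?)
  fix q k assume z: "\<forall>k. (LINT x|lebesgue. H x * (q x * chr k x)) = 0"
  show "(LINT x|lebesgue. H x * (chr l x * q x * chr k x)) = 0"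
    using z[rule_format, of "k + l"] by (simp only: chr_add ac_simps)
qed (auto intro!: continuous_intros continuous_on_chr)

lemma multiplier_sum: "(\<And>i. i \<in> A \<Longrightarrow> multiplier (p i)) \<Longrightarrow> multiplier (\<lambda>x. \<Sum>i\<in>A. p i x)"
  by (induction A rule: infinite_finite_induct) (auto intro: multiplier_const multiplier_add)

lemma multiplier_trig:
  "multiplier (\<lambda>x. complex_of_real (Re (exp (\<i> * complex_of_real (x $ j)))))"
  "multiplier (\<lambda>x. complex_of_real (Im (exp (\<i> * complex_of_real (x $ j)))))"
proof -
  let ?e = "axis j 1 :: int^'d"
  have f: "freq ?e = axis j 1" by (auto simp: freq_def axis_def vec_eq_iff)
  have c: "chr ?e x = exp (\<i> * complex_of_real (x $ j))" for x :: "real^'d"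
    unfolding chr_def f by (simp add: inner_axis inner_commute)
  have "complex_of_real (Re (exp (\<i> * complex_of_real (x $ j)))) = (1/2) * (chr ?e x + chr (- ?e) x)" for x :: "real^'d"
    unfolding c[symmetric] cnj_chr[symmetric] complex_add_cnj by simp
  then show "multiplier (\<lambda>x. complex_of_real (Re (exp (\<i> * complex_of_real (x $ j)))))"
    by (simp only:) (intro multiplier_mult multiplier_const multiplier_add multiplier_chr)
  have "complex_of_real (Im (exp (\<i> * complex_of_real (x $ j)))) = (- \<i> / 2) * (chr ?e x + (-1) * chr (- ?e) x)" for x :: "real^'d"
  proof -
    have "chr ?e x - cnj (chr ?e x) = 2 * Im (chr ?e x) * \<i>" by (simp add: complex_diff_cnj)
    then show ?thesis unfolding c[symmetric] cnj_chr[symmetric] by (simp add: complex_eq_iff)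
  qed
  then show "multiplier (\<lambda>x. complex_of_real (Im (exp (\<i> * complex_of_real (x $ j)))))"
    by (simp only:) (intro multiplier_mult multiplier_const multiplier_add multiplier_chr)
qed

text \<open>A real-linear functional of \<open>circ x\<close> is a combination of the real and
  imaginary parts of its coordinates, that is, of cosines and sines. Polynomials arise from these by
  the algebra operations.\<close>

lemma multiplier_poly:
  fixes P :: "complex^'d \<Rightarrow> real"
  assumes "real_polynomial_function P"
  shows "multiplier (\<lambda>x. complex_of_real (P (circ x)))"
  using assms
proof induction
  case (linear f)
  interpret f: bounded_linear f by fact
  have "complex_of_real (f (circ x)) = (\<Sum>j\<in>UNIV. complex_of_real (f (axis j 1)) * complex_of_real (Re (exp (\<i> * complex_of_real (x $ j))))
      + complex_of_real (f (axis j \<i>)) * complex_of_real (Im (exp (\<i> * complex_of_real (x $ j)))))" for x :: "real^'d"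
  proof -
    have "circ x = (\<Sum>j\<in>UNIV. axis j (circ x $ j))"
      by (simp add: vec_eq_iff axis_def sum.delta)
    also have "\<dots> = (\<Sum>j\<in>UNIV. Re (circ x $ j) *\<^sub>R axis j 1 + Im (circ x $ j) *\<^sub>R axis j \<i>)"
      by (intro sum.cong refl) (simp add: vec_eq_iff axis_def complex_eq_iff)
    finally have eq: "circ x = (\<Sum>j\<in>UNIV. Re (circ x $ j) *\<^sub>R axis j 1 + Im (circ x $ j) *\<^sub>R axis j \<i>)" .
    have "f (circ x) = (\<Sum>j\<in>UNIV. Re (circ x $ j) *\<^sub>R f (axis j 1) + Im (circ x $ j) *\<^sub>R f (axis j \<i>))"
      using arg_cong[OF eq, of f] by (simp only: f.sum f.add f.scaleR)
    then show ?thesis by (simp add: circ_def mult.commute)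
  qed
  then show ?case
    by (simp only:) (intro multiplier_sum multiplier_add multiplier_mult multiplier_const multiplier_trig)
next
  case (const c) then show ?case by (rule multiplier_const)
next
  case (add f g) then show ?case using multiplier_add by simp
next
  case (mult f g) then show ?case using multiplier_mult by simp
qed

lemma zero_poly:
  fixes P :: "complex^'d \<Rightarrow> real"
  assumes "real_polynomial_function P"
  shows "(LINT x|lebesgue. H x * complex_of_real (P (circ x))) = 0"
proof -
  have "annih (\<lambda>x. 1)" using zero by (simp add: annih_def)
  with multiplier_poly[OF assms] have "annih (\<lambda>x. complex_of_real (P (circ x)) * 1)"
    unfolding multiplier_def by blast
  then show ?thesis unfolding annih_def using chr_0 by (metis (no_types, lifting) Bochner_Integration.integral_cong mult.right_neutral)
qed

text \<open>Stone-Weierstrass on the compact image of the cell: a polynomial within \<open>e\<close>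
  of \<open>G\<close> changes the integral by at most \<open>e\<close> times the \<open>L^1\<close>
  norm of \<open>H\<close>.\<close>

lemma zero_continuous:
  fixes G :: "complex^'d \<Rightarrow> real"
  assumes G: "continuous_on UNIV G"
  shows "(LINT x|lebesgue. H x * complex_of_real (G (circ x))) = 0"
proof -
  let ?I = "LINT x|lebesgue. cmod (H x)"
  have cG: "continuous_on UNIV (\<lambda>x. complex_of_real (G (circ x)))"
    by (intro continuous_intros continuous_on_compose2[OF G continuous_on_circ]) auto
  have comp: "compact (circ ` (torus_cell :: (real^'d) set))"
    by (rule compact_continuous_image[OF continuous_on_circ]) (simp add: torus_cell_def)
  have "cmod (LINT x|lebesgue. H x * complex_of_real (G (circ x))) \<le> e * ?I" if e: "e > 0" for e
  proof -
    obtain P where P: "real_polynomial_function P" "\<And>z. z \<in> circ ` (torus_cell :: (real^'d) set) \<Longrightarrow> \<bar>G z - P z\<bar> < e"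
      using Stone_Weierstrass_real_polynomial_function[OF comp continuous_on_subset[OF G] e] by auto
    have cP: "continuous_on UNIV (\<lambda>x. complex_of_real (P (circ x)))"
      using multiplier_poly[OF P(1)] by (simp add: multiplier_def)
    note iG = dominated[OF cG] and iP = dominated[OF cP]
    have "(LINT x|lebesgue. H x * complex_of_real (G (circ x)))
        = (LINT x|lebesgue. H x * complex_of_real (G (circ x)) - H x * complex_of_real (P (circ x)))"
      by (simp only: Bochner_Integration.integral_diff[OF iG iP] zero_poly[OF P(1)] diff_zero)
    also have "cmod \<dots> \<le> (LINT x|lebesgue. norm (H x * complex_of_real (G (circ x)) - H x * complex_of_real (P (circ x))))"
      by (rule integral_norm_bound)
    also have "\<dots> \<le> (LINT x|lebesgue. e * cmod (H x))"
    proof (rule integral_mono)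
      show "integrable lebesgue (\<lambda>x. norm (H x * complex_of_real (G (circ x)) - H x * complex_of_real (P (circ x))))"
        using iG iP by simp
      show "integrable lebesgue (\<lambda>x. e * cmod (H x))" using H by simp
      fix x
      have "H x * complex_of_real (G (circ x)) - H x * complex_of_real (P (circ x)) = H x * complex_of_real (G (circ x) - P (circ x))"
        by (simp add: algebra_simps)
      then show "norm (H x * complex_of_real (G (circ x)) - H x * complex_of_real (P (circ x))) \<le> e * cmod (H x)"
      proof (cases "x \<in> torus_cell")
        case True
        then have "\<bar>G (circ x) - P (circ x)\<bar> \<le> e" using P(2) by force
        then show ?thesis
          using mult_right_mono[of "\<bar>G (circ x) - P (circ x)\<bar>" e "cmod (H x)"]
          by (simp add: \<open>_ = H x * complex_of_real (G (circ x) - P (circ x))\<close> norm_mult mult.commute del: of_real_diff)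
      qed (simp add: H0)
    qed
    also have "\<dots> = e * ?I" by simp
    finally show ?thesis .
  qed
  note * = this
  have I0: "?I \<ge> 0" by simp
  have "cmod (LINT x|lebesgue. H x * complex_of_real (G (circ x))) \<le> 0 + e" if "e > 0" for e
  proof -
    have "e / (?I + 1) > 0" using that I0 by (simp add: add_nonneg_pos)
    from *[OF this] have "cmod (LINT x|lebesgue. H x * complex_of_real (G (circ x))) \<le> e / (?I + 1) * ?I" .
    also have "\<dots> \<le> e" using that I0 by (simp add: divide_le_eq add_nonneg_pos mult_left_mono)
    finally show ?thesis by simp
  qed
  then have "cmod (LINT x|lebesgue. H x * complex_of_real (G (circ x))) \<le> 0" by (rule field_le_epsilon)
  then show ?thesis by simp
qed

lemma zero_compact:
  assumes K: "compact K" "K \<subseteq> box 0 (\<chi> i. 2 * pi)"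
  shows "(LINT x|lebesgue. H x * indicator K x) = 0"
proof (cases "K = {}")
  case False
  let ?C = "circ ` K"
  have cl: "closed ?C" "?C \<noteq> {}"
    using compact_continuous_image[OF continuous_on_circ K(1)] False by (auto intro: compact_imp_closed)
  define G where "G n z = max 0 (1 - real n * infdist z ?C)" for n and z :: "complex^'d"
  have cG: "continuous_on UNIV (G n)" for n unfolding G_def by (intro continuous_intros)
  have cG2: "continuous_on UNIV (\<lambda>x. complex_of_real (G n (circ x)))" for n
    by (intro continuous_intros continuous_on_compose2[OF cG continuous_on_circ]) auto
  have "(\<lambda>n. LINT x|lebesgue. H x * complex_of_real (G n (circ x))) \<longlonglongrightarrow> (LINT x|lebesgue. H x * indicator K x)"
  proof (rule integral_dominated_convergence)
    show "integrable lebesgue (\<lambda>x. cmod (H x))" using H by simp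
    show "(\<lambda>x. H x * complex_of_real (G n (circ x))) \<in> borel_measurable lebesgue" for n
      by (rule borel_measurable_integrable[OF dominated[OF cG2]])
    have "K \<in> sets lebesgue" using K(1) by (simp add: compact_imp_closed)
    then show "(\<lambda>x. H x * indicator K x) \<in> borel_measurable lebesgue"
      using borel_measurable_integrable[OF H] by simp
    show "AE x in lebesgue. norm (H x * complex_of_real (G n (circ x))) \<le> cmod (H x)" for n
      by (rule AE_I2) (auto simp: norm_mult G_def max_def intro!: mult_left_le infdist_nonneg mult_nonneg_nonneg)
    have "torus_cell - box 0 (\<chi> i. 2 * pi) \<in> null_sets (lebesgue :: (real^'d) measure)"
      unfolding torus_cell_def using negligible_frontier_interval negligible_iff_null_sets by blast
    then have "AE x in lebesgue. x \<notin> torus_cell - box 0 (\<chi> i. 2 * pi :: real^'d)"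
      by (rule AE_not_in)
    then show "AE x in lebesgue. (\<lambda>n. H x * complex_of_real (G n (circ x))) \<longlonglongrightarrow> H x * indicator K x"
    proof (rule AE_mp, intro AE_I2 impI)
      fix x :: "real^'d" assume x: "x \<notin> torus_cell - box 0 (\<chi> i. 2 * pi)"
      show "(\<lambda>n. H x * complex_of_real (G n (circ x))) \<longlonglongrightarrow> H x * indicator K x"
      proof (cases "x \<in> torus_cell")
        case True
        then have xb: "x \<in> box 0 (\<chi> i. 2 * pi)" using x by auto
        show ?thesis
        proof (cases "x \<in> K")
          case True
          then have "infdist (circ x) ?C = 0" by simp
          then show ?thesis using True by (simp add: G_def)
        next
          case False
          have "circ x \<notin> ?C" using circ_inj[OF xb] K(2) False by blast
          then have pos: "infdist (circ x) ?C > 0" by (rule infdist_pos_not_in_closed[OF cl])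
          obtain N :: nat where N: "1 / infdist (circ x) ?C < real N" using reals_Archimedean2 by blast
          have "G n (circ x) = 0" if "n \<ge> N" for n
          proof -
            have "1 < real N * infdist (circ x) ?C" using N by (simp only: pos_divide_less_eq[OF pos])
            also have "\<dots> \<le> real n * infdist (circ x) ?C" using that by (intro mult_right_mono infdist_nonneg) simp
            finally show ?thesis by (simp add: G_def)
          qed
          then have "\<forall>\<^sub>F n in sequentially. H x * complex_of_real (G n (circ x)) = 0"
            unfolding eventually_sequentially by auto
          then show ?thesis using False by (simp add: tendsto_eventually)
        qed
      qed (simp add: H0)
    qed
  qed
  then show ?thesis by (simp add: zero_continuous[OF cG] LIMSEQ_const_iff)
qed simp

text \<open>A compact subset of the set where \<open>Re H > 0\<close> carries integral zero of a
  positive function, hence is null. Inner regularity by closed subsets, compact here because the box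
  is bounded, makes the whole set null.\<close>

lemma null_positive: "AE x in lebesgue. x \<in> box 0 (\<chi> i. 2 * pi) \<longrightarrow> Re (H x) \<le> 0"
proof -
  let ?A = "{x \<in> box 0 (\<chi> i. 2 * pi). 0 < Re (H x)}"
  have mH: "H \<in> borel_measurable lebesgue" by (rule borel_measurable_integrable[OF H])
  have mR: "(\<lambda>x. Re (H x)) \<in> borel_measurable lebesgue"
    by (rule measurable_compose[OF mH]) simp
  have "(\<lambda>x. Re (H x)) -` {0<..} \<inter> space lebesgue \<in> sets lebesgue"
    by (rule measurable_sets[OF mR]) simp
  then have "box 0 (\<chi> i. 2 * pi) \<inter> ((\<lambda>x. Re (H x)) -` {0<..} \<inter> space lebesgue) \<in> sets lebesgue"
    by (rule sets.Int[rotated]) simp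
  moreover have "?A = box 0 (\<chi> i. 2 * pi) \<inter> ((\<lambda>x. Re (H x)) -` {0<..} \<inter> space lebesgue)"
    by (rule set_eqI) simp
  ultimately have A: "?A \<in> sets lebesgue" by (simp only:)
  have "emeasure lebesgue ?A \<le> 0 + ennreal e" if e: "e > 0" for e :: real
  proof -
    obtain T where T: "closed T" "T \<subseteq> ?A" "?A - T \<in> lmeasurable" "emeasure lebesgue (?A - T) < ennreal e"
      using sets_lebesgue_inner_closed[OF A e] by blast
    have "bounded T" by (rule bounded_subset[OF bounded_box]) (use T(2) in blast)
    then have cT: "compact T" using T(1) by (simp add: compact_eq_bounded_closed)
    have sT: "T \<in> sets lebesgue" using T(1) by simp
    have TT: "T \<subseteq> box 0 (\<chi> i. 2 * pi)" using T(2) by blast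
    have iT: "integrable lebesgue (\<lambda>x. H x * indicator T x)"
    proof -
      have "(\<lambda>x. H x * indicator T x) = (\<lambda>x. indicator T x *\<^sub>R H x)"
        by (auto simp: fun_eq_iff indicator_def)
      then show ?thesis using integrable_mult_indicator[OF sT H] by (simp only:)
    qed
    have "(LINT x|lebesgue. Re (H x * indicator T x)) = Re (LINT x|lebesgue. H x * indicator T x)"
      using iT by (rule integral_Re)
    then have "(LINT x|lebesgue. Re (H x * indicator T x)) = 0" using zero_compact[OF cT TT] by simp
    moreover have "AE x in lebesgue. 0 \<le> Re (H x * indicator T x)"
      using T(2) by (intro AE_I2) (auto simp: indicator_def)
    moreover have "integrable lebesgue (\<lambda>x. Re (H x * indicator T x))" by (rule integrable_Re[OF iT])
    ultimately have "AE x in lebesgue. Re (H x * indicator T x) = 0"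
      using integral_nonneg_eq_0_iff_AE by blast
    then have "AE x in lebesgue. x \<notin> T"
      by (rule AE_mp) (use T(2) in \<open>auto intro!: AE_I2 simp: indicator_def\<close>)
    then have "T \<in> null_sets lebesgue"
      using sT by (simp add: AE_iff_null_sets)
    then have "emeasure lebesgue T = 0" by auto
    have "emeasure lebesgue ?A \<le> emeasure lebesgue (T \<union> (?A - T))"
      by (rule emeasure_mono) (use sT T(3) A in auto)
    also have "\<dots> \<le> emeasure lebesgue T + emeasure lebesgue (?A - T)"
      by (rule emeasure_subadditive) (use sT T(3) A in auto)
    also have "\<dots> \<le> ennreal e" using T(4) \<open>emeasure lebesgue T = 0\<close> by simp
    finally show ?thesis by simp
  qed
  then have "emeasure lebesgue ?A \<le> 0" by (rule ennreal_le_epsilon)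
  then have "?A \<in> null_sets lebesgue" using A by auto
  then have "AE x in lebesgue. x \<notin> ?A" by (rule AE_not_in)
  then show ?thesis by (rule AE_mp) (auto intro!: AE_I2)
qed

end

text \<open>\<open>null_positive\<close> controls only the sign of a real part, so it is applied to
  \<open>h\<close> multiplied by each of \<open>1\<close>, \<open>-1\<close>, \<open>i\<close> and
  \<open>-i\<close>.\<close>

lemma fourier_unique:
  fixes h :: "real^'d \<Rightarrow> complex"
  assumes h: "set_integrable lebesgue torus_cell h" and z: "\<And>k. fourier_coeff h k = 0"
  shows "AE x in lebesgue. x \<in> torus_cell \<longrightarrow> h x = 0"
proof -
  let ?H = "\<lambda>c x. c * (indicator torus_cell x *\<^sub>R h x)"
  have zz: "(LINT x|lebesgue. (indicator torus_cell x *\<^sub>R h x) * chr k x) = 0" for k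
    using z[of "- k"] by (simp add: fourier_coeff_eq set_lebesgue_integral_def)
  have "zero_fourier (?H c)" for c
  proof
    show "integrable lebesgue (?H c)" using h unfolding set_integrable_def by (intro integrable_mult_right)
    show "(LINT x|lebesgue. ?H c x * chr k x) = 0" for k
      using zz[of k] by (simp only: mult.assoc integral_mult_right_zero mult_zero_right)
  qed auto
  note * = zero_fourier.null_positive[OF this]
  have "torus_cell - box 0 (\<chi> i. 2 * pi) \<in> null_sets (lebesgue :: (real^'d) measure)"
    unfolding torus_cell_def using negligible_frontier_interval negligible_iff_null_sets by blast
  then have "AE x in lebesgue. x \<notin> torus_cell - box 0 (\<chi> i. 2 * pi :: real^'d)"
    by (rule AE_not_in)
  with *[of 1] *[of "-1"] *[of \<i>] *[of "- \<i>"]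
  show ?thesis
  proof eventually_elim
    case (elim x)
    show ?case
    proof
      assume "x \<in> torus_cell"
      with elim have "Re (h x) \<le> 0" "- Re (h x) \<le> 0" "- Im (h x) \<le> 0" "Im (h x) \<le> 0" by auto
      then show "h x = 0" by (simp add: complex_eq_iff)
    qed
  qed
qed

section \<open>Functions of class \<open>H^s\<close> and the elements of the algebra that represent
  them\<close>

context sobolev_space
begin

lemma truncation_sequence:
  "\<exists>Z F. (\<forall>n::nat. finite (F n) \<and> Z n = (\<Sum>k\<in>F n. mode k (coef z k))) \<and> Z \<longlonglongrightarrow> z"
proof -
  have "\<exists>F. finite F \<and> norm (z - (\<Sum>k\<in>F. mode k (coef z k))) < 1 / real (Suc n)" for n
    using l2_truncation[of "1 / real (Suc n)" z] by (simp add: l2_delta_mode coef_def)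
  then obtain F where F: "\<And>n. finite (F n)" "\<And>n. norm (z - (\<Sum>k\<in>F n. mode k (coef z k))) < 1 / real (Suc n)"
    by metis
  have "(\<lambda>n. \<Sum>k\<in>F n. mode k (coef z k)) \<longlonglongrightarrow> z"
  proof (rule LIMSEQ_I)
    fix r :: real assume "0 < r"
    then obtain N where N: "1 / real (Suc N) < r" using nat_approx_posE by blast
    have "norm ((\<Sum>k\<in>F n. mode k (coef z k)) - z) < r" if "n \<ge> N" for n
    proof -
      have "1 / real (Suc n) \<le> 1 / real (Suc N)" using that by (simp add: frac_le)
      then show ?thesis using F(2)[of n] N by (simp add: norm_minus_commute)
    qed
    then show "\<exists>no. \<forall>n\<ge>no. norm ((\<Sum>k\<in>F n. mode k (coef z k)) - z) < r" by blast
  qed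
  with F(1) show ?thesis
    by (intro exI[of _ "\<lambda>n. \<Sum>k\<in>F n. mode k (coef z k)"] exI[of _ F] conjI allI) simp_all
qed

lemma continuous_on_ev: "continuous_on A (\<lambda>p. ev p z)"
proof -
  obtain Z F where Z: "\<And>n::nat. finite (F n)" "\<And>n. Z n = (\<Sum>k\<in>F n. mode k (coef z k))" "Z \<longlonglongrightarrow> z"
    using truncation_sequence by metis
  have evZ: "ev p (Z n) = (\<Sum>k\<in>F n. coef z k * chr k p)" for p n
    unfolding Z(2) bounded_linear.linear[OF bounded_linear_ev, THEN linear_sum] by (simp add: ev_mode)
  have "uniform_limit UNIV (\<lambda>n p. ev p (Z n)) (\<lambda>p. ev p z) sequentially"
  proof (rule uniform_limitI)
    fix e :: real assume e: "e > 0"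
    have L: "Lam + 1 > 0" using Lam_nonneg by simp
    from Z(3) have "\<forall>\<^sub>F n in sequentially. dist (Z n) z < e / (Lam + 1)"
      using e L by (intro tendstoD) auto
    then show "\<forall>\<^sub>F n in sequentially. \<forall>p\<in>UNIV. dist (ev p (Z n)) (ev p z) < e"
    proof (rule eventually_mono, intro ballI)
      fix n and p :: "real^'d" assume n: "dist (Z n) z < e / (Lam + 1)"
      have "dist (ev p (Z n)) (ev p z) = cmod (ev p (Z n - z))"
        by (simp add: dist_norm bounded_linear.linear[OF bounded_linear_ev, THEN linear_diff])
      also have "\<dots> \<le> Lam * norm (Z n - z)" by (rule ev_bound)
      also have "\<dots> \<le> (Lam + 1) * norm (Z n - z)" by (intro mult_right_mono) auto
      also have "\<dots> < e" using n L by (simp add: dist_norm field_simps)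
      finally show "dist (ev p (Z n)) (ev p z) < e" .
    qed
  qed
  then have "continuous_on UNIV (\<lambda>p. ev p z)"
    by (rule uniform_limit_theorem[rotated])
      (simp_all add: evZ continuous_intros continuous_on_chr)
  then show ?thesis by (rule continuous_on_subset) simp
qed

lemma torus_periodic_ev: "torus_periodic (\<lambda>p. ev p z)"
  by (simp add: torus_periodic_def ev_def torus_periodicD[OF torus_periodic_chr])

text \<open>Both sides are bounded linear in \<open>z\<close> and agree on modes by orthogonality of
  characters. Boundedness of the left side is Bessel's inequality for a single frequency.\<close>

lemma fourier_coeff_ev: "fourier_coeff (\<lambda>p. ev p z) k = coef z k"
proof (rule bounded_linear_eq_modeI[where f = "\<lambda>z. fourier_coeff (\<lambda>p. ev p z) k" and g = "\<lambda>z. coef z k"])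
  interpret e: bounded_linear "ev p" for p by (rule bounded_linear_ev)
  have c: "continuous_on UNIV (\<lambda>x. ev x z * chr (- k) x)" for z
    by (intro continuous_intros continuous_on_chr continuous_on_ev)
  show "bounded_linear (\<lambda>z. fourier_coeff (\<lambda>p. ev p z) k)"
  proof (rule bounded_linear_intro[where K = Lam])
    show "fourier_coeff (\<lambda>p. ev p (x + y)) k = fourier_coeff (\<lambda>p. ev p x) k + fourier_coeff (\<lambda>p. ev p y) k" for x y
      unfolding fourier_coeff_cont[OF continuous_on_ev]
      by (simp only: e.add distrib_right
          Henstock_Kurzweil_Integration.integral_add[OF integrable_torus[OF c] integrable_torus[OF c]] add_divide_distrib)
    show "fourier_coeff (\<lambda>p. ev p (r *\<^sub>R x)) k = r *\<^sub>R fourier_coeff (\<lambda>p. ev p x) k" for r x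
      unfolding fourier_coeff_cont[OF continuous_on_ev]
      by (simp only: e.scaleR scaleR_conv_of_real mult.assoc
          Henstock_Kurzweil_Integration.integral_mult_right times_divide_eq_right)
    show "norm (fourier_coeff (\<lambda>p. ev p x) k) \<le> norm x * Lam" for x
    proof -
      have "(\<Sum>k\<in>{k}. (cmod (fourier_coeff (\<lambda>p. ev p x) k))\<^sup>2) \<le> (Lam * norm x)\<^sup>2"
        by (rule bessel_inequality[OF continuous_on_ev ev_bound]) simp
      then have "(norm (fourier_coeff (\<lambda>p. ev p x) k))\<^sup>2 \<le> (norm x * Lam)\<^sup>2" by (simp add: mult.commute)
      then show ?thesis by (rule power2_le_imp_le) (simp add: Lam_nonneg)
    qed
  qed
  show "bounded_linear (\<lambda>z. coef z k)"
    unfolding coef_def by (rule bounded_linear_compose[OF bounded_linear_divide l2_nth_blin])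
  fix i c
  have "fourier_coeff (\<lambda>p. ev p (mode i c)) k = c * fourier_coeff (chr i) k"
    by (simp only: ev_mode fourier_coeff_cont continuous_on_chr continuous_on_mult continuous_on_const mult.assoc
        Henstock_Kurzweil_Integration.integral_mult_right times_divide_eq_right)
  then show "fourier_coeff (\<lambda>p. ev p (mode i c)) k = coef (mode i c) k"
    by (simp add: fourier_coeff_chr coef_mode)
qed

lemma ev_eqI: "(\<And>p. ev p x = ev p y) \<Longrightarrow> x = y"
  by (rule coef_eqI) (simp add: fourier_coeff_ev[symmetric])

text \<open>The bridge between functions and the Banach algebra. Agreement almost everywhere on the
  cell suffices, since Fourier coefficients and \<open>Hs_norm\<close> do not see null sets.\<close>

definition repr :: "(real^'d \<Rightarrow> complex) \<Rightarrow> (int^'d) l2 \<Rightarrow> bool" where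
  "repr f z \<longleftrightarrow> set_borel_measurable lebesgue torus_cell f \<and>
     (AE x in lebesgue. x \<in> torus_cell \<longrightarrow> f x = ev x z)"

lemma measurable_torus_mult:
  fixes f :: "real^'d \<Rightarrow> complex"
  assumes "set_borel_measurable lebesgue torus_cell f" "continuous_on UNIV g"
  shows "set_borel_measurable lebesgue torus_cell (\<lambda>x. f x * g x)"
proof -
  have "g \<in> borel_measurable lebesgue"
    using borel_measurable_continuous_onI[OF assms(2)] by (simp add: measurable_completion)
  with assms(1) have "(\<lambda>x. (indicator torus_cell x *\<^sub>R f x) * g x) \<in> borel_measurable lebesgue"
    unfolding set_borel_measurable_def by (rule borel_measurable_times)
  then show ?thesis unfolding set_borel_measurable_def by simp
qed

lemma measurable_torus_cont:
  fixes g :: "real^'d \<Rightarrow> complex"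
  assumes "continuous_on UNIV g"
  shows "set_borel_measurable lebesgue torus_cell g"
  using set_integrable_torus[OF assms] unfolding set_integrable_def set_borel_measurable_def
  by (rule borel_measurable_integrable)

lemma repr_ev: "repr (\<lambda>p. ev p z) z"
  unfolding repr_def by (simp add: measurable_torus_cont continuous_on_ev)

lemma repr_fourier_coeff:
  assumes "repr f z"
  shows "fourier_coeff f k = coef z k"
proof -
  have m: "set_borel_measurable lebesgue torus_cell f" and ae: "AE x in lebesgue. x \<in> torus_cell \<longrightarrow> f x = ev x z"
    using assms by (auto simp: repr_def)
  have "(LINT x:torus_cell|lebesgue. f x * chr (- k) x) = (LINT x:torus_cell|lebesgue. ev x z * chr (- k) x)"
    unfolding set_lebesgue_integral_def
  proof (rule integral_cong_AE)
    show "(\<lambda>x. indicator torus_cell x *\<^sub>R (f x * chr (- k) x)) \<in> borel_measurable lebesgue"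
      using measurable_torus_mult[OF m continuous_on_chr] unfolding set_borel_measurable_def .
    show "(\<lambda>x. indicator torus_cell x *\<^sub>R (ev x z * chr (- k) x)) \<in> borel_measurable lebesgue"
      using measurable_torus_mult[OF measurable_torus_cont[OF continuous_on_ev] continuous_on_chr]
      unfolding set_borel_measurable_def .
    show "AE x in lebesgue. indicator torus_cell x *\<^sub>R (f x * chr (- k) x) = indicator torus_cell x *\<^sub>R (ev x z * chr (- k) x)"
      using ae by (rule AE_mp) (auto intro!: AE_I2 simp: indicator_def)
  qed
  then have "fourier_coeff f k = fourier_coeff (\<lambda>x. ev x z) k" by (simp only: fourier_coeff_eq)
  then show ?thesis by (simp add: fourier_coeff_ev)
qed

lemma repr_unique: "repr f z \<Longrightarrow> repr f z' \<Longrightarrow> z = z'"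
  by (rule coef_eqI) (metis repr_fourier_coeff)

lemma repr_Hs_norm: "repr f z \<Longrightarrow> Hs_norm s f = norm z"
proof -
  assume r: "repr f z"
  have "(1 + (norm (freq k))\<^sup>2) ^ s * (cmod (fourier_coeff f k))\<^sup>2 = (cmod (l2_nth z k))\<^sup>2" for k
    unfolding repr_fourier_coeff[OF r] by (simp add: coef_def norm_divide power_divide wt_sq[symmetric])
  then have "Hs_norm s f = sqrt ((norm z)\<^sup>2)" unfolding Hs_norm_def l2_norm_sq by simp
  then show ?thesis by simp
qed

text \<open>The element \<open>z\<close> is built from the coefficients of \<open>f\<close>. Its
  continuous evaluation then has the same Fourier coefficients as \<open>f\<close>, and
  \<open>fourier_unique\<close> identifies the two almost everywhere.\<close>

lemma reprI:
  assumes f: "set_integrable lebesgue torus_cell f"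
    and B: "\<And>F. finite F \<Longrightarrow> (\<Sum>k\<in>F. (cmod (complex_of_real (wt s k) * fourier_coeff f k))\<^sup>2) \<le> B\<^sup>2" "B \<ge> 0"
  shows "\<exists>z. repr f z \<and> norm z \<le> B"
proof -
  define z where "z = Abs_l2 (\<lambda>k. complex_of_real (wt s k) * fourier_coeff f k)"
  have z: "coef z k = fourier_coeff f k" "norm z \<le> B" for k
    unfolding z_def coef_def using Abs_l2I[OF B] by auto
  let ?h = "\<lambda>x. f x - ev x z"
  note iz = set_integrable_torus[OF continuous_on_ev, of z]
  have ih: "set_integrable lebesgue torus_cell ?h" by (rule set_integral_diff[OF f iz])
  have m: "set_integrable lebesgue torus_cell (\<lambda>x. g x * chr k x)" if "set_integrable lebesgue torus_cell g" for g :: "real^'d \<Rightarrow> complex" and k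
  proof (rule set_integrable_bound[OF that])
    show "set_borel_measurable lebesgue torus_cell (\<lambda>x. g x * chr k x)"
    proof (rule measurable_torus_mult[OF _ continuous_on_chr])
      show "set_borel_measurable lebesgue torus_cell g"
        using that borel_measurable_integrable unfolding set_integrable_def set_borel_measurable_def by blast
    qed
  qed (simp add: norm_mult)
  have "fourier_coeff ?h k = 0" for k
  proof -
    have "(LINT x:torus_cell|lebesgue. ?h x * chr (- k) x) = (LINT x:torus_cell|lebesgue. f x * chr (- k) x - ev x z * chr (- k) x)"
      by (simp only: left_diff_distrib)
    also have "\<dots> = (LINT x:torus_cell|lebesgue. f x * chr (- k) x) - (LINT x:torus_cell|lebesgue. ev x z * chr (- k) x)"
      by (rule set_integral_diff(2)[OF m[OF f] m[OF iz]])
    finally have "fourier_coeff ?h k = fourier_coeff f k - fourier_coeff (\<lambda>x. ev x z) k"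
      by (simp only: fourier_coeff_eq diff_divide_distrib)
    then show ?thesis by (simp add: fourier_coeff_ev z)
  qed
  from fourier_unique[OF ih this] have "AE x in lebesgue. x \<in> torus_cell \<longrightarrow> f x = ev x z" by simp
  moreover have "set_borel_measurable lebesgue torus_cell f"
    using f borel_measurable_integrable unfolding set_integrable_def set_borel_measurable_def by blast
  ultimately show ?thesis using z(2) unfolding repr_def by blast
qed

lemma Hs_repr: "f \<in> Hs s \<Longrightarrow> \<exists>z. repr f z"
proof -
  assume f: "f \<in> Hs s"
  then have m: "set_borel_measurable lebesgue torus_cell f"
    and i2: "set_integrable lebesgue torus_cell (\<lambda>x. (cmod (f x))\<^sup>2)"
    and sm: "(\<lambda>k. (1 + (norm (freq k))\<^sup>2) ^ s * (cmod (fourier_coeff f k))\<^sup>2) summable_on UNIV"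
    by (auto simp: Hs_def)
  have i1: "set_integrable lebesgue torus_cell (\<lambda>x::real^'d. 1 :: real)"
    unfolding torus_cell_def by (rule absolutely_integrable_continuous) simp
  have "set_integrable lebesgue torus_cell f"
  proof (rule set_integrable_bound[OF set_integral_add(1)[OF i1 i2] m], rule AE_I2, rule impI)
    fix x
    have "cmod (f x) \<le> 1 + (cmod (f x))\<^sup>2"
    proof -
      have "0 \<le> (cmod (f x))\<^sup>2 + 1 - 2 * cmod (f x)"
        using zero_le_power2[of "cmod (f x) - 1"] by (simp add: power2_diff)
      then show ?thesis using norm_ge_zero[of "f x"] by linarith
    qed
    then show "norm (f x) \<le> norm (1 + (cmod (f x))\<^sup>2)" by simp
  qed
  moreover have "(\<Sum>k\<in>F. (cmod (complex_of_real (wt s k) * fourier_coeff f k))\<^sup>2)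
      \<le> (Hs_norm s f)\<^sup>2" if "finite F" for F
  proof -
    have eq: "(cmod (complex_of_real (wt s k) * fourier_coeff f k))\<^sup>2 = (1 + (norm (freq k))\<^sup>2) ^ s * (cmod (fourier_coeff f k))\<^sup>2" for k
      by (simp add: norm_mult power_mult_distrib wt_sq)
    have "(Hs_norm s f)\<^sup>2 = (\<Sum>\<^sub>\<infinity>k. (1 + (norm (freq k))\<^sup>2) ^ s * (cmod (fourier_coeff f k))\<^sup>2)"
      unfolding Hs_norm_def by (intro real_sqrt_pow2 infsum_nonneg mult_nonneg_nonneg zero_le_power) auto
    then show ?thesis unfolding eq using that sm
      by (auto intro!: finite_sum_le_infsum mult_nonneg_nonneg zero_le_power)
  qed
  moreover have "Hs_norm s f \<ge> 0"
    unfolding Hs_norm_def by (intro real_sqrt_ge_zero infsum_nonneg mult_nonneg_nonneg zero_le_power) auto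
  ultimately show ?thesis using reprI by blast
qed

lemma ev_Hs: "(\<lambda>p. ev p z) \<in> Hs s"
  unfolding Hs_def
proof (intro CollectI conjI)
  show "set_borel_measurable lebesgue torus_cell (\<lambda>p. ev p z)"
    by (rule measurable_torus_cont[OF continuous_on_ev])
  have "continuous_on UNIV (\<lambda>x. (cmod (ev x z))\<^sup>2)" by (intro continuous_intros continuous_on_ev)
  then show "set_integrable lebesgue torus_cell (\<lambda>x. (cmod (ev x z))\<^sup>2)"
    unfolding torus_cell_def by (intro absolutely_integrable_continuous) (auto intro: continuous_on_subset)
  have "(1 + (norm (freq k))\<^sup>2) ^ s * (cmod (fourier_coeff (\<lambda>p. ev p z) k))\<^sup>2 = (cmod (l2_nth z k))\<^sup>2" for k
    unfolding fourier_coeff_ev by (simp add: coef_def norm_divide power_divide wt_sq[symmetric])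
  then show "(\<lambda>k. (1 + (norm (freq k))\<^sup>2) ^ s * (cmod (fourier_coeff (\<lambda>p. ev p z) k))\<^sup>2) summable_on UNIV"
    by (simp add: l2_summable)
qed (rule torus_periodic_ev)

end

section \<open>Algebra, exponential, derivations and semigroup\<close>

context sobolev_space
begin

definition cst :: "complex \<Rightarrow> (int^'d) l2" where "cst c = mode 0 c"

lemma ev_cst: "ev p (cst c) = c"
  by (simp add: cst_def ev_mode)

lemma ev_linear: "ev p (x + y) = ev p x + ev p y" "ev p (x - y) = ev p x - ev p y"
  "ev p (- x) = - ev p x" "ev p (r *\<^sub>R x) = complex_of_real r * ev p x" "ev p 0 = 0"
  "ev p (sum f A) = (\<Sum>i\<in>A. ev p (f i))"
proof -
  interpret e: bounded_linear "ev p" by (rule bounded_linear_ev)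
  show "ev p (x + y) = ev p x + ev p y" "ev p (x - y) = ev p x - ev p y"
    "ev p (- x) = - ev p x" "ev p (r *\<^sub>R x) = complex_of_real r * ev p x" "ev p 0 = 0"
    "ev p (sum f A) = (\<Sum>i\<in>A. ev p (f i))"
    by (simp_all add: e.add e.diff e.neg e.scaleR e.zero e.sum scaleR_conv_of_real)
qed

lemmas ev_simps = ev_linear ev_mul ev_cst

lemma mul_commute: "mul x y = mul y x"
  by (rule ev_eqI) (simp add: ev_simps mult.commute)

lemma mul_assoc: "mul (mul x y) z = mul x (mul y z)"
  by (rule ev_eqI) (simp add: ev_simps mult.assoc)

lemma mul_one [simp]: "mul (cst 1) x = x"
  by (rule ev_eqI) (simp add: ev_simps)

lemmas mul_linear_right = bounded_bilinear.bounded_linear_right[OF bounded_bilinear_mul]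
lemmas mul_linear_left = bounded_bilinear.bounded_linear_left[OF bounded_bilinear_mul]
lemmas mul_distribs = bounded_bilinear.add_left[OF bounded_bilinear_mul]
  bounded_bilinear.add_right[OF bounded_bilinear_mul] bounded_bilinear.diff_left[OF bounded_bilinear_mul]
  bounded_bilinear.diff_right[OF bounded_bilinear_mul] bounded_bilinear.scaleR_left[OF bounded_bilinear_mul]
  bounded_bilinear.scaleR_right[OF bounded_bilinear_mul] bounded_bilinear.zero_left[OF bounded_bilinear_mul]
  bounded_bilinear.zero_right[OF bounded_bilinear_mul]

lemma continuous_on_mul [continuous_intros]:
  "continuous_on A f \<Longrightarrow> continuous_on A g \<Longrightarrow> continuous_on A (\<lambda>x. mul (f x) (g x))"
  by (rule bounded_bilinear.continuous_on[OF bounded_bilinear_mul])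

lemma tendsto_mul: "(f \<longlongrightarrow> a) F \<Longrightarrow> (g \<longlongrightarrow> b) F \<Longrightarrow> ((\<lambda>x. mul (f x) (g x)) \<longlongrightarrow> mul a b) F"
  by (rule bounded_bilinear.tendsto[OF bounded_bilinear_mul])

lemma ev_l2_mult_const: "ev p (l2_mult (\<lambda>_. c) x) = c * ev p x"
proof -
  have "coef (l2_mult (\<lambda>_. c) x) k = c * coef x k" for k
    unfolding coef_def by (subst l2_nth_mult[of _ "cmod c"]) simp_all
  then show ?thesis
    unfolding ev_def by (simp add: mult.assoc infsum_cmult_right')
qed

lemma mul_cst: "mul (cst c) x = l2_mult (\<lambda>_. c) x"
  by (rule ev_eqI) (simp add: ev_simps ev_l2_mult_const)

lemma norm_mul_cst_le: "norm (mul (cst c) x) \<le> cmod c * norm x"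
  unfolding mul_cst by (rule norm_l2_mult_le) simp

text \<open>Complex conjugation of functions: it conjugates the coefficients and reflects the
  frequency.\<close>

definition cj :: "(int^'d) l2 \<Rightarrow> (int^'d) l2" where "cj x = Abs_l2 (\<lambda>k. cnj (l2_nth x (- k)))"

lemma l2_nth_cj: "l2_nth (cj x) k = cnj (l2_nth x (- k))"
  and norm_cj_le: "norm (cj x) \<le> norm x"
proof -
  have "(\<Sum>k\<in>F. (cmod (cnj (l2_nth x (- k))))\<^sup>2) \<le> (norm x)\<^sup>2" if F: "finite F" for F
  proof -
    have "(\<Sum>k\<in>F. (cmod (cnj (l2_nth x (- k))))\<^sup>2) = (\<Sum>k\<in>uminus ` F. (cmod (l2_nth x k))\<^sup>2)"
      by (subst sum.reindex) auto
    then show ?thesis using l2_sum_le[of "uminus ` F" x] F by simp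
  qed
  note * = Abs_l2I[of "\<lambda>k. cnj (l2_nth x (- k))", OF this]
  show "l2_nth (cj x) k = cnj (l2_nth x (- k))" "norm (cj x) \<le> norm x"
    unfolding cj_def by (subst *) (auto intro: *)
qed

lemma cj_diff: "cj (x - y) = cj x - cj y"
  by (rule l2_eqI) (simp add: l2_nth_cj)

lemma ev_cj: "ev p (cj x) = cnj (ev p x)"
proof -
  have "ev p (cj x) = (\<Sum>\<^sub>\<infinity>k. coef (cj x) (- k) * chr (- k) p)"
    unfolding ev_def by (rule infsum_reindex_bij_betw[symmetric, of uminus]) (auto intro: bij_uminus)
  also have "\<dots> = (\<Sum>\<^sub>\<infinity>k. cnj (coef x k * chr k p))"
    by (intro infsum_cong) (simp add: coef_def l2_nth_cj cnj_chr)
  finally show ?thesis unfolding ev_def by (simp only: infsum_cnj)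
qed

primrec pw :: "(int^'d) l2 \<Rightarrow> nat \<Rightarrow> (int^'d) l2" where
  "pw x 0 = cst 1"
| "pw x (Suc n) = mul x (pw x n)"

lemma ev_pw: "ev p (pw x n) = ev p x ^ n"
  by (induction n) (simp_all add: ev_simps)

lemma norm_pw_le: "norm (pw x n) \<le> norm (cst 1) * (Kmul * norm x) ^ n"
proof (induction n)
  case (Suc n)
  have "norm (pw x (Suc n)) \<le> Kmul * norm x * norm (pw x n)" by (simp add: norm_mul_le)
  also have "\<dots> \<le> Kmul * norm x * (norm (cst 1) * (Kmul * norm x) ^ n)"
    using Suc by (intro mult_left_mono) (auto simp: Kmul_nonneg)
  finally show ?case by (simp add: mult_ac)
qed simp

text \<open>The norm is submultiplicative only up to the factor \<open>Kmul\<close>, so the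
  estimates of this series compare it with the real exponential of
  \<open>Kmul * norm q\<close>.\<close>

definition Exp :: "(int^'d) l2 \<Rightarrow> (int^'d) l2" where
  "Exp q = (\<Sum>n. pw q n /\<^sub>R fact n)"

lemma Exp_bounds:
  shows Exp_summable: "summable (\<lambda>n. pw q n /\<^sub>R fact n)"
    and norm_Exp_le: "norm (Exp q) \<le> norm (cst 1) * exp (Kmul * norm q)"
    and norm_Exp_remainder: "norm (Exp q - cst 1 - q) \<le> norm (cst 1) * (exp (Kmul * norm q) - 1 - Kmul * norm q)"
proof -
  let ?a = "Kmul * norm q"
  let ?g = "\<lambda>n. norm (cst 1) * (?a ^ n /\<^sub>R fact n)"
  have g: "?g sums (norm (cst 1) * exp ?a)"
    by (intro sums_mult exp_converges)
  have le: "norm (pw q n /\<^sub>R fact n) \<le> ?g n" for n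
    using norm_pw_le[of q n] by (simp add: mult_left_mono field_simps)
  show s: "summable (\<lambda>n. pw q n /\<^sub>R fact n)"
    by (rule summable_comparison_test'[OF sums_summable[OF g] le])
  show "norm (Exp q) \<le> norm (cst 1) * exp ?a"
    unfolding Exp_def using norm_suminf_le[OF le sums_summable[OF g]] sums_unique[OF g] by simp
  have "Exp q = (\<Sum>n. pw q (n + 2) /\<^sub>R fact (n + 2)) + (\<Sum>n<2. pw q n /\<^sub>R fact n)"
    unfolding Exp_def by (rule suminf_split_initial_segment[OF s])
  also have "(\<Sum>n<2. pw q n /\<^sub>R fact n) = cst 1 + q"
    using mul_commute[of q "cst 1"] by (simp add: numeral_2_eq_2)
  finally have E: "Exp q - cst 1 - q = (\<Sum>n. pw q (n + 2) /\<^sub>R fact (n + 2))" by simp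
  have g2: "(\<lambda>n. ?g (n + 2)) sums (norm (cst 1) * exp ?a - (\<Sum>n<2. ?g n))"
    by (rule sums_split_initial_segment[OF g])
  have "norm (Exp q - cst 1 - q) \<le> (\<Sum>n. ?g (n + 2))"
    unfolding E by (rule norm_suminf_le[OF le sums_summable[OF g2]])
  also have "\<dots> = norm (cst 1) * exp ?a - (\<Sum>n<2. ?g n)" using sums_unique[OF g2] by simp
  also have "\<dots> = norm (cst 1) * (exp ?a - 1 - ?a)"
    by (simp add: numeral_2_eq_2 algebra_simps)
  finally show "norm (Exp q - cst 1 - q) \<le> norm (cst 1) * (exp ?a - 1 - ?a)" .
qed

lemma ev_Exp: "ev p (Exp q) = exp (ev p q)"
proof -
  have "ev p (Exp q) = (\<Sum>n. ev p (pw q n /\<^sub>R fact n))"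
    unfolding Exp_def by (rule bounded_linear.suminf[OF bounded_linear_ev Exp_summable])
  also have "\<dots> = exp (ev p q)"
    unfolding exp_def by (intro arg_cong[of _ _ suminf] ext)
      (simp add: ev_simps ev_pw scaleR_conv_of_real)
  finally show ?thesis .
qed

lemma Exp_add: "Exp (x + y) = mul (Exp x) (Exp y)"
  by (rule ev_eqI) (simp add: ev_simps ev_Exp exp_add)

lemma Exp_0 [simp]: "Exp 0 = cst 1"
  by (rule ev_eqI) (simp add: ev_simps ev_Exp)

lemma Exp_minus_mul: "mul (Exp (- x)) (mul (Exp x) y) = y"
  by (rule ev_eqI) (simp add: ev_simps ev_Exp exp_minus)

text \<open>By \<open>Exp_add\<close> only the increment \<open>Exp h - 1 - h\<close> matters, and
  it is quadratically small: the real exponential satisfies \<open>exp x - 1 - x <= x^2\<close> for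
  \<open>x\<close> between \<open>0\<close> and \<open>1\<close>, whence the restriction on
  \<open>y - t\<close>.\<close>

lemma Exp_has_vector_derivative:
  "((\<lambda>t. Exp (t *\<^sub>R q)) has_vector_derivative mul q (Exp (t *\<^sub>R q))) (at t)"
proof -
  let ?a = "Kmul * norm q"
  define C where "C = Kmul * norm (Exp (t *\<^sub>R q)) * norm (cst 1) * ?a\<^sup>2"
  have C0: "C \<ge> 0" by (auto simp: C_def Kmul_nonneg)
  have key: "norm (Exp (y *\<^sub>R q) - Exp (t *\<^sub>R q) - (y - t) *\<^sub>R mul q (Exp (t *\<^sub>R q))) \<le> C * (y - t)\<^sup>2"
    if y: "\<bar>y - t\<bar> * ?a \<le> 1" for y
  proof -
    let ?h = "(y - t) *\<^sub>R q"
    have "y *\<^sub>R q = t *\<^sub>R q + ?h" by (simp add: algebra_simps)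
    then have yt: "Exp (y *\<^sub>R q) = mul (Exp (t *\<^sub>R q)) (Exp ?h)" by (simp only: Exp_add)
    have "Exp (y *\<^sub>R q) - Exp (t *\<^sub>R q) - (y - t) *\<^sub>R mul q (Exp (t *\<^sub>R q)) = mul (Exp (t *\<^sub>R q)) (Exp ?h - cst 1 - ?h)"
      unfolding yt by (rule ev_eqI) (simp add: ev_simps algebra_simps)
    also have "norm \<dots> \<le> Kmul * norm (Exp (t *\<^sub>R q)) * norm (Exp ?h - cst 1 - ?h)" by (rule norm_mul_le)
    also have "\<dots> \<le> Kmul * norm (Exp (t *\<^sub>R q)) * (norm (cst 1) * (exp (Kmul * norm ?h) - 1 - Kmul * norm ?h))"
      by (intro mult_left_mono norm_Exp_remainder) (auto simp: Kmul_nonneg)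
    also have "\<dots> \<le> Kmul * norm (Exp (t *\<^sub>R q)) * (norm (cst 1) * (Kmul * norm ?h)\<^sup>2)"
    proof (intro mult_left_mono)
      have "exp (Kmul * norm ?h) \<le> 1 + Kmul * norm ?h + (Kmul * norm ?h)\<^sup>2"
        using y by (intro exp_bound) (auto simp: Kmul_nonneg mult_ac)
      then show "exp (Kmul * norm ?h) - 1 - Kmul * norm ?h \<le> (Kmul * norm ?h)\<^sup>2" by simp
    qed (auto simp: Kmul_nonneg)
    also have "\<dots> = C * (y - t)\<^sup>2" by (simp add: C_def power_mult_distrib)
    finally show ?thesis .
  qed
  show ?thesis
    unfolding has_vector_derivative_def has_derivative_at_within
  proof (intro conjI bounded_linear_scaleR_left)
    have "((\<lambda>y. C * norm (y - t)) \<longlongrightarrow> C * norm (t - t)) (at t)"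
      by (intro tendsto_intros)
    then have lim: "((\<lambda>y. C * norm (y - t)) \<longlongrightarrow> 0) (at t)" by simp
    have "\<forall>\<^sub>F y in at t. \<bar>y - t\<bar> * ?a < 1"
    proof -
      have "((\<lambda>y. \<bar>y - t\<bar> * ?a) \<longlongrightarrow> \<bar>t - t\<bar> * ?a) (at t)" by (intro tendsto_intros)
      then show ?thesis by (intro order_tendstoD(2)) auto
    qed
    then have ev: "\<forall>\<^sub>F y in at t. norm ((Exp (y *\<^sub>R q) - Exp (t *\<^sub>R q) - (y - t) *\<^sub>R mul q (Exp (t *\<^sub>R q))) /\<^sub>R norm (y - t)) \<le> C * norm (y - t)"
    proof eventually_elim
      case (elim y)
      then have "norm (Exp (y *\<^sub>R q) - Exp (t *\<^sub>R q) - (y - t) *\<^sub>R mul q (Exp (t *\<^sub>R q))) \<le> C * (y - t)\<^sup>2"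
        by (intro key) simp
      note le = this
      show ?case
      proof (cases "y = t")
        case False
        have "(y - t)\<^sup>2 = \<bar>y - t\<bar> * \<bar>y - t\<bar>" by (simp add: power2_eq_square)
        then have "C * (y - t)\<^sup>2 / \<bar>y - t\<bar> = C * norm (y - t)"
          using False by (simp del: abs_mult_self_eq)
        with divide_right_mono[OF le abs_ge_zero[of "y - t"]] show ?thesis
          by (simp only: norm_scaleR norm_inverse real_norm_def abs_abs abs_inverse abs_idempotent divide_inverse mult.commute[of "inverse \<bar>y - t\<bar>"])
      qed simp
    qed
    show "((\<lambda>y. (Exp (y *\<^sub>R q) - Exp (t *\<^sub>R q) - (y - t) *\<^sub>R mul q (Exp (t *\<^sub>R q))) /\<^sub>R norm (y - t)) \<longlongrightarrow> 0) (at t)"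
      by (rule Lim_null_comparison[OF ev lim])
  qed
qed

lemma continuous_on_Exp_scaleR: "continuous_on A (\<lambda>t. Exp (t *\<^sub>R q))"
  by (rule continuous_at_imp_continuous_on)
    (auto intro: has_vector_derivative_continuous Exp_has_vector_derivative)

text \<open>Differentiation is only partially defined on \<open>H^s\<close>; as a relation on
  Fourier coefficients it records both that the derivative exists in \<open>H^s\<close> and what it
  is.\<close>

definition has_partial :: "'d \<Rightarrow> (int^'d) l2 \<Rightarrow> (int^'d) l2 \<Rightarrow> bool" where
  "has_partial j x y \<longleftrightarrow> (\<forall>k. coef y k = \<i> * of_int (k $ j) * coef x k)"

lemma has_partial_mul:
  assumes "has_partial j x x'" "has_partial j y y'"
  shows "has_partial j (mul x y) (mul x' y + mul x y')"
  unfolding has_partial_def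
proof
  fix k
  have e: "coef x' l * coef y (k - l) + coef x l * coef y' (k - l) = \<i> * of_int (k $ j) * (coef x l * coef y (k - l))" for l
    using assms by (simp add: has_partial_def algebra_simps)
  have "coef (mul x' y + mul x y') k = (\<Sum>\<^sub>\<infinity>l. coef x' l * coef y (k - l) + coef x l * coef y' (k - l))"
    unfolding coef_add coef_mul conv_def by (rule infsum_add[symmetric]) (rule conv_summable)+
  also have "\<dots> = \<i> * of_int (k $ j) * conv x y k"
    unfolding e conv_def by (rule infsum_cmult_right) (rule conv_summable)
  finally show "coef (mul x' y + mul x y') k = \<i> * of_int (k $ j) * coef (mul x y) k"
    by (simp add: coef_mul)
qed

lemma has_partial_add: "has_partial j x x' \<Longrightarrow> has_partial j y y' \<Longrightarrow> has_partial j (x + y) (x' + y')"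
  and has_partial_diff: "has_partial j x x' \<Longrightarrow> has_partial j y y' \<Longrightarrow> has_partial j (x - y) (x' - y')"
  and has_partial_scaleR: "has_partial j x x' \<Longrightarrow> has_partial j (r *\<^sub>R x) (r *\<^sub>R x')"
  and has_partial_0: "has_partial j 0 0"
  by (auto simp: has_partial_def coef_add coef_diff coef_scaleR algebra_simps)

lemma has_partial_sum: "(\<And>i. i \<in> I \<Longrightarrow> has_partial j (x i) (x' i)) \<Longrightarrow> has_partial j (sum x I) (sum x' I)"
  by (induction I rule: infinite_finite_induct) (auto intro: has_partial_0 has_partial_add)

lemma has_partial_mode: "has_partial j (mode k c) (mode k (\<i> * of_int (k $ j) * c))"
  by (auto simp: has_partial_def coef_mode)

lemma has_partial_cst: "has_partial j (cst c) 0"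
  by (auto simp: has_partial_def cst_def coef_mode)

lemma has_partial_mul_cst: "has_partial j x x' \<Longrightarrow> has_partial j (mul (cst c) x) (mul (cst c) x')"
  using has_partial_mul[OF has_partial_cst] by (simp add: mul_distribs)

lemma has_partial_pw: "has_partial j q q' \<Longrightarrow> has_partial j (pw q (Suc n)) (real (Suc n) *\<^sub>R mul q' (pw q n))"
proof (induction n)
  case 0
  have "mul q (cst 1) = q" "mul q' (cst 1) = q'" using mul_commute mul_one by metis+
  then show ?case using 0 by simp
next
  case (Suc n)
  have "has_partial j (mul q (pw q (Suc n))) (mul q' (pw q (Suc n)) + mul q (real (Suc n) *\<^sub>R mul q' (pw q n)))"
    by (rule has_partial_mul[OF Suc.prems Suc.IH[OF Suc.prems]])
  moreover have "mul q' (pw q (Suc n)) + mul q (real (Suc n) *\<^sub>R mul q' (pw q n)) = real (Suc (Suc n)) *\<^sub>R mul q' (pw q (Suc n))"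
    by (rule ev_eqI) (simp add: ev_simps algebra_simps)
  ultimately show ?case by simp
qed

lemma bounded_linear_coef: "bounded_linear (\<lambda>z. coef z k)"
  unfolding coef_def by (rule bounded_linear_compose[OF bounded_linear_divide l2_nth_blin])

text \<open>Differentiation is not a bounded operator, but taking one coefficient is. So the series
  is compared coefficientwise: the derivative of its term \<open>n + 1\<close> is \<open>q'\<close>
  times its term \<open>n\<close>, and the constant term contributes nothing.\<close>

lemma has_partial_Exp:
  assumes q: "has_partial j q q'"
  shows "has_partial j (Exp q) (mul q' (Exp q))"
  unfolding has_partial_def
proof
  fix k
  let ?c = "\<i> * of_int (k $ j)"
  have 1: "(\<lambda>n. coef (pw q n /\<^sub>R fact n) k) sums coef (Exp q) k"
    unfolding Exp_def by (rule bounded_linear.sums[OF bounded_linear_coef summable_sums[OF Exp_summable]])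
  have 2: "(\<lambda>n. coef (mul q' (pw q n /\<^sub>R fact n)) k) sums coef (mul q' (Exp q)) k"
    unfolding Exp_def
    by (rule bounded_linear.sums[OF bounded_linear_compose[OF bounded_linear_coef mul_linear_right] summable_sums[OF Exp_summable]])
  have "coef (mul q' (pw q n /\<^sub>R fact n)) k = ?c * coef (pw q (Suc n) /\<^sub>R fact (Suc n)) k" for n
  proof -
    have "has_partial j (pw q (Suc n) /\<^sub>R fact (Suc n)) ((real (Suc n) *\<^sub>R mul q' (pw q n)) /\<^sub>R fact (Suc n))"
      by (rule has_partial_scaleR[OF has_partial_pw[OF q]])
    moreover have "(real (Suc n) *\<^sub>R mul q' (pw q n)) /\<^sub>R fact (Suc n) = mul q' (pw q n /\<^sub>R fact n)"
      by (simp add: mul_distribs fact_reduce[of "Suc n"] divide_simps del: of_nat_Suc fact_Suc)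
    ultimately show ?thesis by (simp only: has_partial_def)
  qed
  then have 3: "(\<lambda>n. ?c * coef (pw q (Suc n) /\<^sub>R fact (Suc n)) k) sums coef (mul q' (Exp q)) k"
    using 2 by simp
  have "coef (pw q 0 /\<^sub>R fact 0) k * ?c = 0"
    using has_partial_cst[of j 1] by (auto simp: has_partial_def mult_ac)
  moreover have "(\<lambda>n. ?c * coef (pw q (Suc n) /\<^sub>R fact (Suc n)) k) sums (?c * (coef (Exp q) k - coef (pw q 0 /\<^sub>R fact 0) k))"
    using 1 by (intro sums_mult sums_Suc_iff[where f = "\<lambda>n. coef (pw q n /\<^sub>R fact n) k", THEN iffD2])
      (simp only: diff_add_cancel)
  ultimately show "coef (mul q' (Exp q)) k = ?c * coef (Exp q) k"
    using sums_unique2[OF 3] by (simp add: right_diff_distrib mult.commute)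
qed

lemma has_partial_unique: "has_partial j x y \<Longrightarrow> has_partial j x y' \<Longrightarrow> y = y'"
  by (rule coef_eqI) (simp add: has_partial_def)

text \<open>Integration by parts.\<close>

lemma inner_has_partial2:
  assumes "has_partial j x y" "has_partial j y z"
  shows "inner (mul (cst c) z) x = - Re c * (norm y)\<^sup>2"
proof -
  have n: "l2_nth y k = \<i> * of_int (k $ j) * l2_nth x k" "l2_nth z k = \<i> * of_int (k $ j) * l2_nth y k" for k
    using assms by (auto simp: has_partial_def coef_def field_simps)
  have "inner (mul (cst c) z) x = (\<Sum>\<^sub>\<infinity>k. - Re c * (cmod (l2_nth y k))\<^sup>2)"
    unfolding inner_l2_def mul_cst
  proof (rule infsum_cong)
    fix k
    have "c * l2_nth z k * cnj (l2_nth x k) = - (c * complex_of_real ((of_int (k $ j))\<^sup>2 * (cmod (l2_nth x k))\<^sup>2))"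
      unfolding n of_real_mult complex_norm_square by (simp add: power2_eq_square algebra_simps)
    then have "Re (c * l2_nth z k * cnj (l2_nth x k)) = - (Re c * (of_int (k $ j))\<^sup>2 * (cmod (l2_nth x k))\<^sup>2)"
      by simp
    also have "\<dots> = - Re c * (cmod (l2_nth y k))\<^sup>2"
      unfolding n by (simp add: norm_mult power_mult_distrib)
    finally show "Re (l2_nth (l2_mult (\<lambda>_. c) z) k * cnj (l2_nth x k)) = - Re c * (cmod (l2_nth y k))\<^sup>2"
      by (simp add: l2_nth_mult[of _ "cmod c"])
  qed
  also have "\<dots> = - Re c * (norm y)\<^sup>2"
    unfolding l2_norm_sq by (rule infsum_cmult_right) (rule l2_summable)
  finally show ?thesis .
qed

text \<open>Clamping the time at zero makes every multiplier bounded by one, so that the semigroup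
  is contractive and strongly continuous on the whole real line.\<close>

definition smul :: "real \<Rightarrow> real \<Rightarrow> int^'d \<Rightarrow> complex" where
  "smul \<nu> t k = exp (- ((1 + \<i> * complex_of_real \<nu>) * complex_of_real (max t 0 * (norm (freq k))\<^sup>2)))"

definition heat :: "real \<Rightarrow> real \<Rightarrow> (int^'d) l2 \<Rightarrow> (int^'d) l2" where "heat \<nu> t = l2_mult (smul \<nu> t)"

lemma norm_smul_le: "cmod (smul \<nu> t k) \<le> 1"
  by (simp add: smul_def norm_exp_eq_Re)

lemma heat_facts:
  shows l2_nth_heat: "l2_nth (heat \<nu> t x) k = smul \<nu> t k * l2_nth x k"
    and norm_heat_le: "norm (heat \<nu> t x) \<le> norm x"
    and bounded_linear_heat: "bounded_linear (heat \<nu> t)"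
proof -
  show "l2_nth (heat \<nu> t x) k = smul \<nu> t k * l2_nth x k"
    unfolding heat_def by (rule l2_nth_mult) (rule norm_smul_le)
  have "norm (heat \<nu> t x) \<le> 1 * norm x"
    unfolding heat_def by (rule norm_l2_mult_le) (rule norm_smul_le)
  then show "norm (heat \<nu> t x) \<le> norm x" by simp
  show "bounded_linear (heat \<nu> t)"
    unfolding heat_def by (rule bounded_linear_l2_mult) (rule norm_smul_le)
qed

lemma coef_heat: "coef (heat \<nu> t x) k = smul \<nu> t k * coef x k"
  by (simp add: coef_def l2_nth_heat)

lemma heat_0: "heat \<nu> 0 x = x"
  by (rule coef_eqI) (simp add: coef_heat smul_def)

lemma heat_add: "0 \<le> t \<Longrightarrow> 0 \<le> u \<Longrightarrow> heat \<nu> (t + u) x = heat \<nu> t (heat \<nu> u x)"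
  by (rule coef_eqI) (simp add: coef_heat smul_def exp_add[symmetric] algebra_simps)

lemma heat_mode: "heat \<nu> t (mode k c) = mode k (smul \<nu> t k * c)"
  by (rule coef_eqI) (simp add: coef_heat coef_mode)

lemma has_partial_heat: "has_partial j x y \<Longrightarrow> has_partial j (heat \<nu> t x) (heat \<nu> t y)"
  by (simp add: has_partial_def coef_heat)

lemma ev_heat: "0 \<le> t \<Longrightarrow> (\<And>k. fourier_coeff f k = coef z k) \<Longrightarrow> heat_semigroup \<nu> t f x = ev x (heat \<nu> t z)"
  unfolding heat_semigroup_def ev_def by (simp add: coef_heat smul_def chr_def)

text \<open>Continuity in \<open>t\<close> is clear on finite sums of modes. Contractivity makes the
  approximation by such sums uniform in \<open>t\<close>.\<close>

lemma continuous_on_heat: "continuous_on A (\<lambda>t. heat \<nu> t z)"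
proof -
  obtain Z F where Z: "\<And>n::nat. finite (F n)" "\<And>n. Z n = (\<Sum>k\<in>F n. mode k (coef z k))" "Z \<longlonglongrightarrow> z"
    using truncation_sequence by metis
  have SZ: "heat \<nu> t (Z n) = (\<Sum>k\<in>F n. mode k (smul \<nu> t k * coef z k))" for t n
    unfolding Z(2) bounded_linear.linear[OF bounded_linear_heat, THEN linear_sum] by (simp add: heat_mode)
  have cont: "continuous_on UNIV (\<lambda>t. heat \<nu> t (Z n))" for n
    unfolding SZ smul_def
    by (intro continuous_intros bounded_linear.continuous_on[OF bounded_linear_mode])
  have "uniform_limit UNIV (\<lambda>n t. heat \<nu> t (Z n)) (\<lambda>t. heat \<nu> t z) sequentially"
  proof (rule uniform_limitI)
    fix e :: real assume e: "e > 0"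
    from Z(3) e have "\<forall>\<^sub>F n in sequentially. dist (Z n) z < e" by (rule tendstoD)
    then show "\<forall>\<^sub>F n in sequentially. \<forall>t\<in>UNIV. dist (heat \<nu> t (Z n)) (heat \<nu> t z) < e"
    proof (rule eventually_mono, intro ballI)
      fix n and t :: real assume n: "dist (Z n) z < e"
      have "dist (heat \<nu> t (Z n)) (heat \<nu> t z) = norm (heat \<nu> t (Z n - z))"
        by (simp add: dist_norm bounded_linear.linear[OF bounded_linear_heat, THEN linear_diff])
      also have "\<dots> \<le> norm (Z n - z)" by (rule norm_heat_le)
      finally show "dist (heat \<nu> t (Z n)) (heat \<nu> t z) < e" using n by (simp add: dist_norm)
    qed
  qed
  then have "continuous_on UNIV (\<lambda>t. heat \<nu> t z)"
    by (rule uniform_limit_theorem[rotated]) (simp_all add: cont)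
  then show ?thesis by (rule continuous_on_subset) simp
qed

text \<open>On a single mode the generator is a scalar; \<open>t > 0\<close> stays away from the
  clamping of time in \<open>smul\<close>.\<close>

lemma heat_mode_has_vector_derivative:
  assumes "t > 0"
  shows "((\<lambda>t. heat \<nu> t (mode k c)) has_vector_derivative
    heat \<nu> t (mode k (- ((1 + \<i> * complex_of_real \<nu>) * complex_of_real ((norm (freq k))\<^sup>2)) * c))) (at t)"
proof -
  let ?a = "- ((1 + \<i> * complex_of_real \<nu>) * complex_of_real ((norm (freq k))\<^sup>2))"
  have "((\<lambda>t. exp (t *\<^sub>R ?a)) has_vector_derivative exp (t *\<^sub>R ?a) * ?a) (at t)"
    by (rule exp_scaleR_has_vector_derivative_right)
  then have "((\<lambda>t. exp (t *\<^sub>R ?a) * c) has_vector_derivative (exp (t *\<^sub>R ?a) * ?a) * c) (at t)"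
    by (rule bounded_linear.has_vector_derivative[OF bounded_linear_mult_left])
  then have "((\<lambda>t. mode k (exp (t *\<^sub>R ?a) * c)) has_vector_derivative mode k ((exp (t *\<^sub>R ?a) * ?a) * c)) (at t)"
    by (rule bounded_linear.has_vector_derivative[OF bounded_linear_mode])
  then have "((\<lambda>t. heat \<nu> t (mode k c)) has_vector_derivative mode k ((exp (t *\<^sub>R ?a) * ?a) * c)) (at t)"
    by (rule has_vector_derivative_transform_within_open[where S = "{0<..}"])
      (use assms in \<open>auto simp: heat_mode smul_def scaleR_conv_of_real algebra_simps\<close>)
  moreover have "mode k ((exp (t *\<^sub>R ?a) * ?a) * c) = heat \<nu> t (mode k (?a * c))"
    using assms by (simp add: heat_mode smul_def scaleR_conv_of_real algebra_simps)
  ultimately show ?thesis by simp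
qed

end

section \<open>Abstract semilinear evolution equations\<close>

text \<open>The auxiliary \<open>h\<close> is the majorant of \<open>g\<close> times the integrating
  factor \<open>exp (- K t)\<close>; the assumed inequality says precisely that the bracket in its
  derivative is nonpositive, so \<open>h\<close> never exceeds \<open>h 0 = c\<close>.\<close>

lemma gronwall_integral:
  fixes g k :: "real \<Rightarrow> real"
  assumes T: "0 \<le> T" and g: "continuous_on {0..T} g" and k: "continuous_on {0..T} k"
    and k0: "\<And>t. t \<in> {0..T} \<Longrightarrow> 0 \<le> k t" and c: "0 \<le> c"
    and le: "\<And>t. t \<in> {0..T} \<Longrightarrow> g t \<le> c + integral {0..t} (\<lambda>\<tau>. k \<tau> * g \<tau>)"
    and t: "t \<in> {0..T}"
  shows "g t \<le> c * exp (integral {0..T} k)"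
proof -
  define K where "K t = integral {0..t} k" for t
  define h where "h t = exp (- K t) * (c + integral {0..t} (\<lambda>\<tau>. k \<tau> * g \<tau>))" for t
  have kg: "continuous_on {0..T} (\<lambda>\<tau>. k \<tau> * g \<tau>)" by (intro continuous_intros k g)
  have dK: "(K has_real_derivative k x) (at x within {0..T})" if "x \<in> {0..T}" for x
    unfolding K_def by (rule integral_has_real_derivative[OF k that])
  have dI: "((\<lambda>t. integral {0..t} (\<lambda>\<tau>. k \<tau> * g \<tau>)) has_real_derivative k x * g x) (at x within {0..T})" if "x \<in> {0..T}" for x
    by (rule integral_has_real_derivative[OF kg that])
  have dh: "(h has_real_derivative exp (- K x) * (k x * (g x - (c + integral {0..x} (\<lambda>\<tau>. k \<tau> * g \<tau>))))) (at x within {0..T})"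
    if "x \<in> {0..T}" for x
  proof -
    have "((\<lambda>t. exp (- K t)) has_real_derivative exp (- K x) * (- k x)) (at x within {0..T})"
      by (rule DERIV_chain'[OF DERIV_minus[OF dK[OF that]] DERIV_exp, simplified mult.commute[of "- k x"]])
    from DERIV_mult[OF this DERIV_add[OF DERIV_const[of c] dI[OF that]]]
    show ?thesis unfolding h_def by (simp add: algebra_simps)
  qed
  have "h t \<le> h 0"
  proof (cases "t = 0")
    case False
    then have t0: "0 < t" "t \<le> T" using t by auto
    show ?thesis
    proof (rule DERIV_nonpos_imp_decreasing_open[where f = h])
      show "continuous_on {0..t} h"
      proof (rule continuous_on_subset[of "{0..T}"])
        show "continuous_on {0..T} h"
          by (rule DERIV_continuous_on[OF dh])
      qed (use t0 in auto)
      fix x assume x: "0 < x" "x < t"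
      then have xT: "x \<in> {0..T}" "x \<in> interior {0..T}" using t0 by simp_all
      have "(h has_real_derivative exp (- K x) * (k x * (g x - (c + integral {0..x} (\<lambda>\<tau>. k \<tau> * g \<tau>))))) (at x)"
        using dh[OF xT(1)] unfolding at_within_interior[OF xT(2)] .
      moreover have "exp (- K x) * (k x * (g x - (c + integral {0..x} (\<lambda>\<tau>. k \<tau> * g \<tau>)))) \<le> 0"
      proof -
        have "g x - (c + integral {0..x} (\<lambda>\<tau>. k \<tau> * g \<tau>)) \<le> 0" using le[OF xT(1)] by linarith
        from mult_nonneg_nonpos[OF exp_ge_zero mult_nonneg_nonpos[OF k0[OF xT(1)] this]] show ?thesis .
      qed
      ultimately show "\<exists>y. (h has_real_derivative y) (at x) \<and> y \<le> 0" by blast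
    qed (use t0 in auto)
  qed simp
  also have "h 0 = c" by (simp add: h_def K_def)
  finally have "exp (- K t) * (c + integral {0..t} (\<lambda>\<tau>. k \<tau> * g \<tau>)) \<le> c" by (simp add: h_def)
  then have "c + integral {0..t} (\<lambda>\<tau>. k \<tau> * g \<tau>) \<le> c * exp (K t)"
    by (simp add: exp_minus field_simps)
  also have "\<dots> \<le> c * exp (integral {0..T} k)"
  proof -
    have "k integrable_on {0..T}" using k by (rule integrable_continuous_real)
    then have "K t \<le> integral {0..T} k"
      unfolding K_def using t k0
      by (intro integral_subset_le) (auto intro: integrable_on_subinterval)
    then show ?thesis using c by (intro mult_left_mono) auto
  qed
  finally show ?thesis using le[OF t] by linarith
qed

lemma gronwall_differential:
  fixes f f' :: "real \<Rightarrow> real"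
  assumes c: "continuous_on {0..1} f"
    and d: "\<And>t. 0 < t \<Longrightarrow> t < 1 \<Longrightarrow> (f has_real_derivative f' t) (at t)"
    and le: "\<And>t. 0 < t \<Longrightarrow> t < 1 \<Longrightarrow> f' t \<le> C * f t + G"
    and C: "0 \<le> C" and G: "0 \<le> G"
  shows "f 1 \<le> exp C * (f 0 + G)"
proof -
  let ?h = "\<lambda>t. exp (- C * t) * f t - G * t"
  have "?h 1 \<le> ?h 0"
  proof (rule DERIV_nonpos_imp_decreasing_open[where f = ?h])
    show "continuous_on {0..1} ?h" by (intro continuous_intros c)
    fix t :: real assume t: "0 < t" "t < 1"
    have d1: "(?h has_real_derivative (exp (- C * t) * (f' t - C * f t) - G)) (at t)"
      by (auto intro!: derivative_eq_intros d[OF t] simp: algebra_simps)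
    have d2: "exp (- C * t) * (f' t - C * f t) \<le> exp (- C * t) * G"
      using le[OF t] by (intro mult_left_mono) auto
    have d3: "exp (- C * t) * G \<le> 1 * G"
      using C G t by (intro mult_right_mono) auto
    show "\<exists>y. (?h has_real_derivative y) (at t) \<and> y \<le> 0"
      by (intro exI conjI, rule d1) (use d2 d3 in linarith)
  qed auto
  then have "exp (- C) * f 1 \<le> f 0 + G" by simp
  then show ?thesis by (simp add: exp_minus field_simps)
qed

section \<open>Duhamel's formula and Picard iteration for contraction semigroups\<close>

locale contraction_semigroup =
  fixes S :: "real \<Rightarrow> 'x::banach \<Rightarrow> 'x"
  assumes S_linear: "bounded_linear (S t)"
    and S_norm: "norm (S t x) \<le> norm x"
    and S_0: "S 0 x = x"
    and S_add: "0 \<le> t \<Longrightarrow> 0 \<le> u \<Longrightarrow> S (t + u) x = S t (S u x)"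
    and S_cont: "continuous_on UNIV (\<lambda>t. S t x)"
begin

lemma S_diff: "S t (x - y) = S t x - S t y"
  by (rule linear_diff[OF bounded_linear.linear[OF S_linear]])

lemma S_plus: "S t (x + y) = S t x + S t y"
  by (rule linear_add[OF bounded_linear.linear[OF S_linear]])

lemma S_scaleR: "S t (r *\<^sub>R x) = r *\<^sub>R S t x"
  by (rule linear_scale[OF bounded_linear.linear[OF S_linear]])

lemma continuous_on_S:
  fixes f :: "'b::topological_space \<Rightarrow> real" and g :: "'b \<Rightarrow> 'x"
  assumes "continuous_on A f" "continuous_on A g"
  shows "continuous_on A (\<lambda>z. S (f z) (g z))"
proof -
  have "((\<lambda>w. S (f w) (g w)) \<longlongrightarrow> S (f z) (g z)) (at z within A)" if z: "z \<in> A" for z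
  proof -
    have 1: "((\<lambda>w. norm (g w - g z)) \<longlongrightarrow> 0) (at z within A)"
      using assms(2) z by (intro tendsto_norm_zero LIM_zero) (simp add: continuous_on_def)
    have "((\<lambda>w. S (f w) (g w - g z)) \<longlongrightarrow> 0) (at z within A)"
      by (rule Lim_null_comparison[OF _ 1]) (simp add: S_norm)
    moreover have "((\<lambda>w. S (f w) (g z)) \<longlongrightarrow> S (f z) (g z)) (at z within A)"
    proof (rule isCont_tendsto_compose[of "f z" "\<lambda>t. S t (g z)"])
      show "isCont (\<lambda>t. S t (g z)) (f z)"
        using S_cont[of "g z"] by (simp add: continuous_on_eq_continuous_at)
      show "(f \<longlongrightarrow> f z) (at z within A)" using assms(1) z by (simp add: continuous_on_def)
    qed
    ultimately have "((\<lambda>w. S (f w) (g w - g z) + S (f w) (g z)) \<longlongrightarrow> 0 + S (f z) (g z)) (at z within A)"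
      by (rule tendsto_add)
    then show ?thesis by (simp add: S_plus[symmetric])
  qed
  then show ?thesis by (simp add: continuous_on_def)
qed

definition duhamel :: "(real \<Rightarrow> 'x) \<Rightarrow> real \<Rightarrow> 'x" where
  "duhamel h t = integral {0..t} (\<lambda>\<tau>. S (t - \<tau>) (h \<tau>))"

lemma duhamel_integrable:
  assumes "continuous_on {0..t} h"
  shows "(\<lambda>\<tau>. S (t - \<tau>) (h \<tau>)) integrable_on {0..t}"
  by (intro integrable_continuous_real continuous_on_S assms continuous_intros)

text \<open>Rescaling to a fixed interval moves the dependence on \<open>t\<close> into the
  integrand, so that continuity in \<open>t\<close> follows from the theorem on parameter
  integrals.\<close>

lemma duhamel_scaled:
  assumes "0 \<le> t"
  shows "duhamel h t = t *\<^sub>R integral {0..1} (\<lambda>\<sigma>. S (t - t * \<sigma>) (h (t * \<sigma>)))"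
proof (cases "t = 0")
  case False
  then have t: "t > 0" using assms by simp
  let ?f = "\<lambda>\<tau>. S (t - \<tau>) (h \<tau>)"
  have "integral {0 / t..t / t} (\<lambda>\<sigma>. ?f (t * \<sigma>)) = (1 / t) *\<^sub>R integral {0..t} ?f"
    using integral_stretch_real[of t 0 t ?f] t by simp
  then show ?thesis using t by (simp add: duhamel_def)
qed (simp add: duhamel_def)

lemma continuous_on_duhamel:
  assumes h: "continuous_on {0..T} h"
  shows "continuous_on {0..T} (duhamel h)"
proof (cases "0 \<le> T")
  case True
  have "continuous_on ({0..T} \<times> cbox 0 1) (\<lambda>(t, \<sigma>). S (t - t * \<sigma>) (h (t * \<sigma>)))"
    unfolding case_prod_beta
  proof (intro continuous_on_S continuous_intros continuous_on_compose2[OF h])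
    show "(\<lambda>x. fst x * snd x) ` ({0..T} \<times> cbox 0 1) \<subseteq> {0..T}"
    proof
      fix y assume "y \<in> (\<lambda>x. fst x * snd x) ` ({0..T} \<times> cbox 0 (1::real))"
      then obtain a b where ab: "y = a * b" "0 \<le> a" "a \<le> T" "0 \<le> b" "b \<le> 1" by auto
      then have "a * b \<le> T * 1" by (intro mult_mono) auto
      with ab show "y \<in> {0..T}" by simp
    qed
  qed
  then have "continuous_on {0..T} (\<lambda>t. integral (cbox 0 1) (\<lambda>\<sigma>. S (t - t * \<sigma>) (h (t * \<sigma>))))"
    by (rule integral_continuous_on_param)
  then have "continuous_on {0..T} (\<lambda>t. t *\<^sub>R integral {0..1} (\<lambda>\<sigma>. S (t - t * \<sigma>) (h (t * \<sigma>))))"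
    by (auto intro: continuous_intros)
  then show ?thesis
    by (rule continuous_on_eq) (simp add: duhamel_scaled)
qed simp

lemma norm_duhamel_le:
  assumes h: "continuous_on {0..t} h" and g: "continuous_on {0..t} g"
    and le: "\<And>\<tau>. \<tau> \<in> {0..t} \<Longrightarrow> norm (h \<tau>) \<le> g \<tau>"
  shows "norm (duhamel h t) \<le> integral {0..t} g"
  unfolding duhamel_def
proof (rule Henstock_Kurzweil_Integration.integral_norm_bound_integral)
  show "(\<lambda>\<tau>. S (t - \<tau>) (h \<tau>)) integrable_on {0..t}" by (rule duhamel_integrable[OF h])
  show "g integrable_on {0..t}" by (rule integrable_continuous_real[OF g])
  show "norm (S (t - \<tau>) (h \<tau>)) \<le> g \<tau>" if "\<tau> \<in> {0..t}" for \<tau>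
    using S_norm le[OF that] by (rule order_trans)
qed

lemma duhamel_diff:
  assumes "continuous_on {0..t} h" "continuous_on {0..t} g"
  shows "duhamel h t - duhamel g t = duhamel (\<lambda>\<tau>. h \<tau> - g \<tau>) t"
  unfolding duhamel_def S_diff by (rule integral_diff[symmetric]) (intro duhamel_integrable assms)+

lemma global_solution:
  fixes F :: "real \<Rightarrow> 'x \<Rightarrow> 'x"
  assumes T: "0 \<le> T"
    and F: "\<And>a. continuous_on {0..T} a \<Longrightarrow> continuous_on {0..T} (\<lambda>t. F t (a t))"
    and L: "\<And>t x y. t \<in> {0..T} \<Longrightarrow> norm (F t x - F t y) \<le> L * norm (x - y)" "0 < L"
  shows "\<exists>a. continuous_on {0..T} a \<and> (\<forall>t\<in>{0..T}. a t = S t x0 + duhamel (\<lambda>\<tau>. F \<tau> (a \<tau>)) t)"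
proof -
  \<comment> \<open>Clamped time lets the fixed point be sought among bounded continuous functions
    on the whole line, a complete space.\<close>
  define cl where "cl t = max 0 (min t T)" for t :: real
  have clc: "continuous_on A cl" for A unfolding cl_def by (intro continuous_intros)
  have clT: "cl t \<in> {0..T}" for t using T by (auto simp: cl_def)
  have cl_id: "cl t = t" if "t \<in> {0..T}" for t using that by (auto simp: cl_def)
  \<comment> \<open>With this rate the contraction constant is \<open>L / l = 1/2\<close>.\<close>
  define l where "l = 2 * L"
  text \<open>Conjugation by \<open>exp (l t)\<close> turns the Picard map into a contraction of the sup norm.\<close>
  define w where "w b \<tau> = exp (l * \<tau>) *\<^sub>R (apply_bcontfun b \<tau>)" for b :: "real \<Rightarrow>\<^sub>C 'x" and \<tau>
  define \<Phi> where "\<Phi> b t = exp (- l * cl t) *\<^sub>R (S (cl t) x0 + duhamel (\<lambda>\<tau>. F \<tau> (w b \<tau>)) (cl t))" for b t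
  have wc: "continuous_on A (w b)" for A b
    unfolding w_def by (intro continuous_intros continuous_on_apply_bcontfun)
  have Fw: "continuous_on {0..T} (\<lambda>\<tau>. F \<tau> (w b \<tau>))" for b by (rule F[OF wc])
  have dc: "continuous_on UNIV (\<lambda>t. duhamel (\<lambda>\<tau>. F \<tau> (w b \<tau>)) (cl t))" for b
    by (rule continuous_on_compose2[OF continuous_on_duhamel[OF Fw] clc]) (use clT in auto)
  have \<Phi>c: "continuous_on UNIV (\<Phi> b)" for b
    unfolding \<Phi>_def by (intro continuous_intros continuous_on_S clc dc)
  have \<Phi>cl: "\<Phi> b t = \<Phi> b (cl t)" for b t
    unfolding \<Phi>_def cl_id[OF clT] ..
  have \<Phi>b: "\<Phi> b \<in> bcontfun" for b
  proof -
    have "compact (\<Phi> b ` {0..T})"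
      by (intro compact_continuous_image continuous_on_subset[OF \<Phi>c]) auto
    then have "bounded (\<Phi> b ` {0..T})" by (rule compact_imp_bounded)
    moreover have "range (\<Phi> b) \<subseteq> \<Phi> b ` {0..T}"
    proof
      fix y assume "y \<in> range (\<Phi> b)"
      then obtain t where "y = \<Phi> b t" by auto
      then show "y \<in> \<Phi> b ` {0..T}" using \<Phi>cl[of b t] clT[of t] by auto
    qed
    ultimately show ?thesis
      using \<Phi>c bounded_subset by (auto simp: bcontfun_def)
  qed
  define \<Psi> where "\<Psi> b = Bcontfun (\<Phi> b)" for b
  have \<Psi>: "apply_bcontfun (\<Psi> b) = \<Phi> b" for b
    unfolding \<Psi>_def by (rule Bcontfun_inverse[OF \<Phi>b])
  have "dist (\<Psi> b) (\<Psi> b') \<le> 1/2 * dist b b'" for b b'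
  proof (rule dist_bound)
    fix t
    let ?t = "cl t"
    note ct = clT[of t]
    have sub: "{0..?t} \<subseteq> {0..T}" using ct by auto
    note c1 = continuous_on_subset[OF Fw sub]
    have "dist (\<Psi> b t) (\<Psi> b' t) = exp (- l * ?t) * norm (duhamel (\<lambda>\<tau>. F \<tau> (w b \<tau>)) ?t - duhamel (\<lambda>\<tau>. F \<tau> (w b' \<tau>)) ?t)"
      unfolding \<Psi> \<Phi>_def dist_norm scaleR_diff_right[symmetric] by simp
    also have "norm (duhamel (\<lambda>\<tau>. F \<tau> (w b \<tau>)) ?t - duhamel (\<lambda>\<tau>. F \<tau> (w b' \<tau>)) ?t)
        \<le> integral {0..?t} (\<lambda>\<tau>. L * (exp (l * \<tau>) * dist b b'))"
      unfolding duhamel_diff[OF c1 c1]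
    proof (rule norm_duhamel_le)
      show "continuous_on {0..?t} (\<lambda>\<tau>. F \<tau> (w b \<tau>) - F \<tau> (w b' \<tau>))" by (intro continuous_on_diff c1)
      show "continuous_on {0..?t} (\<lambda>\<tau>. L * (exp (l * \<tau>) * dist b b'))" by (intro continuous_intros)
      fix \<tau> assume \<tau>: "\<tau> \<in> {0..?t}"
      have "norm (F \<tau> (w b \<tau>) - F \<tau> (w b' \<tau>)) \<le> L * norm (w b \<tau> - w b' \<tau>)"
        using sub \<tau> by (intro L) auto
      also have "norm (w b \<tau> - w b' \<tau>) = exp (l * \<tau>) * dist (b \<tau>) (b' \<tau>)"
        unfolding w_def scaleR_diff_right[symmetric] by (simp add: dist_norm)
      also have "\<dots> \<le> exp (l * \<tau>) * dist b b'" by (intro mult_left_mono dist_bounded) auto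
      finally show "norm (F \<tau> (w b \<tau>) - F \<tau> (w b' \<tau>)) \<le> L * (exp (l * \<tau>) * dist b b')"
        using L(2) by (simp add: mult_left_mono)
    qed
    also have "integral {0..?t} (\<lambda>\<tau>. L * (exp (l * \<tau>) * dist b b')) = (exp (l * ?t) - 1) / 2 * dist b b'"
    proof (rule integral_unique)
      have "((\<lambda>\<tau>. L * (exp (l * \<tau>) * dist b b')) has_integral
          (exp (l * ?t) / 2 * dist b b' - exp (l * 0) / 2 * dist b b')) {0..?t}"
      proof (rule fundamental_theorem_of_calculus[where f = "\<lambda>\<tau>. exp (l * \<tau>) / 2 * dist b b'"])
        show "0 \<le> ?t" using ct by simp
        show "((\<lambda>\<tau>. exp (l * \<tau>) / 2 * dist b b') has_vector_derivative L * (exp (l * \<tau>) * dist b b')) (at \<tau> within {0..?t})" for \<tau>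
          unfolding has_real_derivative_iff_has_vector_derivative[symmetric]
          by (auto intro!: derivative_eq_intros simp: l_def)
      qed
      then show "((\<lambda>\<tau>. L * (exp (l * \<tau>) * dist b b')) has_integral ((exp (l * ?t) - 1) / 2 * dist b b')) {0..?t}"
        by (simp add: algebra_simps diff_divide_distrib)
    qed
    finally have "dist (\<Psi> b t) (\<Psi> b' t) \<le> exp (- l * ?t) * ((exp (l * ?t) - 1) / 2 * dist b b')"
      by simp
    also have "\<dots> = (1 - exp (- l * ?t)) / 2 * dist b b'"
      by (simp add: exp_minus field_simps)
    also have "\<dots> \<le> 1/2 * dist b b'" by (intro mult_right_mono) auto
    finally show "dist (\<Psi> b t) (\<Psi> b' t) \<le> 1/2 * dist b b'" .
  qed
  then obtain b where b: "\<Psi> b = b"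
    using banach_fix_type[of "1/2" \<Psi>] by auto
  have "w b t = S t x0 + duhamel (\<lambda>\<tau>. F \<tau> (w b \<tau>)) t" if t: "t \<in> {0..T}" for t
  proof -
    have "b t = \<Phi> b t" using b \<Psi> by metis
    then show ?thesis unfolding w_def[of b t] by (simp add: \<Phi>_def cl_id[OF t] exp_minus)
  qed
  with wc[of "{0..T}" b] show ?thesis by (intro exI[of _ "w b"]) blast
qed

end

definition radial :: "real \<Rightarrow> 'x::real_normed_vector \<Rightarrow> 'x" where
  "radial R x = (if norm x \<le> R then x else (R / norm x) *\<^sub>R x)"

lemma norm_radial_le: "0 \<le> R \<Longrightarrow> norm (radial R x) \<le> R"
  by (auto simp: radial_def)

lemma radial_id: "norm x \<le> R \<Longrightarrow> radial R x = x"
  by (simp add: radial_def)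

text \<open>In a general normed space the retraction onto a ball need not be nonexpansive, but the
  constant \<open>2\<close> always works: one unit for the difference of the points and one for the
  change of the scaling factor \<open>c\<close>, estimated at the point of larger norm. It turns a
  nonlinearity that is Lipschitz on balls into a globally Lipschitz one.\<close>

lemma radial_lipschitz:
  assumes R: "0 < R"
  shows "norm (radial R x - radial R y) \<le> 2 * norm (x - y)"
proof -
  define c where "c z = (if norm z \<le> R then 1 else R / norm z)" for z :: 'a
  have r: "radial R z = c z *\<^sub>R z" for z by (simp add: radial_def c_def)
  have c01: "0 \<le> c z" "c z \<le> 1" for z using R by (auto simp: c_def divide_le_eq)
  have key: "\<bar>c z - c z'\<bar> * norm z' \<le> norm (z - z')" if le: "norm z \<le> norm z'" for z z' :: 'a
  proof -
    have d: "norm z' - norm z \<le> norm (z - z')" by (metis norm_minus_commute norm_triangle_ineq2)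
    show ?thesis
    proof (cases "norm z' \<le> R")
      case True
      then show ?thesis using le by (simp add: c_def)
    next
      case False
      then have z': "norm z' > R" by simp
      have "norm z' \<noteq> 0" using z' R by linarith
      then have cc: "c z' * norm z' = R" using z' by (simp add: c_def)
      have "c z * norm z' - R \<le> norm z' - norm z"
      proof (cases "norm z \<le> R")
        case False
        then have "norm z \<noteq> 0" using R by linarith
        then have "c z * norm z' - R = R / norm z * (norm z' - norm z)"
          using False by (simp add: c_def right_diff_distrib)
        also have "\<dots> \<le> 1 * (norm z' - norm z)"
          using False R le by (intro mult_right_mono) (auto simp: divide_le_eq)
        finally show ?thesis by simp
      qed (simp add: c_def)
      moreover have "c z \<ge> c z'"
      proof (cases "norm z \<le> R")
        case True
        then show ?thesis using c01 by (simp add: c_def)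
      next
        case False
        then have "R / norm z' \<le> R / norm z"
          using le z' R by (intro divide_left_mono mult_pos_pos) linarith+
        then show ?thesis using z' False by (simp add: c_def)
      qed
      ultimately show ?thesis using d cc by (simp add: left_diff_distrib abs_of_nonneg)
    qed
  qed
  have main: "norm (radial R z - radial R z') \<le> 2 * norm (z - z')" if le: "norm z \<le> norm z'" for z z' :: 'a
  proof -
    have "radial R z - radial R z' = c z *\<^sub>R (z - z') + (c z - c z') *\<^sub>R z'"
      by (simp add: r algebra_simps)
    also have "norm \<dots> \<le> c z * norm (z - z') + \<bar>c z - c z'\<bar> * norm z'"
      using c01 by (metis abs_of_nonneg norm_scaleR norm_triangle_ineq)
    also have "c z * norm (z - z') \<le> 1 * norm (z - z')" using c01 by (intro mult_right_mono) auto
    also have "\<bar>c z - c z'\<bar> * norm z' \<le> norm (z - z')" by (rule key[OF le])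
    finally show ?thesis by simp
  qed
  show ?thesis
    using main[of x y] main[of y x] by (cases "norm x \<le> norm y") (auto simp: norm_minus_commute)
qed

section \<open>Flat smooth controls\<close>

definition smooth_fun :: "(real \<Rightarrow> 'b::real_normed_vector) \<Rightarrow> bool" where
  "smooth_fun u \<longleftrightarrow> (\<exists>D. D 0 = u \<and> (\<forall>n::nat. \<forall>t. (D n has_vector_derivative D (Suc n) t) (at t)))"

text \<open>Flatness at both ends makes the concatenation of two controls the sum of \<open>u\<^sub>1\<close> and a translate of \<open>u\<^sub>2\<close>.\<close>

definition flat_control :: "real \<Rightarrow> (real \<Rightarrow> 'b::real_normed_vector) \<Rightarrow> bool" where
  "flat_control T u \<longleftrightarrow> smooth_fun u \<and> (\<forall>t. t \<notin> {0<..<T} \<longrightarrow> u t = 0)"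

lemma smooth_fun_add_shift:
  assumes "smooth_fun u" "smooth_fun v"
  shows "smooth_fun (\<lambda>t. u t + v (t - c))"
proof -
  obtain D E where D: "D 0 = u" "\<And>n t. (D n has_vector_derivative D (Suc n) t) (at t)"
    and E: "E 0 = v" "\<And>n t. (E n has_vector_derivative E (Suc n) t) (at t)"
    using assms unfolding smooth_fun_def by blast
  have "((\<lambda>t. E n (t - c)) has_vector_derivative E (Suc n) (t - c)) (at t)" for n t
  proof -
    have "((\<lambda>t. t - c) has_vector_derivative 1) (at t)"
      by (auto intro!: derivative_eq_intros)
    from vector_diff_chain_at[OF this, where g = "E n", OF E(2)] show ?thesis by (simp add: o_def)
  qed
  then show ?thesis unfolding smooth_fun_def
    by (intro exI[of _ "\<lambda>n t. D n t + E n (t - c)"]) (auto simp: D(1) E(1) intro!: has_vector_derivative_add D(2))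
qed

lemma smooth_fun_scaled:
  fixes u :: "real \<Rightarrow> real" and c :: "'b::real_normed_vector"
  assumes "smooth_fun u"
  shows "smooth_fun (\<lambda>t. u (t * r) *\<^sub>R c)"
proof -
  obtain D where D: "D 0 = u" "\<And>n t. (D n has_vector_derivative D (Suc n) t) (at t)"
    using assms unfolding smooth_fun_def by blast
  have 1: "((\<lambda>t. D n (t * r)) has_vector_derivative r *\<^sub>R D (Suc n) (t * r)) (at t)" for n t
  proof -
    have "((\<lambda>t. t * r) has_vector_derivative r) (at t)"
      by (auto intro!: derivative_eq_intros simp flip: has_real_derivative_iff_has_vector_derivative)
    from vector_diff_chain_at[OF this, where g = "D n", OF D(2)] show ?thesis by (simp add: o_def)
  qed
  have "((\<lambda>t. (r ^ n * D n (t * r)) *\<^sub>R c) has_vector_derivative (r ^ Suc n * D (Suc n) (t * r)) *\<^sub>R c) (at t)" for n t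
  proof -
    have "((\<lambda>t. r ^ n * D n (t * r)) has_vector_derivative r ^ n * (r *\<^sub>R D (Suc n) (t * r))) (at t)"
      by (rule bounded_linear.has_vector_derivative[OF bounded_linear_mult_right 1])
    from bounded_linear.has_vector_derivative[OF bounded_linear_scaleR_left this]
    show ?thesis by (simp add: mult_ac)
  qed
  then show ?thesis unfolding smooth_fun_def
    by (intro exI[of _ "\<lambda>n t. (r ^ n * D n (t * r)) *\<^sub>R c"]) (auto simp: D(1))
qed

lemma smooth_fun_zero: "smooth_fun (\<lambda>_. 0)"
  unfolding smooth_fun_def by (intro exI[of _ "\<lambda>_ _. 0"]) auto

lemma smooth_fun_continuous: "smooth_fun u \<Longrightarrow> continuous_on A u"
  unfolding smooth_fun_def
  by (metis continuous_at_imp_continuous_on has_vector_derivative_continuous)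

text \<open>The polynomial and the power \<open>k\<close> are carried along so that the family is
  closed under differentiation; smoothness then follows by iterating a single derivative
  formula.\<close>

definition bump :: "real poly \<Rightarrow> nat \<Rightarrow> real \<Rightarrow> real" where
  "bump p k t = (if 0 < t \<and> t < 1 then poly p t * (1 / (t * (1 - t))) ^ k * exp (- (1 / (t * (1 - t)))) else 0)"

text \<open>The term of index \<open>k + 2\<close> in the exponential series of \<open>1 / g\<close>
  already beats the power \<open>k\<close> and leaves the two factors of \<open>g\<close> that make
  the bump flat to second order.\<close>

lemma bump_decay:
  assumes g: "0 < (g::real)"
  shows "(1 / g) ^ k * exp (- (1 / g)) \<le> fact (k + 2) * g\<^sup>2"
proof -
  have "(1 / g) ^ (k + 2) / fact (k + 2) \<le> exp (1 / g)"
  proof -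
    have s: "(\<lambda>n. (1 / g) ^ n /\<^sub>R fact n) sums exp (1 / g)" by (rule exp_converges)
    have "(\<Sum>n\<in>{k + 2}. (1 / g) ^ n /\<^sub>R fact n) \<le> exp (1 / g)"
      unfolding sums_unique[OF s] by (rule sum_le_suminf[OF sums_summable[OF s]]) (use g in auto)
    then show ?thesis by (simp add: divide_inverse mult.commute)
  qed
  moreover have "(0::real) < fact (k + 2)" by (rule fact_gt_zero)
  ultimately have "(1 / g) ^ (k + 2) \<le> fact (k + 2) * exp (1 / g)"
    by (simp only: pos_divide_le_eq mult.commute)
  then have "(1 / g) ^ (k + 2) * exp (- (1 / g)) * g\<^sup>2 \<le> fact (k + 2) * exp (1 / g) * exp (- (1 / g)) * g\<^sup>2"
    by (intro mult_right_mono) auto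
  then have m1: "(1 / g) ^ (k + 2) * exp (- (1 / g)) * g\<^sup>2 \<le> fact (k + 2) * (exp (1 / g) * exp (- (1 / g))) * g\<^sup>2"
    by (simp only: mult.assoc)
  have m2: "(1 / g) ^ (k + 2) * exp (- (1 / g)) * g\<^sup>2 = (1 / g) ^ k * exp (- (1 / g))"
    using g by (simp add: power_add power_divide field_simps power2_eq_square)
  have m3: "exp (1 / g) * exp (- (1 / g)) = 1"
    by (simp flip: exp_add)
  show ?thesis using m1 unfolding m2 m3 mult_1_right .
qed

lemma quadratic_has_derivative_0:
  fixes f :: "real \<Rightarrow> real"
  assumes "\<And>y. \<bar>f y - f x\<bar> \<le> C * (y - x)\<^sup>2"
  shows "(f has_real_derivative 0) (at x)"
proof -
  have "((\<lambda>y. (f y - f x) / (y - x)) \<longlongrightarrow> 0) (at x)"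
  proof (rule Lim_null_comparison)
    show "((\<lambda>y. C * \<bar>y - x\<bar>) \<longlongrightarrow> 0) (at x)"
      using tendsto_mult_right_zero[OF tendsto_rabs_zero[OF LIM_zero[OF tendsto_ident_at]]] .
    show "\<forall>\<^sub>F y in at x. norm ((f y - f x) / (y - x)) \<le> C * \<bar>y - x\<bar>"
      unfolding eventually_at_filter
    proof (intro always_eventually allI impI)
      fix y assume "y \<noteq> x"
      then have n: "0 < \<bar>y - x\<bar>" by simp
      have "\<bar>f y - f x\<bar> \<le> (C * \<bar>y - x\<bar>) * \<bar>y - x\<bar>"
        using assms[of y] by (simp add: power2_eq_square mult.assoc)
      then show "norm ((f y - f x) / (y - x)) \<le> C * \<bar>y - x\<bar>"
        using n by (simp only: real_norm_def abs_divide pos_divide_le_eq)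
    qed
  qed
  then show ?thesis by (simp add: has_field_derivative_iff)
qed

text \<open>With \<open>g = t (1 - t)\<close> the new polynomial is
  \<open>p' g^2 + p (1 - 2 t) (1 - k g)\<close>; the factor \<open>1 / g^2\<close> from
  differentiating \<open>1 / g\<close> raises the power by two. Outside the open interval the bound
  of \<open>bump_decay\<close> makes the increment quadratic, so the derivative there is
  zero.\<close>

lemma bump_has_derivative:
  "(bump p k has_real_derivative
     bump (pderiv p * [:0, 1:]\<^sup>2 * [:1, -1:]\<^sup>2 + p * [:1, -2:] * (1 - of_nat k * [:0, 1:] * [:1, -1:])) (k + 2) t) (at t)"
proof -
  let ?q = "pderiv p * [:0, 1:]\<^sup>2 * [:1, -1:]\<^sup>2 + p * [:1, -2:] * (1 - of_nat k * [:0, 1:] * [:1, -1:])"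
  show ?thesis
  proof (cases "0 < t \<and> t < 1")
    case True
    define g where "g = t * (1 - t)"
    have g: "g > 0" using True by (simp add: g_def)
    have "((\<lambda>t. poly p t * (1 / (t * (1 - t))) ^ k * exp (- (1 / (t * (1 - t))))) has_real_derivative
       (poly (pderiv p) t * (1 / g) ^ k + poly p t * (real k * (1 / g) ^ (k - 1) * (- (1 - 2 * t) / g\<^sup>2))) * exp (- (1 / g))
       + poly p t * (1 / g) ^ k * (exp (- (1 / g)) * ((1 - 2 * t) / g\<^sup>2))) (at t)"
    proof -
      have dG: "((\<lambda>t. 1 / (t * (1 - t))) has_real_derivative (- (1 - 2 * t) / g\<^sup>2)) (at t)"
        using g unfolding g_def
        by (auto intro!: derivative_eq_intros simp: power2_eq_square field_simps)
      have dE: "((\<lambda>t. exp (- (1 / (t * (1 - t))))) has_real_derivative exp (- (1 / g)) * ((1 - 2 * t) / g\<^sup>2)) (at t)"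
        by (rule DERIV_cong[OF DERIV_fun_exp[OF DERIV_minus[OF dG]]])
          (simp only: g_def[symmetric] minus_divide_left minus_minus)
      show ?thesis
        by (rule DERIV_cong[OF DERIV_mult[OF DERIV_mult[OF poly_DERIV DERIV_power[OF dG]] dE]])
          (simp add: g_def algebra_simps)
    qed
    moreover have "(poly (pderiv p) t * (1 / g) ^ k + poly p t * (real k * (1 / g) ^ (k - 1) * (- (1 - 2 * t) / g\<^sup>2))) * exp (- (1 / g))
       + poly p t * (1 / g) ^ k * (exp (- (1 / g)) * ((1 - 2 * t) / g\<^sup>2)) = bump ?q (k + 2) t"
    proof -
      have k: "real k * (1 / g) ^ (k - 1) = real k * (1 / g) ^ k * g"
        using g by (cases k) auto
      have b: "bump q (k + 2) t = poly q t * ((1 / g) ^ k * (1 / g\<^sup>2)) * exp (- (1 / g))" for q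
        using True by (simp add: bump_def g_def[symmetric] power_add power_one_over power2_eq_square)
      have p1: "poly [:0, 1:] t = t" "poly [:1, -1:] t = 1 - t" "poly [:1, -2:] t = 1 - 2 * t" by simp_all
      have q: "poly ?q t = poly (pderiv p) t * g\<^sup>2 + poly p t * (1 - 2 * t) * (1 - real k * g)"
        unfolding poly_mult poly_add poly_power poly_diff poly_1 poly_of_nat p1
        by (simp add: g_def power_mult_distrib mult.assoc)
      have r: "(d * X + c * (X' * (- (1 - 2 * t) / g\<^sup>2))) * e + c * X * (e * ((1 - 2 * t) / g\<^sup>2))
          = (d * g\<^sup>2 + c * (1 - 2 * t) * (1 - real k * g)) * (X * (1 / g\<^sup>2)) * e"
        if "X' = real k * X * g" for d c X X' e :: real
        unfolding that using g by (simp add: field_simps power2_eq_square)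
      show ?thesis unfolding b q by (rule r[OF k])
    qed
    ultimately have "((\<lambda>t. poly p t * (1 / (t * (1 - t))) ^ k * exp (- (1 / (t * (1 - t))))) has_real_derivative bump ?q (k + 2) t) (at t)"
      by simp
    then show ?thesis
      by (rule has_field_derivative_transform_within_open[where S = "{0<..<1}"])
        (use True in \<open>auto simp: bump_def\<close>)
  next
    case False
    have "compact (poly p ` {0..1})" by (intro compact_continuous_image continuous_intros) auto
    then obtain P where P: "\<And>x. x \<in> {0..1} \<Longrightarrow> \<bar>poly p x\<bar> \<le> P"
      by (meson bounded_real compact_imp_bounded imageI)
    have P0: "P \<ge> 0" using P[of 0] by simp
    have est: "\<bar>bump p k y\<bar> \<le> P * (fact (k + 2) * (y * (1 - y))\<^sup>2)" if "0 < y" "y < 1" for y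
    proof -
      have g: "0 < y * (1 - y)" using that by simp
      have "\<bar>bump p k y\<bar> = \<bar>poly p y\<bar> * ((1 / (y * (1 - y))) ^ k * exp (- (1 / (y * (1 - y)))))"
        using that g by (simp add: bump_def abs_mult power_abs)
      also have "\<dots> \<le> P * (fact (k + 2) * (y * (1 - y))\<^sup>2)"
        by (rule mult_mono[OF P bump_decay[OF g]]) (use that P0 g in auto)
      finally show ?thesis .
    qed
    have "\<bar>bump p k y - bump p k t\<bar> \<le> (P * fact (k + 2)) * (y - t)\<^sup>2" for y
    proof (cases "0 < y \<and> y < 1")
      case y: True
      have "\<bar>y * (1 - y)\<bar> \<le> \<bar>y - t\<bar>"
      proof -
        have a: "y * (1 - y) \<le> y * 1" using y by (intro mult_left_mono) auto
        have b: "y * (1 - y) \<le> 1 * (1 - y)" using y by (intro mult_right_mono) auto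
        have c: "\<bar>y * (1 - y)\<bar> = y * (1 - y)" using y by simp
        have "t \<le> 0 \<or> 1 \<le> t" using False by auto
        then show ?thesis
        proof
          assume "t \<le> 0"
          then show ?thesis unfolding c using a y by linarith
        next
          assume "1 \<le> t"
          then have "\<bar>y - t\<bar> = t - y" using y by simp
          then show ?thesis unfolding c using b \<open>1 \<le> t\<close> by simp
        qed
      qed
      then have "(y * (1 - y))\<^sup>2 \<le> (y - t)\<^sup>2" by (simp only: abs_le_square_iff)
      then have "P * fact (k + 2) * (y * (1 - y))\<^sup>2 \<le> P * fact (k + 2) * (y - t)\<^sup>2"
        using P0 by (intro mult_left_mono) auto
      moreover have "bump p k t = 0" using False by (simp only: bump_def if_False)
      ultimately show ?thesis using est[of y] y by simp
    next
      case n: False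
      then have "bump p k y = 0" "bump p k t = 0" using False by (simp_all only: bump_def if_False)
      then show ?thesis using P0 by simp
    qed
    then have "(bump p k has_real_derivative 0) (at t)" by (rule quadratic_has_derivative_0)
    moreover have "bump ?q (k + 2) t = 0" using False by (simp only: bump_def if_False)
    ultimately show ?thesis by simp
  qed
qed

lemma smooth_bump: "smooth_fun (bump p k)"
proof -
  define step where "step pk = (pderiv (fst pk) * [:0, 1:]\<^sup>2 * [:1, -1:]\<^sup>2
    + fst pk * [:1, -2:] * (1 - of_nat (snd pk) * [:0, 1:] * [:1, -1:]), snd pk + 2)" for pk :: "real poly \<times> nat"
  define D where "D n = bump (fst ((step ^^ n) (p, k))) (snd ((step ^^ n) (p, k)))" for n
  have "(D n has_real_derivative D (Suc n) t) (at t)" for n t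
    unfolding D_def by (simp only: funpow.simps o_apply step_def[of "(step ^^ n) (p, k)"] fst_conv snd_conv bump_has_derivative)
  then show ?thesis
    unfolding smooth_fun_def has_real_derivative_iff_has_vector_derivative[symmetric]
    by (intro exI[of _ D]) (simp add: D_def)
qed

lemma unit_bump:
  "\<exists>\<beta>::real \<Rightarrow> real. flat_control 1 \<beta> \<and> (\<forall>t. 0 \<le> \<beta> t) \<and> integral {0..1} \<beta> = 1"
proof -
  let ?b = "bump 1 0"
  define c where "c = integral {0..1} ?b"
  have cont: "continuous_on {0..1} ?b" by (rule smooth_fun_continuous[OF smooth_bump])
  have nn: "0 \<le> ?b t" for t by (simp add: bump_def)
  have "c \<ge> 0" unfolding c_def using nn by (intro integral_nonneg integrable_continuous_real cont)
  moreover have "c \<noteq> 0"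
  proof
    assume "c = 0"
    then have "\<forall>x\<in>{0..1}. ?b x = 0"
      unfolding c_def using integral_eq_0_iff[OF cont _ nn] by simp
    then have "?b (1/2) = 0" by simp
    then show False by (simp add: bump_def)
  qed
  ultimately have c: "c > 0" by simp
  define \<beta> where "\<beta> t = ?b (t * 1) *\<^sub>R (1 / c)" for t
  have "smooth_fun \<beta>" unfolding \<beta>_def by (rule smooth_fun_scaled[OF smooth_bump])
  moreover have "\<beta> t = 0" if "t \<notin> {0<..<1}" for t using that by (auto simp: \<beta>_def bump_def)
  moreover have "integral {0..1} \<beta> = 1"
    unfolding \<beta>_def using c by (simp add: c_def[symmetric])
  moreover have "0 \<le> \<beta> t" for t using nn c by (simp add: \<beta>_def)
  ultimately show ?thesis unfolding flat_control_def by blast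
qed

section \<open>Controlled evolutions\<close>

locale control_system = contraction_semigroup S for S :: "real \<Rightarrow> 'x::banach \<Rightarrow> 'x" +
  fixes V :: real and N :: "'x \<Rightarrow> 'x" and K :: "'u::real_normed_vector \<Rightarrow> 'x \<Rightarrow> 'x"
  assumes N_lip: "\<exists>L\<ge>0. \<forall>x y. norm x \<le> R \<longrightarrow> norm y \<le> R \<longrightarrow> norm (N x - N y) \<le> L * norm (x - y)"
    and K_bilinear: "bounded_bilinear K"
begin

definition src :: "'u \<Rightarrow> 'x \<Rightarrow> 'x" where "src w x = V *\<^sub>R x - N x + K w x"

definition sol :: "(real \<Rightarrow> 'u) \<Rightarrow> real \<Rightarrow> 'x \<Rightarrow> (real \<Rightarrow> 'x) \<Rightarrow> bool" where
  "sol u T x0 a \<longleftrightarrow> continuous_on {0..T} a \<and>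
     (\<forall>t\<in>{0..T}. a t = S t x0 + duhamel (\<lambda>\<tau>. src (u \<tau>) (a \<tau>)) t)"

definition CK :: real where "CK = (SOME C. 0 \<le> C \<and> (\<forall>w x. norm (K w x) \<le> norm w * norm x * C))"

lemma CK: "0 \<le> CK" "norm (K w x) \<le> CK * norm w * norm x"
proof -
  have "\<exists>C. 0 \<le> C \<and> (\<forall>w x. norm (K w x) \<le> norm w * norm x * C)"
    using bounded_bilinear.nonneg_bounded[OF K_bilinear] by blast
  from someI_ex[OF this] show "0 \<le> CK" "norm (K w x) \<le> CK * norm w * norm x"
    unfolding CK_def[symmetric] by (auto simp: mult_ac)
qed

lemma continuous_on_N: "continuous_on A a \<Longrightarrow> continuous_on A (\<lambda>t. N (a t))" for a :: "real \<Rightarrow> 'x"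
proof -
  assume a: "continuous_on A a"
  have "continuous_on UNIV N"
    unfolding continuous_on_eq_continuous_at[OF open_UNIV]
  proof
    fix x :: 'x
    obtain L where L: "L \<ge> 0" "\<And>y z. norm y \<le> norm x + 1 \<Longrightarrow> norm z \<le> norm x + 1 \<Longrightarrow> norm (N y - N z) \<le> L * norm (y - z)"
      using N_lip[of "norm x + 1"] by blast
    have "((\<lambda>y. N y - N x) \<longlongrightarrow> 0) (at x)"
    proof (rule Lim_null_comparison)
      show "((\<lambda>y. L * norm (y - x)) \<longlongrightarrow> 0) (at x)"
        by (rule tendsto_mult_right_zero[OF tendsto_norm_zero[OF LIM_zero[OF tendsto_ident_at]]])
      have "\<forall>\<^sub>F y in at x. dist y x < 1" by (rule tendstoD[OF tendsto_ident_at]) simp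
      then show "\<forall>\<^sub>F y in at x. norm (N y - N x) \<le> L * norm (y - x)"
      proof eventually_elim
        case (elim y)
        have "norm y \<le> norm x + norm (y - x)" using norm_triangle_ineq[of x "y - x"] by simp
        then show ?case using elim by (intro L(2)) (auto simp: dist_norm)
      qed
    qed
    then show "isCont N x" unfolding isCont_def by (rule LIM_zero_cancel)
  qed
  then show ?thesis using a by (rule continuous_on_compose2) simp
qed

lemma continuous_on_src:
  "continuous_on A u \<Longrightarrow> continuous_on A a \<Longrightarrow> continuous_on A (\<lambda>t. src (u t) (a t))" for a :: "real \<Rightarrow> 'x"
  unfolding src_def
  by (intro continuous_intros continuous_on_N bounded_bilinear.continuous_on[OF K_bilinear])

lemma K_diff_right: "K w (x - y) = K w x - K w y"
  by (rule bounded_bilinear.diff_right[OF K_bilinear])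

text \<open>The source of all existence statements: truncate the nonlinearity outside the ball of
  radius \<open>R + 1\<close>, solve globally, compare with \<open>b\<close> by Gronwall. The
  exponent contains the integral of \<open>norm (u \<tau>)\<close> instead of its maximum, so it
  stays bounded for a pulse of size \<open>1/\<delta>\<close> and duration
  \<open>\<delta>\<close>.\<close>

lemma shadowing:
  assumes T: "0 \<le> T" and u: "continuous_on {0..T} u" and b: "continuous_on {0..T} b"
    and R: "0 \<le> R" "\<And>t. t \<in> {0..T} \<Longrightarrow> norm (b t) \<le> R"
    and L: "0 \<le> L" "\<And>x y. norm x \<le> R + 1 \<Longrightarrow> norm y \<le> R + 1 \<Longrightarrow> norm (N x - N y) \<le> L * norm (x - y)"
    and res: "\<And>t. t \<in> {0..T} \<Longrightarrow> norm (b t - (S t x0 + duhamel (\<lambda>\<tau>. src (u \<tau>) (b \<tau>)) t)) \<le> e"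
    and e: "0 \<le> e" "e * exp (integral {0..T} (\<lambda>\<tau>. \<bar>V\<bar> + 2 * L + CK * norm (u \<tau>))) \<le> 1"
  shows "\<exists>a. sol u T x0 a \<and> (\<forall>t\<in>{0..T}. norm (a t - b t) \<le> e * exp (integral {0..T} (\<lambda>\<tau>. \<bar>V\<bar> + 2 * L + CK * norm (u \<tau>))))"
proof -
  let ?k = "\<lambda>\<tau>. \<bar>V\<bar> + 2 * L + CK * norm (u \<tau>)"
  \<comment> \<open>Composition with the radial retraction doubles the Lipschitz constant; hence the
    \<open>2 * L\<close> in the exponent.\<close>
  define N' where "N' x = N (radial (R + 1) x)" for x
  define F where "F \<tau> x = V *\<^sub>R x - N' x + K (u \<tau>) x" for \<tau> x
  have R1: "0 < R + 1" "0 \<le> R + 1" using R by auto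
  have N': "norm (N' x - N' y) \<le> 2 * L * norm (x - y)" for x y
  proof -
    have "norm (N' x - N' y) \<le> L * norm (radial (R + 1) x - radial (R + 1) y)"
      unfolding N'_def by (intro L(2) norm_radial_le R1)
    also have "\<dots> \<le> L * (2 * norm (x - y))" by (intro mult_left_mono radial_lipschitz R1 L)
    finally show ?thesis by simp
  qed
  have Flip: "norm (F \<tau> x - F \<tau> y) \<le> ?k \<tau> * norm (x - y)" for \<tau> x y
  proof -
    have "F \<tau> x - F \<tau> y = V *\<^sub>R (x - y) - (N' x - N' y) + K (u \<tau>) (x - y)"
      by (simp add: F_def K_diff_right scaleR_diff_right algebra_simps)
    also have "norm \<dots> \<le> norm (V *\<^sub>R (x - y)) + norm (N' x - N' y) + norm (K (u \<tau>) (x - y))"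
      by (meson add_mono norm_triangle_ineq norm_triangle_ineq4 order_refl order_trans)
    also have "\<dots> \<le> \<bar>V\<bar> * norm (x - y) + 2 * L * norm (x - y) + CK * norm (u \<tau>) * norm (x - y)"
      by (intro add_mono N' CK) simp
    finally show ?thesis by (simp add: algebra_simps)
  qed
  have N'c: "continuous_on A (\<lambda>t. N' (a t))" if "continuous_on A a" for A and a :: "real \<Rightarrow> 'x"
  proof -
    have "continuous_on UNIV (\<lambda>x. radial (R + 1) x :: 'x)"
      by (rule lipschitz_on_continuous_on[of 2]) (auto simp: lipschitz_on_def dist_norm radial_lipschitz R1)
    then have "continuous_on A (\<lambda>t. radial (R + 1) (a t))" using that by (rule continuous_on_compose2) simp
    then show ?thesis unfolding N'_def by (rule continuous_on_N)
  qed
  have Fc: "continuous_on {0..T} (\<lambda>t. F t (a t))" if "continuous_on {0..T} a" for a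
    unfolding F_def by (intro continuous_intros N'c that bounded_bilinear.continuous_on[OF K_bilinear] u)
  have "bounded (u ` {0..T})" by (intro compact_imp_bounded compact_continuous_image u) simp
  then obtain U where "\<forall>x\<in>u ` {0..T}. norm x \<le> U" unfolding bounded_iff by blast
  then have U: "\<And>\<tau>. \<tau> \<in> {0..T} \<Longrightarrow> norm (u \<tau>) \<le> U" by auto
  have U0: "0 \<le> U" using order_trans[OF norm_ge_zero U[of 0]] T by simp
  have "\<exists>a. continuous_on {0..T} a \<and> (\<forall>t\<in>{0..T}. a t = S t x0 + duhamel (\<lambda>\<tau>. F \<tau> (a \<tau>)) t)"
  proof (rule global_solution[OF T Fc, where L = "\<bar>V\<bar> + 2 * L + CK * U + 1"])
    show "norm (F t x - F t y) \<le> (\<bar>V\<bar> + 2 * L + CK * U + 1) * norm (x - y)" if "t \<in> {0..T}" for t x y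
    proof -
      have "?k t \<le> \<bar>V\<bar> + 2 * L + CK * U + 1"
        using mult_left_mono[OF U[OF that] CK(1)] by simp
      then show ?thesis using Flip[of t x y] mult_right_mono[of "?k t" "\<bar>V\<bar> + 2 * L + CK * U + 1" "norm (x - y)"] by simp
    qed
    show "0 < \<bar>V\<bar> + 2 * L + CK * U + 1" using L(1) CK(1) U0 by (intro add_nonneg_pos add_nonneg_nonneg) auto
  qed
  then obtain a where a: "continuous_on {0..T} a" "\<And>t. t \<in> {0..T} \<Longrightarrow> a t = S t x0 + duhamel (\<lambda>\<tau>. F \<tau> (a \<tau>)) t" by blast
  have kc: "continuous_on {0..T} ?k" by (intro continuous_intros u)
  have est: "norm (a t - b t) \<le> e * exp (integral {0..T} ?k)" if t: "t \<in> {0..T}" for t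
  proof (rule gronwall_integral[where g = "\<lambda>t. norm (a t - b t)", OF T _ kc _ e(1) _ t])
    show "continuous_on {0..T} (\<lambda>t. norm (a t - b t))" by (intro continuous_intros a b)
    show "0 \<le> ?k \<tau>" for \<tau> using L CK by simp
    fix t assume t: "t \<in> {0..T}"
    then have sub: "{0..t} \<subseteq> {0..T}" by auto
    have bb: "duhamel (\<lambda>\<tau>. src (u \<tau>) (b \<tau>)) t = duhamel (\<lambda>\<tau>. F \<tau> (b \<tau>)) t"
      unfolding duhamel_def
    proof (rule Henstock_Kurzweil_Integration.integral_cong)
      fix \<tau> assume "\<tau> \<in> {0..t}"
      then have "norm (b \<tau>) \<le> R + 1" using R(2)[of \<tau>] sub by auto
      then show "S (t - \<tau>) (src (u \<tau>) (b \<tau>)) = S (t - \<tau>) (F \<tau> (b \<tau>))"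
        by (simp add: src_def F_def N'_def radial_id)
    qed
    have c: "continuous_on {0..t} (\<lambda>\<tau>. F \<tau> (a \<tau>))" "continuous_on {0..t} (\<lambda>\<tau>. F \<tau> (b \<tau>))"
      by (rule continuous_on_subset[OF Fc sub], rule a b)+
    have "a t - b t = duhamel (\<lambda>\<tau>. F \<tau> (a \<tau>) - F \<tau> (b \<tau>)) t - (b t - (S t x0 + duhamel (\<lambda>\<tau>. src (u \<tau>) (b \<tau>)) t))"
      unfolding duhamel_diff[OF c, symmetric] bb a(2)[OF t] by simp
    also have "norm \<dots> \<le> norm (duhamel (\<lambda>\<tau>. F \<tau> (a \<tau>) - F \<tau> (b \<tau>)) t) + e"
      using res[OF t] by (meson add_left_mono norm_triangle_ineq4 order_trans)
    also have "norm (duhamel (\<lambda>\<tau>. F \<tau> (a \<tau>) - F \<tau> (b \<tau>)) t) \<le> integral {0..t} (\<lambda>\<tau>. ?k \<tau> * norm (a \<tau> - b \<tau>))"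
      by (rule norm_duhamel_le)
        (intro continuous_on_diff c continuous_on_subset[OF _ sub] continuous_intros kc a b u Flip)+
    finally show "norm (a t - b t) \<le> e + integral {0..t} (\<lambda>\<tau>. ?k \<tau> * norm (a \<tau> - b \<tau>))" by simp
  qed
  \<comment> \<open>The smallness condition on \<open>e\<close> keeps \<open>a\<close> within
    distance one of \<open>b\<close>, hence in the ball where truncation changes nothing:
    \<open>a\<close> solves the original equation.\<close>
  have aR: "norm (a t) \<le> R + 1" if t: "t \<in> {0..T}" for t
  proof -
    have "norm (a t) \<le> norm (a t - b t) + norm (b t)" using norm_triangle_ineq[of "a t - b t" "b t"] by simp
    then show ?thesis using est[OF t] e(2) R(2)[OF t] by linarith
  qed
  have "sol u T x0 a"
    unfolding sol_def
  proof (intro conjI ballI a(1))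
    fix t assume t: "t \<in> {0..T}"
    have "duhamel (\<lambda>\<tau>. src (u \<tau>) (a \<tau>)) t = duhamel (\<lambda>\<tau>. F \<tau> (a \<tau>)) t"
      unfolding duhamel_def
    proof (rule Henstock_Kurzweil_Integration.integral_cong)
      fix \<tau> assume "\<tau> \<in> {0..t}"
      then have "norm (a \<tau>) \<le> R + 1" using aR[of \<tau>] t by auto
      then show "S (t - \<tau>) (src (u \<tau>) (a \<tau>)) = S (t - \<tau>) (F \<tau> (a \<tau>))"
        by (simp add: src_def F_def N'_def radial_id)
    qed
    then show "a t = S t x0 + duhamel (\<lambda>\<tau>. src (u \<tau>) (a \<tau>)) t" using a(2)[OF t] by simp
  qed
  with est show ?thesis by blast
qed

lemma sol_unique:
  assumes u: "continuous_on {0..T} u" and a: "sol u T x0 a" and b: "sol u T x0 b" and t: "t \<in> {0..T}"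
  shows "a t = b t"
proof -
  have T: "0 \<le> T" using t by auto
  have ac: "continuous_on {0..T} a" "continuous_on {0..T} b" using a b by (auto simp: sol_def)
  have "compact (a ` {0..T} \<union> b ` {0..T})" by (intro compact_Un compact_continuous_image ac) auto
  then have "bounded (a ` {0..T} \<union> b ` {0..T})" by (rule compact_imp_bounded)
  then obtain R where "\<forall>x\<in>a ` {0..T} \<union> b ` {0..T}. norm x \<le> R" unfolding bounded_iff by blast
  then have R: "\<And>\<tau>. \<tau> \<in> {0..T} \<Longrightarrow> norm (a \<tau>) \<le> R" "\<And>\<tau>. \<tau> \<in> {0..T} \<Longrightarrow> norm (b \<tau>) \<le> R" by auto
  obtain L where L: "L \<ge> 0" "\<And>x y. norm x \<le> R \<Longrightarrow> norm y \<le> R \<Longrightarrow> norm (N x - N y) \<le> L * norm (x - y)"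
    using N_lip[of R] by blast
  let ?k = "\<lambda>\<tau>. \<bar>V\<bar> + L + CK * norm (u \<tau>)"
  have kc: "continuous_on {0..T} ?k" by (intro continuous_intros u)
  have "norm (a t - b t) \<le> 0 * exp (integral {0..T} ?k)"
  proof (rule gronwall_integral[where g = "\<lambda>t. norm (a t - b t)", OF T _ kc _ _ _ t])
    show "continuous_on {0..T} (\<lambda>t. norm (a t - b t))" by (intro continuous_intros ac)
    show "0 \<le> ?k \<tau>" for \<tau> using L CK by simp
    fix t assume t: "t \<in> {0..T}"
    then have sub: "{0..t} \<subseteq> {0..T}" by auto
    note us = continuous_on_subset[OF u sub] and as = continuous_on_subset[OF ac(1) sub] and bs = continuous_on_subset[OF ac(2) sub]
    have "a t - b t = duhamel (\<lambda>\<tau>. src (u \<tau>) (a \<tau>) - src (u \<tau>) (b \<tau>)) t"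
      using a b t duhamel_diff[OF continuous_on_src[OF us as] continuous_on_src[OF us bs]]
      by (simp add: sol_def)
    also have "norm \<dots> \<le> integral {0..t} (\<lambda>\<tau>. ?k \<tau> * norm (a \<tau> - b \<tau>))"
    proof (rule norm_duhamel_le)
      show "continuous_on {0..t} (\<lambda>\<tau>. src (u \<tau>) (a \<tau>) - src (u \<tau>) (b \<tau>))"
        by (intro continuous_on_diff continuous_on_src us as bs)
      show "continuous_on {0..t} (\<lambda>\<tau>. ?k \<tau> * norm (a \<tau> - b \<tau>))"
        by (intro continuous_intros us as bs)
      fix \<tau> assume "\<tau> \<in> {0..t}"
      then have \<tau>: "\<tau> \<in> {0..T}" using sub by auto
      have "src (u \<tau>) (a \<tau>) - src (u \<tau>) (b \<tau>) = V *\<^sub>R (a \<tau> - b \<tau>) - (N (a \<tau>) - N (b \<tau>)) + K (u \<tau>) (a \<tau> - b \<tau>)"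
        by (simp add: src_def K_diff_right scaleR_diff_right algebra_simps)
      also have "norm \<dots> \<le> norm (V *\<^sub>R (a \<tau> - b \<tau>)) + norm (N (a \<tau>) - N (b \<tau>)) + norm (K (u \<tau>) (a \<tau> - b \<tau>))"
        by (meson add_mono norm_triangle_ineq norm_triangle_ineq4 order_refl order_trans)
      also have "\<dots> \<le> \<bar>V\<bar> * norm (a \<tau> - b \<tau>) + L * norm (a \<tau> - b \<tau>) + CK * norm (u \<tau>) * norm (a \<tau> - b \<tau>)"
        by (intro add_mono L CK R \<tau>) simp
      finally show "norm (src (u \<tau>) (a \<tau>) - src (u \<tau>) (b \<tau>)) \<le> ?k \<tau> * norm (a \<tau> - b \<tau>)" by (simp add: algebra_simps)
    qed
    finally show "norm (a t - b t) \<le> 0 + integral {0..t} (\<lambda>\<tau>. ?k \<tau> * norm (a \<tau> - b \<tau>))" by simp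
  qed simp
  then show ?thesis by simp
qed

lemma duhamel_split:
  assumes h: "continuous_on {0..T1 + t} h" and T1: "0 \<le> T1" and t: "0 \<le> t"
  shows "duhamel h (T1 + t) = S t (duhamel h T1) + duhamel (\<lambda>\<tau>. h (T1 + \<tau>)) t"
proof -
  let ?f = "\<lambda>\<tau>. S (T1 + t - \<tau>) (h \<tau>)"
  have i: "?f integrable_on {0..T1 + t}" by (rule duhamel_integrable[OF h])
  have h1: "continuous_on {0..T1} h" by (rule continuous_on_subset[OF h]) (use t in auto)
  have "duhamel h (T1 + t) = integral {0..T1} ?f + integral {T1..T1 + t} ?f"
    unfolding duhamel_def by (rule Henstock_Kurzweil_Integration.integral_combine[symmetric]) (use T1 t i in auto)
  also have "integral {0..T1} ?f = integral {0..T1} (S t \<circ> (\<lambda>\<tau>. S (T1 - \<tau>) (h \<tau>)))"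
  proof (rule Henstock_Kurzweil_Integration.integral_cong)
    fix \<tau> assume "\<tau> \<in> {0..T1}"
    then show "?f \<tau> = (S t \<circ> (\<lambda>\<tau>. S (T1 - \<tau>) (h \<tau>))) \<tau>"
      using t S_add[of t "T1 - \<tau>" "h \<tau>"] by (simp add: algebra_simps)
  qed
  also have "\<dots> = S t (duhamel h T1)"
    unfolding duhamel_def by (rule integral_linear[OF duhamel_integrable[OF h1] S_linear])
  also have "integral {T1..T1 + t} ?f = duhamel (\<lambda>\<tau>. h (T1 + \<tau>)) t"
    using integral_shift_Icc_real[of 0 t ?f T1] by (simp add: duhamel_def o_def add.commute)
  finally show ?thesis .
qed

lemma sol_concat:
  assumes T: "0 \<le> T1" "0 \<le> T2" and u1: "flat_control T1 u1" and u2: "flat_control T2 u2"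
    and a1: "sol u1 T1 x0 a1" and a2: "sol u2 T2 (a1 T1) a2"
  shows "\<exists>a. sol (\<lambda>t. u1 t + u2 (t - T1)) (T1 + T2) x0 a \<and> a (T1 + T2) = a2 T2"
proof -
  let ?u = "\<lambda>t. u1 t + u2 (t - T1)"
  define a where "a t = (if t \<le> T1 then a1 t else a2 (t - T1))" for t
  have c1: "continuous_on {0..T1} a1" and c2: "continuous_on {0..T2} a2" using a1 a2 by (auto simp: sol_def)
  have a20: "a2 0 = a1 T1" using a2 T by (auto simp: sol_def S_0 duhamel_def)
  have uc: "continuous_on A ?u" for A
    using u1 u2 unfolding flat_control_def by (intro smooth_fun_continuous smooth_fun_add_shift) auto
  have ac: "continuous_on {0..T1 + T2} a"
  proof -
    have "continuous_on ({0..T1} \<union> {T1..T1 + T2}) a"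
      unfolding a_def
    proof (rule continuous_on_If)
      show "continuous_on {T1..T1 + T2} (\<lambda>t. a2 (t - T1))"
        by (rule continuous_on_compose2[OF c2]) (auto intro!: continuous_intros)
    qed (use c1 a20 in auto)
    moreover have "{0..T1} \<union> {T1..T1 + T2} = {0..T1 + T2}" using T by auto
    ultimately show ?thesis by simp
  qed
  \<comment> \<open>Flatness includes the end points, so at the junction both controls vanish and
    the identities hold on closed intervals.\<close>
  have src1: "src (?u \<tau>) (a \<tau>) = src (u1 \<tau>) (a1 \<tau>)" if "\<tau> \<le> T1" for \<tau>
    using that u2 by (simp add: flat_control_def a_def)
  have src2: "src (?u (T1 + \<tau>)) (a (T1 + \<tau>)) = src (u2 \<tau>) (a2 \<tau>)" if "0 \<le> \<tau>" for \<tau>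
    using that u1 a20 by (auto simp: flat_control_def a_def)
  have eq1: "a t = S t x0 + duhamel (\<lambda>\<tau>. src (?u \<tau>) (a \<tau>)) t" if t: "t \<in> {0..T1}" for t
  proof -
    have "duhamel (\<lambda>\<tau>. src (?u \<tau>) (a \<tau>)) t = duhamel (\<lambda>\<tau>. src (u1 \<tau>) (a1 \<tau>)) t"
      unfolding duhamel_def using t by (intro Henstock_Kurzweil_Integration.integral_cong) (simp add: src1)
    then show ?thesis using a1 t by (simp add: sol_def a_def)
  qed
  have eq2: "a (T1 + t) = S (T1 + t) x0 + duhamel (\<lambda>\<tau>. src (?u \<tau>) (a \<tau>)) (T1 + t)" if t: "t \<in> {0..T2}" for t
  proof -
    have h: "continuous_on {0..T1 + t} (\<lambda>\<tau>. src (?u \<tau>) (a \<tau>))"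
      using t T by (intro continuous_on_src uc continuous_on_subset[OF ac]) auto
    have "duhamel (\<lambda>\<tau>. src (?u (T1 + \<tau>)) (a (T1 + \<tau>))) t = duhamel (\<lambda>\<tau>. src (u2 \<tau>) (a2 \<tau>)) t"
      unfolding duhamel_def using src2 by (intro Henstock_Kurzweil_Integration.integral_cong) simp
    then have "S (T1 + t) x0 + duhamel (\<lambda>\<tau>. src (?u \<tau>) (a \<tau>)) (T1 + t)
        = S t (S T1 x0 + duhamel (\<lambda>\<tau>. src (?u \<tau>) (a \<tau>)) T1) + duhamel (\<lambda>\<tau>. src (u2 \<tau>) (a2 \<tau>)) t"
      using t T S_add[of t T1 x0] by (subst duhamel_split[OF h]) (auto simp: S_plus add.commute)
    also have "S T1 x0 + duhamel (\<lambda>\<tau>. src (?u \<tau>) (a \<tau>)) T1 = a1 T1"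
      using eq1[of T1] T by (simp add: a_def)
    also have "S t (a1 T1) + duhamel (\<lambda>\<tau>. src (u2 \<tau>) (a2 \<tau>)) t = a2 t"
      using a2 t by (simp add: sol_def)
    also have "a2 t = a (T1 + t)" using t a20 by (auto simp: a_def)
    finally show ?thesis by simp
  qed
  have "sol ?u (T1 + T2) x0 a"
    unfolding sol_def
  proof (intro conjI ballI ac)
    fix t assume t: "t \<in> {0..T1 + T2}"
    show "a t = S t x0 + duhamel (\<lambda>\<tau>. src (?u \<tau>) (a \<tau>)) t"
    proof (cases "t \<le> T1")
      case False
      then show ?thesis using eq2[of "t - T1"] t by simp
    qed (use eq1[of t] t in auto)
  qed
  moreover have "a (T1 + T2) = a2 T2" using T a20 by (auto simp: a_def)
  ultimately show ?thesis by blast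
qed

text \<open>Shadowing of the linear flow \<open>exp (V t) S t x\<close>. Its residual is the Duhamel
  integral of the nonlinearity alone and so of order \<open>p\<close> in the size of the state,
  uniformly for times up to one.\<close>

lemma free_evolution:
  assumes p: "0 < p" and grow: "0 \<le> C" "\<And>x. norm (N x) \<le> C * norm x ^ p"
  shows "\<exists>M r. 0 < r \<and> (\<forall>x T. norm x \<le> r \<longrightarrow> 0 \<le> T \<longrightarrow> T \<le> 1 \<longrightarrow>
    (\<exists>a. sol (\<lambda>_. 0) T x a \<and> norm (a T - exp (V * T) *\<^sub>R S T x) \<le> M * norm x ^ p))"
proof -
  define R where "R = exp \<bar>V\<bar>"
  obtain L where L: "0 \<le> L" "\<And>x y. norm x \<le> R + 1 \<Longrightarrow> norm y \<le> R + 1 \<Longrightarrow> norm (N x - N y) \<le> L * norm (x - y)"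
    using N_lip[of "R + 1"] by blast
  define E where "E = exp (\<bar>V\<bar> + 2 * L)"
  define M where "M = C * R ^ p * E"
  have M0: "M \<ge> 0" using grow by (simp add: M_def R_def E_def)
  \<comment> \<open>For \<open>norm x <= r\<close> the final error \<open>M * norm x ^ p\<close> is
    at most \<open>M * r <= 1\<close>, the smallness that shadowing requires.\<close>
  define r where "r = min 1 (1 / (M + 1))"
  have r: "0 < r" "r \<le> 1" using M0 by (auto simp: r_def)
  have Mr: "M * r \<le> 1"
  proof -
    have "M * r \<le> M * (1 / (M + 1))" using M0 by (intro mult_left_mono) (auto simp: r_def)
    also have "\<dots> \<le> 1" using M0 by (simp add: divide_le_eq)
    finally show ?thesis .
  qed
  have "\<exists>a. sol (\<lambda>_. 0) T x a \<and> norm (a T - exp (V * T) *\<^sub>R S T x) \<le> M * norm x ^ p"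
    if x: "norm x \<le> r" and T: "0 \<le> T" "T \<le> 1" for x T
  proof -
    define b where "b t = exp (V * t) *\<^sub>R S t x" for t
    have bc: "continuous_on A b" for A
      unfolding b_def by (intro continuous_intros continuous_on_S)
    have eR: "exp (V * t) \<le> R" if "t \<in> {0..T}" for t
    proof -
      have "V * t \<le> \<bar>V\<bar> * t" using that by (intro mult_right_mono) auto
      also have "\<dots> \<le> \<bar>V\<bar> * 1" using that T by (intro mult_left_mono) auto
      finally show ?thesis by (simp add: R_def)
    qed
    have bR: "norm (b t) \<le> R * norm x" if "t \<in> {0..T}" for t
    proof -
      have "exp (V * t) * norm (S t x) \<le> R * norm x"
        using eR[OF that] S_norm[of t x] by (intro mult_mono) (auto simp: R_def)
      then show ?thesis by (simp add: b_def)
    qed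
    have R0: "R \<ge> 0" by (simp add: R_def)
    have bR1: "norm (b t) \<le> R" if "t \<in> {0..T}" for t
    proof -
      have "R * norm x \<le> R * 1" using x r R0 by (intro mult_left_mono) auto
      then show ?thesis using bR[OF that] by simp
    qed
    have K0: "K 0 y = 0" for y by (rule bounded_bilinear.zero_left[OF K_bilinear])
    \<comment> \<open>By the semigroup law the integrand is \<open>V * exp (V * \<tau>)\<close>
      times the fixed vector \<open>S t x\<close>, so the integral is explicit.\<close>
    have lin: "duhamel (\<lambda>\<tau>. V *\<^sub>R b \<tau>) t = b t - S t x" if t: "t \<in> {0..T}" for t
    proof -
      have "((\<lambda>\<tau>. (V * exp (V * \<tau>)) *\<^sub>R S t x) has_integral (exp (V * t) *\<^sub>R S t x - exp (V * 0) *\<^sub>R S t x)) {0..t}"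
      proof (rule fundamental_theorem_of_calculus[where f = "\<lambda>\<tau>. exp (V * \<tau>) *\<^sub>R S t x"])
        show "((\<lambda>\<tau>. exp (V * \<tau>) *\<^sub>R S t x) has_vector_derivative (V * exp (V * \<tau>)) *\<^sub>R S t x) (at \<tau> within {0..t})" for \<tau>
        proof (rule bounded_linear.has_vector_derivative[OF bounded_linear_scaleR_left])
          show "((\<lambda>\<tau>. exp (V * \<tau>)) has_vector_derivative V * exp (V * \<tau>)) (at \<tau> within {0..t})"
            by (auto intro!: derivative_eq_intros simp flip: has_real_derivative_iff_has_vector_derivative)
        qed
      qed (use t in auto)
      moreover have "duhamel (\<lambda>\<tau>. V *\<^sub>R b \<tau>) t = integral {0..t} (\<lambda>\<tau>. (V * exp (V * \<tau>)) *\<^sub>R S t x)"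
        unfolding duhamel_def
      proof (rule Henstock_Kurzweil_Integration.integral_cong)
        fix \<tau> assume "\<tau> \<in> {0..t}"
        then show "S (t - \<tau>) (V *\<^sub>R b \<tau>) = (V * exp (V * \<tau>)) *\<^sub>R S t x"
          using S_add[of "t - \<tau>" \<tau> x] by (simp add: b_def S_scaleR)
      qed
      ultimately show ?thesis by (simp add: b_def integral_unique)
    qed
    define e where "e = C * (R * norm x) ^ p"
    have e0: "e \<ge> 0" using grow R0 by (simp add: e_def)
    have res: "norm (b t - (S t x + duhamel (\<lambda>\<tau>. src ((\<lambda>_. 0) \<tau>) (b \<tau>)) t)) \<le> e" if t: "t \<in> {0..T}" for t
    proof -
      have "duhamel (\<lambda>\<tau>. V *\<^sub>R b \<tau>) t - duhamel (\<lambda>\<tau>. N (b \<tau>)) t = duhamel (\<lambda>\<tau>. src 0 (b \<tau>)) t"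
        unfolding src_def K0 add_0_right
        by (rule duhamel_diff) (intro continuous_intros continuous_on_N bc)+
      then have "b t - (S t x + duhamel (\<lambda>\<tau>. src 0 (b \<tau>)) t) = duhamel (\<lambda>\<tau>. N (b \<tau>)) t"
        unfolding lin[OF t] by (simp add: algebra_simps)
      also have "norm \<dots> \<le> integral {0..t} (\<lambda>_. e)"
      proof (rule norm_duhamel_le)
        show "norm (N (b \<tau>)) \<le> e" if "\<tau> \<in> {0..t}" for \<tau>
        proof -
          have "norm (b \<tau>) ^ p \<le> (R * norm x) ^ p" using bR[of \<tau>] that t by (intro power_mono) auto
          then show ?thesis unfolding e_def using grow by (meson mult_left_mono order_trans)
        qed
      qed (intro continuous_intros continuous_on_N bc)+
      also have "\<dots> \<le> e" using t T e0 mult_right_mono[of t 1 e] by simp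
      finally show ?thesis .
    qed
    have I: "exp (integral {0..T} (\<lambda>\<tau>. \<bar>V\<bar> + 2 * L + CK * norm ((\<lambda>_. 0 :: 'u) \<tau>))) \<le> E"
    proof -
      have "T * (\<bar>V\<bar> + 2 * L) \<le> 1 * (\<bar>V\<bar> + 2 * L)" using T L by (intro mult_right_mono) auto
      then show ?thesis using T by (simp add: E_def)
    qed
    have eM: "e * E = M * norm x ^ p" by (simp add: e_def M_def power_mult_distrib)
    have "M * norm x ^ p \<le> M * r"
    proof (intro mult_left_mono M0)
      have "norm x ^ p \<le> r ^ p" using x by (intro power_mono) auto
      also have "\<dots> \<le> r" using r p power_decreasing[of 1 p r] by simp
      finally show "norm x ^ p \<le> r" .
    qed
    then have le1: "e * E \<le> 1" using eM Mr by linarith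
    have eI: "e * exp (integral {0..T} (\<lambda>\<tau>. \<bar>V\<bar> + 2 * L + CK * norm ((\<lambda>_. 0 :: 'u) \<tau>))) \<le> e * E"
      by (rule mult_left_mono[OF I e0])
    have "\<exists>a. sol (\<lambda>_. 0) T x a \<and> (\<forall>t\<in>{0..T}. norm (a t - b t) \<le> e * exp (integral {0..T} (\<lambda>\<tau>. \<bar>V\<bar> + 2 * L + CK * norm ((\<lambda>_. 0 :: 'u) \<tau>))))"
      by (rule shadowing[OF T(1) continuous_on_const bc R0 bR1 L res e0 order_trans[OF eI le1]])
    then obtain a where "sol (\<lambda>_. 0) T x a" "norm (a T - b T) \<le> e * E" using T eI by force
    then show ?thesis unfolding eM b_def by blast
  qed
  with r(1) show ?thesis by blast
qed

text \<open>The control is a pulse of size \<open>1/\<delta>\<close> and duration \<open>\<delta>\<close>: for small \<open>\<delta>\<close> the other terms do not matter.\<close>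

lemma control_pulse:
  assumes G: "G 0 = x0" "\<And>h. (G has_vector_derivative K c (G h)) (at h)"
    and e: "0 < e" and T0: "0 < T0"
  shows "\<exists>T u a. 0 < T \<and> T < T0 \<and> flat_control T u \<and> sol u T x0 a \<and> norm (a T - G 1) < e"
proof -
  obtain \<beta> :: "real \<Rightarrow> real" where \<beta>: "flat_control 1 \<beta>" "\<And>t. 0 \<le> \<beta> t" "integral {0..1} \<beta> = 1"
    using unit_bump by blast
  have \<beta>s: "smooth_fun \<beta>" and \<beta>0: "\<And>t. t \<notin> {0<..<1} \<Longrightarrow> \<beta> t = 0" using \<beta>(1) by (auto simp: flat_control_def)
  have Gc: "continuous_on A G" for A
    by (rule continuous_at_imp_continuous_on) (auto intro: has_vector_derivative_continuous G)
  have KGc: "continuous_on A (\<lambda>h. K c (G h))" for A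
    by (intro bounded_bilinear.continuous_on[OF K_bilinear] continuous_on_const Gc)
  have bnd: "\<exists>B\<ge>0. \<forall>h\<in>{0..1}. norm (f h) \<le> B" if "continuous_on {0..1} f" for f :: "real \<Rightarrow> 'x"
  proof -
    have "bounded (f ` {0..1})" by (intro compact_imp_bounded compact_continuous_image that) simp
    then obtain B where "\<forall>x\<in>f ` {0..1}. norm x \<le> B" unfolding bounded_iff by blast
    then show ?thesis by (intro exI[of _ "max B 0"]) auto
  qed
  obtain R where R: "0 \<le> R" "\<And>h. h \<in> {0..1} \<Longrightarrow> norm (G h) \<le> R" using bnd[OF Gc] by blast
  obtain W where W: "0 \<le> W" "\<And>h. h \<in> {0..1} \<Longrightarrow> norm (V *\<^sub>R G h - N (G h)) \<le> W"
  proof -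
    have "continuous_on {0..1} (\<lambda>h. V *\<^sub>R G h - N (G h))"
      by (intro continuous_intros continuous_on_N Gc)
    from bnd[OF this] show ?thesis using that by blast
  qed
  obtain L where L: "0 \<le> L" "\<And>x y. norm x \<le> R + 1 \<Longrightarrow> norm y \<le> R + 1 \<Longrightarrow> norm (N x - N y) \<le> L * norm (x - y)"
    using N_lip[of "R + 1"] by blast
  define E where "E = exp (\<bar>V\<bar> + 2 * L + CK * norm c)"
  have E0: "E > 0" by (simp add: E_def)
  \<comment> \<open>The residual will consist of three pieces of size \<open>m\<close>; after
    Gronwall their sum is \<open>min (e / 2) 1\<close>, which serves both the required accuracy and
    the smallness condition of shadowing.\<close>
  define m where "m = min (e / 2) 1 / (3 * E)"
  have m0: "m > 0" using e E0 by (simp add: m_def)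
  \<comment> \<open>Strong continuity of the semigroup becomes uniform along a compact
    curve.\<close>
  have unif: "\<exists>d>0. \<forall>t h. 0 \<le> t \<longrightarrow> t < d \<longrightarrow> h \<in> {0..1} \<longrightarrow> norm (S t (f h) - f h) \<le> m"
    if f: "continuous_on {0..1} f" for f :: "real \<Rightarrow> 'x"
  proof -
    have "continuous_on ({0..1} \<times> {0..1}) (\<lambda>z. S (fst z) (f (snd z)))"
      by (intro continuous_on_S continuous_intros continuous_on_compose2[OF f]) auto
    then have "uniformly_continuous_on ({0..1} \<times> {0..1}) (\<lambda>z. S (fst z) (f (snd z)))"
      by (rule compact_uniformly_continuous) (intro compact_Times compact_Icc)
    then obtain d where d: "d > 0" "\<And>z w. z \<in> {0..1} \<times> {0..1} \<Longrightarrow> w \<in> {0..1} \<times> {0..1} \<Longrightarrow> dist w z < d \<Longrightarrow>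
        dist (S (fst w) (f (snd w))) (S (fst z) (f (snd z))) < m"
      using m0 unfolding uniformly_continuous_on_def by meson
    have "norm (S t (f h) - f h) \<le> m" if "0 \<le> t" "t < min d 1" "h \<in> {0..1}" for t h
      using d(2)[of "(0, h)" "(t, h)"] that by (simp add: S_0 dist_norm dist_Pair_Pair)
    then show ?thesis using d(1) by (intro exI[of _ "min d 1"]) auto
  qed
  obtain d1 where d1: "d1 > 0" "\<And>t h. 0 \<le> t \<Longrightarrow> t < d1 \<Longrightarrow> h \<in> {0..1} \<Longrightarrow> norm (S t (G h) - G h) \<le> m"
    using unif[OF Gc] by blast
  obtain d2 where d2: "d2 > 0" "\<And>t h. 0 \<le> t \<Longrightarrow> t < d2 \<Longrightarrow> h \<in> {0..1} \<Longrightarrow> norm (S t (K c (G h)) - K c (G h)) \<le> m"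
    using unif[OF KGc] by blast
  \<comment> \<open>In turn: the semigroup barely moves the curve \<open>G\<close>, barely moves
    \<open>K c (G h)\<close>, the time limit is met, the exponent is bounded, and the remaining
    terms of the equation contribute at most \<open>m\<close>.\<close>
  define \<delta> where "\<delta> = Min {d1 / 2, d2 / 2, T0 / 2, 1, m / (W + 1)}"
  have W1: "0 < m / (W + 1)" using m0 W(1) by (intro divide_pos_pos) linarith+
  have "\<delta> \<le> d1 / 2" "\<delta> \<le> d2 / 2" "\<delta> \<le> T0 / 2" and \<delta>le: "\<delta> \<le> 1" "\<delta> \<le> m / (W + 1)"
    unfolding \<delta>_def by (rule Min_le; simp)+
  moreover have \<delta>0: "0 < \<delta>"
    unfolding \<delta>_def by (subst Min_gr_iff) (use d1(1) d2(1) T0 W1 in simp_all)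
  ultimately have "\<delta> < d1" "\<delta> < d2" "\<delta> < T0" by linarith+
  note \<delta> = \<delta>0 this \<delta>le
  have \<delta>W: "\<delta> * W \<le> m"
  proof -
    have "\<delta> * W \<le> m / (W + 1) * W" using \<delta> W by (intro mult_right_mono) auto
    also have "\<dots> \<le> m" using m0 W(1) by (simp add: field_simps)
    finally show ?thesis .
  qed
  define \<eta> where "\<eta> t = \<beta> (t * (1 / \<delta>)) * (1 / \<delta>)" for t
  define u where "u t = \<beta> (t * (1 / \<delta>)) *\<^sub>R ((1 / \<delta>) *\<^sub>R c)" for t
  have u\<eta>: "u t = \<eta> t *\<^sub>R c" for t by (simp add: u_def \<eta>_def)
  have us: "smooth_fun u" unfolding u_def by (rule smooth_fun_scaled[OF \<beta>s])
  have u_flat: "flat_control \<delta> u"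
    unfolding flat_control_def
  proof (intro conjI us allI impI)
    fix t assume "t \<notin> {0<..<\<delta>}"
    then have "t * (1 / \<delta>) \<notin> {0<..<1}" using \<delta>(1) by (auto simp: zero_less_divide_iff divide_less_eq)
    from \<beta>0[OF this] show "u t = 0" by (simp only: u_def scaleR_zero_left)
  qed
  have \<eta>c: "continuous_on A \<eta>" for A
    unfolding \<eta>_def by (intro continuous_intros continuous_on_compose2[OF smooth_fun_continuous[OF \<beta>s, of UNIV]]) auto
  have \<eta>0: "0 \<le> \<eta> t" for t using \<beta>(2) \<delta>(1) by (simp add: \<eta>_def)
  \<comment> \<open>\<open>H\<close> runs from \<open>0\<close> to \<open>1\<close> during the
    pulse, since the profile has unit mass: it is the time of the pure control equation.\<close>
  define H where "H t = integral {0..t} \<eta>" for t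
  have \<eta>i: "\<eta> integrable_on {a..b}" for a b by (rule integrable_continuous_real[OF \<eta>c])
  have H\<delta>: "H \<delta> = 1"
  proof -
    have "integral {0..\<delta>} (\<lambda>t. \<beta> (1 / \<delta> * t)) = \<delta> * integral {0..1} \<beta>"
      using integral_stretch_real[of "1 / \<delta>" 0 1 \<beta>] \<delta>(1) by (simp add: image_mult_atLeastAtMost_if')
    then show ?thesis using \<delta>(1) \<beta>(3) by (simp add: H_def \<eta>_def[abs_def] mult.commute)
  qed
  have H01: "H t \<in> {0..1}" if "t \<in> {0..\<delta>}" for t
  proof -
    have "H t \<le> H \<delta>" unfolding H_def using that \<eta>0 by (intro integral_subset_le \<eta>i) auto
    moreover have "0 \<le> H t" unfolding H_def by (intro integral_nonneg \<eta>i \<eta>0)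
    ultimately show ?thesis using H\<delta> by simp
  qed
  have Hd: "(H has_vector_derivative \<eta> t) (at t within {0..\<delta>})" if "t \<in> {0..\<delta>}" for t
    unfolding H_def by (rule integral_has_vector_derivative[OF \<eta>c that])
  \<comment> \<open>The reparametrised curve solves \<open>b' = K (u t) b\<close> exactly; all that
    it misses is the semigroup and the terms with \<open>V\<close> and \<open>N\<close>.\<close>
  define b where "b t = G (H t)" for t
  have bd: "(b has_vector_derivative K (u t) (b t)) (at t within {0..\<delta>})" if t: "t \<in> {0..\<delta>}" for t
  proof -
    have "(G \<circ> H has_vector_derivative \<eta> t *\<^sub>R K c (G (H t))) (at t within {0..\<delta>})"
      by (rule vector_diff_chain_within[OF Hd[OF t] has_vector_derivative_at_within[OF G(2)]])
    then show ?thesis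
      by (simp add: b_def[abs_def] o_def u\<eta> bounded_bilinear.scaleR_left[OF K_bilinear])
  qed
  have bc: "continuous_on {0..\<delta>} b"
    unfolding continuous_on_eq_continuous_within by (rule ballI) (rule has_vector_derivative_continuous[OF bd])
  have uc: "continuous_on A u" for A by (rule smooth_fun_continuous[OF us])
  have res: "norm (b t - (S t x0 + duhamel (\<lambda>\<tau>. src (u \<tau>) (b \<tau>)) t)) \<le> 3 * m" if t: "t \<in> {0..\<delta>}" for t
  proof -
    have sub: "{0..t} \<subseteq> {0..\<delta>}" using t by auto
    note bt = continuous_on_subset[OF bc sub]
    have Kc: "continuous_on {0..t} (\<lambda>\<tau>. K (u \<tau>) (b \<tau>))"
      by (intro bounded_bilinear.continuous_on[OF K_bilinear] uc bt)
    have VNc: "continuous_on {0..t} (\<lambda>\<tau>. V *\<^sub>R b \<tau> - N (b \<tau>))" by (intro continuous_intros continuous_on_N bt)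
    have "((\<lambda>\<tau>. K (u \<tau>) (b \<tau>)) has_integral (b t - b 0)) {0..t}"
      by (rule fundamental_theorem_of_calculus[where f = b])
        (use t sub in \<open>auto intro: has_vector_derivative_within_subset[OF bd]\<close>)
    then have bI: "b t = x0 + integral {0..t} (\<lambda>\<tau>. K (u \<tau>) (b \<tau>))"
      by (simp add: integral_unique b_def H_def G(1))
    have sp: "duhamel (\<lambda>\<tau>. src (u \<tau>) (b \<tau>)) t = duhamel (\<lambda>\<tau>. V *\<^sub>R b \<tau> - N (b \<tau>)) t + duhamel (\<lambda>\<tau>. K (u \<tau>) (b \<tau>)) t"
      unfolding duhamel_def src_def S_plus
      by (rule Henstock_Kurzweil_Integration.integral_add) (intro duhamel_integrable VNc Kc)+
    \<comment> \<open>The three pieces: the semigroup on the initial state, the semigroup on the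
      control term, and the terms with \<open>V\<close> and \<open>N\<close>.\<close>
    have eq: "b t - (S t x0 + duhamel (\<lambda>\<tau>. src (u \<tau>) (b \<tau>)) t)
        = (x0 - S t x0) + (integral {0..t} (\<lambda>\<tau>. K (u \<tau>) (b \<tau>)) - duhamel (\<lambda>\<tau>. K (u \<tau>) (b \<tau>)) t)
          - duhamel (\<lambda>\<tau>. V *\<^sub>R b \<tau> - N (b \<tau>)) t"
      unfolding bI sp by simp
    have n3: "norm (p + q - r) \<le> norm p + norm q + norm r" for p q r :: 'x
      by (meson add_mono norm_triangle_ineq norm_triangle_ineq4 order_refl order_trans)
    have b1: "norm (x0 - S t x0) \<le> m"
      using d1(2)[of t 0] t \<delta> by (simp add: G(1) norm_minus_commute)
    have b3: "norm (duhamel (\<lambda>\<tau>. V *\<^sub>R b \<tau> - N (b \<tau>)) t) \<le> m"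
    proof -
      have "norm (duhamel (\<lambda>\<tau>. V *\<^sub>R b \<tau> - N (b \<tau>)) t) \<le> integral {0..t} (\<lambda>_. W)"
        by (rule norm_duhamel_le[OF VNc]) (use W(2) H01 sub in \<open>auto simp: b_def\<close>)
      also have "\<dots> \<le> \<delta> * W" using t W by (simp add: mult_right_mono)
      finally show ?thesis using \<delta>W by linarith
    qed
    have b2: "norm (integral {0..t} (\<lambda>\<tau>. K (u \<tau>) (b \<tau>)) - duhamel (\<lambda>\<tau>. K (u \<tau>) (b \<tau>)) t) \<le> m"
    proof -
      have eq2: "integral {0..t} (\<lambda>\<tau>. K (u \<tau>) (b \<tau>)) - duhamel (\<lambda>\<tau>. K (u \<tau>) (b \<tau>)) t
          = integral {0..t} (\<lambda>\<tau>. K (u \<tau>) (b \<tau>) - S (t - \<tau>) (K (u \<tau>) (b \<tau>)))"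
        unfolding duhamel_def
        by (rule integral_diff[symmetric]) (intro integrable_continuous_real Kc duhamel_integrable)+
      have "norm (integral {0..t} (\<lambda>\<tau>. K (u \<tau>) (b \<tau>) - S (t - \<tau>) (K (u \<tau>) (b \<tau>)))) \<le> integral {0..t} (\<lambda>\<tau>. \<eta> \<tau> * m)"
      proof (rule Henstock_Kurzweil_Integration.integral_norm_bound_integral)
        show "(\<lambda>\<tau>. K (u \<tau>) (b \<tau>) - S (t - \<tau>) (K (u \<tau>) (b \<tau>))) integrable_on {0..t}"
          by (intro integrable_diff integrable_continuous_real Kc duhamel_integrable)
        show "(\<lambda>\<tau>. \<eta> \<tau> * m) integrable_on {0..t}" by (intro integrable_continuous_real continuous_intros \<eta>c)
        fix \<tau> assume \<tau>: "\<tau> \<in> {0..t}"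
        have "norm (S (t - \<tau>) (K c (b \<tau>)) - K c (b \<tau>)) \<le> m"
          unfolding b_def by (rule d2(2)) (use \<tau> t \<delta> H01[of \<tau>] in auto)
        moreover have "norm (K (u \<tau>) (b \<tau>) - S (t - \<tau>) (K (u \<tau>) (b \<tau>))) = \<eta> \<tau> * norm (S (t - \<tau>) (K c (b \<tau>)) - K c (b \<tau>))"
          using \<eta>0[of \<tau>] by (simp add: u\<eta> bounded_bilinear.scaleR_left[OF K_bilinear] S_scaleR norm_minus_commute flip: scaleR_diff_right)
        ultimately show "norm (K (u \<tau>) (b \<tau>) - S (t - \<tau>) (K (u \<tau>) (b \<tau>))) \<le> \<eta> \<tau> * m"
          using \<eta>0[of \<tau>] by (simp add: mult_left_mono)
      qed
      also have "\<dots> = H t * m" by (simp add: H_def)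
      also have "\<dots> \<le> 1 * m" using H01[OF t] m0 by (intro mult_right_mono) auto
      finally show ?thesis unfolding eq2 by simp
    qed
    show ?thesis unfolding eq using n3 b1 b2 b3 by (smt (verit))
  qed
  \<comment> \<open>Only the unit mass of the pulse enters, so \<open>E\<close> could be fixed
    before \<open>\<delta>\<close>.\<close>
  have I: "exp (integral {0..\<delta>} (\<lambda>\<tau>. \<bar>V\<bar> + 2 * L + CK * norm (u \<tau>))) \<le> E"
  proof -
    have "integral {0..\<delta>} (\<lambda>\<tau>. \<bar>V\<bar> + 2 * L + CK * norm (u \<tau>)) = integral {0..\<delta>} (\<lambda>\<tau>. (\<bar>V\<bar> + 2 * L) + (CK * norm c) * \<eta> \<tau>)"
      using \<eta>0 by (intro Henstock_Kurzweil_Integration.integral_cong) (simp add: u\<eta>)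
    also have "\<dots> = \<delta> * (\<bar>V\<bar> + 2 * L) + CK * norm c * H \<delta>"
      by (subst Henstock_Kurzweil_Integration.integral_add) (use \<delta>(1) in \<open>auto intro!: integrable_continuous_real continuous_intros \<eta>c simp: H_def\<close>)
    also have "\<dots> \<le> 1 * (\<bar>V\<bar> + 2 * L) + CK * norm c * 1"
      unfolding H\<delta> using \<delta> L by (intro add_mono mult_right_mono) auto
    finally show ?thesis by (simp add: E_def)
  qed
  have mE: "3 * m * E = min (e / 2) 1" using E0 by (simp add: m_def)
  have eI: "3 * m * exp (integral {0..\<delta>} (\<lambda>\<tau>. \<bar>V\<bar> + 2 * L + CK * norm (u \<tau>))) \<le> 3 * m * E"
    using m0 by (intro mult_left_mono I) auto
  have le1: "3 * m * exp (integral {0..\<delta>} (\<lambda>\<tau>. \<bar>V\<bar> + 2 * L + CK * norm (u \<tau>))) \<le> 1" using eI mE by linarith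
  have b_le: "norm (b t) \<le> R" if "t \<in> {0..\<delta>}" for t unfolding b_def by (rule R(2)[OF H01[OF that]])
  have "\<exists>a. sol u \<delta> x0 a \<and> (\<forall>t\<in>{0..\<delta>}. norm (a t - b t) \<le> 3 * m * exp (integral {0..\<delta>} (\<lambda>\<tau>. \<bar>V\<bar> + 2 * L + CK * norm (u \<tau>))))"
    by (rule shadowing[OF _ uc bc R(1) b_le L res _ le1]) (use \<delta> m0 in auto)
  then obtain a where a1: "sol u \<delta> x0 a"
    and a2: "\<forall>t\<in>{0..\<delta>}. norm (a t - b t) \<le> 3 * m * exp (integral {0..\<delta>} (\<lambda>\<tau>. \<bar>V\<bar> + 2 * L + CK * norm (u \<tau>)))"
    by blast
  have "\<delta> \<in> {0..\<delta>}" using \<delta>(1) by simp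
  from order_trans[OF bspec[OF a2 this] eI] a1
  have a: "sol u \<delta> x0 a" "norm (a \<delta> - b \<delta>) \<le> 3 * m * E" by auto
  have "norm (a \<delta> - G 1) < e" using a(2) mE e by (simp add: b_def H\<delta> min_def split: if_splits)
  then show ?thesis using a(1) u_flat \<delta> by blast
qed

end

section \<open>The conjugated heat flow\<close>

lemma eventually_ge_one_inverse: "\<forall>\<^sub>F l in at_top. C / l < (e::real)" if "0 < e"
proof -
  have "((\<lambda>l. C / l) \<longlongrightarrow> 0) at_top"
    by (rule tendsto_divide_0[OF tendsto_const]) (simp add: filterlim_at_top_imp_at_infinity filterlim_ident)
  then show ?thesis using that by (rule order_tendstoD(2))
qed

context sobolev_space
begin

text \<open>
  With \<open>w \<tau> = Exp (- \<lambda> A) \<cdot> heat (\<tau> / \<lambda>\<^sup>2) y\<close>, conjugation of the Laplacian turns \<open>w' = \<lambda>\<^sup>-\<^sup>2 (1 + i \<nu>) \<Delta>w + \<dots>\<close> into an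
  equation whose first-order part is absorbed by the dissipation, uniformly in \<open>\<lambda> \<ge> 1\<close>.
\<close>

lemma conjugated_identity:
  assumes "E1 = - (l *\<^sub>R mul A1 E)" "E2 = - (l *\<^sub>R mul A2 E) - l *\<^sub>R mul A1 E1"
    and "w = mul E y" "w1 = mul E1 y + mul E y1" "w2 = (mul E2 y + mul E1 y1) + (mul E1 y1 + mul E y2)"
  shows "mul E y2 = w2 + (2 * l) *\<^sub>R mul A1 w1 + l *\<^sub>R mul A2 w + l\<^sup>2 *\<^sub>R mul (mul A1 A1) w"
  unfolding assms by (rule ev_eqI) (simp add: ev_simps algebra_simps power2_eq_square)

lemma weighted_am_gm:
  fixes p q :: real
  assumes "0 \<le> a"
  shows "2 * a * (p * q) \<le> p\<^sup>2 + a\<^sup>2 * q\<^sup>2"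
  using zero_le_power2[of "p - a * q"] by (simp add: power2_diff power_mult_distrib mult_ac)

text \<open>An energy method for the difference of the conjugated flow and a solution of the limit
  equation \<open>v' = m v\<close>, with a constant independent of \<open>l\<close>. The second
  derivatives yield dissipation that absorbs the first-order term of size \<open>l\<close>; the
  failure of \<open>v\<close> to solve the conjugated equation costs only \<open>B / l\<close>.
  Taking \<open>v = 0\<close> yields stability, and a regular \<open>v\<close> yields the limit.
  Finite sums of modes keep all time derivatives in \<open>H^s\<close>.\<close>

lemma energy_estimate:
  fixes A :: "(int^'d) l2" and A1 A2 :: "'d \<Rightarrow> (int^'d) l2" and \<nu> :: real
  defines "c \<equiv> 1 + \<i> * complex_of_real \<nu>"
  defines "m \<equiv> mul (cst c) (\<Sum>j\<in>UNIV. mul (A1 j) (A1 j))"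
  assumes A: "\<And>j. has_partial j A (A1 j)" "\<And>j. has_partial j (A1 j) (A2 j)"
  obtains C where "0 \<le> C" and
    "\<And>l F y v v1 v2 B. 1 \<le> l \<Longrightarrow> finite F \<Longrightarrow> continuous_on {0..1} v \<Longrightarrow>
      (\<And>t. 0 < t \<Longrightarrow> t < 1 \<Longrightarrow> (v has_vector_derivative mul m (v t)) (at t)) \<Longrightarrow>
      (\<And>j t. has_partial j (v t) (v1 j t)) \<Longrightarrow> (\<And>j t. has_partial j (v1 j t) (v2 j t)) \<Longrightarrow>
      (\<And>t. 0 < t \<Longrightarrow> t < 1 \<Longrightarrow> norm (\<Sum>j\<in>UNIV. v2 j t) \<le> B) \<Longrightarrow>
      (\<And>t. 0 < t \<Longrightarrow> t < 1 \<Longrightarrow> norm (\<Sum>j\<in>UNIV. 2 *\<^sub>R mul (A1 j) (v1 j t) + mul (A2 j) (v t)) \<le> B) \<Longrightarrow>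
      (norm (mul (Exp (- (l *\<^sub>R A))) (heat \<nu> (1 / l\<^sup>2) (\<Sum>k\<in>F. mode k (y k))) - v 1))\<^sup>2
        \<le> C * ((norm (mul (Exp (- (l *\<^sub>R A))) (\<Sum>k\<in>F. mode k (y k)) - v 0))\<^sup>2 + (2 * cmod c * B / l)\<^sup>2)"
proof -
  \<comment> \<open>The summands come from absorbing the first-order term, from the term with
    \<open>A2\<close>, from the limit multiplier \<open>m\<close>, and from Young's inequality for
    the residual.\<close>
  define C0 where "C0 = (\<Sum>j\<in>UNIV. (cmod c * Kmul * norm (A1 j))\<^sup>2) + (\<Sum>j\<in>UNIV. cmod c * Kmul * norm (A2 j)) + Kmul * norm m + 1/2"
  have C0: "C0 \<ge> 0" unfolding C0_def
    by (intro add_nonneg_nonneg sum_nonneg mult_nonneg_nonneg) (auto simp: Kmul_nonneg)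
  show thesis
  proof (rule that[of "exp (2 * C0)"])
    show "0 \<le> exp (2 * C0)" by simp
    fix l :: real and F :: "(int^'d) set" and y :: "int^'d \<Rightarrow> complex" and v :: "real \<Rightarrow> (int^'d) l2"
      and v1 v2 :: "'d \<Rightarrow> real \<Rightarrow> (int^'d) l2" and B :: real
    assume l: "1 \<le> l" and F: "finite F" and vc: "continuous_on {0..1} v"
      and vd: "\<And>t. 0 < t \<Longrightarrow> t < 1 \<Longrightarrow> (v has_vector_derivative mul m (v t)) (at t)"
      and v1: "\<And>j t. has_partial j (v t) (v1 j t)" and v2: "\<And>j t. has_partial j (v1 j t) (v2 j t)"
      and B1: "\<And>t. 0 < t \<Longrightarrow> t < 1 \<Longrightarrow> norm (\<Sum>j\<in>UNIV. v2 j t) \<le> B"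
      and B2: "\<And>t. 0 < t \<Longrightarrow> t < 1 \<Longrightarrow> norm (\<Sum>j\<in>UNIV. 2 *\<^sub>R mul (A1 j) (v1 j t) + mul (A2 j) (v t)) \<le> B"
    have l0: "0 < l" "l \<noteq> 0" using l by auto
    \<comment> \<open>On this time scale the term with \<open>l^2\<close> and the squared gradient
      keeps coefficient one, while all other terms carry a negative power of \<open>l\<close> in
      front.\<close>
    define \<delta> where "\<delta> = 1 / l\<^sup>2"
    have \<delta>0: "\<delta> > 0" "\<delta> * l\<^sup>2 = 1" using l0 by (auto simp: \<delta>_def)
    define Y where "Y = (\<Sum>k\<in>F. mode k (y k))"
    define Y1 where "Y1 j = (\<Sum>k\<in>F. mode k (\<i> * of_int (k $ j) * y k))" for j
    define Y2 where "Y2 j = (\<Sum>k\<in>F. mode k (\<i> * of_int (k $ j) * (\<i> * of_int (k $ j) * y k)))" for j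
    have Yd: "has_partial j Y (Y1 j)" "has_partial j (Y1 j) (Y2 j)" for j
      unfolding Y_def Y1_def Y2_def by (intro has_partial_sum has_partial_mode)+
    define y0 where "y0 t = heat \<nu> (\<delta> * t) Y" for t
    define y1 where "y1 j t = heat \<nu> (\<delta> * t) (Y1 j)" for j t
    define y2 where "y2 j t = heat \<nu> (\<delta> * t) (Y2 j)" for j t
    have yD: "has_partial j (y0 t) (y1 j t)" "has_partial j (y1 j t) (y2 j t)" for j t
      unfolding y0_def y1_def y2_def by (intro has_partial_heat Yd)+
    have lap: "(\<Sum>j\<in>UNIV. mul (cst c) (Y2 j)) = (\<Sum>k\<in>F. mode k (- (c * complex_of_real ((norm (freq k))\<^sup>2)) * y k))"
    proof (rule coef_eqI)
      fix n :: "int^'d"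
      have nf: "(norm (freq n))\<^sup>2 = (\<Sum>j\<in>UNIV. (real_of_int (n $ j))\<^sup>2)"
        unfolding power2_norm_eq_inner inner_vec_def by (simp add: freq_def power2_eq_square)
      have cf': "coef (sum f I) n = (\<Sum>i\<in>I. coef (f i) n)" for f and I :: "'d set"
        by (rule linear_sum[OF bounded_linear.linear[OF bounded_linear_coef]])
      have cc: "coef (mul (cst c) z) n = c * coef z n" for z
        unfolding mul_cst coef_def by (simp add: l2_nth_mult[of _ "cmod c"])
      have cF: "coef (\<Sum>k\<in>F. mode k (f k)) n = (if n \<in> F then f n else 0)" for f
        using F by (simp add: linear_sum[OF bounded_linear.linear[OF bounded_linear_coef]] coef_mode)
      show "coef (\<Sum>j\<in>UNIV. mul (cst c) (Y2 j)) n = coef (\<Sum>k\<in>F. mode k (- (c * complex_of_real ((norm (freq k))\<^sup>2)) * y k)) n"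
        unfolding cf' cc Y2_def cF nf
        by (simp add: sum_distrib_left sum_distrib_right sum_negf power2_eq_square algebra_simps)
    qed
    have y0d: "(y0 has_vector_derivative \<delta> *\<^sub>R (\<Sum>j\<in>UNIV. mul (cst c) (y2 j t))) (at t)" if t: "0 < t" for t
    proof -
      have Sgsum: "heat \<nu> s (sum f I) = (\<Sum>i\<in>I. heat \<nu> s (f i))" for s f and I :: "(int^'d) set"
        by (rule linear_sum[OF bounded_linear.linear[OF bounded_linear_heat]])
      have Sgsum': "heat \<nu> s (sum f I) = (\<Sum>i\<in>I. heat \<nu> s (f i))" for s f and I :: "'d set"
        by (rule linear_sum[OF bounded_linear.linear[OF bounded_linear_heat]])
      have Sgc: "heat \<nu> s (mul (cst c) z) = mul (cst c) (heat \<nu> s z)" for s z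
        unfolding mul_cst by (rule l2_eqI) (simp add: l2_nth_heat l2_nth_mult[of _ "cmod c"])
      have "((\<lambda>s. heat \<nu> s Y) has_vector_derivative (\<Sum>k\<in>F. heat \<nu> (\<delta> * t) (mode k (- (c * complex_of_real ((norm (freq k))\<^sup>2)) * y k)))) (at (\<delta> * t))"
        unfolding Y_def Sgsum c_def
        by (rule has_vector_derivative_sum) (rule heat_mode_has_vector_derivative, use t \<delta>0 in simp)
      also have "(\<Sum>k\<in>F. heat \<nu> (\<delta> * t) (mode k (- (c * complex_of_real ((norm (freq k))\<^sup>2)) * y k))) = (\<Sum>j\<in>UNIV. mul (cst c) (y2 j t))"
        unfolding Sgsum[symmetric] lap[symmetric] Sgsum' Sgc y2_def ..
      finally have 1: "((\<lambda>s. heat \<nu> s Y) has_vector_derivative (\<Sum>j\<in>UNIV. mul (cst c) (y2 j t))) (at (\<delta> * t))" .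
      have "((\<lambda>t. \<delta> * t) has_vector_derivative \<delta>) (at t)"
        by (auto intro!: derivative_eq_intros simp flip: has_real_derivative_iff_has_vector_derivative)
      from vector_diff_chain_at[OF this, where g = "\<lambda>s. heat \<nu> s Y", OF 1]
      show ?thesis by (simp add: y0_def[abs_def] o_def)
    qed
    define E where "E = Exp (- (l *\<^sub>R A))"
    define E1 where "E1 j = - (l *\<^sub>R mul (A1 j) E)" for j
    define E2 where "E2 j = - (l *\<^sub>R mul (A2 j) E) - l *\<^sub>R mul (A1 j) (E1 j)" for j
    have E1: "has_partial j E (E1 j)" for j
    proof -
      have "has_partial j ((- l) *\<^sub>R A) ((- l) *\<^sub>R A1 j)" by (rule has_partial_scaleR[OF A(1)])
      from has_partial_Exp[OF this] show ?thesis by (simp add: E_def E1_def mul_distribs bounded_bilinear.minus_left[OF bounded_bilinear_mul])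
    qed
    have E2: "has_partial j (E1 j) (E2 j)" for j
    proof -
      have "has_partial j ((- l) *\<^sub>R mul (A1 j) E) ((- l) *\<^sub>R (mul (A2 j) E + mul (A1 j) (E1 j)))"
        by (intro has_partial_scaleR has_partial_mul A(2) E1)
      then show ?thesis by (simp add: E1_def[of j] E2_def algebra_simps)
    qed
    define w where "w t = mul E (y0 t)" for t
    define w1 where "w1 j t = mul (E1 j) (y0 t) + mul E (y1 j t)" for j t
    define w2 where "w2 j t = (mul (E2 j) (y0 t) + mul (E1 j) (y1 j t)) + (mul (E1 j) (y1 j t) + mul E (y2 j t))" for j t
    have w1: "has_partial j (w t) (w1 j t)" for j t unfolding w_def w1_def by (intro has_partial_mul E1 yD)
    have w2: "has_partial j (w1 j t) (w2 j t)" for j t unfolding w1_def w2_def by (intro has_partial_add has_partial_mul E1 E2 yD)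
    note id = conjugated_identity[OF E1_def E2_def w_def w1_def w2_def]
    define e where "e t = w t - v t" for t
    define e1 where "e1 j t = w1 j t - v1 j t" for j t
    define e2 where "e2 j t = w2 j t - v2 j t" for j t
    have eD: "has_partial j (e t) (e1 j t)" "has_partial j (e1 j t) (e2 j t)" for j t
      unfolding e_def e1_def e2_def by (intro has_partial_diff w1 w2 v1 v2)+
    \<comment> \<open>The residual of \<open>v\<close> in the conjugated equation: exactly the terms
      that vanish in the limit.\<close>
    define g where "g t = mul (cst c) (\<delta> *\<^sub>R (\<Sum>j\<in>UNIV. v2 j t) + (\<delta> * l) *\<^sub>R (\<Sum>j\<in>UNIV. 2 *\<^sub>R mul (A1 j) (v1 j t) + mul (A2 j) (v t)))" for t
    define e' where "e' t = (\<Sum>j\<in>UNIV. \<delta> *\<^sub>R mul (cst c) (e2 j t) + (2 * \<delta> * l) *\<^sub>R mul (cst c) (mul (A1 j) (e1 j t)) + (\<delta> * l) *\<^sub>R mul (cst c) (mul (A2 j) (e t)))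
        + mul m (e t) + g t" for t
    have ed: "(e has_vector_derivative e' t) (at t)" if t: "0 < t" "t < 1" for t
    proof -
      have "(w has_vector_derivative mul E (\<delta> *\<^sub>R (\<Sum>j\<in>UNIV. mul (cst c) (y2 j t)))) (at t)"
        unfolding w_def[abs_def] by (rule bounded_linear.has_vector_derivative[OF mul_linear_right y0d[OF t(1)]])
      from has_vector_derivative_diff[OF this vd[OF t]]
      have "(e has_vector_derivative mul E (\<delta> *\<^sub>R (\<Sum>j\<in>UNIV. mul (cst c) (y2 j t))) - mul m (v t)) (at t)"
        unfolding e_def[abs_def] .
      moreover have "mul E (\<delta> *\<^sub>R (\<Sum>j\<in>UNIV. mul (cst c) (y2 j t))) - mul m (v t) = e' t"
      proof -
        have "mul E (\<delta> *\<^sub>R (\<Sum>j\<in>UNIV. mul (cst c) (y2 j t))) = \<delta> *\<^sub>R (\<Sum>j\<in>UNIV. mul (cst c) (mul E (y2 j t)))"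
          by (rule ev_eqI) (simp add: ev_simps sum_distrib_left mult_ac)
        also have "\<dots> = (\<Sum>j\<in>UNIV. \<delta> *\<^sub>R mul (cst c) (w2 j t) + (2 * \<delta> * l) *\<^sub>R mul (cst c) (mul (A1 j) (w1 j t)) + (\<delta> * l) *\<^sub>R mul (cst c) (mul (A2 j) (w t))
            + (\<delta> * l\<^sup>2) *\<^sub>R mul (cst c) (mul (mul (A1 j) (A1 j)) (w t)))"
          unfolding id by (rule ev_eqI) (simp add: ev_simps sum_distrib_left algebra_simps)
        also have "\<dots> = (\<Sum>j\<in>UNIV. \<delta> *\<^sub>R mul (cst c) (w2 j t) + (2 * \<delta> * l) *\<^sub>R mul (cst c) (mul (A1 j) (w1 j t)) + (\<delta> * l) *\<^sub>R mul (cst c) (mul (A2 j) (w t)))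
            + mul m (w t)"
          unfolding \<delta>0(2) m_def by (rule ev_eqI) (simp add: ev_simps sum.distrib sum_distrib_left sum_distrib_right mult_ac)
        finally show ?thesis
          unfolding e'_def g_def e_def e1_def e2_def
          by (intro ev_eqI) (simp add: ev_simps sum.distrib sum_distrib_left sum_distrib_right sum_subtractf algebra_simps)
      qed
      ultimately show ?thesis by simp
    qed
    have gB: "norm (g t) \<le> 2 * cmod c * B / l" if t: "0 < t" "t < 1" for t
    proof -
      have B0: "B \<ge> 0" using B1[OF t] norm_ge_zero order_trans by blast
      have "norm (g t) \<le> cmod c * norm (\<delta> *\<^sub>R (\<Sum>j\<in>UNIV. v2 j t) + (\<delta> * l) *\<^sub>R (\<Sum>j\<in>UNIV. 2 *\<^sub>R mul (A1 j) (v1 j t) + mul (A2 j) (v t)))"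
        unfolding g_def by (rule norm_mul_cst_le)
      also have "\<dots> \<le> cmod c * (\<delta> * B + (\<delta> * l) * B)"
      proof (intro mult_left_mono norm_ge_zero order_trans[OF norm_triangle_ineq] add_mono)
        show "norm (\<delta> *\<^sub>R (\<Sum>j\<in>UNIV. v2 j t)) \<le> \<delta> * B" using B1[OF t] \<delta>0 by simp
        show "norm ((\<delta> * l) *\<^sub>R (\<Sum>j\<in>UNIV. 2 *\<^sub>R mul (A1 j) (v1 j t) + mul (A2 j) (v t))) \<le> \<delta> * l * B"
          using B2[OF t] \<delta>0 l0 by simp
      qed
      also have "\<dots> \<le> cmod c * (1 / l * B + 1 / l * B)"
      proof (intro mult_left_mono add_mono mult_right_mono B0)
        have "1 * l \<le> l * l" using l by (intro mult_right_mono) auto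
        then show "\<delta> \<le> 1 / l" using l0 by (simp add: \<delta>_def field_simps power2_eq_square)
        show "\<delta> * l \<le> 1 / l" using l0 by (simp add: \<delta>_def power2_eq_square)
      qed auto
      finally show ?thesis by (simp add: field_simps)
    qed
    have est: "2 * inner (e' t) (e t) \<le> (2 * C0) * (norm (e t))\<^sup>2 + (2 * cmod c * B / l)\<^sup>2" if t: "0 < t" "t < 1" for t
    proof -
      let ?n = "norm (e t)"
      have step: "inner (\<delta> *\<^sub>R mul (cst c) (e2 j t) + (2 * \<delta> * l) *\<^sub>R mul (cst c) (mul (A1 j) (e1 j t)) + (\<delta> * l) *\<^sub>R mul (cst c) (mul (A2 j) (e t))) (e t)
          \<le> (cmod c * Kmul * norm (A1 j))\<^sup>2 * ?n\<^sup>2 + cmod c * Kmul * norm (A2 j) * ?n\<^sup>2" for j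
      proof -
        let ?a = "cmod c * Kmul * norm (A1 j)"
        have a0: "?a \<ge> 0" by (simp add: Kmul_nonneg)
        have i1: "inner (\<delta> *\<^sub>R mul (cst c) (e2 j t)) (e t) = - \<delta> * (norm (e1 j t))\<^sup>2"
          using inner_has_partial2[OF eD, of c] by (simp add: c_def)
        \<comment> \<open>Cauchy's inequality with weight: as \<open>\<delta> * l^2 = 1\<close>, the
          gradient part equals the dissipation in \<open>i1\<close>, and the remainder is a multiple
          of \<open>norm (e t)\<close> squared without any power of \<open>l\<close>.\<close>
        have i2: "inner ((2 * \<delta> * l) *\<^sub>R mul (cst c) (mul (A1 j) (e1 j t))) (e t) \<le> \<delta> * (norm (e1 j t))\<^sup>2 + ?a\<^sup>2 * ?n\<^sup>2"
        proof -
          have "inner (mul (cst c) (mul (A1 j) (e1 j t))) (e t) \<le> norm (mul (cst c) (mul (A1 j) (e1 j t))) * ?n"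
            by (rule norm_cauchy_schwarz)
          also have "\<dots> \<le> (?a * norm (e1 j t)) * ?n"
          proof (intro mult_right_mono norm_ge_zero)
            have "norm (mul (cst c) (mul (A1 j) (e1 j t))) \<le> cmod c * norm (mul (A1 j) (e1 j t))" by (rule norm_mul_cst_le)
            also have "\<dots> \<le> cmod c * (Kmul * norm (A1 j) * norm (e1 j t))" by (intro mult_left_mono norm_mul_le) simp
            finally show "norm (mul (cst c) (mul (A1 j) (e1 j t))) \<le> ?a * norm (e1 j t)" by (simp add: mult.assoc)
          qed
          finally have "inner ((2 * \<delta> * l) *\<^sub>R mul (cst c) (mul (A1 j) (e1 j t))) (e t) \<le> (2 * \<delta> * l) * (?a * norm (e1 j t) * ?n)"
            using \<delta>0 l0 by simp
          also have "\<dots> = \<delta> * (2 * (?a * l) * (norm (e1 j t) * ?n))" by (simp add: mult_ac)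
          also have "\<dots> \<le> \<delta> * ((norm (e1 j t))\<^sup>2 + (?a * l)\<^sup>2 * ?n\<^sup>2)"
            using \<delta>0 l0 a0 by (intro mult_left_mono weighted_am_gm mult_nonneg_nonneg) (auto simp: Kmul_nonneg)
          also have "\<dots> = \<delta> * (norm (e1 j t))\<^sup>2 + (\<delta> * l\<^sup>2) * (?a\<^sup>2 * ?n\<^sup>2)"
            by (simp add: distrib_left power_mult_distrib mult_ac)
          finally show ?thesis unfolding \<delta>0(2) by simp
        qed
        have i3: "inner ((\<delta> * l) *\<^sub>R mul (cst c) (mul (A2 j) (e t))) (e t) \<le> cmod c * Kmul * norm (A2 j) * ?n\<^sup>2"
        proof -
          have "inner (mul (cst c) (mul (A2 j) (e t))) (e t) \<le> norm (mul (cst c) (mul (A2 j) (e t))) * ?n"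
            by (rule norm_cauchy_schwarz)
          also have "\<dots> \<le> (cmod c * (Kmul * norm (A2 j) * ?n)) * ?n"
            by (intro mult_right_mono norm_ge_zero order_trans[OF norm_mul_cst_le] mult_left_mono norm_mul_le)
          also have "\<dots> = cmod c * Kmul * norm (A2 j) * ?n\<^sup>2" by (simp add: power2_eq_square mult_ac)
          finally have "inner (mul (cst c) (mul (A2 j) (e t))) (e t) \<le> cmod c * Kmul * norm (A2 j) * ?n\<^sup>2" .
          then have "(\<delta> * l) * inner (mul (cst c) (mul (A2 j) (e t))) (e t) \<le> (\<delta> * l) * (cmod c * Kmul * norm (A2 j) * ?n\<^sup>2)"
            using \<delta>0 l0 by (intro mult_left_mono) auto
          also have "\<dots> \<le> 1 * (cmod c * Kmul * norm (A2 j) * ?n\<^sup>2)"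
          proof (intro mult_right_mono)
            show "\<delta> * l \<le> 1" using l l0 by (simp add: \<delta>_def power2_eq_square)
          qed (simp add: Kmul_nonneg)
          finally show ?thesis by simp
        qed
        show ?thesis using i1 i2 i3 by (simp add: inner_add_left)
      qed
      have "inner (\<Sum>j\<in>UNIV. \<delta> *\<^sub>R mul (cst c) (e2 j t) + (2 * \<delta> * l) *\<^sub>R mul (cst c) (mul (A1 j) (e1 j t)) + (\<delta> * l) *\<^sub>R mul (cst c) (mul (A2 j) (e t))) (e t)
          \<le> (\<Sum>j\<in>UNIV. (cmod c * Kmul * norm (A1 j))\<^sup>2 * ?n\<^sup>2 + cmod c * Kmul * norm (A2 j) * ?n\<^sup>2)"
        unfolding inner_sum_left by (rule sum_mono) (rule step)
      also have "\<dots> = ((\<Sum>j\<in>UNIV. (cmod c * Kmul * norm (A1 j))\<^sup>2) + (\<Sum>j\<in>UNIV. cmod c * Kmul * norm (A2 j))) * ?n\<^sup>2"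
        by (simp only: sum.distrib sum_distrib_right distrib_right)
      finally have s1: "inner (\<Sum>j\<in>UNIV. \<delta> *\<^sub>R mul (cst c) (e2 j t) + (2 * \<delta> * l) *\<^sub>R mul (cst c) (mul (A1 j) (e1 j t)) + (\<delta> * l) *\<^sub>R mul (cst c) (mul (A2 j) (e t))) (e t)
          \<le> ((\<Sum>j\<in>UNIV. (cmod c * Kmul * norm (A1 j))\<^sup>2) + (\<Sum>j\<in>UNIV. cmod c * Kmul * norm (A2 j))) * ?n\<^sup>2" .
      have s2: "inner (mul m (e t)) (e t) \<le> Kmul * norm m * ?n\<^sup>2"
      proof -
        have "inner (mul m (e t)) (e t) \<le> norm (mul m (e t)) * ?n" by (rule norm_cauchy_schwarz)
        also have "\<dots> \<le> (Kmul * norm m * ?n) * ?n" by (intro mult_right_mono norm_mul_le) simp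
        finally show ?thesis by (simp add: power2_eq_square mult_ac)
      qed
      have s3: "inner (g t) (e t) \<le> 1/2 * ?n\<^sup>2 + 1/2 * (2 * cmod c * B / l)\<^sup>2"
      proof -
        have "inner (g t) (e t) \<le> norm (g t) * ?n" by (rule norm_cauchy_schwarz)
        also have "\<dots> \<le> (2 * cmod c * B / l) * ?n" by (intro mult_right_mono gB[OF t]) simp
        also have "\<dots> \<le> 1/2 * ?n\<^sup>2 + 1/2 * (2 * cmod c * B / l)\<^sup>2"
          using sum_squares_bound[of "2 * cmod c * B / l" ?n] by simp
        finally show ?thesis .
      qed
      show ?thesis
        using s1 s2 s3 unfolding e'_def C0_def inner_add_left by (simp only: distrib_right distrib_left)
    qed
    have ec: "continuous_on {0..1} e"
      unfolding e_def w_def y0_def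
      by (intro continuous_intros vc continuous_on_compose2[OF continuous_on_heat]) auto
    have "(norm (e 1))\<^sup>2 \<le> exp (2 * C0) * ((norm (e 0))\<^sup>2 + (2 * cmod c * B / l)\<^sup>2)"
    proof (rule gronwall_differential[where f = "\<lambda>t. (norm (e t))\<^sup>2" and f' = "\<lambda>t. 2 * inner (e' t) (e t)"])
      show "continuous_on {0..1} (\<lambda>t. (norm (e t))\<^sup>2)" by (intro continuous_intros ec)
      fix t :: real assume t: "0 < t" "t < 1"
      have "((\<lambda>t. inner (e t) (e t)) has_vector_derivative inner (e t) (e' t) + inner (e' t) (e t)) (at t)"
        by (rule bounded_bilinear.has_vector_derivative[OF bounded_bilinear_inner ed[OF t] ed[OF t]])
      then show "((\<lambda>t. (norm (e t))\<^sup>2) has_real_derivative 2 * inner (e' t) (e t)) (at t)"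
        by (simp add: power2_norm_eq_inner has_real_derivative_iff_has_vector_derivative inner_commute)
      show "2 * inner (e' t) (e t) \<le> (2 * C0) * (norm (e t))\<^sup>2 + (2 * cmod c * B / l)\<^sup>2" by (rule est[OF t])
    qed (use C0 in auto)
    then show "(norm (mul (Exp (- (l *\<^sub>R A))) (heat \<nu> (1 / l\<^sup>2) (\<Sum>k\<in>F. mode k (y k))) - v 1))\<^sup>2
        \<le> exp (2 * C0) * ((norm (mul (Exp (- (l *\<^sub>R A))) (\<Sum>k\<in>F. mode k (y k)) - v 0))\<^sup>2 + (2 * cmod c * B / l)\<^sup>2)"
      by (simp add: e_def w_def y0_def E_def \<delta>_def Y_def heat_0)
  qed
qed

end

context sobolev_space
begin

text \<open>Stability and consistency imply convergence: the operators are bounded uniformly in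
  \<open>l >= 1\<close>, and on finite sums of modes the error is of order \<open>1 / l\<close>. For
  general \<open>x\<close> such a sum approximates it and the uniform bound handles the
  rest.\<close>

lemma conjugated_limit:
  fixes A :: "(int^'d) l2" and A1 A2 m1 m2 :: "'d \<Rightarrow> (int^'d) l2" and \<nu> :: real
  defines "m \<equiv> mul (cst (1 + \<i> * complex_of_real \<nu>)) (\<Sum>j\<in>UNIV. mul (A1 j) (A1 j))"
  assumes A: "\<And>j. has_partial j A (A1 j)" "\<And>j. has_partial j (A1 j) (A2 j)"
    and m: "\<And>j. has_partial j m (m1 j)" "\<And>j. has_partial j (m1 j) (m2 j)"
  shows "((\<lambda>l. mul (Exp (- (l *\<^sub>R A))) (heat \<nu> (1 / l\<^sup>2) (mul (Exp (l *\<^sub>R A)) x))) \<longlongrightarrow> mul (Exp m) x) at_top"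
proof -
  define c where "c = 1 + \<i> * complex_of_real \<nu>"
  define Em where "Em l = Exp (- (l *\<^sub>R A))" for l
  define P where "P l z = mul (Em l) (heat \<nu> (1 / l\<^sup>2) z)" for l z
  obtain C where C: "0 \<le> C" and en:
    "\<And>l F y v v1 v2 B. 1 \<le> l \<Longrightarrow> finite F \<Longrightarrow> continuous_on {0..1} v \<Longrightarrow>
      (\<And>t. 0 < t \<Longrightarrow> t < 1 \<Longrightarrow> (v has_vector_derivative mul m (v t)) (at t)) \<Longrightarrow>
      (\<And>j t. has_partial j (v t) (v1 j t)) \<Longrightarrow> (\<And>j t. has_partial j (v1 j t) (v2 j t)) \<Longrightarrow>
      (\<And>t. 0 < t \<Longrightarrow> t < 1 \<Longrightarrow> norm (\<Sum>j\<in>UNIV. v2 j t) \<le> B) \<Longrightarrow>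
      (\<And>t. 0 < t \<Longrightarrow> t < 1 \<Longrightarrow> norm (\<Sum>j\<in>UNIV. 2 *\<^sub>R mul (A1 j) (v1 j t) + mul (A2 j) (v t)) \<le> B) \<Longrightarrow>
      (norm (mul (Exp (- (l *\<^sub>R A))) (heat \<nu> (1 / l\<^sup>2) (\<Sum>k\<in>F. mode k (y k))) - v 1))\<^sup>2
        \<le> C * ((norm (mul (Exp (- (l *\<^sub>R A))) (\<Sum>k\<in>F. mode k (y k)) - v 0))\<^sup>2 + (2 * cmod c * B / l)\<^sup>2)"
    using energy_estimate[of A A1 A2 \<nu>, OF A, folded m_def c_def] by blast
  have P_lim: "(\<lambda>n. P l (Z n)) \<longlonglongrightarrow> P l z" if "Z \<longlonglongrightarrow> z" for l Z z
    unfolding P_def by (intro tendsto_mul tendsto_const bounded_linear.tendsto[OF bounded_linear_heat] that)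
  \<comment> \<open>The flow starts from \<open>Exp (l A) x\<close>, which need not be a finite sum
    of modes. For fixed \<open>l\<close> the estimate is continuous in the initial state and extends
    to all of them.\<close>
  have ext: "(norm (P l z - v 1))\<^sup>2 \<le> C * ((norm (mul (Em l) z - v 0))\<^sup>2 + (2 * cmod c * B / l)\<^sup>2)"
    if l: "1 \<le> l" and v: "continuous_on {0..1} v" "\<And>t. 0 < t \<Longrightarrow> t < 1 \<Longrightarrow> (v has_vector_derivative mul m (v t)) (at t)"
      "\<And>j t. has_partial j (v t) (v1 j t)" "\<And>j t. has_partial j (v1 j t) (v2 j t)"
      "\<And>t. 0 < t \<Longrightarrow> t < 1 \<Longrightarrow> norm (\<Sum>j\<in>UNIV. v2 j t) \<le> B"
      "\<And>t. 0 < t \<Longrightarrow> t < 1 \<Longrightarrow> norm (\<Sum>j\<in>UNIV. 2 *\<^sub>R mul (A1 j) (v1 j t) + mul (A2 j) (v t)) \<le> B"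
    for l z v v1 v2 B
  proof -
    obtain Z F where Z: "\<And>n::nat. finite (F n)" "\<And>n. Z n = (\<Sum>k\<in>F n. mode k (coef z k))" "Z \<longlonglongrightarrow> z"
      using truncation_sequence by metis
    have "(\<lambda>n. (norm (P l (Z n) - v 1))\<^sup>2) \<longlonglongrightarrow> (norm (P l z - v 1))\<^sup>2"
      by (intro tendsto_intros P_lim Z(3))
    moreover have "(\<lambda>n. C * ((norm (mul (Em l) (Z n) - v 0))\<^sup>2 + (2 * cmod c * B / l)\<^sup>2))
        \<longlonglongrightarrow> C * ((norm (mul (Em l) z - v 0))\<^sup>2 + (2 * cmod c * B / l)\<^sup>2)"
      by (intro tendsto_intros tendsto_mul Z(3))
    moreover have "(norm (P l (Z n) - v 1))\<^sup>2 \<le> C * ((norm (mul (Em l) (Z n) - v 0))\<^sup>2 + (2 * cmod c * B / l)\<^sup>2)" for n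
      unfolding P_def Em_def Z(2) by (rule en[OF l Z(1) v])
    ultimately show ?thesis by (intro LIMSEQ_le) auto
  qed
  have cancel: "mul (Em l) (mul (Exp (l *\<^sub>R A)) y) = y" for l y
    unfolding Em_def by (rule Exp_minus_mul)
  \<comment> \<open>The comparison with the zero solution, whose residual vanishes.\<close>
  have stable: "norm (P l (mul (Exp (l *\<^sub>R A)) y)) \<le> sqrt C * norm y" if l: "1 \<le> l" for l y
  proof -
    have "(norm (P l (mul (Exp (l *\<^sub>R A)) y) - 0))\<^sup>2 \<le> C * ((norm (mul (Em l) (mul (Exp (l *\<^sub>R A)) y) - 0))\<^sup>2 + (2 * cmod c * 0 / l)\<^sup>2)"
      by (rule ext[where v = "\<lambda>_. 0" and ?v1.0 = "\<lambda>_ _. 0" and ?v2.0 = "\<lambda>_ _. 0" and B = 0, OF l])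
        (simp_all add: has_partial_0 mul_distribs)
    then have "sqrt ((norm (P l (mul (Exp (l *\<^sub>R A)) y)))\<^sup>2) \<le> sqrt (C * (norm y)\<^sup>2)"
      unfolding cancel by (intro real_sqrt_le_mono) simp
    then show ?thesis by (simp add: real_sqrt_mult)
  qed
  \<comment> \<open>The comparison with \<open>v t = Exp (t m) x\<close>; the derivatives of
    \<open>m\<close> and of the finite sum \<open>x\<close> keep its residual bounded for times in
    the unit interval.\<close>
  have consistent: "\<exists>B. \<forall>l\<ge>1. norm (P l (mul (Exp (l *\<^sub>R A)) x) - mul (Exp m) x) \<le> B / l"
    if F: "finite F" and x: "x = (\<Sum>k\<in>F. mode k (y k))" for F y x
  proof -
    define x1 where "x1 j = (\<Sum>k\<in>F. mode k (\<i> * of_int (k $ j) * y k))" for j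
    define x2 where "x2 j = (\<Sum>k\<in>F. mode k (\<i> * of_int (k $ j) * (\<i> * of_int (k $ j) * y k)))" for j
    have xd: "has_partial j x (x1 j)" "has_partial j (x1 j) (x2 j)" for j
      unfolding x x1_def x2_def by (intro has_partial_sum has_partial_mode)+
    define X where "X t = Exp (t *\<^sub>R m)" for t
    define X1 where "X1 j t = mul (t *\<^sub>R m1 j) (X t)" for j t
    define X2 where "X2 j t = mul (t *\<^sub>R m2 j) (X t) + mul (t *\<^sub>R m1 j) (X1 j t)" for j t
    have Xd: "has_partial j (X t) (X1 j t)" "has_partial j (X1 j t) (X2 j t)" for j t
    proof -
      show 1: "has_partial j (X t) (X1 j t)" unfolding X_def X1_def by (intro has_partial_Exp has_partial_scaleR m)
      show "has_partial j (X1 j t) (X2 j t)" unfolding X2_def X1_def[of j t]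
        using 1 unfolding X1_def by (intro has_partial_mul has_partial_scaleR m)
    qed
    define v where "v t = mul (X t) x" for t
    define v1 where "v1 j t = mul (X1 j t) x + mul (X t) (x1 j)" for j t
    define v2 where "v2 j t = (mul (X2 j t) x + mul (X1 j t) (x1 j)) + (mul (X1 j t) (x1 j) + mul (X t) (x2 j))" for j t
    have vd: "has_partial j (v t) (v1 j t)" "has_partial j (v1 j t) (v2 j t)" for j t
      unfolding v_def v1_def v2_def by (intro has_partial_add has_partial_mul Xd xd)+
    have Xc: "continuous_on S X" for S unfolding X_def by (rule continuous_on_Exp_scaleR)
    have X1c: "continuous_on S (X1 j)" for S j unfolding X1_def by (intro continuous_intros Xc)
    have X2c: "continuous_on S (X2 j)" for S j unfolding X2_def by (intro continuous_intros Xc X1c)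
    have vc: "continuous_on S v" for S unfolding v_def by (intro continuous_intros Xc)
    have v1c: "continuous_on S (v1 j)" for S j unfolding v1_def by (intro continuous_intros Xc X1c)
    have v2c: "continuous_on S (v2 j)" for S j unfolding v2_def by (intro continuous_intros Xc X1c X2c)
    have bnd: "\<exists>B. \<forall>t\<in>{0..1}. norm (f t) \<le> B" if "continuous_on {0..1} f" for f :: "real \<Rightarrow> (int^'d) l2"
    proof -
      have "bounded (f ` {0..1})" by (intro compact_imp_bounded compact_continuous_image that) simp
      then show ?thesis unfolding bounded_iff by blast
    qed
    have "continuous_on {0..1} (\<lambda>t. \<Sum>j\<in>UNIV. v2 j t)" by (intro continuous_intros v2c)
    then obtain B1 where B1: "\<And>t. t \<in> {0..1} \<Longrightarrow> norm (\<Sum>j\<in>UNIV. v2 j t) \<le> B1" using bnd by blast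
    have "continuous_on {0..1} (\<lambda>t. \<Sum>j\<in>UNIV. 2 *\<^sub>R mul (A1 j) (v1 j t) + mul (A2 j) (v t))"
      by (intro continuous_intros v1c vc)
    then obtain B2 where B2: "\<And>t. t \<in> {0..1} \<Longrightarrow> norm (\<Sum>j\<in>UNIV. 2 *\<^sub>R mul (A1 j) (v1 j t) + mul (A2 j) (v t)) \<le> B2" using bnd by blast
    define B where "B = max B1 B2"
    have B0: "B \<ge> 0"
    proof -
      have "0 \<le> B1" using order_trans[OF norm_ge_zero B1[of 0]] by simp
      then show ?thesis by (simp add: B_def le_max_iff_disj)
    qed
    have vder: "(v has_vector_derivative mul m (v t)) (at t)" for t
    proof -
      have "(v has_vector_derivative mul (mul m (X t)) x) (at t)"
        unfolding v_def[abs_def] X_def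
        by (rule bounded_linear.has_vector_derivative[OF mul_linear_left Exp_has_vector_derivative])
      then show ?thesis by (simp add: v_def mul_assoc)
    qed
    have "norm (P l (mul (Exp (l *\<^sub>R A)) x) - mul (Exp m) x) \<le> (sqrt C * (2 * cmod c * B)) / l" if l: "1 \<le> l" for l
    proof -
      have v0: "v 0 = x" "v 1 = mul (Exp m) x" by (simp_all add: v_def X_def)
      have "(norm (P l (mul (Exp (l *\<^sub>R A)) x) - v 1))\<^sup>2 \<le> C * ((norm (mul (Em l) (mul (Exp (l *\<^sub>R A)) x) - v 0))\<^sup>2 + (2 * cmod c * B / l)\<^sup>2)"
      proof (rule ext[OF l vc vder vd])
        fix t :: real assume t: "0 < t" "t < 1"
        show "norm (\<Sum>j\<in>UNIV. v2 j t) \<le> B" using B1[of t] t by (simp add: B_def le_max_iff_disj)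
        show "norm (\<Sum>j\<in>UNIV. 2 *\<^sub>R mul (A1 j) (v1 j t) + mul (A2 j) (v t)) \<le> B" using B2[of t] t by (simp add: B_def le_max_iff_disj)
      qed
      then have "sqrt ((norm (P l (mul (Exp (l *\<^sub>R A)) x) - v 1))\<^sup>2) \<le> sqrt (C * (2 * cmod c * B / l)\<^sup>2)"
        unfolding cancel v0(1) by (intro real_sqrt_le_mono) simp
      also have "sqrt (C * (2 * cmod c * B / l)\<^sup>2) = sqrt C * (2 * cmod c * B / l)"
        using B0 l by (simp add: real_sqrt_mult)
      finally show ?thesis unfolding v0(2) by simp
    qed
    then show ?thesis by blast
  qed
  have "\<forall>\<^sub>F l in at_top. dist (P l (mul (Exp (l *\<^sub>R A)) x)) (mul (Exp m) x) < e" if e: "0 < e" for e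
  proof -
    define D where "D = sqrt C + Kmul * norm (Exp m) + 1"
    have D: "D > 0" using C Kmul_nonneg by (simp add: D_def add_nonneg_pos)
    obtain F where F: "finite F" "norm (x - (\<Sum>k\<in>F. l2_delta k (l2_nth x k))) < e / (2 * D)"
      using l2_truncation[of "e / (2 * D)" x] e D by auto
    define x' where "x' = (\<Sum>k\<in>F. mode k (coef x k))"
    have x': "norm (x - x') < e / (2 * D)" using F(2) by (simp add: x'_def l2_delta_mode coef_def)
    obtain B where B: "\<And>l. 1 \<le> l \<Longrightarrow> norm (P l (mul (Exp (l *\<^sub>R A)) x') - mul (Exp m) x') \<le> B / l"
      using consistent[OF F(1) x'_def] by blast
    have "\<forall>\<^sub>F l in at_top. B / l < e / 2" by (rule eventually_ge_one_inverse) (use e in simp)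
    moreover have "\<forall>\<^sub>F l in at_top. (1::real) \<le> l" by (rule eventually_ge_at_top)
    ultimately show ?thesis
    proof eventually_elim
      case (elim l)
      have "P l (mul (Exp (l *\<^sub>R A)) x) - mul (Exp m) x
          = P l (mul (Exp (l *\<^sub>R A)) (x - x')) + (P l (mul (Exp (l *\<^sub>R A)) x') - mul (Exp m) x') - mul (Exp m) (x - x')"
        by (simp add: P_def mul_distribs linear_diff[OF bounded_linear.linear[OF bounded_linear_heat]])
      moreover have "norm (P l (mul (Exp (l *\<^sub>R A)) (x - x')) + (P l (mul (Exp (l *\<^sub>R A)) x') - mul (Exp m) x') - mul (Exp m) (x - x'))
          \<le> norm (P l (mul (Exp (l *\<^sub>R A)) (x - x'))) + norm (P l (mul (Exp (l *\<^sub>R A)) x') - mul (Exp m) x') + norm (mul (Exp m) (x - x'))"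
        by (meson add_mono norm_triangle_ineq norm_triangle_ineq4 order_refl order_trans)
      ultimately have "dist (P l (mul (Exp (l *\<^sub>R A)) x)) (mul (Exp m) x)
          \<le> sqrt C * norm (x - x') + B / l + Kmul * norm (Exp m) * norm (x - x')"
        using stable[OF elim(2), of "x - x'"] B[OF elim(2)] norm_mul_le[of "Exp m" "x - x'"]
        by (simp only: dist_norm)
      also have "\<dots> \<le> D * norm (x - x') + B / l" by (simp add: D_def algebra_simps)
      also have "D * norm (x - x') < e / 2" using x' D by (simp add: field_simps)
      finally show ?case using elim(1) by linarith
    qed
  qed
  then show ?thesis unfolding P_def Em_def by (rule tendstoI)
qed

section \<open>The nonlinearity on the Sobolev algebra\<close>

definition bounded_lipschitz :: "((int^'d) l2 \<Rightarrow> (int^'d) l2) \<Rightarrow> bool" where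
  "bounded_lipschitz f \<longleftrightarrow> (\<forall>R. \<exists>L\<ge>0. \<forall>x y. norm x \<le> R \<longrightarrow> norm y \<le> R \<longrightarrow> norm (f x - f y) \<le> L * norm (x - y))"

lemma bounded_lipschitz_bounded:
  assumes "bounded_lipschitz f"
  shows "\<exists>B\<ge>0. \<forall>x. norm x \<le> R \<longrightarrow> norm (f x) \<le> B"
proof -
  obtain L where L: "L \<ge> 0" "\<And>x y. norm x \<le> \<bar>R\<bar> \<Longrightarrow> norm y \<le> \<bar>R\<bar> \<Longrightarrow> norm (f x - f y) \<le> L * norm (x - y)"
    using assms unfolding bounded_lipschitz_def by blast
  have "norm (f x) \<le> norm (f 0) + L * \<bar>R\<bar>" if "norm x \<le> R" for x
  proof -
    have "norm (f x) \<le> norm (f 0) + norm (f x - f 0)" using norm_triangle_ineq[of "f 0" "f x - f 0"] by simp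
    also have "norm (f x - f 0) \<le> L * norm (x - 0)" using that by (intro L(2)) auto
    also have "\<dots> \<le> L * \<bar>R\<bar>" using that L by (intro mult_left_mono) auto
    finally show ?thesis by simp
  qed
  then show ?thesis using L(1) by (intro exI[of _ "norm (f 0) + L * \<bar>R\<bar>"]) auto
qed

lemma bounded_lipschitz_mul:
  assumes f: "bounded_lipschitz f" and g: "bounded_lipschitz g"
  shows "bounded_lipschitz (\<lambda>x. mul (f x) (g x))"
  unfolding bounded_lipschitz_def
proof
  fix R
  obtain L where L: "L \<ge> 0" "\<And>x y. norm x \<le> R \<Longrightarrow> norm y \<le> R \<Longrightarrow> norm (f x - f y) \<le> L * norm (x - y)"
    using f unfolding bounded_lipschitz_def by blast
  obtain L' where L': "L' \<ge> 0" "\<And>x y. norm x \<le> R \<Longrightarrow> norm y \<le> R \<Longrightarrow> norm (g x - g y) \<le> L' * norm (x - y)"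
    using g unfolding bounded_lipschitz_def by blast
  obtain B where B: "B \<ge> 0" "\<And>x. norm x \<le> R \<Longrightarrow> norm (f x) \<le> B" using bounded_lipschitz_bounded[OF f] by blast
  obtain B' where B': "B' \<ge> 0" "\<And>x. norm x \<le> R \<Longrightarrow> norm (g x) \<le> B'" using bounded_lipschitz_bounded[OF g] by blast
  have "norm (mul (f x) (g x) - mul (f y) (g y)) \<le> (Kmul * L * B' + Kmul * B * L') * norm (x - y)"
    if xy: "norm x \<le> R" "norm y \<le> R" for x y
  proof -
    have "mul (f x) (g x) - mul (f y) (g y) = mul (f x - f y) (g x) + mul (f y) (g x - g y)"
      by (simp add: mul_distribs)
    also have "norm \<dots> \<le> Kmul * norm (f x - f y) * norm (g x) + Kmul * norm (f y) * norm (g x - g y)"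
      by (intro order_trans[OF norm_triangle_ineq] add_mono norm_mul_le)
    also have "\<dots> \<le> Kmul * (L * norm (x - y)) * B' + Kmul * B * (L' * norm (x - y))"
      using xy L L' B B' by (intro add_mono mult_mono) (auto simp: Kmul_nonneg)
    finally show ?thesis by (simp add: algebra_simps)
  qed
  then show "\<exists>L\<ge>0. \<forall>x y. norm x \<le> R \<longrightarrow> norm y \<le> R \<longrightarrow> norm (mul (f x) (g x) - mul (f y) (g y)) \<le> L * norm (x - y)"
    using L L' B B' Kmul_nonneg by (intro exI[of _ "Kmul * L * B' + Kmul * B * L'"]) auto
qed

lemma bounded_lipschitz_const: "bounded_lipschitz (\<lambda>_. c)" unfolding bounded_lipschitz_def by (intro allI exI[of _ 0]) simp

lemma bounded_lipschitz_id: "bounded_lipschitz (\<lambda>x. x)" unfolding bounded_lipschitz_def by (intro allI exI[of _ 1]) simp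

lemma bounded_lipschitz_cj: "bounded_lipschitz cj"
  unfolding bounded_lipschitz_def by (intro allI exI[of _ 1]) (simp add: cj_diff[symmetric] norm_cj_le)

lemma bounded_lipschitz_pw: "bounded_lipschitz f \<Longrightarrow> bounded_lipschitz (\<lambda>x. pw (f x) n)"
  by (induction n) (auto intro: bounded_lipschitz_const bounded_lipschitz_mul)

text \<open>For integer \<open>\<sigma>\<close> the nonlinearity is the polynomial with factors
  \<open>x^(\<sigma> + 1)\<close> and \<open>cj x ^ \<sigma>\<close>; this form gives its Lipschitz
  bounds on balls and its growth of order \<open>2 \<sigma> + 1\<close> from the algebra
  alone.\<close>

definition nonlin :: "real \<Rightarrow> nat \<Rightarrow> (int^'d) l2 \<Rightarrow> (int^'d) l2" where
  "nonlin \<mu> \<sigma> x = mul (cst (1 + \<i> * complex_of_real \<mu>)) (mul (pw x (Suc \<sigma>)) (pw (cj x) \<sigma>))"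

lemma ev_nonlin:
  "ev p (nonlin \<mu> \<sigma> x) = (1 + \<i> * complex_of_real \<mu>) * complex_of_real (cmod (ev p x) ^ (2 * \<sigma>)) * ev p x"
proof -
  have "ev p x ^ \<sigma> * cnj (ev p x) ^ \<sigma> = complex_of_real (cmod (ev p x) ^ (2 * \<sigma>))"
    unfolding power_mult_distrib[symmetric] complex_norm_square[symmetric] power_mult by simp
  then show ?thesis by (simp add: nonlin_def ev_simps ev_pw ev_cj mult_ac)
qed

lemma bounded_lipschitz_nonlin: "bounded_lipschitz (nonlin \<mu> \<sigma>)"
  unfolding nonlin_def[abs_def] by (intro bounded_lipschitz_mul bounded_lipschitz_const bounded_lipschitz_pw bounded_lipschitz_id bounded_lipschitz_cj)

lemma nonlin_growth: "\<exists>C\<ge>0. \<forall>x. norm (nonlin \<mu> \<sigma> x) \<le> C * norm x ^ (2 * \<sigma> + 1)"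
proof -
  let ?n = "norm (cst 1)" and ?m = "cmod (1 + \<i> * complex_of_real \<mu>)"
  define C where "C = ?m * (Kmul * (?n * Kmul ^ Suc \<sigma>) * (?n * Kmul ^ \<sigma>))"
  have "norm (nonlin \<mu> \<sigma> x) \<le> C * norm x ^ (2 * \<sigma> + 1)" for x
  proof -
    have p1: "norm (pw x (Suc \<sigma>)) \<le> ?n * (Kmul * norm x) ^ Suc \<sigma>" by (rule norm_pw_le)
    have p2: "norm (pw (cj x) \<sigma>) \<le> ?n * (Kmul * norm x) ^ \<sigma>"
      by (rule order_trans[OF norm_pw_le])
        (intro mult_left_mono power_mono norm_cj_le mult_nonneg_nonneg Kmul_nonneg norm_ge_zero)
    have "norm (nonlin \<mu> \<sigma> x) \<le> ?m * norm (mul (pw x (Suc \<sigma>)) (pw (cj x) \<sigma>))"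
      unfolding nonlin_def by (rule norm_mul_cst_le)
    also have "\<dots> \<le> ?m * (Kmul * norm (pw x (Suc \<sigma>)) * norm (pw (cj x) \<sigma>))"
      by (intro mult_left_mono norm_mul_le) simp
    also have "\<dots> \<le> ?m * (Kmul * (?n * (Kmul * norm x) ^ Suc \<sigma>) * (?n * (Kmul * norm x) ^ \<sigma>))"
      using p1 p2 Kmul_nonneg by (intro mult_left_mono mult_mono) (auto intro!: mult_nonneg_nonneg)
    also have "\<dots> = C * norm x ^ (2 * \<sigma> + 1)"
    proof -
      have "norm x ^ (2 * \<sigma> + 1) = norm x * (norm x ^ \<sigma> * norm x ^ \<sigma>)"
        unfolding mult_2 power_add by simp
      then show ?thesis unfolding C_def power_mult_distrib by (simp only: power_Suc mult_ac)
    qed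
    finally show ?thesis .
  qed
  moreover have "C \<ge> 0" unfolding C_def using Kmul_nonneg by (intro mult_nonneg_nonneg) auto
  ultimately show ?thesis by blast
qed

lemma contraction_semigroup_heat: "contraction_semigroup (heat \<nu>)"
  by (rule contraction_semigroup.intro)
    (simp_all only: bounded_linear_heat norm_heat_le heat_0 heat_add continuous_on_heat)

end

section \<open>The calculus of steerable exponents\<close>

locale cgl_system = sobolev_space s dim for s :: nat and dim :: "'d::finite itself" +
  fixes V \<nu> \<mu> :: real and \<sigma> :: nat and kq :: "real^'q::finite \<Rightarrow> (int^'d) l2"
  assumes \<sigma>: "\<sigma> \<ge> 1" and kq: "bounded_linear kq"
begin

sublocale control_system "heat \<nu>" V "nonlin \<mu> \<sigma>" "\<lambda>w x. mul (kq w) x"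
proof (intro control_system.intro control_system_axioms.intro contraction_semigroup_heat)
  show "\<exists>L\<ge>0. \<forall>x y. norm x \<le> R \<longrightarrow> norm y \<le> R \<longrightarrow> norm (nonlin \<mu> \<sigma> x - nonlin \<mu> \<sigma> y) \<le> L * norm (x - y)" for R
    using bounded_lipschitz_nonlin[of \<mu> \<sigma>] unfolding bounded_lipschitz_def by (rule spec)
  show "bounded_bilinear (\<lambda>w x. mul (kq w) x)"
    by (rule bounded_bilinear.comp1[OF bounded_bilinear_mul kq])
qed

definition steer :: "(int^'d) l2 \<Rightarrow> bool" where
  "steer q \<longleftrightarrow> (\<forall>x0 e T0. 0 < e \<longrightarrow> 0 < T0 \<longrightarrow> (\<exists>T u a. 0 < T \<and> T < T0 \<and> flat_control T u \<and>
     sol u T x0 a \<and> norm (a T - mul (Exp q) x0) < e))"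

lemma steerE:
  assumes "steer q" "0 < e" "0 < T0"
  obtains T u a where "0 < T" "T < T0" "flat_control T u" "sol u T x0 a" "norm (a T - mul (Exp q) x0) < e"
  using assms unfolding steer_def by blast

lemma flat_concat:
  assumes "0 < T1" "0 < T2" "flat_control T1 u1" "flat_control T2 u2"
  shows "flat_control (T1 + T2) (\<lambda>t. u1 t + u2 (t - T1))"
  using assms unfolding flat_control_def by (auto intro!: smooth_fun_add_shift)

lemma steer_control: "steer (kq c)"
  unfolding steer_def
proof (intro allI impI)
  fix x0 :: "(int^'d) l2" and e T0 :: real assume e: "0 < e" and T0: "0 < T0"
  define G where "G h = mul (Exp (h *\<^sub>R kq c)) x0" for h
  have "(G has_vector_derivative mul (kq c) (G h)) (at h)" for h
    unfolding G_def[abs_def]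
    using bounded_linear.has_vector_derivative[OF mul_linear_left Exp_has_vector_derivative]
    by (simp add: mul_assoc)
  moreover have "G 0 = x0" by (simp add: G_def)
  ultimately obtain T u a where "0 < T" "T < T0" "flat_control T u" "sol u T x0 a" "norm (a T - G 1) < e"
    using control_pulse[of G x0 c e T0] e T0 by blast
  then show "\<exists>T u a. 0 < T \<and> T < T0 \<and> flat_control T u \<and> sol u T x0 a \<and> norm (a T - mul (Exp (kq c)) x0) < e"
    by (auto simp: G_def)
qed

lemma steer_add:
  assumes p: "steer p" and q: "steer q"
  shows "steer (p + q)"
  unfolding steer_def
proof (intro allI impI)
  fix x0 :: "(int^'d) l2" and e T0 :: real assume e: "0 < e" and T0: "0 < T0"
  \<comment> \<open>The second control starts from the state actually reached. The error made before
    it is multiplied by \<open>Exp q\<close>, that is, amplified by at most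
    \<open>k\<close>.\<close>
  define k where "k = Kmul * norm (Exp q) + 1"
  have k: "k > 0" using Kmul_nonneg by (simp add: k_def add_nonneg_pos)
  obtain T1 u1 a1 where 1: "0 < T1" "T1 < T0 / 2" "flat_control T1 u1" "sol u1 T1 x0 a1" "norm (a1 T1 - mul (Exp p) x0) < e / (2 * k)"
    using steerE[OF p, of "e / (2 * k)" "T0 / 2" x0] e T0 k by auto
  obtain T2 u2 a2 where 2: "0 < T2" "T2 < T0 / 2" "flat_control T2 u2" "sol u2 T2 (a1 T1) a2" "norm (a2 T2 - mul (Exp q) (a1 T1)) < e / 2"
    using steerE[OF q, of "e / 2" "T0 / 2" "a1 T1"] e T0 by auto
  obtain a where a: "sol (\<lambda>t. u1 t + u2 (t - T1)) (T1 + T2) x0 a" "a (T1 + T2) = a2 T2"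
    using sol_concat[OF _ _ 1(3) 2(3) 1(4) 2(4)] 1(1) 2(1) by auto
  have "norm (mul (Exp q) (a1 T1 - mul (Exp p) x0)) \<le> Kmul * norm (Exp q) * norm (a1 T1 - mul (Exp p) x0)" by (rule norm_mul_le)
  also have "\<dots> \<le> k * norm (a1 T1 - mul (Exp p) x0)" unfolding k_def by (intro mult_right_mono) auto
  also have "\<dots> < e / 2" using 1(5) k by (simp add: field_simps)
  finally have b: "norm (mul (Exp q) (a1 T1 - mul (Exp p) x0)) < e / 2" .
  have "a (T1 + T2) - mul (Exp (p + q)) x0 = (a2 T2 - mul (Exp q) (a1 T1)) + mul (Exp q) (a1 T1 - mul (Exp p) x0)"
    unfolding a(2) Exp_add by (rule ev_eqI) (simp add: ev_simps algebra_simps)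
  then have "norm (a (T1 + T2) - mul (Exp (p + q)) x0) < e"
    using norm_triangle_ineq[of "a2 T2 - mul (Exp q) (a1 T1)" "mul (Exp q) (a1 T1 - mul (Exp p) x0)"] b 2(5) by simp
  moreover have "0 < T1 + T2" "T1 + T2 < T0" using 1 2 by auto
  ultimately show "\<exists>T u a. 0 < T \<and> T < T0 \<and> flat_control T u \<and> sol u T x0 a \<and> norm (a T - mul (Exp (p + q)) x0) < e"
    using a(1) flat_concat[OF 1(1) 2(1) 1(3) 2(3)] by blast
qed

lemma steer_limit:
  assumes lim: "\<And>e. 0 < e \<Longrightarrow> \<exists>q'. steer q' \<and> norm (q' - q) < e"
  shows "steer q"
  unfolding steer_def
proof (intro allI impI)
  fix x0 :: "(int^'d) l2" and e T0 :: real assume e: "0 < e" and T0: "0 < T0"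
  \<comment> \<open>Bounds the change of the target when the exponent moves by \<open>h\<close> with
    \<open>norm h = r\<close>: \<open>Exp (q + h) - Exp q\<close> factors through
    \<open>Exp h - 1\<close>. It is continuous and vanishes at zero.\<close>
  define f where "f r = Kmul * norm (Exp q) * (Kmul * (norm (cst 1) * (exp (Kmul * r) - 1 - Kmul * r) + r) * norm x0)" for r
  have "\<exists>q'. steer q' \<and> norm (q' - q) < 1 / real (Suc n)" for n by (rule lim) simp
  then obtain Q where Q: "\<And>n. steer (Q n)" "\<And>n. norm (Q n - q) < 1 / real (Suc n)" by metis
  have "(\<lambda>n. norm (Q n - q)) \<longlonglongrightarrow> 0"
  proof (rule tendsto_sandwich[OF _ _ tendsto_const LIMSEQ_inverse_real_of_nat])
    have "norm (Q n - q) \<le> inverse (real (Suc n))" for n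
      using less_imp_le[OF Q(2)[of n]] by (simp only: inverse_eq_divide)
    then show "\<forall>\<^sub>F n in sequentially. norm (Q n - q) \<le> inverse (real (Suc n))"
      by (intro always_eventually allI)
  qed simp
  then have "(\<lambda>n. f (norm (Q n - q))) \<longlonglongrightarrow> f 0"
    unfolding f_def by (intro tendsto_intros)
  then have "\<forall>\<^sub>F n in sequentially. f (norm (Q n - q)) < e / 2"
    using e by (intro order_tendstoD(2)) (auto simp: f_def)
  then obtain n where n: "f (norm (Q n - q)) < e / 2" by (auto simp: eventually_sequentially)
  define h where "h = Q n - q"
  have "mul (Exp (Q n)) x0 - mul (Exp q) x0 = mul (Exp q) (mul (Exp h - cst 1) x0)"
  proof -
    have "Exp (Q n) = mul (Exp q) (Exp h)" unfolding Exp_add[symmetric] h_def by simp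
    then show ?thesis by (intro ev_eqI) (simp add: ev_simps algebra_simps)
  qed
  also have "norm \<dots> \<le> Kmul * norm (Exp q) * (Kmul * norm (Exp h - cst 1) * norm x0)"
    by (rule order_trans[OF norm_mul_le]) (intro mult_left_mono norm_mul_le mult_nonneg_nonneg Kmul_nonneg norm_ge_zero)
  also have "\<dots> \<le> f (norm h)"
    unfolding f_def
  proof (intro mult_left_mono mult_right_mono mult_nonneg_nonneg Kmul_nonneg norm_ge_zero)
    show "norm (Exp h - cst 1) \<le> norm (cst 1) * (exp (Kmul * norm h) - 1 - Kmul * norm h) + norm h"
      using norm_Exp_remainder[of h] norm_triangle_ineq[of "Exp h - cst 1 - h" h] by simp
  qed
  finally have d: "norm (mul (Exp (Q n)) x0 - mul (Exp q) x0) < e / 2" using n by (simp add: h_def)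
  obtain T u a where a: "0 < T" "T < T0" "flat_control T u" "sol u T x0 a" "norm (a T - mul (Exp (Q n)) x0) < e / 2"
    using steerE[OF Q(1), of "e / 2" T0 x0 n] e T0 by auto
  have "norm (a T - mul (Exp q) x0) < e"
    using norm_triangle_ineq[of "a T - mul (Exp (Q n)) x0" "mul (Exp (Q n)) x0 - mul (Exp q) x0"] a(5) d by simp
  with a show "\<exists>T u a. 0 < T \<and> T < T0 \<and> flat_control T u \<and> sol u T x0 a \<and> norm (a T - mul (Exp q) x0) < e" by blast
qed

lemma mul_Exp_shift:
  "mul (Exp (l *\<^sub>R (A - k *\<^sub>R cst (1 - \<i> * complex_of_real \<nu>)))) x
     = mul (cst (exp (- complex_of_real (l * k) * (1 - \<i> * complex_of_real \<nu>)))) (mul (Exp (l *\<^sub>R A)) x)"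
proof (rule ev_eqI)
  fix p
  have "complex_of_real l * (ev p A - complex_of_real k * (1 - \<i> * complex_of_real \<nu>))
      = - complex_of_real (l * k) * (1 - \<i> * complex_of_real \<nu>) + complex_of_real l * ev p A"
    by (simp add: algebra_simps)
  then show "ev p (mul (Exp (l *\<^sub>R (A - k *\<^sub>R cst (1 - \<i> * complex_of_real \<nu>)))) x)
      = ev p (mul (cst (exp (- complex_of_real (l * k) * (1 - \<i> * complex_of_real \<nu>)))) (mul (Exp (l *\<^sub>R A)) x))"
    by (simp only: ev_simps ev_Exp exp_add mult.assoc)
qed

text \<open>A constant exponent acts as a scalar, here of modulus \<open>exp (- l k)\<close>. It is
  pulled out without any factor \<open>Kmul\<close>, so \<open>l * k\<close> and
  \<open>- l * k\<close> balance exactly between the two exponentials.\<close>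

lemma norm_mul_Exp_shift_le:
  "norm (mul (Exp (l *\<^sub>R (A - k *\<^sub>R cst (1 - \<i> * complex_of_real \<nu>)))) x)
     \<le> exp (- (l * k)) * (Kmul * norm (cst 1) * exp (\<bar>l\<bar> * (Kmul * norm A)) * norm x)"
proof -
  have "norm (mul (Exp (l *\<^sub>R (A - k *\<^sub>R cst (1 - \<i> * complex_of_real \<nu>)))) x)
      \<le> cmod (exp (- complex_of_real (l * k) * (1 - \<i> * complex_of_real \<nu>))) * norm (mul (Exp (l *\<^sub>R A)) x)"
    unfolding mul_Exp_shift by (rule norm_mul_cst_le)
  also have "cmod (exp (- complex_of_real (l * k) * (1 - \<i> * complex_of_real \<nu>))) = exp (- (l * k))"
    by (simp add: norm_exp_eq_Re)
  also have "norm (mul (Exp (l *\<^sub>R A)) x) \<le> Kmul * norm (Exp (l *\<^sub>R A)) * norm x" by (rule norm_mul_le)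
  also have "norm (Exp (l *\<^sub>R A)) \<le> norm (cst 1) * exp (\<bar>l\<bar> * (Kmul * norm A))"
    using norm_Exp_le[of "l *\<^sub>R A"] by (simp add: mult_ac)
  finally show ?thesis
    by (simp add: mult_left_mono mult_right_mono Kmul_nonneg mult.assoc)
qed

text \<open>
  Before the uncontrolled step the state is multiplied by \<open>exp (l (A - k (1 - i \<nu>)))\<close>. The large constant
  \<open>k\<close> cancels in the conjugated linear flow, but it makes the state so small that the nonlinear
  contribution, of order \<open>2 \<sigma> + 1 \<ge> 3\<close>, survives multiplication by the inverse exponential only as
  \<open>exp (- 2 l)\<close>.
\<close>

lemma steer_square:
  fixes A :: "(int^'d) l2" and A1 A2 m1 m2 :: "'d \<Rightarrow> (int^'d) l2"
  defines "m \<equiv> mul (cst (1 + \<i> * complex_of_real \<nu>)) (\<Sum>j\<in>UNIV. mul (A1 j) (A1 j))"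
  assumes A: "\<And>j. has_partial j A (A1 j)" "\<And>j. has_partial j (A1 j) (A2 j)"
    and m: "\<And>j. has_partial j m (m1 j)" "\<And>j. has_partial j (m1 j) (m2 j)"
    and sA: "\<And>t. steer (t *\<^sub>R A)" and sc: "\<And>t. steer (t *\<^sub>R cst (1 - \<i> * complex_of_real \<nu>))"
  shows "steer m"
  unfolding steer_def
proof (intro allI impI)
  fix x0 :: "(int^'d) l2" and e T0 :: real assume e: "0 < e" and T0: "0 < T0"
  define p where "p = 2 * \<sigma> + 1"
  define \<alpha> where "\<alpha> = Kmul * norm A"
  have \<alpha>0: "0 \<le> \<alpha>" by (simp add: \<alpha>_def Kmul_nonneg)
  \<comment> \<open>The state has size \<open>exp (- l (\<alpha> + 1))\<close> and the inverse
    exponential costs \<open>exp (l (3 \<alpha> + 1))\<close>. The third power of the former times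
    the latter is \<open>exp (- 2 l)\<close>, whatever \<open>\<alpha>\<close> is.\<close>
  define k where "k = 2 * \<alpha> + 1"
  define A' where "A' = A - k *\<^sub>R cst (1 - \<i> * complex_of_real \<nu>)"
  \<comment> \<open>Constants have no derivative, so the limit multiplier \<open>m\<close> is
    unchanged by the shift.\<close>
  have A': "has_partial j A' (A1 j)" for j
    using has_partial_diff[OF A(1) has_partial_scaleR[OF has_partial_cst]] by (simp add: A'_def)
  have sA': "steer (t *\<^sub>R A')" for t
  proof -
    have "t *\<^sub>R A' = t *\<^sub>R A + (- (t * k)) *\<^sub>R cst (1 - \<i> * complex_of_real \<nu>)"
      by (simp add: A'_def scaleR_diff_right)
    then show ?thesis using steer_add[OF sA[of t] sc[of "- (t * k)"]] by (simp only:)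
  qed
  obtain C where C: "0 \<le> C" "\<And>x. norm (nonlin \<mu> \<sigma> x) \<le> C * norm x ^ p"
    using nonlin_growth[of \<mu> \<sigma>] unfolding p_def by blast
  have p0: "0 < p" by (simp add: p_def)
  obtain M r where r: "0 < r" and free: "\<And>x T. norm x \<le> r \<Longrightarrow> 0 \<le> T \<Longrightarrow> T \<le> 1 \<Longrightarrow>
      \<exists>a. sol (\<lambda>_. 0) T x a \<and> norm (a T - exp (V * T) *\<^sub>R heat \<nu> T x) \<le> M * norm x ^ p"
    using free_evolution[OF p0 C] by blast
  define E where "E l = Exp (- (l *\<^sub>R A'))" for l
  define x where "x l = mul (Exp (l *\<^sub>R A')) x0" for l
  define n1 where "n1 = Kmul * norm (cst 1)"
  have n10: "0 \<le> n1" by (simp add: n1_def Kmul_nonneg)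
  have xb: "norm (x l) \<le> n1 * norm x0 * exp (- l * (\<alpha> + 1))" if "0 \<le> l" for l
  proof -
    have "norm (x l) \<le> exp (- (l * k)) * (n1 * exp (l * \<alpha>) * norm x0)"
      using norm_mul_Exp_shift_le[of l A k x0] that by (simp add: x_def A'_def n1_def \<alpha>_def)
    also have "\<dots> = n1 * norm x0 * exp (- (l * k) + l * \<alpha>)" by (simp only: exp_add mult_ac)
    also have "- (l * k) + l * \<alpha> = - l * (\<alpha> + 1)" by (simp add: k_def algebra_simps)
    finally show ?thesis .
  qed
  have Eb: "norm (mul (E l) z) \<le> n1 * exp (l * (3 * \<alpha> + 1)) * norm z" if "0 \<le> l" for l z
  proof -
    have "norm (mul (E l) z) \<le> exp (l * k) * (n1 * exp (l * \<alpha>) * norm z)"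
      using norm_mul_Exp_shift_le[of "- l" A k z] that by (simp add: E_def A'_def n1_def \<alpha>_def)
    also have "\<dots> = n1 * exp (l * k + l * \<alpha>) * norm z" by (simp only: exp_add mult_ac)
    also have "l * k + l * \<alpha> = l * (3 * \<alpha> + 1)" by (simp add: k_def algebra_simps)
    finally show ?thesis .
  qed
  \<comment> \<open>The first summand bounds the nonlinear contribution after the inverse
    exponential, the second is the error of the conjugated linear flow.\<close>
  define err where "err l = n1 * exp (l * (3 * \<alpha> + 1)) * (\<bar>M\<bar> * norm (x l) ^ p)
      + norm (exp (V * (1 / l\<^sup>2)) *\<^sub>R mul (E l) (heat \<nu> (1 / l\<^sup>2) (x l)) - mul (Exp m) x0)" for l
  have e2: "((\<lambda>l::real. exp (- 2 * l)) \<longlongrightarrow> 0) at_top"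
    by (rule filterlim_compose[OF exp_at_bot filterlim_tendsto_neg_mult_at_bot[OF tendsto_const _ filterlim_ident]])
      simp
  have sq: "((\<lambda>l::real. 1 / l\<^sup>2) \<longlongrightarrow> 0) at_top"
    by (rule tendsto_divide_0[OF tendsto_const])
      (intro filterlim_at_top_imp_at_infinity filterlim_pow_at_top filterlim_ident, simp)
  have L1: "((\<lambda>l. n1 * exp (l * (3 * \<alpha> + 1)) * (\<bar>M\<bar> * norm (x l) ^ p)) \<longlongrightarrow> 0) at_top"
  proof (rule Lim_null_comparison)
    define D where "D = n1 * \<bar>M\<bar> * (n1 * norm x0) ^ p"
    show "((\<lambda>l. D * exp (- 2 * l)) \<longlongrightarrow> 0) at_top" by (rule tendsto_mult_right_zero[OF e2])
    have "norm (n1 * exp (l * (3 * \<alpha> + 1)) * (\<bar>M\<bar> * norm (x l) ^ p)) \<le> D * exp (- 2 * l)" if l: "0 \<le> l" for l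
    proof -
      have "norm (x l) ^ p \<le> (n1 * norm x0 * exp (- l * (\<alpha> + 1))) ^ p"
        by (intro power_mono xb l) simp
      also have "\<dots> = (n1 * norm x0) ^ p * exp (- l * (\<alpha> + 1)) ^ p" by (rule power_mult_distrib)
      also have "\<dots> \<le> (n1 * norm x0) ^ p * exp (- l * (\<alpha> + 1)) ^ 3"
      proof (intro mult_left_mono power_decreasing zero_le_power mult_nonneg_nonneg n10 norm_ge_zero)
        show "3 \<le> p" using \<sigma> by (simp add: p_def)
        show "exp (- l * (\<alpha> + 1)) \<le> 1" using l \<alpha>0 by simp
      qed simp
      also have "exp (- l * (\<alpha> + 1)) ^ 3 = exp (- l * (3 * \<alpha> + 3))"
        unfolding exp_of_nat_mult[symmetric] by (simp add: algebra_simps)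
      finally have "n1 * exp (l * (3 * \<alpha> + 1)) * (\<bar>M\<bar> * norm (x l) ^ p)
          \<le> n1 * exp (l * (3 * \<alpha> + 1)) * (\<bar>M\<bar> * ((n1 * norm x0) ^ p * exp (- l * (3 * \<alpha> + 3))))"
        by (intro mult_left_mono mult_nonneg_nonneg n10) auto
      also have "\<dots> = D * (exp (l * (3 * \<alpha> + 1)) * exp (- l * (3 * \<alpha> + 3)))" by (simp add: D_def mult_ac)
      also have "exp (l * (3 * \<alpha> + 1)) * exp (- l * (3 * \<alpha> + 3)) = exp (- 2 * l)"
        unfolding exp_add[symmetric] by (simp add: algebra_simps)
      finally show ?thesis using n10 by (simp add: abs_mult)
    qed
    then show "\<forall>\<^sub>F l in at_top. norm (n1 * exp (l * (3 * \<alpha> + 1)) * (\<bar>M\<bar> * norm (x l) ^ p)) \<le> D * exp (- 2 * l)"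
      by (intro eventually_mono[OF eventually_ge_at_top[of 0]])
  qed
  have L2: "((\<lambda>l. norm (exp (V * (1 / l\<^sup>2)) *\<^sub>R mul (E l) (heat \<nu> (1 / l\<^sup>2) (x l)) - mul (Exp m) x0)) \<longlongrightarrow> 0) at_top"
  proof -
    have "((\<lambda>l. mul (E l) (heat \<nu> (1 / l\<^sup>2) (x l))) \<longlongrightarrow> mul (Exp m) x0) at_top"
      unfolding E_def x_def m_def using conjugated_limit[OF A' A(2) m(1)[unfolded m_def] m(2)] .
    moreover have "((\<lambda>l. exp (V * (1 / l\<^sup>2))) \<longlongrightarrow> exp (V * 0)) at_top"
      by (intro tendsto_exp tendsto_mult tendsto_const sq)
    ultimately have "((\<lambda>l. exp (V * (1 / l\<^sup>2)) *\<^sub>R mul (E l) (heat \<nu> (1 / l\<^sup>2) (x l)) - mul (Exp m) x0)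
        \<longlongrightarrow> exp (V * 0) *\<^sub>R mul (Exp m) x0 - mul (Exp m) x0) at_top"
      by (intro tendsto_diff tendsto_scaleR tendsto_const)
    then show ?thesis by (intro tendsto_norm_zero) simp
  qed
  have "(err \<longlongrightarrow> 0 + 0) at_top" unfolding err_def[abs_def] by (rule tendsto_add[OF L1 L2])
  then have "\<forall>\<^sub>F l in at_top. err l < e / 2" using e by (intro order_tendstoD(2)) auto
  moreover have "\<forall>\<^sub>F l in at_top. norm (x l) < r"
  proof -
    have "((\<lambda>l. n1 * norm x0 / l) \<longlongrightarrow> 0) at_top"
      by (rule tendsto_divide_0[OF tendsto_const]) (simp add: filterlim_at_top_imp_at_infinity filterlim_ident)
    then have "\<forall>\<^sub>F l in at_top. n1 * norm x0 / l < r" using r by (rule order_tendstoD(2))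
    with eventually_gt_at_top[of 0] show ?thesis
    proof eventually_elim
      case (elim l)
      have "l \<le> exp (l * (\<alpha> + 1))"
      proof -
        have "l * 1 \<le> l * (\<alpha> + 1)" using elim(1) \<alpha>0 by (intro mult_left_mono) auto
        then show ?thesis using exp_ge_add_one_self[of "l * (\<alpha> + 1)"] by linarith
      qed
      then have "inverse (exp (l * (\<alpha> + 1))) \<le> inverse l" using elim(1) by (intro le_imp_inverse_le)
      then have "n1 * norm x0 * exp (- l * (\<alpha> + 1)) \<le> n1 * norm x0 * inverse l"
        using n10 by (intro mult_left_mono) (auto simp: exp_minus)
      then show ?case using xb[of l] elim by (simp add: divide_inverse)
    qed
  qed
  moreover have "\<forall>\<^sub>F l in at_top. 1 / l\<^sup>2 < min 1 (T0 / 3)"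
    using sq T0 by (intro order_tendstoD(2)) auto
  moreover have "\<forall>\<^sub>F l in at_top. (0::real) < l" by (rule eventually_gt_at_top)
  ultimately have "\<forall>\<^sub>F l in at_top. err l < e / 2 \<and> norm (x l) < r \<and> 1 / l\<^sup>2 < min 1 (T0 / 3) \<and> 0 < l"
    by eventually_elim auto
  then obtain l where l: "err l < e / 2" "norm (x l) < r" "1 / l\<^sup>2 < min 1 (T0 / 3)" "0 < l"
    using eventually_happens'[OF trivial_limit_at_top_linorder] by blast
  define \<delta> where "\<delta> = 1 / l\<^sup>2"
  have \<delta>: "0 < \<delta>" "\<delta> \<le> 1" "\<delta> < T0 / 3" using l by (auto simp: \<delta>_def)
  \<comment> \<open>The first control reaches \<open>x l\<close> only approximately. With
    \<open>l\<close> now fixed, the same error bound is continuous in the state, so a neighbourhood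
    of \<open>x l\<close> of radius \<open>\<rho>\<close> is good enough.\<close>
  define \<Phi> where "\<Phi> z = n1 * exp (l * (3 * \<alpha> + 1)) * (\<bar>M\<bar> * norm z ^ p)
      + norm (exp (V * \<delta>) *\<^sub>R mul (E l) (heat \<nu> \<delta> z) - mul (Exp m) x0)" for z
  have "(\<Phi> \<longlongrightarrow> \<Phi> (x l)) (nhds (x l))"
    unfolding \<Phi>_def
    by (intro tendsto_intros tendsto_mul bounded_linear.tendsto[OF bounded_linear_heat] filterlim_ident)
  moreover have "\<Phi> (x l) < e / 2" using l(1) by (simp add: \<Phi>_def err_def \<delta>_def)
  ultimately have "\<forall>\<^sub>F z in nhds (x l). \<Phi> z < e / 2" by (rule order_tendstoD(2))
  moreover have "\<forall>\<^sub>F z in nhds (x l). norm z < r"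
    by (rule order_tendstoD(2)[OF tendsto_norm[OF filterlim_ident] l(2)])
  ultimately have "\<forall>\<^sub>F z in nhds (x l). \<Phi> z < e / 2 \<and> norm z < r" by eventually_elim auto
  then obtain \<rho> where \<rho>: "0 < \<rho>" "\<And>z. dist z (x l) < \<rho> \<Longrightarrow> \<Phi> z < e / 2 \<and> norm z < r"
    unfolding eventually_nhds_metric by blast
  obtain T1 u1 a1 where 1: "0 < T1" "T1 < T0 / 3" "flat_control T1 u1" "sol u1 T1 x0 a1" "norm (a1 T1 - x l) < \<rho>"
    using steerE[OF sA'[of l], of \<rho> "T0 / 3" x0] \<rho>(1) T0 unfolding x_def by auto
  have z: "\<Phi> (a1 T1) < e / 2" "norm (a1 T1) < r" using \<rho>(2)[of "a1 T1"] 1(5) by (auto simp: dist_norm)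
  obtain a2 where 2: "sol (\<lambda>_. 0) \<delta> (a1 T1) a2" "norm (a2 \<delta> - exp (V * \<delta>) *\<^sub>R heat \<nu> \<delta> (a1 T1)) \<le> M * norm (a1 T1) ^ p"
    using free[of "a1 T1" \<delta>] z(2) \<delta> by auto
  have f0: "flat_control \<delta> (\<lambda>_. 0 :: real^'q)" by (simp add: flat_control_def smooth_fun_zero)
  obtain T3 u3 a3 where 3: "0 < T3" "T3 < T0 / 3" "flat_control T3 u3" "sol u3 T3 (a2 \<delta>) a3" "norm (a3 T3 - mul (E l) (a2 \<delta>)) < e / 2"
    using steerE[OF sA'[of "- l"], of "e / 2" "T0 / 3" "a2 \<delta>"] e T0 unfolding E_def by auto
  obtain a12 where 12: "sol (\<lambda>t. u1 t + 0) (T1 + \<delta>) x0 a12" "a12 (T1 + \<delta>) = a2 \<delta>"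
    using sol_concat[OF _ _ 1(3) f0 1(4) 2(1)] 1(1) \<delta>(1) by auto
  have f12: "flat_control (T1 + \<delta>) (\<lambda>t. u1 t + 0)" using flat_concat[OF 1(1) \<delta>(1) 1(3) f0] by simp
  obtain a where a: "sol (\<lambda>t. (u1 t + 0) + u3 (t - (T1 + \<delta>))) (T1 + \<delta> + T3) x0 a" "a (T1 + \<delta> + T3) = a3 T3"
    using sol_concat[OF _ _ f12 3(3) 12(1)] 3(4) 12(2) 1(1) \<delta>(1) 3(1) by auto
  have "norm (mul (E l) (a2 \<delta>) - mul (Exp m) x0) \<le> \<Phi> (a1 T1)"
  proof -
    have "mul (E l) (a2 \<delta>) - mul (Exp m) x0 = mul (E l) (a2 \<delta> - exp (V * \<delta>) *\<^sub>R heat \<nu> \<delta> (a1 T1))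
        + (exp (V * \<delta>) *\<^sub>R mul (E l) (heat \<nu> \<delta> (a1 T1)) - mul (Exp m) x0)"
      by (simp add: mul_distribs)
    also have "norm \<dots> \<le> norm (mul (E l) (a2 \<delta> - exp (V * \<delta>) *\<^sub>R heat \<nu> \<delta> (a1 T1)))
        + norm (exp (V * \<delta>) *\<^sub>R mul (E l) (heat \<nu> \<delta> (a1 T1)) - mul (Exp m) x0)"
      by (rule norm_triangle_ineq)
    also have "norm (mul (E l) (a2 \<delta> - exp (V * \<delta>) *\<^sub>R heat \<nu> \<delta> (a1 T1)))
        \<le> n1 * exp (l * (3 * \<alpha> + 1)) * norm (a2 \<delta> - exp (V * \<delta>) *\<^sub>R heat \<nu> \<delta> (a1 T1))"
      by (rule Eb) (use l(4) in simp)
    also have "\<dots> \<le> n1 * exp (l * (3 * \<alpha> + 1)) * (\<bar>M\<bar> * norm (a1 T1) ^ p)"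
    proof (intro mult_left_mono mult_nonneg_nonneg n10 exp_ge_zero)
      have "M * norm (a1 T1) ^ p \<le> \<bar>M\<bar> * norm (a1 T1) ^ p" by (intro mult_right_mono) auto
      then show "norm (a2 \<delta> - exp (V * \<delta>) *\<^sub>R heat \<nu> \<delta> (a1 T1)) \<le> \<bar>M\<bar> * norm (a1 T1) ^ p" using 2(2) by linarith
    qed
    finally show ?thesis by (simp add: \<Phi>_def)
  qed
  then have "norm (a3 T3 - mul (Exp m) x0) < e"
    using norm_triangle_ineq[of "a3 T3 - mul (E l) (a2 \<delta>)" "mul (E l) (a2 \<delta>) - mul (Exp m) x0"] 3(5) z(1) by simp
  then have "norm (a (T1 + \<delta> + T3) - mul (Exp m) x0) < e" by (simp only: a(2))
  moreover have "0 < T1 + \<delta> + T3" "T1 + \<delta> + T3 < T0" using 1 3 \<delta> by auto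
  moreover have "flat_control (T1 + \<delta> + T3) (\<lambda>t. (u1 t + 0) + u3 (t - (T1 + \<delta>)))"
    by (rule flat_concat[OF _ 3(1) f12 3(3)]) (use 1(1) \<delta>(1) in simp)
  ultimately show "\<exists>T u a. 0 < T \<and> T < T0 \<and> flat_control T u \<and> sol u T x0 a \<and> norm (a T - mul (Exp m) x0) < e"
    using a(1) by blast
qed

end

section \<open>Differentiable functions on the torus\<close>

lemma iter_partial_Nil [simp]: "iter_partial [] f = f"
  and iter_partial_Cons [simp]: "iter_partial (j # js) f = partial j (iter_partial js f)"
  and iter_partial_snoc: "iter_partial (js @ [j]) f = iter_partial js (partial j f)"
  by (simp_all add: iter_partial_def)

lemma torus_periodic_iter_partial: "torus_periodic f \<Longrightarrow> torus_periodic (iter_partial js f)"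
  by (induction js) (simp_all add: torus_periodic_partial)

lemma Cr_partial:
  assumes "f \<in> Cr_torus (Suc n)"
  shows "partial j f \<in> Cr_torus n"
  using assms unfolding Cr_torus_def
  by (auto simp: torus_periodic_partial iter_partial_snoc[symmetric])

lemma CrD:
  assumes "f \<in> Cr_torus n"
  shows "torus_periodic f" "length js < n \<Longrightarrow> iter_partial js f differentiable (at x)"
    "length js \<le> n \<Longrightarrow> continuous_on UNIV (iter_partial js f)"
  using assms by (auto simp: Cr_torus_def)

lemma Cr_continuous: "f \<in> Cr_torus n \<Longrightarrow> continuous_on UNIV f"
  using CrD(3)[of f n "[]"] by simp

lemma Cr_differentiable: "f \<in> Cr_torus (Suc n) \<Longrightarrow> f differentiable (at x)"
  using CrD(2)[of f "Suc n" "[]"] by simp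

lemma iter_partial_bounded_linear:
  assumes h: "bounded_linear h" and f: "f \<in> Cr_torus n" and l: "length js \<le> n"
  shows "iter_partial js (\<lambda>x. h (f x)) = (\<lambda>x. h (iter_partial js f x))"
  using l
proof (induction js)
  case (Cons j js)
  have d: "(iter_partial js f has_derivative frechet_derivative (iter_partial js f) (at x)) (at x)" for x
    using CrD(2)[OF f, of js x] Cons.prems by (simp add: frechet_derivative_works[symmetric])
  have "partial j (\<lambda>x. h (iter_partial js f x)) x = h (partial j (iter_partial js f) x)" for x
    using partial_eqI[OF bounded_linear.has_derivative[OF h d[of x]]] by (simp add: partial_def)
  then show ?case using Cons by auto
qed simp

lemma Cr_bounded_linear:
  fixes f :: "real^'d \<Rightarrow> 'b::real_normed_vector"
  assumes h: "bounded_linear h" and f: "f \<in> Cr_torus n"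
  shows "(\<lambda>x. h (f x)) \<in> Cr_torus n"
  unfolding Cr_torus_def
proof (intro CollectI conjI allI impI)
  show "torus_periodic (\<lambda>x. h (f x))" using CrD(1)[OF f] by (simp add: torus_periodic_def)
  fix js :: "'d list"
  {
    fix x assume l: "length js < n"
    show "iter_partial js (\<lambda>x. h (f x)) differentiable (at x)"
      using bounded_linear.has_derivative[OF h frechet_derivative_works[THEN iffD1, OF CrD(2)[OF f l, of x]]] l
      by (simp add: iter_partial_bounded_linear[OF h f]) (rule differentiableI)
  }
  assume l: "length js \<le> n"
  show "continuous_on UNIV (iter_partial js (\<lambda>x. h (f x)))"
    unfolding iter_partial_bounded_linear[OF h f l]
    by (rule bounded_linear.continuous_on[OF h CrD(3)[OF f l]])
qed

lemma iter_partial_add: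
  assumes f: "f \<in> Cr_torus n" and g: "g \<in> Cr_torus n" and l: "length js \<le> n"
  shows "iter_partial js (\<lambda>x. f x + g x) = (\<lambda>x. iter_partial js f x + iter_partial js g x)"
  using l
proof (induction js)
  case (Cons j js)
  have d: "(iter_partial js f has_derivative frechet_derivative (iter_partial js f) (at x)) (at x)"
    "(iter_partial js g has_derivative frechet_derivative (iter_partial js g) (at x)) (at x)" for x
    using CrD(2)[OF f, of js x] CrD(2)[OF g, of js x] Cons.prems
    by (simp_all add: frechet_derivative_works[symmetric])
  have "partial j (\<lambda>x. iter_partial js f x + iter_partial js g x) x
      = partial j (iter_partial js f) x + partial j (iter_partial js g) x" for x
    using partial_eqI[OF has_derivative_add[OF d[of x]]] by (simp add: partial_def)
  then show ?case using Cons by auto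
qed simp

lemma Cr_add:
  fixes f :: "real^'d \<Rightarrow> 'b::real_normed_vector"
  assumes f: "f \<in> Cr_torus n" and g: "g \<in> Cr_torus n"
  shows "(\<lambda>x. f x + g x) \<in> Cr_torus n"
  unfolding Cr_torus_def
proof (intro CollectI conjI allI impI)
  show "torus_periodic (\<lambda>x. f x + g x)" using CrD(1)[OF f] CrD(1)[OF g] by (simp add: torus_periodic_def)
  fix js :: "'d list"
  {
    fix x assume l: "length js < n"
    show "iter_partial js (\<lambda>x. f x + g x) differentiable (at x)"
      using l CrD(2)[OF f l, of x] CrD(2)[OF g l, of x] by (simp add: iter_partial_add[OF f g])
  }
  assume l: "length js \<le> n"
  show "continuous_on UNIV (iter_partial js (\<lambda>x. f x + g x))"
    unfolding iter_partial_add[OF f g l] by (intro continuous_intros CrD(3)[OF f l] CrD(3)[OF g l])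
qed

text \<open>Subtracting the integer part of \<open>x $ j / (2 * pi)\<close> in every coordinate;
  bounds on the compact cell thereby become bounds on the whole space.\<close>

lemma torus_reduce:
  fixes f :: "real^'d \<Rightarrow> 'b"
  assumes "torus_periodic f"
  shows "\<exists>y\<in>torus_cell. f y = f x"
proof -
  have nat: "f (x + axis j (2 * pi * real n)) = f x" for x j and n :: nat
  proof (induction n)
    case (Suc n)
    have e: "x + axis j (2 * pi * real (Suc n)) = (x + axis j (2 * pi * real n)) + axis j (2 * pi)"
      by (simp add: vec_eq_iff axis_def algebra_simps)
    show ?case unfolding e torus_periodicD[OF assms] by (rule Suc)
  next
    case 0
    have "x + axis j (2 * pi * real 0) = x" by (simp add: axis_def vec_eq_iff)
    then show ?case by (rule arg_cong)
  qed
  have int: "f (x + axis j (2 * pi * real_of_int n)) = f x" for x j n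
  proof (cases "n \<ge> 0")
    case True
    then show ?thesis using nat[of x j "nat n"] by simp
  next
    case False
    have "(x + axis j (2 * pi * real_of_int n)) + axis j (2 * pi * real (nat (- n))) = x"
      using False by (simp add: vec_eq_iff axis_def)
    then show ?thesis using nat[of "x + axis j (2 * pi * real_of_int n)" j "nat (- n)"] by (simp only:)
  qed
  have "f (x + (\<Sum>j\<in>J. axis j (2 * pi * real_of_int (n j)))) = f x" if "finite J" for J n
    using that
  proof (induction J)
    case (insert j J)
    have "x + (\<Sum>j\<in>insert j J. axis j (2 * pi * real_of_int (n j)))
        = (x + (\<Sum>j\<in>J. axis j (2 * pi * real_of_int (n j)))) + axis j (2 * pi * real_of_int (n j))"
      using insert by (simp add: algebra_simps)
    then show ?case using int[of "x + (\<Sum>j\<in>J. axis j (2 * pi * real_of_int (n j)))" j "n j"] insert(3) by (simp only:)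
  qed simp
  note * = this[of UNIV "\<lambda>j. - \<lfloor>x $ j / (2 * pi)\<rfloor>"]
  let ?y = "x + (\<Sum>j\<in>UNIV. axis j (2 * pi * real_of_int (- \<lfloor>x $ j / (2 * pi)\<rfloor>)))"
  have y: "?y $ i = x $ i - 2 * pi * real_of_int \<lfloor>x $ i / (2 * pi)\<rfloor>" for i
    by (simp add: axis_def sum.delta)
  have "?y \<in> torus_cell"
    unfolding torus_cell_def mem_box_cart y
  proof
    fix i
    have p: "2 * pi > 0" by simp
    have "2 * pi * w \<le> x $ i" if "w \<le> x $ i / (2 * pi)" for w
      using that pos_le_divide_eq[OF p, of w "x $ i"] by (simp add: mult.commute[of w])
    from this[OF of_int_floor_le] have 1: "2 * pi * real_of_int \<lfloor>x $ i / (2 * pi)\<rfloor> \<le> x $ i" .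
    have "x $ i \<le> 2 * pi * w" if "x $ i / (2 * pi) \<le> w" for w
      using that pos_divide_le_eq[OF p, of "x $ i" w] by (simp add: mult.commute[of w])
    moreover have "x $ i / (2 * pi) \<le> real_of_int \<lfloor>x $ i / (2 * pi)\<rfloor> + 1" by linarith
    ultimately have 2: "x $ i \<le> 2 * pi * (real_of_int \<lfloor>x $ i / (2 * pi)\<rfloor> + 1)" .
    show "0 $ i \<le> x $ i - 2 * pi * real_of_int \<lfloor>x $ i / (2 * pi)\<rfloor> \<and>
        x $ i - 2 * pi * real_of_int \<lfloor>x $ i / (2 * pi)\<rfloor> \<le> (\<chi> i. 2 * pi) $ i"
      using 1 2 by (simp add: distrib_left)
  qed
  with * show ?thesis by auto
qed

text \<open>A supremum controls its members only when the set is bounded above. Periodicity and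
  continuity bound each derivative, and there are finitely many lists of length at most
  \<open>n\<close>.\<close>

lemma Cr_norm_bound:
  fixes f :: "real^'d \<Rightarrow> 'b::real_normed_vector"
  assumes f: "f \<in> Cr_torus n" and l: "length js \<le> n"
  shows "norm (iter_partial js f x) \<le> Cr_norm n f"
proof -
  let ?L = "{js :: 'd list. length js \<le> n}"
  have "\<exists>B. \<forall>x. norm (iter_partial js f x) \<le> B" if "length js \<le> n" for js
  proof -
    have "compact (iter_partial js f ` torus_cell)"
      by (rule compact_continuous_image[OF continuous_on_subset[OF CrD(3)[OF f that]]]) (auto simp: torus_cell_def)
    then have "bounded (iter_partial js f ` torus_cell)" by (rule compact_imp_bounded)
    then obtain B where B: "\<forall>y\<in>iter_partial js f ` torus_cell. norm y \<le> B" unfolding bounded_iff by blast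
    have "norm (iter_partial js f x) \<le> B" for x
    proof -
      obtain y where "y \<in> torus_cell" "iter_partial js f y = iter_partial js f x"
        using torus_reduce[OF torus_periodic_iter_partial[OF CrD(1)[OF f]]] by blast
      then show ?thesis using B by (metis imageI)
    qed
    then show ?thesis by blast
  qed
  then obtain B where B: "\<And>js x. length js \<le> n \<Longrightarrow> norm (iter_partial js f x) \<le> B js" by metis
  have fin: "finite ?L" using finite_lists_length_le[of "UNIV :: 'd set" n] by simp
  have "bdd_above ((\<lambda>(js, x). norm (iter_partial js f x)) ` (?L \<times> UNIV))"
  proof (rule bdd_aboveI2)
    fix z assume z: "z \<in> ?L \<times> (UNIV :: (real^'d) set)"
    then obtain js x where zz: "z = (js, x)" "length js \<le> n" by auto
    have "norm (iter_partial js f x) \<le> \<bar>B js\<bar>" using B[OF zz(2), of x] by linarith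
    also have "\<dots> \<le> (\<Sum>js\<in>?L. \<bar>B js\<bar>)" by (rule member_le_sum) (use zz fin in auto)
    finally show "(case z of (js, x) \<Rightarrow> norm (iter_partial js f x)) \<le> (\<Sum>js\<in>?L. \<bar>B js\<bar>)" using zz by simp
  qed
  then show ?thesis
    unfolding Cr_norm_def using cSUP_upper[of "(js, x)" "?L \<times> UNIV" "\<lambda>(js, x). norm (iter_partial js f x)"] l by simp
qed

lemma smooth_bounded_linear:
  assumes h: "bounded_linear h" and f: "f \<in> smooth_torus"
  shows "(\<lambda>x. h (f x)) \<in> smooth_torus"
  unfolding smooth_torus_def
proof
  fix n
  have "f \<in> Cr_torus n" using f by (simp add: smooth_torus_def)
  then show "(\<lambda>x. h (f x)) \<in> Cr_torus n" by (rule Cr_bounded_linear[OF h])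
qed

lemma smooth_Cr: "f \<in> smooth_torus \<Longrightarrow> f \<in> Cr_torus n"
  by (simp add: smooth_torus_def)

section \<open>The saturation process\<close>

definition representable :: "(real ^ 'd \<Rightarrow> real) set \<Rightarrow> (real ^ 'd \<Rightarrow> real) \<Rightarrow> bool" where
  "representable H \<phi> \<longleftrightarrow> (\<exists>n\<ge>1. \<exists>\<theta>::nat \<Rightarrow> real ^ 'd \<Rightarrow> real. (\<forall>j\<le>n. \<theta> j \<in> H) \<and>
     \<phi> = (\<lambda>x. \<theta> 0 x + (\<Sum>j=1..n. grad_square (\<theta> j) x)))"

lemma representableE:
  assumes "representable H \<phi>"
  obtains n :: nat and \<theta> where "n \<ge> 1" "\<And>j. j \<le> n \<Longrightarrow> \<theta> j \<in> H" "\<phi> = (\<lambda>x. \<theta> 0 x + (\<Sum>j=1..n. grad_square (\<theta> j) x))"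
  using assms unfolding representable_def
  by (elim exE conjE) (rule that, assumption, erule allE, erule mp, assumption, assumption)

lemma grad_square_zero: "grad_square (\<lambda>_. 0) x = 0"
proof -
  have "partial j (\<lambda>_. 0 :: real) x = 0" for j
    using partial_eqI[OF has_derivative_const[of "0 :: real" "at x"]] by simp
  then show ?thesis by (simp add: grad_square_def)
qed

lemma representable_zero:
  fixes H :: "(real ^ 'd \<Rightarrow> real) set"
  assumes "real_fun.subspace H"
  shows "representable H 0"
proof -
  have z: "(\<lambda>_. 0) \<in> H"
    using real_fun.subspace_0[OF assms] by (simp only: zero_fun_def)
  have e: "0 = (\<lambda>x :: real ^ 'd. 0 + (\<Sum>j = 1..1::nat. grad_square (\<lambda>_. 0) x))"
    by (rule ext) (simp add: grad_square_zero)
  show ?thesis unfolding representable_def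
    by (rule exI[of _ "1 :: nat"], rule conjI, simp, rule exI[of _ "\<lambda>_ _. 0"], rule conjI,
      intro allI impI, rule z, rule e)
qed

text \<open>The linear parts at index \<open>0\<close> are added, the lists of squared gradients are
  concatenated with the second one shifted by \<open>n\<close>.\<close>

lemma representable_add:
  assumes H: "real_fun.subspace H" and \<phi>: "representable H \<phi>" and \<psi>: "representable H \<psi>"
  shows "representable H (\<phi> + \<psi>)"
proof -
  obtain n :: nat and \<theta> where n: "n \<ge> 1" "\<And>j. j \<le> n \<Longrightarrow> \<theta> j \<in> H" "\<phi> = (\<lambda>x. \<theta> 0 x + (\<Sum>j=1..n. grad_square (\<theta> j) x))"
    by (rule representableE[OF \<phi>]) (rule that)
  obtain m :: nat and \<eta> where m: "m \<ge> 1" "\<And>j. j \<le> m \<Longrightarrow> \<eta> j \<in> H" "\<psi> = (\<lambda>x. \<eta> 0 x + (\<Sum>j=1..m. grad_square (\<eta> j) x))"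
    by (rule representableE[OF \<psi>]) (rule that)
  define \<zeta> where "\<zeta> j = (if j = 0 then \<theta> 0 + \<eta> 0 else if j \<le> n then \<theta> j else \<eta> (j - n))" for j :: nat
  have \<zeta>H: "\<zeta> j \<in> H" if "j \<le> n + m" for j
  proof (cases "j = 0")
    case True
    then show ?thesis using real_fun.subspace_add[OF H n(2) m(2)] by (simp add: \<zeta>_def)
  next
    case False
    then show ?thesis using that n(2)[of j] m(2)[of "j - n"] by (cases "j \<le> n") (simp_all add: \<zeta>_def)
  qed
  have eq: "(\<phi> + \<psi>) x = \<zeta> 0 x + (\<Sum>j=1..n + m. grad_square (\<zeta> j) x)" for x
  proof -
    have "(\<Sum>j=1..n + m. grad_square (\<zeta> j) x) = (\<Sum>j=1..n. grad_square (\<zeta> j) x) + (\<Sum>j=n + 1..n + m. grad_square (\<zeta> j) x)"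
      by (rule sum.ub_add_nat) simp
    also have "(\<Sum>j=1..n. grad_square (\<zeta> j) x) = (\<Sum>j=1..n. grad_square (\<theta> j) x)"
      by (intro sum.cong) (auto simp: \<zeta>_def)
    also have "(\<Sum>j=n + 1..n + m. grad_square (\<zeta> j) x) = (\<Sum>j=1..m. grad_square (\<zeta> (j + n)) x)"
      using sum.shift_bounds_cl_nat_ivl[of "\<lambda>j. grad_square (\<zeta> j) x" 1 n m] by (simp add: add.commute)
    also have "\<dots> = (\<Sum>j=1..m. grad_square (\<eta> j) x)"
      by (intro sum.cong) (auto simp: \<zeta>_def)
    finally show ?thesis by (simp add: n(3) m(3) \<zeta>_def)
  qed
  show ?thesis unfolding representable_def
  proof (intro exI conjI allI impI)
    show "1 \<le> n + m" using n(1) by simp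
    show "\<zeta> j \<in> H" if "j \<le> n + m" for j by (rule \<zeta>H[OF that])
    show "\<phi> + \<psi> = (\<lambda>x. \<zeta> 0 x + (\<Sum>j=1..n + m. grad_square (\<zeta> j) x))" by (rule ext) (rule eq)
  qed
qed

text \<open>The greatest element has to be exhibited: it is the span of the union of all admissible
  subspaces. Representable functions need not be closed under negative multiples; but a scalar
  multiple of a generator stays in the admissible subspace of that generator, and sums are covered
  by \<open>representable_add\<close>.\<close>

lemma sat_step_props:
  assumes H: "real_fun.subspace H" and Hr: "H \<subseteq> Cr_torus r"
  shows "real_fun.subspace (sat_step r H)" "sat_step r H \<subseteq> Cr_torus r"
    "\<phi> \<in> sat_step r H \<Longrightarrow> representable H \<phi>"
proof -
  define P where "P G \<longleftrightarrow> real_fun.subspace G \<and> G \<subseteq> Cr_torus r \<and> (\<forall>\<phi>\<in>G. representable H \<phi>)" for G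
  define G where "G = real_fun.span (\<Union>{G. P G})"
  have 0: "(0 :: real^'a \<Rightarrow> real) \<in> Cr_torus r" using real_fun.subspace_0[OF H] Hr by blast
  have G: "\<phi> \<in> Cr_torus r \<and> representable H \<phi>" if "\<phi> \<in> G" for \<phi>
    using that unfolding G_def
  proof (induction rule: real_fun.span_induct_alt)
    case base
    show ?case using 0 representable_zero[OF H] by blast
  next
    case (step c x y)
    then obtain G' where G': "P G'" "x \<in> G'" by blast
    then have "(\<lambda>p. c * x p) \<in> G'" using real_fun.subspace_scale[of G' x c] by (simp only: P_def)
    then have cx: "(\<lambda>p. c * x p) \<in> Cr_torus r" "representable H (\<lambda>p. c * x p)" using G' by (auto simp: P_def)
    have "(\<lambda>p. c * x p) + y = (\<lambda>p. c * x p + y p)" by (simp add: fun_eq_iff)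
    then have "(\<lambda>p. c * x p) + y \<in> Cr_torus r" using Cr_add[OF cx(1) conjunct1[OF step(2)]] by simp
    moreover have "representable H ((\<lambda>p. c * x p) + y)"
      by (rule representable_add[OF H cx(2) conjunct2[OF step(2)]])
    ultimately show ?case by blast
  qed
  have PG: "P G" unfolding P_def
  proof (intro conjI ballI subsetI)
    show "real_fun.subspace G" unfolding G_def by (rule real_fun.subspace_span)
    show "\<phi> \<in> Cr_torus r" if "\<phi> \<in> G" for \<phi> using G[OF that] by (rule conjunct1)
    show "representable H \<phi>" if "\<phi> \<in> G" for \<phi> using G[OF that] by (rule conjunct2)
  qed
  have "sat_step r H = (GREATEST G. P G)" unfolding sat_step_def P_def representable_def ..
  also have "\<dots> = G"
  proof (rule Greatest_equality)
    show "P G" by (rule PG)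
    show "G' \<le> G" if "P G'" for G'
    proof
      fix \<phi> assume "\<phi> \<in> G'"
      then have "\<phi> \<in> \<Union>{G. P G}" using that by blast
      then show "\<phi> \<in> G" unfolding G_def by (rule subsetD[OF real_fun.span_superset])
    qed
  qed
  finally have "sat_step r H = G" .
  then show "real_fun.subspace (sat_step r H)" "sat_step r H \<subseteq> Cr_torus r"
    "\<phi> \<in> sat_step r H \<Longrightarrow> representable H \<phi>"
    using PG by (simp_all only: P_def)
qed

lemma span_components:
  fixes Q :: "real ^ 'd \<Rightarrow> real ^ 'q"
  assumes "\<phi> \<in> real_fun.span (range (\<lambda>j x. Q x $ j))"
  shows "\<exists>w. \<phi> = (\<lambda>x. w \<bullet> Q x)"
  using assms
proof (induction rule: real_fun.span_induct_alt)
  case base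
  show ?case by (rule exI[of _ 0]) (auto simp: fun_eq_iff)
next
  case (step c x y)
  then obtain j w where "x = (\<lambda>p. Q p $ j)" "y = (\<lambda>p. w \<bullet> Q p)" by auto
  then show ?case
    by (intro exI[of _ "axis j c + w"]) (auto simp: fun_eq_iff inner_add_left inner_axis' )
qed

section \<open>Sobolev representatives of differentiable functions\<close>

context sobolev_space
begin

lemma fourier_coeff_iter_partial:
  fixes f :: "real^'d \<Rightarrow> complex"
  assumes f: "f \<in> Cr_torus n" and m: "m \<le> n"
  shows "fourier_coeff (iter_partial (replicate m j) f) k = (\<i> * of_int (k $ j)) ^ m * fourier_coeff f k"
  using m
proof (induction m)
  case (Suc m)
  have "fourier_coeff (partial j (iter_partial (replicate m j) f)) k
      = \<i> * of_int (k $ j) * fourier_coeff (iter_partial (replicate m j) f) k"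
  proof (rule fourier_coeff_partial)
    show "torus_periodic (iter_partial (replicate m j) f)"
      by (rule torus_periodic_iter_partial[OF CrD(1)[OF f]])
    show "iter_partial (replicate m j) f differentiable (at x)" for x
      by (rule CrD(2)[OF f]) (use Suc.prems in simp)
    show "continuous_on UNIV (partial j (iter_partial (replicate m j) f))"
      using CrD(3)[OF f, of "j # replicate m j"] Suc.prems by simp
  qed
  then show ?case using Suc by simp
qed simp

text \<open>The Sobolev weight is controlled by pure powers: its base is at most
  \<open>d + 1\<close> times the maximum \<open>b\<close> of \<open>1\<close> and the squared
  coordinates, and \<open>b ^ s\<close> is one of the summands on the right. Hence only the
  derivatives of order \<open>s\<close> in a single direction have to be estimated.\<close>

lemma wt_sq_le:
  "(wt s k)\<^sup>2 \<le> real (CARD('d) + 1) ^ s * (1 + (\<Sum>j\<in>UNIV. (real_of_int (k $ j))\<^sup>2 ^ s))" for k :: "int^'d"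
proof -
  let ?a = "\<lambda>j. (real_of_int (k $ j))\<^sup>2"
  define b where "b = Max (insert 1 (range ?a))"
  have b: "1 \<le> b" "\<And>j. ?a j \<le> b" unfolding b_def by (rule Max_ge; simp)+
  have nf: "(norm (freq k))\<^sup>2 = (\<Sum>j\<in>UNIV. ?a j)"
    unfolding power2_norm_eq_inner inner_vec_def by (simp add: freq_def power2_eq_square)
  have "1 + (norm (freq k))\<^sup>2 \<le> b + (\<Sum>j\<in>(UNIV::'d set). b)"
    unfolding nf using b by (intro add_mono sum_mono) auto
  also have "\<dots> = real (CARD('d) + 1) * b" by (simp add: algebra_simps)
  finally have "(1 + (norm (freq k))\<^sup>2) ^ s \<le> (real (CARD('d) + 1) * b) ^ s"
    by (intro power_mono) (auto intro: add_nonneg_nonneg)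
  also have "\<dots> = real (CARD('d) + 1) ^ s * b ^ s" by (rule power_mult_distrib)
  also have "b ^ s \<le> 1 + (\<Sum>j\<in>UNIV. ?a j ^ s)"
  proof -
    have "b \<in> insert 1 (range ?a)" unfolding b_def by (rule Max_in) auto
    then consider "b = 1" | j where "b = ?a j" by auto
    then show ?thesis
    proof cases
      case 1
      then show ?thesis by (simp add: sum_nonneg)
    next
      case 2
      have "?a j ^ s \<le> (\<Sum>j\<in>UNIV. ?a j ^ s)" by (rule member_le_sum) auto
      then show ?thesis using 2 by simp
    qed
  qed
  finally show ?thesis by (simp add: wt_sq mult_left_mono)
qed

definition Cr_const :: real where "Cr_const = sqrt (real (CARD('d) + 1) ^ s * real (CARD('d) + 1))"

lemma Cr_const_nonneg: "Cr_const \<ge> 0" by (simp add: Cr_const_def)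

text \<open>The embedding of \<open>C^n\<close>, \<open>n >= s\<close>, into \<open>H^s\<close>:
  Bessel's inequality for \<open>f\<close> and for its \<open>s\<close>-fold derivatives in each
  coordinate direction, weighted by \<open>wt_sq_le\<close>.\<close>

lemma repr_Cr:
  fixes f :: "real^'d \<Rightarrow> complex"
  assumes f: "f \<in> Cr_torus n" and n: "s \<le> n" and B: "\<And>js x. length js \<le> n \<Longrightarrow> cmod (iter_partial js f x) \<le> B"
  shows "\<exists>z. repr f z \<and> norm z \<le> Cr_const * B"
proof (rule reprI)
  have B0: "0 \<le> B" using order_trans[OF norm_ge_zero B[of "[]" undefined]] by simp
  show "set_integrable lebesgue torus_cell f" by (rule set_integrable_torus[OF Cr_continuous[OF f]])
  show "0 \<le> Cr_const * B" using B0 Cr_const_nonneg by simp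
  fix F :: "(int^'d) set" assume F: "finite F"
  let ?D = "real (CARD('d) + 1)"
  have "(\<Sum>k\<in>F. (cmod (complex_of_real (wt s k) * fourier_coeff f k))\<^sup>2)
      \<le> (\<Sum>k\<in>F. ?D ^ s * ((cmod (fourier_coeff f k))\<^sup>2 + (\<Sum>j\<in>UNIV. (cmod (fourier_coeff (iter_partial (replicate s j) f) k))\<^sup>2)))"
  proof (rule sum_mono)
    fix k
    have "(cmod (complex_of_real (wt s k) * fourier_coeff f k))\<^sup>2 = (wt s k)\<^sup>2 * (cmod (fourier_coeff f k))\<^sup>2"
      by (simp add: norm_mult power_mult_distrib)
    also have "\<dots> \<le> ?D ^ s * (1 + (\<Sum>j\<in>UNIV. (real_of_int (k $ j))\<^sup>2 ^ s)) * (cmod (fourier_coeff f k))\<^sup>2"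
      by (intro mult_right_mono wt_sq_le) simp
    also have "\<dots> = ?D ^ s * ((cmod (fourier_coeff f k))\<^sup>2 + (\<Sum>j\<in>UNIV. (real_of_int (k $ j))\<^sup>2 ^ s * (cmod (fourier_coeff f k))\<^sup>2))"
      by (simp only: distrib_right sum_distrib_right mult_1 mult.assoc)
    also have "(\<Sum>j\<in>UNIV. (real_of_int (k $ j))\<^sup>2 ^ s * (cmod (fourier_coeff f k))\<^sup>2)
        = (\<Sum>j\<in>UNIV. (cmod (fourier_coeff (iter_partial (replicate s j) f) k))\<^sup>2)"
    proof (rule sum.cong)
      fix j
      have "(real_of_int (k $ j))\<^sup>2 ^ s = (\<bar>real_of_int (k $ j)\<bar> ^ s)\<^sup>2"
        by (subst power2_abs[symmetric]) (simp only: power_mult[symmetric] mult.commute)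
      then show "(real_of_int (k $ j))\<^sup>2 ^ s * (cmod (fourier_coeff f k))\<^sup>2 = (cmod (fourier_coeff (iter_partial (replicate s j) f) k))\<^sup>2"
        by (simp add: fourier_coeff_iter_partial[OF f n] norm_mult norm_power power_mult_distrib)
    qed simp
    finally show "(cmod (complex_of_real (wt s k) * fourier_coeff f k))\<^sup>2
        \<le> ?D ^ s * ((cmod (fourier_coeff f k))\<^sup>2 + (\<Sum>j\<in>UNIV. (cmod (fourier_coeff (iter_partial (replicate s j) f) k))\<^sup>2))" .
  qed
  also have "\<dots> = ?D ^ s * ((\<Sum>k\<in>F. (cmod (fourier_coeff f k))\<^sup>2) + (\<Sum>j\<in>UNIV. \<Sum>k\<in>F. (cmod (fourier_coeff (iter_partial (replicate s j) f) k))\<^sup>2))"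
    by (simp only: sum_distrib_left[symmetric] sum.distrib sum.swap[of _ UNIV F])
  also have "\<dots> \<le> ?D ^ s * (B\<^sup>2 + (\<Sum>j\<in>(UNIV::'d set). B\<^sup>2))"
  proof (intro mult_left_mono add_mono sum_mono)
    show "(\<Sum>k\<in>F. (cmod (fourier_coeff f k))\<^sup>2) \<le> B\<^sup>2"
      by (rule bessel_inequality[OF Cr_continuous[OF f] _ F]) (use B[of "[]"] in simp)
    show "(\<Sum>k\<in>F. (cmod (fourier_coeff (iter_partial (replicate s j) f) k))\<^sup>2) \<le> B\<^sup>2" for j
      by (rule bessel_inequality[OF CrD(3)[OF f] B F]) (use n in simp_all)
  qed simp
  also have "\<dots> = (Cr_const * B)\<^sup>2"
    by (simp add: Cr_const_def power_mult_distrib algebra_simps)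
  finally show "(\<Sum>k\<in>F. (cmod (complex_of_real (wt s k) * fourier_coeff f k))\<^sup>2) \<le> (Cr_const * B)\<^sup>2" .
qed

lemma repr_partial:
  fixes f :: "real^'d \<Rightarrow> complex"
  assumes f: "f \<in> Cr_torus (Suc n)" and n: "s \<le> n" and z: "repr f z"
  shows "\<exists>z'. repr (partial j f) z' \<and> has_partial j z z'"
proof -
  have pf: "partial j f \<in> Cr_torus n" by (rule Cr_partial[OF f])
  obtain z' where z': "repr (partial j f) z'"
    using repr_Cr[OF pf n Cr_norm_bound[OF pf]] by blast
  have "fourier_coeff (partial j f) k = \<i> * of_int (k $ j) * fourier_coeff f k" for k
    by (rule fourier_coeff_partial[OF CrD(1)[OF f] Cr_differentiable[OF f] Cr_continuous[OF pf]])
  then have "has_partial j z z'" unfolding has_partial_def repr_fourier_coeff[OF z, symmetric] repr_fourier_coeff[OF z', symmetric] by blast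
  with z' show ?thesis by blast
qed

lemma measurable_indicator:
  "set_borel_measurable lebesgue torus_cell f \<longleftrightarrow> (\<lambda>x. indicator torus_cell x *\<^sub>R f x) \<in> borel_measurable lebesgue"
  by (simp add: set_borel_measurable_def)

lemma repr_mult:
  assumes "repr f y" "repr g z"
  shows "repr (\<lambda>x. f x * g x) (mul y z)"
  unfolding repr_def
proof
  have m: "(\<lambda>x. indicator torus_cell x *\<^sub>R f x) \<in> borel_measurable lebesgue" "(\<lambda>x. indicator torus_cell x *\<^sub>R g x) \<in> borel_measurable lebesgue"
    using assms by (auto simp: repr_def measurable_indicator)
  have "(\<lambda>x. indicator torus_cell x *\<^sub>R (f x * g x)) = (\<lambda>x. (indicator torus_cell x *\<^sub>R f x) * (indicator torus_cell x *\<^sub>R g x))"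
    by (auto simp: fun_eq_iff indicator_def)
  then show "set_borel_measurable lebesgue torus_cell (\<lambda>x. f x * g x)"
    unfolding measurable_indicator using borel_measurable_times[OF m] by (simp only:)
  show "AE x in lebesgue. x \<in> torus_cell \<longrightarrow> f x * g x = ev x (mul y z)"
    using assms[unfolded repr_def, THEN conjunct2] by eventually_elim (simp add: ev_simps)
qed

lemma repr_add:
  assumes "repr f y" "repr g z"
  shows "repr (\<lambda>x. f x + g x) (y + z)"
  unfolding repr_def
proof
  have m: "(\<lambda>x. indicator torus_cell x *\<^sub>R f x) \<in> borel_measurable lebesgue" "(\<lambda>x. indicator torus_cell x *\<^sub>R g x) \<in> borel_measurable lebesgue"
    using assms by (auto simp: repr_def measurable_indicator)
  show "set_borel_measurable lebesgue torus_cell (\<lambda>x. f x + g x)"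
    unfolding measurable_indicator scaleR_add_right using borel_measurable_add[OF m] by simp
  show "AE x in lebesgue. x \<in> torus_cell \<longrightarrow> f x + g x = ev x (y + z)"
    using assms[unfolded repr_def, THEN conjunct2] by eventually_elim (simp add: ev_simps)
qed

lemma repr_const: "repr (\<lambda>_. c) (cst c)"
  using repr_ev[of "cst c"] by (simp add: ev_cst)

lemma repr_cmult: "repr f z \<Longrightarrow> repr (\<lambda>x. c * f x) (mul (cst c) z)"
  by (rule repr_mult[OF repr_const])

lemma repr_diff: "repr f y \<Longrightarrow> repr g z \<Longrightarrow> repr (\<lambda>x. f x - g x) (y - z)"
proof -
  assume f: "repr f y" and g: "repr g z"
  have e1: "y - z = y + mul (cst (- 1)) z" by (rule ev_eqI) (simp add: ev_simps)
  have e2: "(\<lambda>x. f x - g x) = (\<lambda>x. f x + (- 1) * g x)" by simp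
  show ?thesis unfolding e1 e2 by (rule repr_add[OF f repr_cmult[OF g]])
qed

lemma repr_sum: "(\<And>i. i \<in> I \<Longrightarrow> repr (f i) (z i)) \<Longrightarrow> repr (\<lambda>x. \<Sum>i\<in>I. f i x) (\<Sum>i\<in>I. z i)"
proof (induction I rule: infinite_finite_induct)
  case (insert i I)
  then show ?case using repr_add[of "f i" "z i" "\<lambda>x. \<Sum>i\<in>I. f i x" "\<Sum>i\<in>I. z i"] by simp
next
  case (infinite A)
  have "cst 0 = 0" by (rule ev_eqI) (simp add: ev_simps)
  then show ?case using repr_const[of 0] infinite by simp
next
  case empty
  have "cst 0 = 0" by (rule ev_eqI) (simp add: ev_simps)
  then show ?case using repr_const[of 0] by simp
qed

lemma repr_map:
  assumes z: "repr f z" and \<phi>: "continuous_on UNIV \<phi>" and y: "\<And>p. \<phi> (ev p z) = ev p y"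
  shows "repr (\<lambda>x. \<phi> (f x)) y"
  unfolding repr_def
proof
  have m: "(\<lambda>x. indicator torus_cell x *\<^sub>R f x) \<in> borel_measurable lebesgue"
    using z by (auto simp: repr_def measurable_indicator)
  have "\<phi> \<in> borel_measurable borel" by (rule borel_measurable_continuous_onI[OF \<phi>])
  from measurable_compose[OF m this]
  have "(\<lambda>x. indicator torus_cell x *\<^sub>R \<phi> (indicator torus_cell x *\<^sub>R f x)) \<in> borel_measurable lebesgue"
    by (intro borel_measurable_scaleR borel_measurable_indicator) (simp_all add: torus_cell_def)
  also have "(\<lambda>x. indicator torus_cell x *\<^sub>R \<phi> (indicator torus_cell x *\<^sub>R f x)) = (\<lambda>x. indicator torus_cell x *\<^sub>R \<phi> (f x))"
    by (auto simp: fun_eq_iff indicator_def)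
  finally show "set_borel_measurable lebesgue torus_cell (\<lambda>x. \<phi> (f x))" unfolding measurable_indicator .
  have "AE x in lebesgue. x \<in> torus_cell \<longrightarrow> f x = ev x z" using z by (simp add: repr_def)
  then show "AE x in lebesgue. x \<in> torus_cell \<longrightarrow> \<phi> (f x) = ev x y"
  proof eventually_elim
    case (elim x)
    then show ?case using y[of x] by simp
  qed
qed

lemma repr_exp: "repr f z \<Longrightarrow> repr (\<lambda>x. exp (f x)) (Exp z)"
  by (rule repr_map) (auto intro!: continuous_intros simp: ev_Exp)

text \<open>Passing to the squared gradient uses two derivatives of that square in
  \<open>H^s\<close>, hence three of the function itself, whereas \<open>C^(s + 2)\<close> puts only
  two there. Regularity of all orders, available for the smooth \<open>Q\<close>, survives sums,
  products and derivatives.\<close>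

primrec regular :: "nat \<Rightarrow> (int^'d) l2 \<Rightarrow> bool" where
  "regular 0 z = True"
| "regular (Suc n) z = (\<forall>j. \<exists>z'. has_partial j z z' \<and> regular n z')"

lemma regular_Suc_imp: "regular (Suc n) z \<Longrightarrow> regular n z"
  by (induction n arbitrary: z) (simp, metis regular.simps(2))

lemma regular_add: "regular n x \<Longrightarrow> regular n y \<Longrightarrow> regular n (x + y)"
proof (induction n arbitrary: x y)
  case (Suc n)
  then show ?case by (simp) (meson has_partial_add)
qed simp

lemma regular_mul: "regular n x \<Longrightarrow> regular n y \<Longrightarrow> regular n (mul x y)"
proof (induction n arbitrary: x y)
  case (Suc n)
  show ?case unfolding regular.simps
  proof
    fix j
    obtain x' where x': "has_partial j x x'" "regular n x'" using Suc.prems(1)[unfolded regular.simps, THEN spec, of j] by blast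
    obtain y' where y': "has_partial j y y'" "regular n y'" using Suc.prems(2)[unfolded regular.simps, THEN spec, of j] by blast
    from x' y' show "\<exists>z'. has_partial j (mul x y) z' \<and> regular n z'"
      using Suc.prems[THEN regular_Suc_imp] by (meson has_partial_mul Suc.IH regular_add)
  qed
qed simp

lemma regular_0: "regular n 0"
  by (induction n) (use has_partial_0 in auto)

lemma regular_cst: "regular n (cst c)"
  by (cases n) (use has_partial_cst regular_0 in auto)

lemma regular_sum: "(\<And>i. i \<in> I \<Longrightarrow> regular n (x i)) \<Longrightarrow> regular n (sum x I)"
  by (induction I rule: infinite_finite_induct) (auto intro: regular_0 regular_add)

lemma regular_smooth:
  fixes f :: "real^'d \<Rightarrow> complex"
  shows "f \<in> smooth_torus \<Longrightarrow> repr f z \<Longrightarrow> regular n z"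
proof (induction n arbitrary: f z)
  case (Suc n)
  show ?case unfolding regular.simps
  proof
    fix j
    have f: "f \<in> Cr_torus m" for m using Suc.prems(1) by (auto simp: smooth_torus_def)
    obtain z' where z': "repr (partial j f) z'" "has_partial j z z'" using repr_partial[OF f order_refl Suc.prems(2)] by blast
    have "partial j f \<in> smooth_torus" using Cr_partial[OF f] by (auto simp: smooth_torus_def)
    then show "\<exists>z'. has_partial j z z' \<and> regular n z'" using Suc.IH z' by blast
  qed
qed simp

lemma repr_Cr_norm:
  fixes f :: "real^'d \<Rightarrow> complex"
  assumes f: "f \<in> Cr_torus n" and n: "s \<le> n"
  shows "\<exists>z. repr f z \<and> norm z \<le> Cr_const * Cr_norm n f"
  by (rule repr_Cr[OF f n Cr_norm_bound[OF f]])

lemma repr_nonlin: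
  assumes "repr f z"
  shows "repr (\<lambda>x. (1 + \<i> * complex_of_real \<mu>) * complex_of_real (cmod (f x) ^ (2 * \<sigma>)) * f x) (nonlin \<mu> \<sigma> z)"
  by (rule repr_map[OF assms]) (auto intro!: continuous_intros simp: ev_nonlin)

lemma scale_ev: "mul (cst (complex_of_real c)) y = c *\<^sub>R y"
  by (rule ev_eqI) (simp add: ev_simps scaleR_conv_of_real linear_cmul[OF bounded_linear.linear[OF bounded_linear_ev]])

lemma ev_scaleR: "ev p (c *\<^sub>R y) = c *\<^sub>R ev p y"
  by (rule linear_cmul[OF bounded_linear.linear[OF bounded_linear_ev]])

end

text \<open>\<open>a\<close> is a square root of \<open>(1 - i\<nu>) / (1 + i\<nu>)\<close> which is a real multiple of \<open>1 - i\<nu>\<close>.\<close>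

lemma root_factor:
  fixes \<nu> :: real
  defines "a \<equiv> (1 - \<i> * complex_of_real \<nu>) * complex_of_real (1 / sqrt (1 + \<nu>\<^sup>2))"
  shows "(1 + \<i> * complex_of_real \<nu>) * a\<^sup>2 = 1 - \<i> * complex_of_real \<nu>"
proof -
  have p: "1 + \<nu>\<^sup>2 > 0" by (rule add_pos_nonneg) simp_all
  have "(1 / sqrt (1 + \<nu>\<^sup>2))\<^sup>2 = 1 / (1 + \<nu>\<^sup>2)" using p by (simp add: power_divide)
  then have "(complex_of_real (1 / sqrt (1 + \<nu>\<^sup>2)))\<^sup>2 = 1 / complex_of_real (1 + \<nu>\<^sup>2)"
    by (metis of_real_power of_real_divide of_real_1)
  then have "(1 + \<i> * complex_of_real \<nu>) * a\<^sup>2 = (1 + \<i> * complex_of_real \<nu>) * (1 - \<i> * complex_of_real \<nu>)\<^sup>2 * (1 / complex_of_real (1 + \<nu>\<^sup>2))"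
    unfolding a_def power_mult_distrib by simp
  also have "(1 + \<i> * complex_of_real \<nu>) * (1 - \<i> * complex_of_real \<nu>)\<^sup>2 = (1 - \<i> * complex_of_real \<nu>) * complex_of_real (1 + \<nu>\<^sup>2)"
  proof -
    have "(1 + \<i> * complex_of_real \<nu>) * (1 - \<i> * complex_of_real \<nu>) = complex_of_real (1 + \<nu>\<^sup>2)"
      by (simp add: algebra_simps power2_eq_square)
    then show ?thesis by (simp only: power2_eq_square mult.assoc[symmetric]) (simp only: mult.commute)
  qed
  also have "\<dots> * (1 / complex_of_real (1 + \<nu>\<^sup>2)) = 1 - \<i> * complex_of_real \<nu>"
  proof -
    have "complex_of_real (1 + \<nu>\<^sup>2) \<noteq> 0" using p of_real_eq_0_iff[of "1 + \<nu>\<^sup>2", where 'a = complex] by linarith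
    then show ?thesis by simp
  qed
  finally show ?thesis .
qed

section \<open>Steerability along the saturation process\<close>

locale cgl_torus = sobolev_space s dim for s :: nat and dim :: "'d::finite itself" +
  fixes V \<nu> \<mu> :: real and \<sigma> :: nat and Q :: "real^'d \<Rightarrow> real^'q::finite"
  assumes \<sigma>: "\<sigma> \<ge> 1" and Q: "Q \<in> smooth_torus"
begin

text \<open>The coefficient \<open>r1 + i r2\<close> of the control for \<open>r1 = 1\<close> and
  \<open>r2 = - \<nu>\<close>; it is built into \<open>kq\<close>.\<close>

abbreviation w0 :: complex where "w0 \<equiv> 1 - \<i> * complex_of_real \<nu>"

definition component :: "'q \<Rightarrow> (int^'d) l2" where
  "component j = (SOME z. repr (\<lambda>x. complex_of_real (Q x $ j)) z)"

definition kq :: "real^'q \<Rightarrow> (int^'d) l2" where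
  "kq w = (\<Sum>j\<in>UNIV. (w $ j) *\<^sub>R mul (cst w0) (component j))"

lemma repr_component: "repr (\<lambda>x. complex_of_real (Q x $ j)) (component j)"
proof -
  have "(\<lambda>x. complex_of_real (Q x $ j)) \<in> smooth_torus"
    by (rule smooth_bounded_linear[OF bounded_linear_of_real smooth_bounded_linear[OF bounded_linear_vec_nth Q]])
  then have "(\<lambda>x. complex_of_real (Q x $ j)) \<in> Cr_torus s" by (rule smooth_Cr)
  then obtain z where "repr (\<lambda>x. complex_of_real (Q x $ j)) z" using repr_Cr_norm[OF _ order_refl] by blast
  then show ?thesis unfolding component_def by (rule someI)
qed

lemma kq_linear: "bounded_linear kq"
proof -
  have "bounded_linear (\<lambda>w :: real^'q. (w $ j) *\<^sub>R mul (cst w0) (component j))" for j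
    by (rule bounded_linear_compose[OF bounded_linear_scaleR_left bounded_linear_vec_nth])
  then show ?thesis unfolding kq_def[abs_def] by (rule bounded_linear_sum)
qed

lemma repr_kq: "repr (\<lambda>x. w0 * complex_of_real (w \<bullet> Q x)) (kq w)"
proof -
  have "repr (\<lambda>x. \<Sum>j\<in>UNIV. complex_of_real (w $ j) * (w0 * complex_of_real (Q x $ j)))
      (\<Sum>j\<in>UNIV. mul (cst (complex_of_real (w $ j))) (mul (cst w0) (component j)))"
    by (rule repr_sum) (rule repr_cmult[OF repr_cmult[OF repr_component]])
  moreover have "(\<Sum>j\<in>UNIV. complex_of_real (w $ j) * (w0 * complex_of_real (Q x $ j))) = w0 * complex_of_real (w \<bullet> Q x)" for x
    by (simp add: inner_vec_def sum_distrib_left mult.left_commute)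
  ultimately show ?thesis by (simp only: kq_def scale_ev)
qed

sublocale cgl_system s dim V \<nu> \<mu> \<sigma> kq
  by (intro cgl_system.intro cgl_system_axioms.intro sobolev_space_axioms \<sigma> kq_linear)

definition steerable :: "(real^'d \<Rightarrow> real) \<Rightarrow> bool" where
  "steerable \<theta> \<longleftrightarrow> (\<exists>z. repr (\<lambda>x. complex_of_real (\<theta> x)) z \<and> (\<forall>n. regular n z) \<and> steer (mul (cst w0) z))"

lemma steerable_span:
  assumes "\<phi> \<in> real_fun.span (range (\<lambda>j x. Q x $ j))"
  shows "steerable \<phi>" "\<phi> \<in> Cr_torus n"
proof -
  obtain w where w: "\<phi> = (\<lambda>x. w \<bullet> Q x)" using span_components[OF assms] by blast
  have sm: "\<phi> \<in> smooth_torus" unfolding w by (rule smooth_bounded_linear[OF bounded_linear_inner_right Q])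
  then show "\<phi> \<in> Cr_torus n" by (rule smooth_Cr)
  have sc: "(\<lambda>x. complex_of_real (\<phi> x)) \<in> smooth_torus"
    by (rule smooth_bounded_linear[OF bounded_linear_of_real sm])
  obtain z where z: "repr (\<lambda>x. complex_of_real (\<phi> x)) z"
    using repr_Cr_norm[OF smooth_Cr[OF sc] order_refl] by blast
  have "mul (cst w0) z = kq w"
    by (rule repr_unique[OF repr_cmult[OF z]]) (unfold w, rule repr_kq)
  then have "steer (mul (cst w0) z)" using steer_control[of w] by simp
  then show "steerable \<phi>" unfolding steerable_def using z regular_smooth[OF sc z] by blast
qed

lemma steerable_add:
  assumes "steerable \<theta>" "steerable \<eta>"
  shows "steerable (\<lambda>x. \<theta> x + \<eta> x)"
proof -
  obtain y z where y: "repr (\<lambda>x. complex_of_real (\<theta> x)) y" "\<And>n. regular n y" "steer (mul (cst w0) y)"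
    and z: "repr (\<lambda>x. complex_of_real (\<eta> x)) z" "\<And>n. regular n z" "steer (mul (cst w0) z)"
    using assms unfolding steerable_def by blast
  have "mul (cst w0) (y + z) = mul (cst w0) y + mul (cst w0) z"
    by (rule ev_eqI) (simp add: ev_simps algebra_simps)
  then have "steer (mul (cst w0) (y + z))" using steer_add[OF y(3) z(3)] by simp
  moreover have "repr (\<lambda>x. complex_of_real (\<theta> x + \<eta> x)) (y + z)" using repr_add[OF y(1) z(1)] by simp
  ultimately show ?thesis unfolding steerable_def using regular_add[OF y(2) z(2)] by blast
qed

lemma steerable_sum:
  assumes "finite I" "I \<noteq> {}" "\<And>i. i \<in> I \<Longrightarrow> steerable (\<theta> i)"
  shows "steerable (\<lambda>x. \<Sum>i\<in>I. \<theta> i x)"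
  using assms
proof (induction I rule: finite_ne_induct)
  case (insert i I)
  have "steerable (\<lambda>x. \<theta> i x + (\<Sum>i\<in>I. \<theta> i x))" by (rule steerable_add) (use insert in auto)
  then show ?case using insert by simp
qed simp

text \<open>All real multiples of \<open>\<theta>\<close> are assumed steerable because the
  conjugation needs both \<open>Exp (l A)\<close> and its inverse, for arbitrarily large
  \<open>l\<close>.\<close>

lemma steerable_grad_square:
  assumes \<theta>: "\<theta> \<in> Cr_torus (s + 2)" and sc: "\<And>t. steerable (\<lambda>x. t * \<theta> x)"
    and s1: "\<And>t. steer (t *\<^sub>R cst w0)"
  shows "steerable (grad_square \<theta>)"
proof -
  define f where "f x = complex_of_real (\<theta> x)" for x
  define c where "c = 1 / sqrt (1 + \<nu>\<^sup>2)"
  have f: "f \<in> Cr_torus (Suc (Suc s))"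
    using Cr_bounded_linear[OF bounded_linear_of_real \<theta>] by (simp add: f_def[abs_def])
  obtain z where z: "repr f z" "\<And>n. regular n z" using sc[of 1] unfolding steerable_def f_def by auto
  have "\<exists>z'. repr (partial j f) z' \<and> has_partial j z z'" for j
    by (rule repr_partial[OF f _ z(1)]) simp
  then obtain z1 where z1: "\<And>j. repr (partial j f) (z1 j)" "\<And>j. has_partial j z (z1 j)" by metis
  \<comment> \<open>\<open>regular\<close> only asserts that some derivative is regular; uniqueness
    identifies it with \<open>z1 j\<close>.\<close>
  have r1: "regular n (z1 j)" for n j
  proof -
    have "regular (Suc n) z" by (rule z(2))
    then obtain z' where "has_partial j z z'" "regular n z'" by auto
    then show ?thesis using has_partial_unique[OF z1(2)] by metis
  qed
  have "regular (Suc 0) (z1 j)" for j by (rule r1)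
  then have "\<exists>z'. has_partial j (z1 j) z'" for j by auto
  then obtain z2 where z2: "\<And>j. has_partial j (z1 j) (z2 j)" by metis
  have pf: "partial j f = (\<lambda>x. complex_of_real (partial j \<theta> x))" for j
    using iter_partial_bounded_linear[OF bounded_linear_of_real[where 'a = complex] \<theta>, of "[j]"] by (simp add: f_def[abs_def])
  define P where "P = (\<Sum>j\<in>UNIV. mul (z1 j) (z1 j))"
  have "repr (\<lambda>x. \<Sum>j\<in>UNIV. partial j f x * partial j f x) P"
    unfolding P_def by (rule repr_sum) (rule repr_mult[OF z1(1) z1(1)])
  then have rP: "repr (\<lambda>x. complex_of_real (grad_square \<theta> x)) P"
    by (simp add: pf grad_square_def power2_eq_square)
  have gP: "regular n P" for n unfolding P_def by (rule regular_sum) (rule regular_mul[OF r1 r1])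
  \<comment> \<open>The real factor \<open>c\<close> turns \<open>w0\<close> into a square root of
    \<open>w0 / (1 + i \<nu>)\<close>, so the limit multiplier is \<open>w0\<close> times the
    squared gradient, while \<open>A\<close> remains a real multiple of
    \<open>w0 * \<theta>\<close>.\<close>
  define A where "A = mul (cst (w0 * complex_of_real c)) z"
  define A1 where "A1 j = mul (cst (w0 * complex_of_real c)) (z1 j)" for j
  define A2 where "A2 j = mul (cst (w0 * complex_of_real c)) (z2 j)" for j
  define m where "m = mul (cst (1 + \<i> * complex_of_real \<nu>)) (\<Sum>j\<in>UNIV. mul (A1 j) (A1 j))"
  have ev_sum: "ev p (sum F UNIV) = (\<Sum>j\<in>UNIV. ev p (F j))" for p and F :: "'d \<Rightarrow> (int^'d) l2"
    by (rule linear_sum[OF bounded_linear.linear[OF bounded_linear_ev]])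
  have m: "m = mul (cst w0) P"
  proof (rule ev_eqI)
    fix p
    have "ev p m = (\<Sum>j\<in>UNIV. ((1 + \<i> * complex_of_real \<nu>) * (w0 * complex_of_real c)\<^sup>2) * (ev p (z1 j) * ev p (z1 j)))"
      unfolding m_def A1_def by (simp only: ev_simps ev_sum sum_distrib_left power2_eq_square mult_ac)
    also have "\<dots> = (\<Sum>j\<in>UNIV. w0 * (ev p (z1 j) * ev p (z1 j)))"
      unfolding c_def root_factor ..
    also have "\<dots> = ev p (mul (cst w0) P)"
      unfolding P_def by (simp only: ev_simps ev_sum sum_distrib_left)
    finally show "ev p m = ev p (mul (cst w0) P)" .
  qed
  have rm: "regular (Suc (Suc 0)) m" unfolding m by (rule regular_mul[OF regular_cst gP])
  have "\<exists>m1 m2. has_partial j m m1 \<and> has_partial j m1 m2" for j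
    using rm by (simp del: regular.simps(1)) blast
  then obtain m1 m2 where m12: "\<And>j. has_partial j m (m1 j)" "\<And>j. has_partial j (m1 j) (m2 j)" by metis
  have sA: "steer (t *\<^sub>R A)" for t
  proof -
    obtain y where y: "repr (\<lambda>x. complex_of_real (t * c * \<theta> x)) y" "steer (mul (cst w0) y)"
      using sc[of "t * c"] unfolding steerable_def by blast
    have "repr (\<lambda>x. complex_of_real (t * c * \<theta> x)) (mul (cst (complex_of_real (t * c))) z)"
      using repr_cmult[OF z(1), of "complex_of_real (t * c)"] by (simp add: f_def)
    then have "y = mul (cst (complex_of_real (t * c))) z" by (rule repr_unique[OF y(1)])
    then have "mul (cst w0) y = t *\<^sub>R A"
      unfolding A_def by (intro ev_eqI) (simp add: ev_simps ev_scaleR scaleR_conv_of_real)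
    with y(2) show ?thesis by simp
  qed
  have "steer m"
    unfolding m_def
  proof (rule steer_square[of A A1 A2 m1 m2])
    show "has_partial j A (A1 j)" "has_partial j (A1 j) (A2 j)" for j
      unfolding A_def A1_def A2_def by (rule has_partial_mul_cst[OF z1(2)], rule has_partial_mul_cst[OF z2])
  qed (fold m_def, (rule m12 sA s1)+)
  then show ?thesis unfolding steerable_def m using rP gP by blast
qed

text \<open>That \<open>H\<close> is a subspace supplies the real multiples demanded by
  \<open>steerable_grad_square\<close>.\<close>

lemma steerable_step:
  assumes H: "real_fun.subspace H" "H \<subseteq> Cr_torus (s + 2)" and g: "\<And>\<phi>. \<phi> \<in> H \<Longrightarrow> steerable \<phi>"
    and s1: "\<And>t. steer (t *\<^sub>R cst w0)" and \<phi>: "representable H \<phi>"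
  shows "steerable \<phi>"
proof -
  obtain n :: nat and \<theta> where n: "n \<ge> 1" "\<And>j. j \<le> n \<Longrightarrow> \<theta> j \<in> H" "\<phi> = (\<lambda>x. \<theta> 0 x + (\<Sum>j=1..n. grad_square (\<theta> j) x))"
    by (rule representableE[OF \<phi>]) (rule that)
  have "steerable (grad_square (\<theta> j))" if "j \<in> {1..n}" for j
  proof (rule steerable_grad_square[OF _ _ s1])
    have j: "\<theta> j \<in> H" using that n(2) by simp
    then show "\<theta> j \<in> Cr_torus (s + 2)" using H(2) by blast
    show "steerable (\<lambda>x. t * \<theta> j x)" for t by (rule g[OF real_fun.subspace_scale[OF H(1) j]])
  qed
  then have "steerable (\<lambda>x. \<Sum>j=1..n. grad_square (\<theta> j) x)" using n(1) by (intro steerable_sum) auto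
  moreover have "steerable (\<theta> 0)" by (rule g[OF n(2)]) simp
  ultimately show ?thesis unfolding n(3) by (intro steerable_add)
qed

context
  assumes one: "(\<lambda>x. 1) \<in> real_fun.span (range (\<lambda>j x. Q x $ j))"
begin

text \<open>Provides the scalar damping that keeps the nonlinearity harmless; this is where the
  constant function in the span is used.\<close>

lemma steer_const: "steer (t *\<^sub>R cst w0)"
proof -
  have "(\<lambda>x. t * 1) \<in> real_fun.span (range (\<lambda>j x. Q x $ j))" by (rule real_fun.span_scale[OF one])
  then obtain z where z: "repr (\<lambda>x. complex_of_real (t * 1)) z" "steer (mul (cst w0) z)"
    using steerable_span(1) unfolding steerable_def by blast
  have "z = cst (complex_of_real (t * 1))" by (rule repr_unique[OF z(1) repr_const])
  then have "mul (cst w0) z = t *\<^sub>R cst w0"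
    by (intro ev_eqI) (simp add: ev_simps ev_scaleR scaleR_conv_of_real)
  with z(2) show ?thesis by simp
qed

lemma steerable_sat_limit:
  assumes "\<phi> \<in> sat_limit (s + 2) (real_fun.span (range (\<lambda>j x. Q x $ j)))"
  shows "steerable \<phi>" "\<phi> \<in> Cr_torus (s + 2)"
proof -
  let ?H = "\<lambda>j. (sat_step (s + 2) ^^ j) (real_fun.span (range (\<lambda>j x. Q x $ j)))"
  have "real_fun.subspace (?H j) \<and> ?H j \<subseteq> Cr_torus (s + 2) \<and> (\<forall>\<phi>\<in>?H j. steerable \<phi>)" for j
  proof (induction j)
    case 0
    show ?case using steerable_span real_fun.subspace_span[of "range (\<lambda>j x. Q x $ j)"] by auto
  next
    case (Suc j)
    then have H: "real_fun.subspace (?H j)" "?H j \<subseteq> Cr_torus (s + 2)" "\<And>\<phi>. \<phi> \<in> ?H j \<Longrightarrow> steerable \<phi>" by auto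
    have "steerable \<phi>" if "\<phi> \<in> sat_step (s + 2) (?H j)" for \<phi>
      by (rule steerable_step[OF H steer_const sat_step_props(3)[OF H(1,2) that]])
    then show ?case using sat_step_props(1,2)[OF H(1,2)] by simp
  qed
  then show "steerable \<phi>" "\<phi> \<in> Cr_torus (s + 2)" using assms unfolding sat_limit_def by blast+
qed

text \<open>Density in \<open>C^r\<close> becomes density of exponents in \<open>H^s\<close> through
  the embedding, and steerable exponents are closed under limits.\<close>

lemma steer_Cr:
  assumes sat: "saturating (s + 2) (real_fun.span (range (\<lambda>j x. Q x $ j)))" and \<theta>: "\<theta> \<in> Cr_torus (s + 2)"
  shows "\<exists>z. repr (\<lambda>x. complex_of_real (\<theta> x)) z \<and> steer (mul (cst w0) z)"
proof -
  have \<theta>c: "(\<lambda>x. complex_of_real (\<theta> x)) \<in> Cr_torus (s + 2)" by (rule Cr_bounded_linear[OF bounded_linear_of_real \<theta>])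
  obtain z where z: "repr (\<lambda>x. complex_of_real (\<theta> x)) z" using repr_Cr_norm[OF \<theta>c] by auto
  have "steer (mul (cst w0) z)"
  proof (rule steer_limit)
    fix e :: real assume e: "0 < e"
    \<comment> \<open>The embedding costs \<open>Cr_const\<close> and multiplication by
      \<open>w0\<close> costs its modulus; the added \<open>1\<close> keeps the denominator positive
      and the final inequality strict.\<close>
    define e' where "e' = e / (cmod w0 * Cr_const + 1)"
    have p: "cmod w0 * Cr_const + 1 > 0" using Cr_const_nonneg by (intro add_nonneg_pos mult_nonneg_nonneg) auto
    then have "e' > 0" unfolding e'_def using e by simp
    then obtain g where g: "g \<in> sat_limit (s + 2) (real_fun.span (range (\<lambda>j x. Q x $ j)))" "Cr_norm (s + 2) (\<lambda>x. \<theta> x - g x) < e'"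
      using sat \<theta> unfolding saturating_def by blast
    obtain y where y: "repr (\<lambda>x. complex_of_real (g x)) y" "steer (mul (cst w0) y)"
      using steerable_sat_limit(1)[OF g(1)] unfolding steerable_def by blast
    have "(\<lambda>x. - g x) \<in> Cr_torus (s + 2)"
      by (rule Cr_bounded_linear[OF bounded_linear_minus[OF bounded_linear_ident] steerable_sat_limit(2)[OF g(1)]])
    from Cr_add[OF \<theta> this] have d: "(\<lambda>x. \<theta> x - g x) \<in> Cr_torus (s + 2)" by simp
    have "\<exists>v. repr (\<lambda>x. complex_of_real (\<theta> x - g x)) v \<and> norm v \<le> Cr_const * e'"
    proof (rule repr_Cr)
      show "(\<lambda>x. complex_of_real (\<theta> x - g x)) \<in> Cr_torus (s + 2)" by (rule Cr_bounded_linear[OF bounded_linear_of_real d])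
      show "s \<le> s + 2" by simp
      fix js :: "'d list" and x assume l: "length js \<le> s + 2"
      have "norm (iter_partial js (\<lambda>x. \<theta> x - g x) x) \<le> e'"
        using Cr_norm_bound[OF d l, of x] g(2) by linarith
      then show "cmod (iter_partial js (\<lambda>x. complex_of_real (\<theta> x - g x)) x) \<le> e'"
        unfolding iter_partial_bounded_linear[OF bounded_linear_of_real[where 'a = complex] d l] by simp
    qed
    then obtain v where v: "repr (\<lambda>x. complex_of_real (\<theta> x - g x)) v" "norm v \<le> Cr_const * e'" by blast
    have "repr (\<lambda>x. complex_of_real (\<theta> x - g x)) (z - y)" using repr_diff[OF z y(1)] by simp
    then have vz: "z - y = v" by (rule repr_unique[OF _ v(1)])
    have "mul (cst w0) y - mul (cst w0) z = - mul (cst w0) (z - y)"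
      using bounded_bilinear.diff_right[OF bounded_bilinear_mul, of "cst w0" z y] by simp
    then have "norm (mul (cst w0) y - mul (cst w0) z) = norm (mul (cst w0) v)"
      unfolding vz by (simp only: norm_minus_cancel)
    also have "\<dots> \<le> cmod w0 * norm v" by (rule norm_mul_cst_le)
    also have "\<dots> \<le> cmod w0 * (Cr_const * e')" by (rule mult_left_mono[OF v(2)]) simp
    also have "\<dots> < (cmod w0 * Cr_const + 1) * e'" using \<open>e' > 0\<close> by (simp add: distrib_right)
    also have "\<dots> = e" unfolding e'_def using p by simp
    finally show "\<exists>q'. steer q' \<and> norm (q' - mul (cst w0) z) < e" using y(2) by blast
  qed
  with z show ?thesis by blast
qed

end

section \<open>Mild solutions and the resolving operator\<close>

lemma repr_src:
  assumes f: "repr f z"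
  shows "repr (cgl_source V \<mu> \<sigma> Q w 1 (- \<nu>) f) (src w z)"
proof -
  have "repr (\<lambda>x. complex_of_real V * f x
       - (1 + \<i> * complex_of_real \<mu>) * complex_of_real (cmod (f x) ^ (2 * \<sigma>)) * f x
       + w0 * complex_of_real (w \<bullet> Q x) * f x)
     (mul (cst (complex_of_real V)) z - nonlin \<mu> \<sigma> z + mul (kq w) z)"
    by (rule repr_add[OF repr_diff[OF repr_cmult[OF f] repr_nonlin[OF f]] repr_mult[OF repr_kq f]])
  then show ?thesis by (simp add: cgl_source_def[abs_def] src_def scale_ev)
qed

lemma heat_repr: "repr f z \<Longrightarrow> 0 \<le> t \<Longrightarrow> heat_semigroup \<nu> t f x = ev x (heat \<nu> t z)"
  using ev_heat repr_fourier_coeff by blast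

text \<open>Point evaluation is bounded and linear, so it commutes with the vector-valued integral;
  this matches the pointwise time integrals of \<open>mild_solution\<close> with
  \<open>duhamel\<close>.\<close>

lemma duhamel_pointwise:
  assumes \<psi>0: "repr \<psi>0 x0" and t: "0 \<le> t" and u: "continuous_on {0..t} u" and a: "continuous_on {0..t} a"
    and r: "\<And>\<tau>. \<tau> \<in> {0..t} \<Longrightarrow> repr (\<psi> \<tau>) (a \<tau>)"
  shows "set_integrable lebesgue {0..t} (\<lambda>\<tau>. heat_semigroup \<nu> (t - \<tau>) (cgl_source V \<mu> \<sigma> Q (u \<tau>) 1 (- \<nu>) (\<psi> \<tau>)) x)"
      (is "set_integrable _ _ ?h")
    and "heat_semigroup \<nu> t \<psi>0 x + (LINT \<tau>:{0..t}|lebesgue. heat_semigroup \<nu> (t - \<tau>) (cgl_source V \<mu> \<sigma> Q (u \<tau>) 1 (- \<nu>) (\<psi> \<tau>)) x)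
      = ev x (heat \<nu> t x0 + duhamel (\<lambda>\<tau>. src (u \<tau>) (a \<tau>)) t)"
proof -
  let ?g = "\<lambda>\<tau>. heat \<nu> (t - \<tau>) (src (u \<tau>) (a \<tau>))"
  have h: "?h \<tau> = ev x (?g \<tau>)" if "\<tau> \<in> {0..t}" for \<tau>
    by (rule heat_repr[OF repr_src[OF r[OF that]]]) (use that in simp)
  have c: "continuous_on {0..t} (\<lambda>\<tau>. src (u \<tau>) (a \<tau>))" by (rule continuous_on_src[OF u a])
  have cg: "continuous_on {0..t} ?g" by (intro continuous_on_S c continuous_intros)
  have ai: "set_integrable lebesgue {0..t} (\<lambda>\<tau>. ev x (?g \<tau>))"
    by (rule absolutely_integrable_continuous_real[OF bounded_linear.continuous_on[OF bounded_linear_ev cg]])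
  show "set_integrable lebesgue {0..t} ?h"
    by (rule set_integrable_cong[OF refl refl h, THEN iffD2, OF _ ai])
  have "(LINT \<tau>:{0..t}|lebesgue. ?h \<tau>) = (LINT \<tau>:{0..t}|lebesgue. ev x (?g \<tau>))"
    by (rule set_lebesgue_integral_cong) (simp_all add: h)
  also have "\<dots> = integral {0..t} (\<lambda>\<tau>. ev x (?g \<tau>))" by (rule set_lebesgue_integral_eq_integral(2)[OF ai])
  also have "\<dots> = ev x (duhamel (\<lambda>\<tau>. src (u \<tau>) (a \<tau>)) t)"
    using integral_linear[OF duhamel_integrable[OF c] bounded_linear_ev[of x]] unfolding duhamel_def comp_def .
  finally show "heat_semigroup \<nu> t \<psi>0 x + (LINT \<tau>:{0..t}|lebesgue. ?h \<tau>) = ev x (heat \<nu> t x0 + duhamel (\<lambda>\<tau>. src (u \<tau>) (a \<tau>)) t)"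
    unfolding heat_repr[OF \<psi>0 t] by (simp only: ev_simps)
qed

lemma sol_mild:
  assumes \<psi>0: "repr \<psi>0 x0" and u: "continuous_on {0..T} u" and a: "sol u T x0 a"
  shows "mild_solution V \<nu> \<mu> \<sigma> Q s \<psi>0 u 1 (- \<nu>) T (\<lambda>t x. ev x (a t))"
  unfolding mild_solution_def
proof (intro conjI ballI AE_I2)
  have ac: "continuous_on {0..T} a" using a by (simp add: sol_def)
  show "Hs_continuous_on s {0..T} (\<lambda>t x. ev x (a t))"
    unfolding Hs_continuous_on_def repr_Hs_norm[OF repr_diff[OF repr_ev repr_ev]]
  proof (intro ballI conjI ev_Hs)
    fix t assume "t \<in> {0..T}"
    then have "(a \<longlongrightarrow> a t) (at t within {0..T})" using ac by (simp add: continuous_on_def)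
    then show "((\<lambda>\<tau>. norm (a \<tau> - a t)) \<longlongrightarrow> 0) (at t within {0..T})"
      using tendsto_norm_zero[OF LIM_zero] by blast
  qed
  fix t x assume t: "t \<in> {0..T}"
  then have sub: "{0..t} \<subseteq> {0..T}" by simp
  note d = duhamel_pointwise[OF \<psi>0 _ continuous_on_subset[OF u sub] continuous_on_subset[OF ac sub] repr_ev, of x]
  show "set_integrable lebesgue {0..t} (\<lambda>\<tau>. heat_semigroup \<nu> (t - \<tau>) (cgl_source V \<mu> \<sigma> Q (u \<tau>) 1 (- \<nu>) (\<lambda>x. ev x (a \<tau>))) x)"
    by (rule d(1)) (use t in simp)
  have "a t = heat \<nu> t x0 + duhamel (\<lambda>\<tau>. src (u \<tau>) (a \<tau>)) t" using a t by (simp add: sol_def)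
  then show "ev x (a t) = heat_semigroup \<nu> t \<psi>0 x + (LINT \<tau>:{0..t}|lebesgue. heat_semigroup \<nu> (t - \<tau>) (cgl_source V \<mu> \<sigma> Q (u \<tau>) 1 (- \<nu>) (\<lambda>x. ev x (a \<tau>))) x)"
    using d(2) t by simp
qed

text \<open>An arbitrary mild solution is lifted to the algebra. Its chosen elements depend
  continuously on time because \<open>Hs_norm\<close> of a difference is the norm of the difference
  of the elements; the pointwise formula then gives Duhamel's formula by uniqueness of the
  represented element.\<close>

lemma mild_sol:
  assumes \<psi>0: "repr \<psi>0 x0" and u: "continuous_on {0..T} u" and \<psi>: "mild_solution V \<nu> \<mu> \<sigma> Q s \<psi>0 u 1 (- \<nu>) T \<psi>"
  shows "\<exists>a. sol u T x0 a \<and> (\<forall>t\<in>{0..T}. repr (\<psi> t) (a t))"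
proof -
  have c: "\<And>t. t \<in> {0..T} \<Longrightarrow> \<psi> t \<in> Hs s"
      "\<And>t. t \<in> {0..T} \<Longrightarrow> ((\<lambda>\<tau>. Hs_norm s (\<lambda>x. \<psi> \<tau> x - \<psi> t x)) \<longlongrightarrow> 0) (at t within {0..T})"
    using \<psi> unfolding mild_solution_def Hs_continuous_on_def by blast+
  define a where "a t = (SOME z. repr (\<psi> t) z)" for t
  have a: "repr (\<psi> t) (a t)" if "t \<in> {0..T}" for t
    unfolding a_def by (rule someI_ex[OF Hs_repr[OF c(1)[OF that]]])
  have ac: "continuous_on {0..T} a" unfolding continuous_on_def
  proof
    fix t assume t: "t \<in> {0..T}"
    have "((\<lambda>\<tau>. norm (a \<tau> - a t)) \<longlongrightarrow> 0) (at t within {0..T})"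
    proof (rule Lim_transform_within[OF c(2)[OF t] zero_less_one])
      fix \<tau> assume "\<tau> \<in> {0..T}"
      then show "Hs_norm s (\<lambda>x. \<psi> \<tau> x - \<psi> t x) = norm (a \<tau> - a t)"
        by (rule repr_Hs_norm[OF repr_diff[OF a a[OF t]]])
    qed
    then show "(a \<longlongrightarrow> a t) (at t within {0..T})"
      using tendsto_norm_zero_iff LIM_zero_cancel by blast
  qed
  have "a t = heat \<nu> t x0 + duhamel (\<lambda>\<tau>. src (u \<tau>) (a \<tau>)) t" if t: "t \<in> {0..T}" for t
  proof (rule repr_unique[OF a[OF t]])
    have sub: "{0..t} \<subseteq> {0..T}" using t by simp
    have r: "repr (\<psi> \<tau>) (a \<tau>)" if "\<tau> \<in> {0..t}" for \<tau> using that sub by (intro a) blast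
    have t0: "0 \<le> t" using t by simp
    note d = duhamel_pointwise(2)[OF \<psi>0 t0 continuous_on_subset[OF u sub] continuous_on_subset[OF ac sub] r]
    have "AE x in lebesgue. \<psi> t x = heat_semigroup \<nu> t \<psi>0 x + (LINT \<tau>:{0..t}|lebesgue. heat_semigroup \<nu> (t - \<tau>) (cgl_source V \<mu> \<sigma> Q (u \<tau>) 1 (- \<nu>) (\<psi> \<tau>)) x)"
      using \<psi> t unfolding mild_solution_def by auto
    then have "AE x in lebesgue. x \<in> torus_cell \<longrightarrow> \<psi> t x = ev x (heat \<nu> t x0 + duhamel (\<lambda>\<tau>. src (u \<tau>) (a \<tau>)) t)"
      by eventually_elim (use d in simp)
    then show "repr (\<psi> t) (heat \<nu> t x0 + duhamel (\<lambda>\<tau>. src (u \<tau>) (a \<tau>)) t)"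
      using a[OF t] unfolding repr_def by blast
  qed
  then show ?thesis using a ac unfolding sol_def by blast
qed

text \<open>\<open>resolving_op\<close> selects an unspecified mild solution. One exists by
  \<open>sol_mild\<close>; whichever is selected lifts to a solution in the algebra, and
  \<open>sol_unique\<close> identifies its end point with that of \<open>a\<close>.\<close>

lemma resolving_op_repr:
  assumes \<psi>0: "repr \<psi>0 x0" and T: "0 \<le> T" and u: "continuous_on {0..T} u" and a: "sol u T x0 a"
  shows "repr (resolving_op V \<nu> \<mu> \<sigma> Q s T \<psi>0 (u, 1, - \<nu>)) (a T)"
proof -
  define \<psi> where "\<psi> = (SOME \<psi>. mild_solution V \<nu> \<mu> \<sigma> Q s \<psi>0 u 1 (- \<nu>) T \<psi>)"
  have "mild_solution V \<nu> \<mu> \<sigma> Q s \<psi>0 u 1 (- \<nu>) T \<psi>"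
    unfolding \<psi>_def by (rule someI[of "mild_solution V \<nu> \<mu> \<sigma> Q s \<psi>0 u 1 (- \<nu>) T"]) (rule sol_mild[OF \<psi>0 u a])
  from mild_sol[OF \<psi>0 u this] obtain b where b: "sol u T x0 b" "\<And>t. t \<in> {0..T} \<Longrightarrow> repr (\<psi> t) (b t)" by blast
  have "b T = a T" by (rule sol_unique[OF u b(1) a]) (use T in simp)
  then show ?thesis using b(2)[of T] T by (simp add: resolving_op_def \<psi>_def)
qed

end

lemma flat_control_smooth:
  assumes "flat_control T u"
  shows "u \<in> smooth_controls T" "continuous_on A u"
proof -
  obtain D where D: "D 0 = u" "\<And>n t. (D n has_vector_derivative D (Suc n) t) (at t)"
    using assms unfolding flat_control_def smooth_fun_def by blast
  show "u \<in> smooth_controls T" unfolding smooth_controls_def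
  proof (intro CollectI exI[of _ D] conjI allI ballI)
    show "(D n has_vector_derivative D (Suc n) t) (at t within {0..T})" for n t
      by (rule has_vector_derivative_at_within[OF D(2)])
  qed (simp add: D(1))
  show "continuous_on A u"
    using has_vector_derivative_continuous[OF D(2)[of 0]] unfolding D(1)
    by (simp add: continuous_at_imp_continuous_on)
qed

lemma continuous_L2_controls:
  assumes "continuous_on {0..T} u"
  shows "u \<in> L2_controls T"
  unfolding L2_controls_def
proof (intro CollectI conjI)
  have "set_integrable lebesgue {0..T} u" by (rule absolutely_integrable_continuous_real[OF assms])
  then show "set_borel_measurable lebesgue {0..T} u"
    unfolding set_integrable_def set_borel_measurable_def by (rule borel_measurable_integrable)
  show "set_integrable lebesgue {0..T} (\<lambda>t. (norm (u t))\<^sup>2)"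
    by (intro absolutely_integrable_continuous_real continuous_intros assms)
qed

theorem theorem3p2:
  fixes Q :: "real ^ 'd \<Rightarrow> real ^ 'q"
    and \<sigma> s r :: nat
    and V \<nu> \<mu> \<epsilon> T0 :: real
    and \<psi>0 :: "real ^ 'd \<Rightarrow> complex"
    and \<theta> :: "real ^ 'd \<Rightarrow> real"
  assumes "\<sigma> \<ge> 1"
    and "V \<ge> 0"
    and "Q \<in> smooth_torus"
    and "s \<ge> sobolev_index CARD('d)"
    and "r = s + 2"
    and "saturating r (real_fun.span (range (\<lambda>j x. Q x $ j)))"
    and "(\<lambda>x. 1) \<in> real_fun.span (range (\<lambda>j x. Q x $ j))"
    and "\<epsilon> > 0"
    and "T0 > 0"
    and "\<psi>0 \<in> Hs s"
    and "\<theta> \<in> Cr_torus r"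
  shows "\<exists>T u. 0 < T \<and> T < T0 \<and>
           u \<in> admissible_controls V \<nu> \<mu> \<sigma> Q s \<psi>0 T \<inter> smooth_controls T \<and>
           Hs_norm s (\<lambda>x. resolving_op V \<nu> \<mu> \<sigma> Q s T \<psi>0 (u, 1, - \<nu>) x
             - exp ((1 - \<i> * complex_of_real \<nu>) * complex_of_real (\<theta> x)) * \<psi>0 x) < \<epsilon>"
proof -
  have "real CARD('d) / 2 < real (sobolev_index CARD('d))"
    unfolding sobolev_index_def by (rule LeastI_ex, rule reals_Archimedean2)
  then have "CARD('d) < 2 * s" using assms(4) by linarith
  then interpret cgl_torus s "TYPE('d)" V \<nu> \<mu> \<sigma> Q
    using assms(1,3) by unfold_locales auto
  obtain z where z: "repr (\<lambda>x. complex_of_real (\<theta> x)) z" "steer (mul (cst w0) z)"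
    using steer_Cr[OF assms(7)] assms(6,11) unfolding assms(5) by blast
  obtain x0 where x0: "repr \<psi>0 x0" using Hs_repr[OF assms(10)] by blast
  obtain T u a where T: "0 < T" "T < T0" and u: "flat_control T u" and a: "sol u T x0 a"
    and e: "norm (a T - mul (Exp (mul (cst w0) z)) x0) < \<epsilon>"
    by (rule steerE[OF z(2) assms(8,9)])
  have uc: "continuous_on {0..T} u" by (rule flat_control_smooth(2)[OF u])
  have "u \<in> admissible_controls V \<nu> \<mu> \<sigma> Q s \<psi>0 T"
    unfolding admissible_controls_def using continuous_L2_controls[OF uc] sol_mild[OF x0 uc a] by blast
  \<comment> \<open>Both functions have representatives in the algebra, so the distance is computed
    there; \<open>repr_exp\<close> identifies the pointwise exponential with
    \<open>Exp\<close>.\<close>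
  moreover have "Hs_norm s (\<lambda>x. resolving_op V \<nu> \<mu> \<sigma> Q s T \<psi>0 (u, 1, - \<nu>) x - exp (w0 * complex_of_real (\<theta> x)) * \<psi>0 x)
      = norm (a T - mul (Exp (mul (cst w0) z)) x0)"
    by (rule repr_Hs_norm[OF repr_diff[OF resolving_op_repr[OF x0 less_imp_le[OF T(1)] uc a] repr_mult[OF repr_exp[OF repr_cmult[OF z(1)]] x0]]])
  ultimately show ?thesis
    by (intro exI[of _ T] exI[of _ u] conjI IntI T flat_control_smooth(1)[OF u]) (simp_all only: e)
qed

end
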